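(* Let $k\ge 0$, let $D$ and $D_i$ ($i=1,2,\dots$) be elements of $D_k(G)$, and suppose $\lim_{i\to\infty}E_{\flat}(D_i-D)=0$. Then $$W(D)\le\liminf_{i\to\infty}W(D_i),\qquad M(D)\le\liminf_{i\to\infty}M(D_i),\qquad E(D)\le\liminf_{i\to\infty}E(D_i).$$ That is, weight, mass and energy are lower semicontinuous with respect to the norm $E_\flat$.
   Context: Coefficients: $G$ is an abelian group with a complete translation-invariant metric; $|g|$ denotes the distance from $g$ to the identity $0$. Polyhedra: for $k\ge1$ a $k$-cell $\sigma$ in $\mathbb{R}^3$ is a nonempty bounded oriented subset of an affine $k$-plane that is a finite intersection of open half spaces of that plane; a $0$-cell is a point. $\mathbf{P}_k(\mathbb{Z})$ is the group of formal integer combinations of $k$-cells modulo the relation that two formal sums are identified when all smooth differential $k$-forms have the same integral over both (so $-\sigma$ is $\sigma$ with reversed orientation, and a cell equals the sum of the cells of a subdivision). $\mathbf{P}_k(G)=G\otimes\mathbf{P}_k(\mathbb{Z})$, with the usual boundary $\partial$ ($\partial=0$ on $\mathbf{P}_0$). $M(\sigma)$ is the $k$-dimensional Hausdorff measure of the cell $\sigma$ ($M=1$ for a point). Dipolyhedra: each $k$-cell $\sigma$ determines a $k$-dimensional dipole cell $\delta\sigma$, and each $(k-1)$-cell $\tau$ determines a $k$-dimensional mass cell $\mu\tau$. (They arise as limits in $\mathbb{R}^4$: with $e_4=(0,0,0,1)$, $\mu\tau=\lim_j 2^j(\tau\times 2^{-j}e_4)$, where $\tau\times w$ is the oriented orbit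 of $\tau$ under translation by $tw$, $0\le t\le1$, and $\delta\sigma=\partial\mu\sigma+\mu\partial\sigma$.) $S_k(G)$ is the group of dipole chains $\sum g_i\delta\sigma_i$, and $T_k(G)$ the group of mass chains $\sum g_i\mu\tau_i$ ($T_0(G)=0$); $\delta$ and $\mu$ extend additively to isomorphisms $\delta:\mathbf{P}_k(G)\to S_k(G)$ and $\mu:\mathbf{P}_{k-1}(G)\to T_k(G)$. The group of dipolyhedra is $D_k(G)=S_k(G)\oplus T_k(G)$, with elements written $D=S+T$. The boundary $\partial:D_k(G)\to D_{k-1}(G)$ is given by $\partial\delta\sigma=\delta\partial\sigma$ and $\partial\mu\tau=\delta\tau-\mu\partial\tau$. Weight, mass, energy: if $S=\sum g_i\delta\sigma_i$ with the $\sigma_i$ nonoverlapping, $W(S)=\sum|g_i|M(\sigma_i)$; if $T=\sum g_i\mu\tau_i$ with the $\tau_i$ nonoverlapping, $M(T)=\sum|g_i|M(\tau_i)$. For $D=S+T$, $W(D)=W(S)$, $M(D)=M(T)$ and $E(D)=W(S)+M(T)$. Norm: $E_\flat(D)=\inf\{E(B)+E(C): D=B+\partial C,\ B\in D_k(G),\ C\in D_{k+1}(G)\}$ for $D\in D_k(G)$. *)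

theory Defs
  imports "HOL-Analysis.Analysis" "HOL-Library.Poly_Mapping"
begin

section \<open>Oriented cells in \<open>\<real>\<^sup>3\<close>\<close>

definition open_half_space_of :: "(real^3) set \<Rightarrow> (real^3) set \<Rightarrow> bool" where
  "open_half_space_of L H \<longleftrightarrow> (\<exists>a b. H = {x \<in> L. a \<bullet> x < b}) \<and> H \<noteq> {} \<and> H \<noteq> L"

text \<open>An affine \<open>0\<close>-plane is a point and has no open half spaces in the above sense, so the
  \<open>0\<close>-cells are exactly the points.\<close>

definition is_cell :: "nat \<Rightarrow> (real^3) set \<Rightarrow> bool" where
  "is_cell k A \<longleftrightarrow> A \<noteq> {} \<and> bounded A \<and>
     (\<exists>L \<H>. affine L \<and> aff_dim L = int k \<and>
        finite \<H> \<and> (\<forall>H\<in>\<H>. open_half_space_of L H) \<and> A = L \<inter> \<Inter>\<H>)"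

definition direction_space :: "(real^3) set \<Rightarrow> (real^3) set" where
  "direction_space A = span {x - y | x y. x \<in> A \<and> y \<in> A}"

definition ordered_basis :: "(real^3) set \<Rightarrow> (real^3) list \<Rightarrow> bool" where
  "ordered_basis V vs \<longleftrightarrow> distinct vs \<and> independent (set vs) \<and> span (set vs) = V"

text \<open>The orientation of a cell is recorded by an ordered basis of its direction space. Bases of
  the same orientation class give the same element of the group of polyhedral chains below, and
  bases of opposite classes give opposite elements. For a \<open>0\<close>-cell the only basis is the
  empty list.\<close>

typedef oriented_cell =
  "{(A, vs). is_cell (length vs) A \<and> ordered_basis (direction_space A) vs}"
proof
  have "is_cell 0 {0}"
    unfolding is_cell_def by (intro conjI exI[of _ "{0}"] exI[of _ "{}"]) auto
  then show "({0}, []) \<in>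
      {(A, vs). is_cell (length vs) A \<and> ordered_basis (direction_space A) vs}"
    by (simp add: ordered_basis_def direction_space_def independent_empty)
qed

definition cell_set :: "oriented_cell \<Rightarrow> (real^3) set" where
  "cell_set \<sigma> = fst (Rep_oriented_cell \<sigma>)"

definition cell_frame :: "oriented_cell \<Rightarrow> (real^3) list" where
  "cell_frame \<sigma> = snd (Rep_oriented_cell \<sigma>)"

definition cell_dim :: "oriented_cell \<Rightarrow> nat" where
  "cell_dim \<sigma> = length (cell_frame \<sigma>)"


section \<open>Hausdorff measure\<close>

text \<open>The usual normalisation, under which the \<open>k\<close>-dimensional measure agrees with Lebesgue
  measure on \<open>k\<close>-planes. Empty members of a cover must contribute \<open>0\<close> also when
  \<open>k = 0\<close>; and \<^const>\<open>diameter\<close> is only meaningful on bounded sets.\<close>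

definition hausdorff_pre :: "nat \<Rightarrow> real \<Rightarrow> 'a::metric_space set \<Rightarrow> ennreal" where
  "hausdorff_pre k d A =
     (INF U \<in> {U :: nat \<Rightarrow> 'a set. A \<subseteq> (\<Union>i. U i) \<and> (\<forall>i. bounded (U i) \<and> diameter (U i) \<le> d)}.
        suminf (\<lambda>i. if U i = {} then 0
            else ennreal (unit_ball_vol (real k) * (diameter (U i) / 2) ^ k)))"

definition hausdorff_measure :: "nat \<Rightarrow> 'a::metric_space set \<Rightarrow> ennreal" where
  "hausdorff_measure k A = (SUP d\<in>{0<..}. hausdorff_pre k d A)"

definition cell_mass :: "oriented_cell \<Rightarrow> real" where
  "cell_mass \<sigma> = enn2real (hausdorff_measure (cell_dim \<sigma>) (cell_set \<sigma>))"


section \<open>Smooth differential forms and their integrals over cells\<close>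

primrec n_smooth :: "nat \<Rightarrow> (real^3 \<Rightarrow> real) \<Rightarrow> bool" where
  "n_smooth 0 f \<longleftrightarrow> continuous_on UNIV f"
| "n_smooth (Suc n) f \<longleftrightarrow>
     (\<exists>f'. (\<forall>x. (f has_derivative f' x) (at x)) \<and> (\<forall>v. n_smooth n (\<lambda>x. f' x v)))"

definition smooth :: "(real^3 \<Rightarrow> real) \<Rightarrow> bool" where
  "smooth f \<longleftrightarrow> (\<forall>n. n_smooth n f)"

definition alternating_form :: "nat \<Rightarrow> ((real^3) list \<Rightarrow> real) \<Rightarrow> bool" where
  "alternating_form k \<alpha> \<longleftrightarrow>
     (\<forall>vs. length vs = k \<longrightarrow>
        (\<forall>i<k. linear (\<lambda>v. \<alpha> (vs[i := v]))) \<and>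
        (\<forall>j<k. \<forall>i<j. vs ! i = vs ! j \<longrightarrow> \<alpha> vs = 0))"

definition smooth_form :: "nat \<Rightarrow> (real^3 \<Rightarrow> (real^3) list \<Rightarrow> real) \<Rightarrow> bool" where
  "smooth_form k \<omega> \<longleftrightarrow>
     (\<forall>x. alternating_form k (\<omega> x)) \<and> (\<forall>vs. length vs = k \<longrightarrow> smooth (\<lambda>x. \<omega> x vs))"

text \<open>The integral of a form over an oriented cell is the Lebesgue integral of its pullback under
  the affine parametrisation \<open>t \<mapsto> p + (\<Sum>i. t\<^sub>i v\<^sub>i)\<close> given by the positively oriented basis
  \<open>v\<close>; it does not depend on \<open>p\<close>. Points of \<open>\<real>\<^sup>k\<close> are functions on
  \<open>{..<k}\<close>; for \<open>k = 0\<close> this evaluates the form at the point.\<close>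

definition cell_point :: "oriented_cell \<Rightarrow> (nat \<Rightarrow> real) \<Rightarrow> real^3" where
  "cell_point \<sigma> t =
     (SOME p. p \<in> cell_set \<sigma>) + (\<Sum>i<cell_dim \<sigma>. t i *\<^sub>R (cell_frame \<sigma> ! i))"

definition cell_integral :: "(real^3 \<Rightarrow> (real^3) list \<Rightarrow> real) \<Rightarrow> oriented_cell \<Rightarrow> real" where
  "cell_integral \<omega> \<sigma> =
     (\<integral>t. indicat_real (cell_set \<sigma>) (cell_point \<sigma> t) * \<omega> (cell_point \<sigma> t) (cell_frame \<sigma>)
        \<partial>(\<Pi>\<^sub>M i\<in>{..<cell_dim \<sigma>}. lborel))"


section \<open>Integral polyhedral chains\<close>

text \<open>Formal integer combinations of cells of all dimensions are treated together; the integral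
  of a \<open>k\<close>-form sees only the \<open>k\<close>-cells. The resulting quotient \<open>zchain\<close> is
  the direct sum over \<open>k\<close> of the groups \<open>\<^bold>P\<^sub>k(\<int>)\<close>, whose copies inside it are the sets
  \<open>zchains k\<close>.\<close>

definition formal_integral ::
    "nat \<Rightarrow> (real^3 \<Rightarrow> (real^3) list \<Rightarrow> real) \<Rightarrow> (oriented_cell \<Rightarrow>\<^sub>0 int) \<Rightarrow> real" where
  "formal_integral k \<omega> c =
     (\<Sum>\<sigma>\<in>Poly_Mapping.keys c.
        if cell_dim \<sigma> = k then of_int (Poly_Mapping.lookup c \<sigma>) * cell_integral \<omega> \<sigma> else 0)"

lemma formal_integral_superset:
  assumes "finite S" "Poly_Mapping.keys c \<subseteq> S"
  shows "formal_integral k \<omega> c =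
    (\<Sum>\<sigma>\<in>S. if cell_dim \<sigma> = k then of_int (Poly_Mapping.lookup c \<sigma>) * cell_integral \<omega> \<sigma> else 0)"
  unfolding formal_integral_def
  by (rule sum.mono_neutral_left) (use assms in \<open>auto simp: in_keys_iff\<close>)

lemma formal_integral_add:
  "formal_integral k \<omega> (a + b) = formal_integral k \<omega> a + formal_integral k \<omega> b"
proof -
  let ?S = "Poly_Mapping.keys a \<union> Poly_Mapping.keys b"
  show ?thesis
    by (subst (1 2 3) formal_integral_superset[where S = ?S])
      (auto simp: Poly_Mapping.keys_add lookup_add algebra_simps
        simp flip: sum.distrib intro!: sum.cong)
qed

lemma formal_integral_uminus: "formal_integral k \<omega> (- a) = - formal_integral k \<omega> a"
proof -
  have "formal_integral k \<omega> (a + - a) = formal_integral k \<omega> a + formal_integral k \<omega> (- a)"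
    by (rule formal_integral_add)
  then show ?thesis
    by (simp add: formal_integral_def)
qed

definition same_integrals :: "(oriented_cell \<Rightarrow>\<^sub>0 int) \<Rightarrow> (oriented_cell \<Rightarrow>\<^sub>0 int) \<Rightarrow> bool" where
  "same_integrals c c' \<longleftrightarrow>
     (\<forall>k \<omega>. smooth_form k \<omega> \<longrightarrow> formal_integral k \<omega> c = formal_integral k \<omega> c')"

quotient_type zchain = "oriented_cell \<Rightarrow>\<^sub>0 int" / same_integrals
  by (rule equivpI) (auto simp: reflp_def symp_def transp_def same_integrals_def)

instantiation zchain :: ab_group_add
begin

lift_definition zero_zchain :: zchain is 0 .

lift_definition plus_zchain :: "zchain \<Rightarrow> zchain \<Rightarrow> zchain" is "(+)"
  by (auto simp: same_integrals_def formal_integral_add)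

lift_definition uminus_zchain :: "zchain \<Rightarrow> zchain" is uminus
  by (auto simp: same_integrals_def formal_integral_uminus)

definition minus_zchain :: "zchain \<Rightarrow> zchain \<Rightarrow> zchain" where
  "minus_zchain a b = a + - b"

instance
proof
  fix a b c :: zchain
  show "a + b + c = a + (b + c)"
    by transfer (simp add: same_integrals_def add.assoc)
  show "a + b = b + a"
    by transfer (simp add: same_integrals_def add.commute)
  show "0 + a = a"
    by transfer (simp add: same_integrals_def)
  show "- a + a = 0"
    by transfer (simp add: same_integrals_def)
  show "a - b = a + - b"
    by (rule minus_zchain_def)
qed

end

definition zcell :: "oriented_cell \<Rightarrow> zchain" where
  "zcell \<sigma> = abs_zchain (frag_of \<sigma>)"

definition zchains :: "nat \<Rightarrow> zchain set" where
  "zchains k = {abs_zchain c | c. \<forall>\<sigma>\<in>Poly_Mapping.keys c. cell_dim \<sigma> = k}"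


section \<open>Boundary of integral chains\<close>

text \<open>Inner product of the simple \<open>k\<close>-vectors \<open>a\<^sub>1 \<and> \<dots> \<and> a\<^sub>k\<close> and
  \<open>b\<^sub>1 \<and> \<dots> \<and> b\<^sub>k\<close>. Two ordered bases of one \<open>k\<close>-dimensional space have the same
  orientation iff it is positive.\<close>

definition kvector_inner :: "(real^3) list \<Rightarrow> (real^3) list \<Rightarrow> real" where
  "kvector_inner as bs =
     (\<Sum>p | p permutes {..<length as}. of_int (sign p) * (\<Prod>i<length as. as ! i \<bullet> bs ! p i))"

text \<open>The sign makes each facet carry the induced orientation (outward vector first). As outward
  vector serves the difference of a point of the facet and a point of the open cell, and the facet
  is given an arbitrary basis of its direction space. A point has no facets, as
  \<^const>\<open>facet_of\<close> excludes the empty face.\<close>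

definition facet_frame :: "(real^3) set \<Rightarrow> (real^3) list" where
  "facet_frame F = (SOME ws. ordered_basis (direction_space F) ws)"

definition facet_sign :: "oriented_cell \<Rightarrow> (real^3) set \<Rightarrow> int" where
  "facet_sign \<sigma> F =
     (if kvector_inner
           (((SOME y. y \<in> rel_interior F) - (SOME x. x \<in> cell_set \<sigma>)) # facet_frame F)
           (cell_frame \<sigma>) > 0
      then 1 else - 1)"

definition cell_boundary :: "oriented_cell \<Rightarrow> oriented_cell \<Rightarrow>\<^sub>0 int" where
  "cell_boundary \<sigma> =
     (\<Sum>F | F facet_of closure (cell_set \<sigma>).
        frag_cmul (facet_sign \<sigma> F)
          (frag_of (Abs_oriented_cell (rel_interior F, facet_frame F))))"

text \<open>Independent of the representative by Stokes' theorem.\<close>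

definition zboundary :: "zchain \<Rightarrow> zchain" where
  "zboundary z = abs_zchain (frag_extend cell_boundary (rep_zchain z))"


section \<open>Tensor product of abelian groups\<close>

inductive_set bilinear_relators ::
    "(('a::ab_group_add \<times> 'b::ab_group_add) \<Rightarrow>\<^sub>0 int) set" where
  zero: "0 \<in> bilinear_relators"
| left: "frag_of (a + a', b) - frag_of (a, b) - frag_of (a', b) \<in> bilinear_relators"
| right: "frag_of (a, b + b') - frag_of (a, b) - frag_of (a, b') \<in> bilinear_relators"
| diff: "x \<in> bilinear_relators \<Longrightarrow> y \<in> bilinear_relators \<Longrightarrow> x - y \<in> bilinear_relators"

lemma bilinear_relators_uminus:
  "x \<in> bilinear_relators \<Longrightarrow> - x \<in> bilinear_relators"
  using bilinear_relators.diff[OF bilinear_relators.zero, of x] by simp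

lemma bilinear_relators_add:
  "x \<in> bilinear_relators \<Longrightarrow> y \<in> bilinear_relators \<Longrightarrow> x + y \<in> bilinear_relators"
  using bilinear_relators.diff[OF _ bilinear_relators_uminus, of x y] by simp

definition tensor_rel ::
    "(('a::ab_group_add \<times> 'b::ab_group_add) \<Rightarrow>\<^sub>0 int) \<Rightarrow> (('a \<times> 'b) \<Rightarrow>\<^sub>0 int) \<Rightarrow> bool" where
  "tensor_rel x y \<longleftrightarrow> x - y \<in> bilinear_relators"

quotient_type (overloaded) ('a, 'b) tensor =
  "('a::ab_group_add \<times> 'b::ab_group_add) \<Rightarrow>\<^sub>0 int" / tensor_rel
proof (rule equivpI)
  show "reflp (tensor_rel :: (('a \<times> 'b) \<Rightarrow>\<^sub>0 int) \<Rightarrow> _)"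
    by (simp add: reflp_def tensor_rel_def bilinear_relators.zero)
  show "symp (tensor_rel :: (('a \<times> 'b) \<Rightarrow>\<^sub>0 int) \<Rightarrow> _)"
    using bilinear_relators_uminus by (fastforce simp: symp_def tensor_rel_def)
  show "transp (tensor_rel :: (('a \<times> 'b) \<Rightarrow>\<^sub>0 int) \<Rightarrow> _)"
    using bilinear_relators_add by (fastforce simp: transp_def tensor_rel_def)
qed

instantiation tensor :: (ab_group_add, ab_group_add) ab_group_add
begin

lift_definition zero_tensor :: "('a, 'b) tensor" is 0 .

lift_definition plus_tensor :: "('a, 'b) tensor \<Rightarrow> ('a, 'b) tensor \<Rightarrow> ('a, 'b) tensor" is "(+)"
  using bilinear_relators_add by (fastforce simp: tensor_rel_def add_diff_add)

lift_definition uminus_tensor :: "('a, 'b) tensor \<Rightarrow> ('a, 'b) tensor" is uminus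
  using bilinear_relators_uminus by (fastforce simp: tensor_rel_def)

definition minus_tensor :: "('a, 'b) tensor \<Rightarrow> ('a, 'b) tensor \<Rightarrow> ('a, 'b) tensor" where
  "minus_tensor a b = a + - b"

instance
proof
  fix a b c :: "('a, 'b) tensor"
  show "a + b + c = a + (b + c)"
    by transfer (simp add: tensor_rel_def add.assoc bilinear_relators.zero)
  show "a + b = b + a"
    by transfer (simp add: tensor_rel_def add.commute bilinear_relators.zero)
  show "0 + a = a"
    by transfer (simp add: tensor_rel_def bilinear_relators.zero)
  show "- a + a = 0"
    by transfer (simp add: tensor_rel_def bilinear_relators.zero)
  show "a - b = a + - b"
    by (rule minus_tensor_def)
qed

end

definition pure_tensor :: "'a::ab_group_add \<Rightarrow> 'b::ab_group_add \<Rightarrow> ('a, 'b) tensor" where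
  "pure_tensor a b = abs_tensor (frag_of (a, b))"

text \<open>The homomorphism \<open>id \<otimes> f\<close>; independent of the representative when \<open>f\<close> is
  additive.\<close>

definition tensor_map ::
    "('b \<Rightarrow> 'c) \<Rightarrow> ('a::ab_group_add, 'b::ab_group_add) tensor \<Rightarrow> ('a, 'c::ab_group_add) tensor"
  where
  "tensor_map f x = abs_tensor (frag_extend (\<lambda>(a, b). frag_of (a, f b)) (rep_tensor x))"


section \<open>Polyhedral chains with coefficients\<close>

type_synonym 'g chain = "('g, zchain) tensor"

text \<open>\<open>\<^bold>P\<^sub>k(G) = G \<otimes> \<^bold>P\<^sub>k(\<int>)\<close>, as a direct summand of \<open>G \<otimes> (\<Oplus>\<^sub>j \<^bold>P\<^sub>j(\<int>))\<close>.\<close>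

definition chains :: "nat \<Rightarrow> 'g::ab_group_add chain set" where
  "chains k = {\<Sum>i<n. pure_tensor (g i) (z i) | (n::nat) g z. \<forall>i<n. z i \<in> zchains k}"

definition chain_boundary :: "'g::ab_group_add chain \<Rightarrow> 'g chain" where
  "chain_boundary = tensor_map zboundary"

text \<open>Cells are open in their planes, so nonoverlapping means disjoint.\<close>

definition nonoverlapping :: "nat \<Rightarrow> nat \<Rightarrow> (nat \<Rightarrow> oriented_cell) \<Rightarrow> bool" where
  "nonoverlapping k n \<sigma> \<longleftrightarrow>
     (\<forall>i<n. cell_dim (\<sigma> i) = k) \<and>
     (\<forall>i<n. \<forall>j<n. i \<noteq> j \<longrightarrow> cell_set (\<sigma> i) \<inter> cell_set (\<sigma> j) = {})"


section \<open>Dipolyhedra\<close>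

text \<open>Pairs model the direct sum \<open>D\<^sub>k(G) = S\<^sub>k(G) \<oplus> T\<^sub>k(G)\<close> of \<open>S\<^sub>k(G) = \<delta> \<^bold>P\<^sub>k(G)\<close> and
  \<open>T\<^sub>k(G) = \<mu> \<^bold>P\<^bsub>k-1\<^esub>(G)\<close>, where \<open>\<delta>\<close> and \<open>\<mu>\<close> are isomorphisms onto their images; in
  particular the dipole cell of \<open>\<sigma>\<close> with coefficient \<open>g\<close> is
  \<open>dipole (g \<otimes> \<sigma>)\<close>, and similarly for mass cells.\<close>

type_synonym 'g dichain = "'g chain \<times> 'g chain"

definition dipole :: "'g::ab_group_add chain \<Rightarrow> 'g dichain" where
  "dipole p = (p, 0)"

definition masschain :: "'g::ab_group_add chain \<Rightarrow> 'g dichain" where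
  "masschain q = (0, q)"

definition dipole_chains :: "nat \<Rightarrow> 'g::ab_group_add dichain set" where
  "dipole_chains k = dipole ` chains k"

definition mass_chains :: "nat \<Rightarrow> 'g::ab_group_add dichain set" where
  "mass_chains k = (case k of 0 \<Rightarrow> {0} | Suc j \<Rightarrow> masschain ` chains j)"

definition dipolyhedra :: "nat \<Rightarrow> 'g::ab_group_add dichain set" where
  "dipolyhedra k = {S + T | S T. S \<in> dipole_chains k \<and> T \<in> mass_chains k}"

definition dipole_part :: "'g::ab_group_add dichain \<Rightarrow> 'g dichain" where
  "dipole_part D = dipole (fst D)"

definition mass_part :: "'g::ab_group_add dichain \<Rightarrow> 'g dichain" where
  "mass_part D = masschain (snd D)"

definition dipole_boundary :: "'g::ab_group_add dichain \<Rightarrow> 'g dichain" where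
  "dipole_boundary D =
     dipole (chain_boundary (fst D)) +
     (dipole (snd D) - masschain (chain_boundary (snd D)))"

definition weight :: "nat \<Rightarrow> 'g::{ab_group_add, metric_space} dichain \<Rightarrow> real" where
  "weight k D =
     (THE w. \<exists>n g \<sigma>. nonoverlapping k n \<sigma> \<and>
        dipole_part D = (\<Sum>i<n. dipole (pure_tensor (g i) (zcell (\<sigma> i)))) \<and>
        w = (\<Sum>i<n. dist (g i) 0 * cell_mass (\<sigma> i)))"

text \<open>For \<open>k = 0\<close> the mass part is \<open>0\<close>, so its mass is \<open>0\<close> regardless of the
  truncated \<open>k - 1\<close>.\<close>

definition mass :: "nat \<Rightarrow> 'g::{ab_group_add, metric_space} dichain \<Rightarrow> real" where
  "mass k D =
     (THE m. \<exists>n g \<tau>. nonoverlapping (k - 1) n \<tau> \<and>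
        mass_part D = (\<Sum>i<n. masschain (pure_tensor (g i) (zcell (\<tau> i)))) \<and>
        m = (\<Sum>i<n. dist (g i) 0 * cell_mass (\<tau> i)))"

definition energy :: "nat \<Rightarrow> 'g::{ab_group_add, metric_space} dichain \<Rightarrow> real" where
  "energy k D = weight k D + mass k D"

definition energy_flat :: "nat \<Rightarrow> 'g::{ab_group_add, metric_space} dichain \<Rightarrow> real" where
  "energy_flat k D =
     Inf {energy k B + energy (Suc k) C | B C.
            B \<in> dipolyhedra k \<and> C \<in> dipolyhedra (Suc k) \<and> D = B + dipole_boundary C}"

end

(* For an orthonormal k-frame, the projection of R^3 onto its span gives a k-cell transversal to
   the fibres a multiplicity +-1 at each of its points. An integral chain thereby acquires an
   integer multiplicity at every point, and integrating against forms h dx_1 ... dx_k shows that, on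
   almost every fibre, these multiplicities depend only on the class of the chain. Tensoring, a
   chain with coefficients in G has a G-valued multiplicity; in the case of nonoverlapping cells the
   integral of its distance to 0 over the projection is at most the mass, with equality for cells
   parallel to the frame. Stokes' theorem for these forms says that on almost every fibre, which a
   (k+1)-cell meets in a segment, the boundary of the cell has opposite multiplicities at the two
   end points of the segment.

   Let P have nonoverlapping cells sigma_j, let P' = P + A + A' + (boundary of C), choose disjoint
   compact K_j inside sigma_j that carry almost all of the mass, and project to the plane of
   sigma_j. Counting multiplicities in the points within distance s of K_j bounds the mass of P
   near K_j by the masses of P', A and A' near K_j, plus the mass of those fibre segments of C that
   have exactly one end point there. Such a segment crosses distance s, so integrating over s in a short
   interval (0, r) bounds that last term, for a suitable s, by a constant times M(C) / r. Hence
   M(P) <= M(P') + eta + L (M(A) + M(A') + M(C)), where L depends on P and eta only. If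
   E_flat(D' - D) is small, the dipole and mass parts of D' and D are related in just this way. *)
theory Submission
  imports Defs
begin

section \<open>Alternating forms and frames\<close>

text \<open>\<open>weight\<close> and \<open>mass\<close> are definite descriptions and
  \<open>zboundary\<close> acts on a chosen representative, so their well-definedness has to come
  out of the proof. Nonoverlapping representations exist by refining along a hyperplane arrangement.
  That all of them have the same mass is the final inequality itself, with every error chain zero.
  Additivity of the boundary holds since the multiplicities in all projections determine an integral
  chain. Multiplicities are controlled only outside null sets; statements therefore read: for almost
  every y, for all x above y. One exceptional set of fibres then serves every region near K_j and
  every radius s. In D' - D = B + (boundary of C) the dipole part reads \<open>fst D'\<close> =
  \<open>fst D\<close> + \<open>fst B\<close> + \<open>snd C\<close> + (boundary of
  \<open>fst C\<close>), the mass part \<open>snd D'\<close> = \<open>snd D\<close> +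
  \<open>snd B\<close> - (boundary of \<open>snd C\<close>). The summand \<open>snd C\<close>, whose
  mass belongs to E(C), is the second error chain A'. A multiple n g may be shorter than |n| |g|;
  the mass of sigma_j can still be recovered because a cell meets each fibre transversal to it at
  most once.\<close>

lemma sum_permutations_diagonal:
  fixes f :: "nat \<Rightarrow> nat \<Rightarrow> real"
  assumes z: "\<And>i j. 0 < i \<Longrightarrow> i < n \<Longrightarrow> j < n \<Longrightarrow> i \<noteq> j \<Longrightarrow> f i j = 0"
  shows "(\<Sum>p | p permutes {..<n}. of_int (sign p) * (\<Prod>i<n. f i (p i))) = (\<Prod>i<n. f i i)"
proof -
  have "(\<Prod>i<n. f i (p i)) = 0" if p: "p permutes {..<n}" "p \<noteq> id" for p
  proof -
    \<comment> \<open>Row 0 is unrestricted: a permutation that fixes every other index fixes 0 as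
      well. This lets the first vector of a frame be arbitrary in the determinants below.\<close>
    have "\<exists>i. 0 < i \<and> i < n \<and> p i \<noteq> i"
    proof (rule ccontr)
      assume c: "\<not> ?thesis"
      have "p i = i" if "0 < i" for i
        using c that permutes_not_in[OF p(1), of i] by auto
      moreover have "p 0 = 0"
        using calculation permutes_inj[OF p(1)] by (metis injD neq0_conv)
      ultimately have "p = id"
        by (metis eq_id_iff neq0_conv)
      with p show False by simp
    qed
    then obtain i where i: "0 < i" "i < n" "p i \<noteq> i" by blast
    have "p i < n" using permutes_in_image[OF p(1), of i] i by simp
    then have "f i (p i) = 0" using z i by metis
    then show ?thesis using i by (auto intro!: prod_zero)
  qed
  then have "(\<Sum>p | p permutes {..<n}. of_int (sign p) * (\<Prod>i<n. f i (p i)))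
      = (\<Sum>p\<in>{id}. of_int (sign p) * (\<Prod>i<n. f i (p i)))"
    by (intro sum.mono_neutral_right) (auto simp: permutes_id finite_permutations)
  then show ?thesis by simp
qed

lemma kvector_inner_triangular:
  assumes "length as = length bs"
    and "\<And>i j. 0 < i \<Longrightarrow> i < length as \<Longrightarrow> j < length as \<Longrightarrow> i \<noteq> j \<Longrightarrow> as ! i \<bullet> bs ! j = 0"
  shows "kvector_inner as bs = (\<Prod>i<length as. as ! i \<bullet> bs ! i)"
  unfolding kvector_inner_def using assms by (intro sum_permutations_diagonal) auto

text \<open>The determinant of the transpose: sum over inverse permutations, then reindex each
  product by \<open>p\<close>.\<close>

lemma kvector_inner_commute:
  assumes "length as = length bs"
  shows "kvector_inner as bs = kvector_inner bs as"
proof -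
  let ?n = "length as"
  have "kvector_inner as bs =
      (\<Sum>p | p permutes {..<?n}. of_int (sign (inv p)) * (\<Prod>i<?n. as ! i \<bullet> bs ! inv p i))"
    unfolding kvector_inner_def by (rule sum_permutations_inverse)
  also have "\<dots> = (\<Sum>p | p permutes {..<?n}. of_int (sign p) * (\<Prod>i<?n. bs ! i \<bullet> as ! p i))"
  proof (rule sum.cong[OF refl])
    fix p assume "p \<in> {p. p permutes {..<?n}}"
    then have p: "p permutes {..<?n}" by simp
    have "(\<Prod>i<?n. as ! i \<bullet> bs ! inv p i) = (\<Prod>i<?n. as ! p i \<bullet> bs ! inv p (p i))"
      using prod.reindex_bij_betw[OF permutes_imp_bij[OF p], of "\<lambda>i. as ! i \<bullet> bs ! inv p i"] by simp
    also have "\<dots> = (\<Prod>i<?n. bs ! i \<bullet> as ! p i)"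
      using permutes_inverses[OF p] by (simp add: inner_commute)
    finally have *: "(\<Prod>i<?n. as ! i \<bullet> bs ! inv p i) = (\<Prod>i<?n. bs ! i \<bullet> as ! p i)" .
    show "of_int (sign (inv p)) * (\<Prod>i<?n. as ! i \<bullet> bs ! inv p i) =
        (of_int (sign p) * (\<Prod>i<?n. bs ! i \<bullet> as ! p i) :: real)"
    proof -
      have "permutation p" unfolding permutation_permutes using p finite_lessThan by blast
      then show ?thesis by (simp add: sign_inverse * )
    qed
  qed
  finally show ?thesis unfolding kvector_inner_def using assms by simp
qed

lemma alternating_form_kvector_inner: "alternating_form (length as) (kvector_inner as)"
  unfolding alternating_form_def
proof (intro allI impI conjI)
  let ?n = "length as"
  fix vs :: "(real^3) list" assume len: "length vs = ?n"
  fix j assume j: "j < ?n"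
  {
    have "linear (\<lambda>v. of_int (sign p) * (\<Prod>i<?n. as ! i \<bullet> vs[j := v] ! p i) :: real)"
      if p: "p permutes {..<?n}" for p
    proof -
      \<comment> \<open>Only the factor with index \<open>inv p j\<close> contains the
        \<open>j\<close>-th vector; it is pulled out, and the rest of the product is constant in
        \<open>v\<close>.\<close>
      let ?i = "inv p j"
      have i: "?i < ?n" "p ?i = j"
        using permutes_in_image[OF permutes_inv[OF p], of j] j permutes_inverses[OF p] by auto
      have "(\<Prod>i<?n. as ! i \<bullet> vs[j := v] ! p i) =
          (as ! ?i \<bullet> v) * (\<Prod>i\<in>{..<?n} - {?i}. as ! i \<bullet> vs ! p i)" for v
      proof -
        have "(\<Prod>i<?n. as ! i \<bullet> vs[j := v] ! p i) =
            (as ! ?i \<bullet> vs[j := v] ! p ?i) * (\<Prod>i\<in>{..<?n} - {?i}. as ! i \<bullet> vs[j := v] ! p i)"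
          using i by (intro prod.remove) auto
        also have "(\<Prod>i\<in>{..<?n} - {?i}. as ! i \<bullet> vs[j := v] ! p i)
            = (\<Prod>i\<in>{..<?n} - {?i}. as ! i \<bullet> vs ! p i)"
        proof (rule prod.cong[OF refl])
          fix i assume "i \<in> {..<?n} - {?i}"
          then have "p i \<noteq> j" using permutes_inverses[OF p] by auto
          then show "as ! i \<bullet> vs[j := v] ! p i = as ! i \<bullet> vs ! p i" by simp
        qed
        finally show ?thesis using i j len by simp
      qed
      then show ?thesis
        by (auto simp: linear_iff algebra_simps inner_add_right inner_scaleR_right)
    qed
    then show "linear (\<lambda>v. kvector_inner as (vs[j := v]))"
      unfolding kvector_inner_def by (intro linear_compose_sum) auto
  next
    fix i assume ij: "i < j" and eq: "vs ! i = vs ! j"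
    let ?t = "Transposition.transpose i j"
    let ?f = "\<lambda>p. of_int (sign p) * (\<Prod>i<?n. as ! i \<bullet> vs ! p i) :: real"
    have t: "?t permutes {..<?n}" using ij j by (intro permutes_swap_id) auto
    \<comment> \<open>Exchanging the two equal entries leaves every product unchanged and reverses
      the sign, so the sum is its own negative.\<close>
    have "sum ?f {p. p permutes {..<?n}} = (\<Sum>p | p permutes {..<?n}. ?f (?t \<circ> p))"
      by (rule setum_permutations_compose_left[OF t])
    also have "\<dots> = (\<Sum>p | p permutes {..<?n}. - ?f p)"
    proof (rule sum.cong[OF refl])
      fix p assume "p \<in> {p. p permutes {..<?n}}"
      then have p: "p permutes {..<?n}" by simp
      have "sign (?t \<circ> p) = - sign p"
      proof -
        have "permutation ?t" "permutation p"
          unfolding permutation_permutes using p t finite_lessThan by blast+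
        then show ?thesis using ij by (simp add: sign_compose sign_swap_id)
      qed
      moreover have "vs ! (?t \<circ> p) k = vs ! p k" for k
        using eq by (auto simp: Transposition.transpose_def)
      ultimately show "?f (?t \<circ> p) = - ?f p" by simp
    qed
    finally have "sum ?f {p. p permutes {..<?n}} = 0"
      by (simp add: sum_negf)
    then show "kvector_inner as vs = 0" unfolding kvector_inner_def .
  }
qed

lemma alternating_form_linear:
  assumes "alternating_form k \<alpha>" "Suc (length us + length ws) = k"
  shows "linear (\<lambda>v. \<alpha> (us @ v # ws))"
proof -
  have "linear (\<lambda>v. \<alpha> ((us @ 0 # ws)[length us := v]))"
  proof -
    have "length us < k" using assms(2) by simp
    moreover have "length (us @ 0 # ws) = k" using assms(2) by simp
    ultimately show ?thesis using assms(1) unfolding alternating_form_def by blast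
  qed
  then show ?thesis by (simp add: list_update_append)
qed

text \<open>A repeated entry gives zero, so the form vanishes when \<open>x\<close> is one of the
  other entries, and by linearity on their whole span.\<close>

lemma alternating_form_span_0:
  assumes \<alpha>: "alternating_form k \<alpha>" "Suc (length us + length ws) = k"
    and x: "x \<in> span (set us \<union> set ws)"
  shows "\<alpha> (us @ x # ws) = 0"
proof -
  have rep: "\<alpha> vs = 0" if "i < k" "j < k" "i \<noteq> j" "vs ! i = vs ! j" "length vs = k" for vs i j
    using \<alpha> that unfolding alternating_form_def by (metis linorder_neqE_nat)
  have "\<alpha> (us @ x # ws) = 0" if "x \<in> set us \<union> set ws" for x
  proof (cases "x \<in> set us")
    case True
    then obtain i where "i < length us" "us ! i = x" by (auto simp: in_set_conv_nth)
    then show ?thesis using \<alpha>(2) by (intro rep[of i "length us"]) (auto simp: nth_append)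
  next
    case False
    then have "x \<in> set ws" using that by blast
    then obtain i where "i < length ws" "ws ! i = x" unfolding in_set_conv_nth by blast
    then show ?thesis using \<alpha>(2)
      by (intro rep[of "Suc (length us + i)" "length us"]) (auto simp: nth_append)
  qed
  moreover have "linear (\<lambda>v. \<alpha> (us @ v # ws))" by (rule alternating_form_linear[OF \<alpha>])
  ultimately show ?thesis
    using x linear_eq_0_on_span[of "\<lambda>v. \<alpha> (us @ v # ws)" "set us \<union> set ws" x] by blast
qed

section \<open>Lebesgue measure on planes parametrised by a frame\<close>

definition frame_point :: "real^3 \<Rightarrow> (real^3) list \<Rightarrow> (nat \<Rightarrow> real) \<Rightarrow> real^3" where
  "frame_point p vs t = p + (\<Sum>i<length vs. t i *\<^sub>R vs ! i)"

text \<open>The image of Lebesgue measure is not normalised by a Gram determinant, because this is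
  the measure that occurs in \<open>cell_integral\<close>. It scales inversely to the frame; for an
  orthonormal frame it is Lebesgue measure on the plane.\<close>

definition frame_measure :: "real^3 \<Rightarrow> (real^3) list \<Rightarrow> (real^3) measure" where
  "frame_measure p vs = distr (\<Pi>\<^sub>M i\<in>{..<length vs}. lborel) borel (frame_point p vs)"

interpretation lborel_product: product_sigma_finite "\<lambda>i :: nat. lborel :: real measure"
  by standard

lemma frame_point_measurable_pair [measurable]:
  "(\<lambda>(q, t). frame_point q vs t) \<in> borel_measurable (borel \<Otimes>\<^sub>M (\<Pi>\<^sub>M i\<in>{..<length vs}. lborel))"
proof -
  have "(\<lambda>x. snd x i) \<in> borel_measurable (borel \<Otimes>\<^sub>M (\<Pi>\<^sub>M i\<in>{..<length vs}. lborel))"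
    if "i < length vs" for i
    using measurable_compose[OF measurable_snd measurable_component_singleton, of i] that by simp
  then show ?thesis
    unfolding frame_point_def split_beta
    by (intro borel_measurable_add borel_measurable_sum borel_measurable_scaleR) auto
qed

lemma frame_point_measurable [measurable]:
  "frame_point q vs \<in> borel_measurable (\<Pi>\<^sub>M i\<in>{..<length vs}. lborel)"
proof -
  have "(\<lambda>t. (q, t)) \<in> (\<Pi>\<^sub>M i\<in>{..<length vs}. lborel) \<rightarrow>\<^sub>M (borel \<Otimes>\<^sub>M (\<Pi>\<^sub>M i\<in>{..<length vs}. lborel))"
    by (intro measurable_Pair) auto
  from measurable_comp[OF this frame_point_measurable_pair] show ?thesis by (simp add: o_def)
qed

lemma sets_frame_measure [simp, measurable_cong]: "sets (frame_measure p vs) = sets borel"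
  by (simp add: frame_measure_def)

lemma space_frame_measure [simp]: "space (frame_measure p vs) = UNIV"
  by (simp add: frame_measure_def)

lemma nn_integral_frame_measure:
  "f \<in> borel_measurable borel \<Longrightarrow>
    (\<integral>\<^sup>+ x. f x \<partial>frame_measure p vs) = (\<integral>\<^sup>+ t. f (frame_point p vs t) \<partial>(\<Pi>\<^sub>M i\<in>{..<length vs}. lborel))"
  unfolding frame_measure_def by (rule nn_integral_distr) auto

lemma nn_integral_frame_measure_measurable [measurable]:
  assumes [measurable]: "f \<in> borel_measurable borel"
  shows "(\<lambda>q. \<integral>\<^sup>+ x. f x \<partial>frame_measure q vs) \<in> borel_measurable borel"
proof -
  interpret sigma_finite_measure "\<Pi>\<^sub>M i\<in>{..<length vs}. lborel :: real measure"
    by (rule lborel_product.sigma_finite) simp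
  have "(\<lambda>x. f (case x of (q, t) \<Rightarrow> frame_point q vs t))
      \<in> borel_measurable (borel \<Otimes>\<^sub>M (\<Pi>\<^sub>M i\<in>{..<length vs}. lborel))"
    by (rule measurable_compose[OF frame_point_measurable_pair assms])
  then have "(\<lambda>q. \<integral>\<^sup>+ t. f (frame_point q vs t) \<partial>(\<Pi>\<^sub>M i\<in>{..<length vs}. lborel)) \<in> borel_measurable borel"
    by (intro borel_measurable_nn_integral) (simp add: split_beta)
  then show ?thesis by (simp add: nn_integral_frame_measure)
qed

lemma nn_integral_frame_measure_translate:
  assumes [measurable]: "f \<in> borel_measurable borel"
  shows "(\<integral>\<^sup>+ x. f x \<partial>frame_measure (p + q) vs) = (\<integral>\<^sup>+ x. f (x + q) \<partial>frame_measure p vs)"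
  by (simp add: nn_integral_frame_measure frame_point_def algebra_simps)

lemma nn_integral_frame_measure_snoc:
  assumes [measurable]: "f \<in> borel_measurable borel"
  shows "(\<integral>\<^sup>+ x. f x \<partial>frame_measure p (vs @ [v])) =
    (\<integral>\<^sup>+ t. (\<integral>\<^sup>+ x. f x \<partial>frame_measure (p + t *\<^sub>R v) vs) \<partial>lborel)"
proof -
  let ?n = "length vs"
  have ins: "{..<length (vs @ [v])} = insert ?n {..<?n}" by auto
  have m: "(\<lambda>t. f (frame_point p (vs @ [v]) t)) \<in> borel_measurable (Pi\<^sub>M (insert ?n {..<?n}) (\<lambda>_. lborel))"
    using measurable_compose[OF frame_point_measurable[of p "vs @ [v]"] assms] unfolding ins .
  have "(\<integral>\<^sup>+ x. f x \<partial>frame_measure p (vs @ [v])) =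
      (\<integral>\<^sup>+ t. f (frame_point p (vs @ [v]) t) \<partial>(Pi\<^sub>M (insert ?n {..<?n}) (\<lambda>_. lborel)))"
    by (simp only: nn_integral_frame_measure[OF assms] ins)
  also have "\<dots> = (\<integral>\<^sup>+ s. (\<integral>\<^sup>+ t. f (frame_point p (vs @ [v]) (t(?n := s)))
      \<partial>(Pi\<^sub>M {..<?n} (\<lambda>_. lborel))) \<partial>lborel)"
    by (rule lborel_product.product_nn_integral_insert_rev[OF _ _ m]) auto
  also have "\<dots> = (\<integral>\<^sup>+ s. (\<integral>\<^sup>+ t. f (frame_point (p + s *\<^sub>R v) vs t) \<partial>(Pi\<^sub>M {..<?n} (\<lambda>_. lborel))) \<partial>lborel)"
  proof -
    have "frame_point p (vs @ [v]) (t(?n := s)) = frame_point (p + s *\<^sub>R v) vs t" for s t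
      unfolding frame_point_def by (simp add: nth_append algebra_simps)
    then show ?thesis by simp
  qed
  finally show ?thesis by (simp add: nn_integral_frame_measure[OF assms])
qed

text \<open>By Tonelli's theorem any one coordinate may be made the outermost; the induction peels
  off the vectors behind \<open>v\<close>.\<close>

lemma nn_integral_frame_measure_insert:
  assumes [measurable]: "f \<in> borel_measurable borel"
  shows "(\<integral>\<^sup>+ x. f x \<partial>frame_measure p (us @ v # ws)) =
    (\<integral>\<^sup>+ t. (\<integral>\<^sup>+ x. f x \<partial>frame_measure (p + t *\<^sub>R v) (us @ ws)) \<partial>lborel)"
proof (induction ws arbitrary: p rule: rev_induct)
  case Nil
  then show ?case using nn_integral_frame_measure_snoc[OF assms] by simp
next
  case (snoc w ws)
  let ?F = "\<lambda>q. \<integral>\<^sup>+ x. f x \<partial>frame_measure q (us @ ws)"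
  have [measurable]: "?F \<in> borel_measurable borel" by simp
  have "(\<integral>\<^sup>+ x. f x \<partial>frame_measure p (us @ v # ws @ [w])) =
      (\<integral>\<^sup>+ s. (\<integral>\<^sup>+ x. f x \<partial>frame_measure (p + s *\<^sub>R w) (us @ v # ws)) \<partial>lborel)"
    using nn_integral_frame_measure_snoc[OF assms, of p "us @ v # ws" w] by simp
  also have "\<dots> = (\<integral>\<^sup>+ s. (\<integral>\<^sup>+ t. ?F (p + s *\<^sub>R w + t *\<^sub>R v) \<partial>lborel) \<partial>lborel)"
    by (simp add: snoc.IH)
  also have "\<dots> = (\<integral>\<^sup>+ t. (\<integral>\<^sup>+ s. ?F (p + s *\<^sub>R w + t *\<^sub>R v) \<partial>lborel) \<partial>lborel)"
    by (rule lborel_pair.Fubini') measurable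
  also have "\<dots> = (\<integral>\<^sup>+ t. (\<integral>\<^sup>+ s. ?F (p + t *\<^sub>R v + s *\<^sub>R w) \<partial>lborel) \<partial>lborel)"
    by (simp add: algebra_simps)
  also have "\<dots> = (\<integral>\<^sup>+ t. (\<integral>\<^sup>+ x. f x \<partial>frame_measure (p + t *\<^sub>R v) (us @ ws @ [w])) \<partial>lborel)"
    using nn_integral_frame_measure_snoc[OF assms, of _ "us @ ws" w] by simp
  finally show ?case by simp
qed

text \<open>A shift by a multiple of one frame vector translates one real coordinate, which is made
  the outermost; an arbitrary shift is a finite sum of such.\<close>

lemma nn_integral_frame_measure_span:
  assumes [measurable]: "f \<in> borel_measurable borel" and "q \<in> span (set vs)"
  shows "(\<integral>\<^sup>+ x. f x \<partial>frame_measure (p + q) vs) = (\<integral>\<^sup>+ x. f x \<partial>frame_measure p vs)"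
  using assms(2)
proof (induction q arbitrary: p rule: span_induct_alt)
  case base
  then show ?case by simp
next
  case (step c v y)
  obtain us ws where vs: "vs = us @ v # ws" using step(1) by (auto simp: in_set_conv_decomp)
  have "(\<integral>\<^sup>+ x. f x \<partial>frame_measure (p + (c *\<^sub>R v + y)) vs) = (\<integral>\<^sup>+ x. f x \<partial>frame_measure (p + c *\<^sub>R v) vs)"
    using step(2)[of "p + c *\<^sub>R v"] by (simp add: add.assoc)
  also have "\<dots> = (\<integral>\<^sup>+ t. (\<integral>\<^sup>+ x. f x \<partial>frame_measure (p + (c + 1 * t) *\<^sub>R v) (us @ ws)) \<partial>lborel)"
    unfolding vs nn_integral_frame_measure_insert[OF assms(1)] by (simp add: algebra_simps)
  also have "\<dots> = (\<integral>\<^sup>+ t. (\<integral>\<^sup>+ x. f x \<partial>frame_measure (p + t *\<^sub>R v) (us @ ws)) \<partial>lborel)"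
    by (subst nn_integral_real_affine[where c = 1 and t = c]) (auto simp: )
  finally show ?case
    unfolding vs nn_integral_frame_measure_insert[OF assms(1)] by simp
qed

text \<open>\<open>ws\<close> is, as a simple multivector, \<open>r\<close> times \<open>vs\<close>.\<close>

definition frame_ratio :: "real \<Rightarrow> (real^3) list \<Rightarrow> (real^3) list \<Rightarrow> bool" where
  "frame_ratio r vs ws \<longleftrightarrow> r \<noteq> 0 \<and> length ws = length vs \<and>
     (\<forall>\<alpha>. alternating_form (length vs) \<alpha> \<longrightarrow> \<alpha> ws = r * \<alpha> vs) \<and>
     (\<forall>p. \<forall>f \<in> borel_measurable borel.
        ennreal \<bar>r\<bar> * (\<integral>\<^sup>+ x. f x \<partial>frame_measure p ws) = (\<integral>\<^sup>+ x. f x \<partial>frame_measure p vs))"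

lemma frame_ratio_refl: "frame_ratio 1 vs vs"
  by (simp add: frame_ratio_def)

lemma frame_ratio_trans:
  assumes "frame_ratio r us vs" "frame_ratio s vs ws"
  shows "frame_ratio (s * r) us ws"
  using assms unfolding frame_ratio_def
  by (auto simp: abs_mult ennreal_mult mult.assoc mult.left_commute[of "ennreal \<bar>s\<bar>"])

text \<open>An elementary column operation. Multilinearity and
  \<open>alternating_form_span_0\<close> give its effect on forms; the substitution along one line
  and \<open>nn_integral_frame_measure_span\<close> give its effect on the measure. Both effects are
  recorded by the same real number, so orientation and Jacobian come together.\<close>

lemma frame_ratio_replace:
  assumes a: "a \<noteq> 0" and u: "u \<in> span (set us \<union> set ws)"
  shows "frame_ratio a (us @ v # ws) (us @ (a *\<^sub>R v + u) # ws)"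
  unfolding frame_ratio_def
proof (intro conjI allI impI ballI a)
  fix \<alpha> assume al: "alternating_form (length (us @ v # ws)) \<alpha>"
  have l: "linear (\<lambda>v. \<alpha> (us @ v # ws))" using alternating_form_linear[OF al] by simp
  show "\<alpha> (us @ (a *\<^sub>R v + u) # ws) = a * \<alpha> (us @ v # ws)"
    using alternating_form_span_0[OF al _ u] linear_add[OF l, of "a *\<^sub>R v" u] linear_scale[OF l, of a v]
    by simp
next
  fix p :: "real^3" and f :: "real^3 \<Rightarrow> ennreal" assume f [measurable]: "f \<in> borel_measurable borel"
  let ?F = "\<lambda>q. \<integral>\<^sup>+ x. f x \<partial>frame_measure q (us @ ws)"
  have [measurable]: "?F \<in> borel_measurable borel" by simp
  have F: "?F (p + t *\<^sub>R (a *\<^sub>R v + u)) = ?F (p + (0 + a * t) *\<^sub>R v)" for t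
    using nn_integral_frame_measure_span[OF f, of "t *\<^sub>R u" "us @ ws" "p + (a * t) *\<^sub>R v"] u
    by (simp add: span_mul algebra_simps)
  have "ennreal \<bar>a\<bar> * (\<integral>\<^sup>+ x. f x \<partial>frame_measure p (us @ (a *\<^sub>R v + u) # ws)) =
      ennreal \<bar>a\<bar> * (\<integral>\<^sup>+ t. ?F (p + (0 + a * t) *\<^sub>R v) \<partial>lborel)"
    unfolding nn_integral_frame_measure_insert[OF f] F ..
  also have "\<dots> = (\<integral>\<^sup>+ t. ?F (p + t *\<^sub>R v) \<partial>lborel)"
    by (rule nn_integral_real_affine[symmetric]) (use a in auto)
  finally show "ennreal \<bar>a\<bar> * (\<integral>\<^sup>+ x. f x \<partial>frame_measure p (us @ (a *\<^sub>R v + u) # ws)) =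
      (\<integral>\<^sup>+ x. f x \<partial>frame_measure p (us @ v # ws))"
    unfolding nn_integral_frame_measure_insert[OF f] .
qed simp

text \<open>A transposition is three shears followed by one change of sign.\<close>

lemma frame_ratio_swap: "frame_ratio (-1) (us @ a # b # ws) (us @ b # a # ws)"
proof -
  have 1: "frame_ratio 1 (us @ a # b # ws) (us @ (a + b) # b # ws)"
    using frame_ratio_replace[of 1 b us "b # ws" a] by (simp add: span_base)
  have 2: "frame_ratio 1 (us @ (a + b) # b # ws) (us @ (a + b) # (- a) # ws)"
  proof -
    have "- (a + b) \<in> span (set (us @ [a + b]) \<union> set ws)"
      by (intro span_neg span_base) simp
    from frame_ratio_replace[OF _ this, of 1 b] show ?thesis by simp
  qed
  have 3: "frame_ratio 1 (us @ (a + b) # (- a) # ws) (us @ b # (- a) # ws)"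
    using frame_ratio_replace[of 1 "- a" us "(- a) # ws" "a + b"] by (simp add: span_base)
  have 4: "frame_ratio (-1) (us @ b # (- a) # ws) (us @ b # a # ws)"
    using frame_ratio_replace[of "-1" 0 "us @ [b]" ws "- a"] by (simp add: span_zero)
  show ?thesis
    using frame_ratio_trans[OF frame_ratio_trans[OF frame_ratio_trans[OF 1 2] 3] 4] by simp
qed

lemma frame_ratio_move: "\<exists>r. frame_ratio r (us @ vs @ w # ws) (us @ w # vs @ ws)"
proof (induction vs arbitrary: us)
  case Nil
  show ?case using frame_ratio_refl by auto
next
  case (Cons v vs)
  obtain r where "frame_ratio r (us @ v # vs @ w # ws) (us @ v # w # vs @ ws)"
    using Cons.IH[of "us @ [v]"] by auto
  from frame_ratio_trans[OF this frame_ratio_swap] show ?case by auto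
qed

lemma ordered_basis_iff: "ordered_basis V vs \<longleftrightarrow> span (set vs) = V \<and> length vs = dim V"
proof
  assume *: "ordered_basis V vs"
  then have "card (set vs) = dim V"
    unfolding ordered_basis_def by (metis dim_eq_card dim_span)
  then show "span (set vs) = V \<and> length vs = dim V"
    using * by (auto simp: ordered_basis_def distinct_card)
next
  assume *: "span (set vs) = V \<and> length vs = dim V"
  then have "card (set vs) \<ge> dim V" using dim_le_card[of V "set vs"] by auto
  then have c: "card (set vs) = length vs" using * card_length[of vs] by linarith
  then have "distinct vs" by (simp add: card_distinct)
  moreover have "independent (set vs)"
    using * c card_le_dim_spanning[of "set vs" V] by (auto simp: span_base span_superset)
  ultimately show "ordered_basis V vs" using * by (simp add: ordered_basis_def)
qed

text \<open>Steinitz exchange: since \<open>w\<close> is not in the span of \<open>U\<close> alone,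
  some vector of \<open>vs\<close> must occur in it with a nonzero coefficient.\<close>

lemma span_exchange_coefficient:
  assumes "w \<in> span (U \<union> set vs)" "w \<notin> span U"
  shows "\<exists>xs v ys a u. vs = xs @ v # ys \<and> a \<noteq> 0 \<and> w = a *\<^sub>R v + u \<and> u \<in> span (U \<union> set (xs @ ys))"
  using assms(1)
proof (induction vs)
  case Nil
  then show ?case using assms(2) by simp
next
  case (Cons v vs)
  from Cons.prems obtain k where k: "w - k *\<^sub>R v \<in> span (U \<union> set vs)"
    using span_breakdown_eq[of w v "U \<union> set vs"] by auto
  show ?case
  proof (cases "k = 0")
    case False
    then have "v # vs = [] @ v # vs \<and> k \<noteq> 0 \<and> w = k *\<^sub>R v + (w - k *\<^sub>R v) \<and>
        w - k *\<^sub>R v \<in> span (U \<union> set ([] @ vs))" using k by simp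
    then show ?thesis by blast
  next
    case True
    then obtain xs v' ys a u where *: "vs = xs @ v' # ys" "a \<noteq> 0" "w = a *\<^sub>R v' + u"
      "u \<in> span (U \<union> set (xs @ ys))" using Cons.IH k by auto
    then have "u \<in> span (U \<union> set ((v # xs) @ ys))" by (rule_tac subsetD[OF span_mono]) auto
    then have "v # vs = (v # xs) @ v' # ys \<and> a \<noteq> 0 \<and> w = a *\<^sub>R v' + u \<and>
        u \<in> span (U \<union> set ((v # xs) @ ys))" using * by simp
    then show ?thesis by blast
  qed
qed

lemma frame_ratio_exists_append:
  assumes "ordered_basis V (us @ vs)" "ordered_basis V (us @ ws)"
  shows "\<exists>r. frame_ratio r (us @ vs) (us @ ws)"
  using assms
proof (induction ws arbitrary: us vs)
  case Nil
  then have "vs = []" by (simp add: ordered_basis_iff)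
  then show ?case using frame_ratio_refl by auto
next
  case (Cons w ws)
  have "independent (set (us @ w # ws))" "distinct (us @ w # ws)"
    using Cons.prems(2) by (auto simp: ordered_basis_def)
  then have "independent (insert w (set us))" "w \<notin> set us"
    by (auto elim!: independent_mono)
  then have "w \<notin> span (set us)" by (simp add: independent_insert)
  moreover have "w \<in> span (set us \<union> set vs)"
  proof -
    have "w \<in> V" using Cons.prems(2) by (auto simp: ordered_basis_def intro: span_base)
    then show ?thesis using Cons.prems(1) by (simp add: ordered_basis_def)
  qed
  ultimately obtain xs v ys a u where *: "vs = xs @ v # ys" "a \<noteq> 0" "w = a *\<^sub>R v + u"
      "u \<in> span (set us \<union> set (xs @ ys))" using span_exchange_coefficient by blast
  have 1: "frame_ratio a (us @ vs) (us @ xs @ w # ys)"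
    using frame_ratio_replace[of a u "us @ xs" ys v] * by (simp add: Un_assoc)
  obtain r where 2: "frame_ratio r (us @ xs @ w # ys) (us @ w # xs @ ys)"
    using frame_ratio_move by blast
  \<comment> \<open>The exchanged vector can be recovered, so the new list still spans
    \<open>V\<close> and, having the same length, is again a basis.\<close>
  have v: "v = (1 / a) *\<^sub>R w - (1 / a) *\<^sub>R u" using * by (simp add: algebra_simps)
  have u': "u \<in> span (set (us @ w # xs @ ys))"
    by (rule subsetD[OF span_mono *(4)]) auto
  then have "v \<in> span (set (us @ w # xs @ ys))"
    unfolding v by (intro span_diff span_mul u' span_base[of w]) auto
  then have "set (us @ vs) \<subseteq> span (set (us @ w # xs @ ys))"
    using *(1) by (simp add: span_superset subset_iff span_base)
  then have "V \<subseteq> span (set (us @ w # xs @ ys))"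
    using span_minimal[OF _ subspace_span] Cons.prems(1) unfolding ordered_basis_def by blast
  moreover have "set (us @ w # xs @ ys) \<subseteq> V"
  proof -
    have "set us \<union> set vs \<subseteq> V" "w \<in> V"
      using Cons.prems by (auto simp: ordered_basis_def intro: span_base)
    then show ?thesis using *(1) by auto
  qed
  ultimately have "span (set (us @ w # xs @ ys)) = V"
    using span_minimal[of "set (us @ w # xs @ ys)" V] subspace_span[of "set (us @ vs)"] Cons.prems(1)
    unfolding ordered_basis_def by blast
  then have "ordered_basis V ((us @ [w]) @ (xs @ ys))"
    using Cons.prems(1) *(1) by (simp add: ordered_basis_iff)
  moreover have "ordered_basis V ((us @ [w]) @ ws)" using Cons.prems(2) by simp
  ultimately obtain s where 3: "frame_ratio s ((us @ [w]) @ (xs @ ys)) ((us @ [w]) @ ws)"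
    using Cons.IH by blast
  show ?case using frame_ratio_trans[OF frame_ratio_trans[OF 1 2]] 3 by auto
qed

lemma frame_ratio_exists:
  assumes "ordered_basis V vs" "ordered_basis V ws"
  obtains r where "frame_ratio r vs ws"
  using frame_ratio_exists_append[of V "[]" vs ws] assms by auto

lemma frame_ratio_nonzero: "frame_ratio r vs ws \<Longrightarrow> r \<noteq> 0"
  by (simp add: frame_ratio_def)

lemma frame_ratio_form: "frame_ratio r vs ws \<Longrightarrow> alternating_form (length vs) \<alpha> \<Longrightarrow> \<alpha> ws = r * \<alpha> vs"
  by (simp add: frame_ratio_def)

lemma frame_ratio_integral: "frame_ratio r vs ws \<Longrightarrow> f \<in> borel_measurable borel \<Longrightarrow>
  (\<integral>\<^sup>+ x. f x \<partial>frame_measure p vs) = ennreal \<bar>r\<bar> * (\<integral>\<^sup>+ x. f x \<partial>frame_measure p ws)"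
  by (simp add: frame_ratio_def)

section \<open>Orthogonal projections\<close>

definition orthonormal_frame :: "(real^3) list \<Rightarrow> bool" where
  "orthonormal_frame es \<longleftrightarrow>
     (\<forall>i<length es. \<forall>j<length es. es ! i \<bullet> es ! j = (if i = j then 1 else 0))"

text \<open>Equivalently, \<open>bs ! j\<close> lies above \<open>es ! j\<close> under
  \<open>proj es\<close>. The plane spanned by \<open>bs\<close> is then a graph over the span of
  \<open>es\<close>.\<close>

definition dual_frame :: "(real^3) list \<Rightarrow> (real^3) list \<Rightarrow> bool" where
  "dual_frame es bs \<longleftrightarrow> length bs = length es \<and>
     (\<forall>i<length es. \<forall>j<length es. es ! i \<bullet> bs ! j = (if i = j then 1 else 0))"

definition proj :: "(real^3) list \<Rightarrow> real^3 \<Rightarrow> real^3" where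
  "proj es x = (\<Sum>i<length es. (x \<bullet> es ! i) *\<^sub>R es ! i)"

text \<open>For \<open>y\<close> in the span of \<open>es\<close>, the point above \<open>y\<close> of the plane through \<open>p\<close> spanned by the
  dual frame \<open>bs\<close>.\<close>

definition lift :: "(real^3) list \<Rightarrow> real^3 \<Rightarrow> (real^3) list \<Rightarrow> real^3 \<Rightarrow> real^3" where
  "lift es p bs y = p + (\<Sum>i<length es. ((y - p) \<bullet> es ! i) *\<^sub>R bs ! i)"

lemma dual_frame_self: "orthonormal_frame es \<Longrightarrow> dual_frame es es"
  by (simp add: orthonormal_frame_def dual_frame_def)

lemma linear_proj: "linear (proj es)"
  unfolding proj_def by (simp add: linear_iff inner_add_left scaleR_add_left sum.distrib scaleR_sum_right)

lemma continuous_on_lift: "continuous_on S (lift es p bs)"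
  unfolding lift_def by (intro continuous_intros)

lemma lift_measurable [measurable]: "lift es p bs \<in> borel_measurable borel"
  by (intro borel_measurable_continuous_onI continuous_on_lift)

lemma inner_sum_dual:
  assumes "dual_frame es bs" "j < length es"
  shows "(\<Sum>i<length es. c i *\<^sub>R bs ! i) \<bullet> es ! j = c j"
proof -
  have "(\<Sum>i<length es. c i *\<^sub>R bs ! i) \<bullet> es ! j = (\<Sum>i<length es. if i = j then c i else 0)"
    unfolding inner_sum_left using assms
    by (intro sum.cong) (auto simp: dual_frame_def inner_commute)
  then show ?thesis using assms(2) by simp
qed

lemma proj_inner:
  assumes "orthonormal_frame es" "j < length es"
  shows "proj es x \<bullet> es ! j = x \<bullet> es ! j"
  unfolding proj_def by (rule inner_sum_dual[OF dual_frame_self[OF assms(1)] assms(2)])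

lemma proj_in_span: "proj es x \<in> span (set es)"
  unfolding proj_def by (intro span_sum span_mul span_base) simp

lemma proj_sum_dual:
  assumes "dual_frame es bs"
  shows "proj es (\<Sum>i<length es. c i *\<^sub>R bs ! i) = (\<Sum>i<length es. c i *\<^sub>R es ! i)"
  unfolding proj_def using inner_sum_dual[OF assms] by simp

lemma span_set_list_sum:
  assumes "x \<in> span (set vs)"
  shows "\<exists>c. x = (\<Sum>i<length vs. c i *\<^sub>R vs ! i)"
  using assms
proof (induction rule: span_induct_alt)
  case base
  show ?case by (rule exI[of _ "\<lambda>_. 0"]) simp
next
  case (step a v y)
  obtain j where j: "j < length vs" "vs ! j = v" using step(1) unfolding in_set_conv_nth by blast
  obtain c where c: "y = (\<Sum>i<length vs. c i *\<^sub>R vs ! i)" using step by blast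
  have "(\<Sum>i<length vs. (c i + (if i = j then a else 0)) *\<^sub>R vs ! i) = y + (\<Sum>i<length vs. (if i = j then a *\<^sub>R vs ! i else 0))"
    unfolding c sum.distrib[symmetric] by (intro sum.cong) (auto simp: algebra_simps)
  also have "\<dots> = a *\<^sub>R v + y" using j by simp
  finally show ?case by metis
qed

lemma proj_eq_self: "orthonormal_frame es \<Longrightarrow> y \<in> span (set es) \<Longrightarrow> proj es y = y"
  using span_set_list_sum[of y es] proj_sum_dual[OF dual_frame_self] by fastforce

lemma proj_eq_0_iff:
  assumes "orthonormal_frame es"
  shows "proj es x = 0 \<longleftrightarrow> (\<forall>i<length es. x \<bullet> es ! i = 0)"
  using proj_inner[OF assms, of _ x] unfolding proj_def by auto

lemma proj_lift:
  assumes "orthonormal_frame es" "dual_frame es bs" "y \<in> span (set es)"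
  shows "proj es (lift es p bs y) = y"
proof -
  have "proj es (lift es p bs y) = proj es p + (\<Sum>i<length es. ((y - p) \<bullet> es ! i) *\<^sub>R es ! i)"
    unfolding lift_def linear_add[OF linear_proj] proj_sum_dual[OF assms(2)] ..
  also have "(\<Sum>i<length es. ((y - p) \<bullet> es ! i) *\<^sub>R es ! i) = proj es (y - p)"
    by (simp add: proj_def)
  finally show ?thesis
    using proj_eq_self[OF assms(1,3)] by (simp add: linear_diff[OF linear_proj])
qed

lemma lift_in_plane: "length bs = length es \<Longrightarrow> lift es p bs y - p \<in> span (set bs)"
  unfolding lift_def by (simp, intro span_sum span_mul span_base) simp

lemma lift_proj:
  assumes "orthonormal_frame es" "dual_frame es bs" "x - p \<in> span (set bs)"
  shows "lift es p bs (proj es x) = x"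
proof -
  have l: "length bs = length es" using assms(2) by (simp add: dual_frame_def)
  obtain c where c: "x - p = (\<Sum>i<length es. c i *\<^sub>R bs ! i)" using span_set_list_sum[OF assms(3)] l by auto
  have "(proj es x - p) \<bullet> es ! i = c i" if "i < length es" for i
    using inner_sum_dual[OF assms(2) that, of c] proj_inner[OF assms(1) that, of x] unfolding c[symmetric]
    by (simp add: inner_diff_left)
  then have "lift es p bs (proj es x) = p + (\<Sum>i<length es. c i *\<^sub>R bs ! i)"
    unfolding lift_def by simp
  then show ?thesis using c by (simp add: algebra_simps)
qed

lemma dual_frame_basis:
  assumes "dual_frame es bs"
  shows "ordered_basis (span (set bs)) bs"
proof -
  have l: "length bs = length es" using assms by (simp add: dual_frame_def)
  have z: "\<forall>i<length es. c i = 0" if "(\<Sum>i<length es. c i *\<^sub>R bs ! i) = 0" for c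
    using inner_sum_dual[OF assms, of _ c] that by auto
  have d: "distinct bs"
    unfolding distinct_conv_nth using assms l unfolding dual_frame_def by (metis zero_neq_one)
  have b: "bij_betw (\<lambda>i. bs ! i) {..<length bs} (set bs)"
    by (rule bij_betw_nth[OF d]) auto
  have "independent (set bs)"
  proof (rule independent_if_scalars_zero)
    fix f x assume s: "(\<Sum>x\<in>set bs. f x *\<^sub>R x) = 0" and x: "x \<in> set bs"
    have "(\<Sum>i<length es. f (bs ! i) *\<^sub>R bs ! i) = 0"
      using s sum.reindex_bij_betw[OF b, of "\<lambda>x. f x *\<^sub>R x"] l by simp
    then show "f x = 0" using z[of "\<lambda>i. f (bs ! i)"] x l by (metis in_set_conv_nth)
  qed simp
  then show ?thesis using d by (simp add: ordered_basis_def)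
qed

lemma orthonormal_frame_basis: "orthonormal_frame es \<Longrightarrow> ordered_basis (span (set es)) es"
  using dual_frame_basis dual_frame_self by blast

lemma orthonormal_frame_exists:
  fixes V :: "(real^3) set"
  assumes "subspace V"
  obtains es where "orthonormal_frame es" "span (set es) = V" "length es = dim V"
proof -
  obtain B where B: "B \<subseteq> V" "pairwise orthogonal B" "\<And>x. x \<in> B \<Longrightarrow> norm x = 1"
      "independent B" "card B = dim V" "span B = V"
    using orthonormal_basis_subspace[OF assms] by metis
  obtain es where es: "set es = B" "distinct es"
    using finite_distinct_list[OF independent_imp_finite[OF B(4)]] by blast
  have "orthonormal_frame es"
    unfolding orthonormal_frame_def
  proof (intro allI impI)
    fix i j assume ij: "i < length es" "j < length es"
    show "es ! i \<bullet> es ! j = (if i = j then 1 else 0)"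
    proof (cases "i = j")
      case True
      then show ?thesis using B(3)[of "es ! i"] es ij by (metis dot_square_norm nth_mem one_power2)
    next
      case False
      then have "es ! i \<noteq> es ! j" using es(2) ij nth_eq_iff_index_eq by blast
      then show ?thesis using False B(2) es(1) ij by (auto simp: pairwise_def orthogonal_def)
    qed
  qed
  then show ?thesis using es B distinct_card[OF es(2)] by (intro that[of es]) auto
qed

lemma kvector_inner_dual:
  assumes "dual_frame es bs"
  shows "kvector_inner es bs = 1"
  using assms by (subst kvector_inner_triangular) (auto simp: dual_frame_def)

lemma kvector_inner_Cons_dual:
  assumes d: "dual_frame es bs" and l: "\<And>i. i < length es \<Longrightarrow> es ! i \<bullet> l = 0"
  shows "kvector_inner (b # es) (l # bs) = b \<bullet> l"
proof -
  have "kvector_inner (b # es) (l # bs) = (\<Prod>i<Suc (length es). (b # es) ! i \<bullet> (l # bs) ! i)"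
    using d l by (subst kvector_inner_triangular) (auto simp: dual_frame_def nth_Cons' less_Suc_eq_0_disj)
  also have "\<dots> = b \<bullet> l"
    unfolding prod.lessThan_Suc_shift using d by (simp add: dual_frame_def)
  finally show ?thesis .
qed

text \<open>Complete \<open>v\<close> to a basis of \<open>V\<close>. In this basis the matrix of
  inner products has a zero column, and \<open>frame_ratio\<close> carries the vanishing over to
  \<open>vs\<close>. Hence a nonzero value means that the projection is injective on
  \<open>V\<close>.\<close>

lemma kvector_inner_eq_0:
  assumes "ordered_basis V vs" "length es = length vs" "v \<in> V" "v \<noteq> 0" "\<And>i. i < length es \<Longrightarrow> es ! i \<bullet> v = 0"
  shows "kvector_inner es vs = 0"
proof -
  have V: "subspace V" using assms(1) by (metis ordered_basis_def subspace_span)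
  obtain B where B: "{v} \<subseteq> B" "B \<subseteq> V" "independent B" "V \<subseteq> span B"
    using maximal_independent_subset_extend[of "{v}" V] assms by auto
  have sB: "span B = V" using B V by (metis span_minimal subset_antisym)
  obtain ws where ws: "set ws = B - {v}" "distinct ws"
    using finite_distinct_list independent_imp_finite[OF B(3)] by (metis finite_Diff)
  have "set (v # ws) = B" using ws B by auto
  then have ob: "ordered_basis V (v # ws)"
    using ws B(3) sB by (auto simp: ordered_basis_def)
  obtain r where r: "frame_ratio r (v # ws) vs" using frame_ratio_exists[OF ob assms(1)] .
  have "length (v # ws) = length es" using ob assms(1,2) by (simp add: ordered_basis_iff)
  then have "kvector_inner es (v # ws) = 0"
  proof -
    assume len: "length (v # ws) = length es"
    have "(\<Prod>i<length es. es ! i \<bullet> (v # ws) ! p i) = 0" if p: "p permutes {..<length es}" for p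
    proof -
      have "0 < length es" using len by (cases es) auto
      then have "inv p 0 < length es" "p (inv p 0) = 0"
        using permutes_in_image[OF permutes_inv[OF p], of 0] permutes_inverses[OF p] by auto
      then have "es ! inv p 0 \<bullet> (v # ws) ! p (inv p 0) = 0" using assms(5) by simp
      then show ?thesis using \<open>inv p 0 < length es\<close> by (intro prod_zero) auto
    qed
    then show ?thesis unfolding kvector_inner_def by (simp add: sum.neutral)
  qed
  moreover have "kvector_inner es vs = r * kvector_inner es (v # ws)"
    using frame_ratio_form[OF r] alternating_form_kvector_inner[of es] \<open>length (v # ws) = length es\<close> by simp
  ultimately show ?thesis by simp
qed

text \<open>By dimension, an injective projection maps \<open>V\<close> onto the span of
  \<open>es\<close>; the dual frame consists of the preimages of the vectors of
  \<open>es\<close>.\<close>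

lemma dual_frame_exists:
  assumes es: "orthonormal_frame es" and inj: "\<And>v. v \<in> V \<Longrightarrow> proj es v = 0 \<Longrightarrow> v = 0"
    and V: "subspace V" "dim V = length es"
  obtains bs where "dual_frame es bs" "ordered_basis V bs"
proof -
  have "inj_on (proj es) (span V)"
    unfolding span_eq_iff[THEN iffD2, OF V(1)] linear_injective_on_subspace_0[OF linear_proj V(1)]
    using inj by blast
  then have "dim (proj es ` V) = dim V" by (rule dim_image_eq[OF linear_proj])
  moreover have "dim (span (set es)) = length es"
    using orthonormal_frame_basis[OF es] by (simp add: ordered_basis_iff)
  moreover have "subspace (proj es ` V)" by (rule linear_subspace_image[OF linear_proj V(1)])
  moreover have "proj es ` V \<subseteq> span (set es)" using proj_in_span by blast
  ultimately have im: "proj es ` V = span (set es)"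
    using subspace_dim_equal[of "proj es ` V" "span (set es)"] V by auto
  have "\<exists>b. b \<in> V \<and> proj es b = es ! i" if "i < length es" for i
    using im span_base[of "es ! i" "set es"] that by (metis image_iff nth_mem)
  then obtain b where b: "\<And>i. i < length es \<Longrightarrow> b i \<in> V \<and> proj es (b i) = es ! i" by metis
  let ?bs = "map b [0..<length es]"
  have "es ! i \<bullet> b j = (if i = j then 1 else 0)" if "i < length es" "j < length es" for i j
    using proj_inner[OF es that(1), of "b j"] b[OF that(2)] es that
    unfolding orthonormal_frame_def by (metis inner_commute)
  then have d: "dual_frame es ?bs" by (simp add: dual_frame_def)
  have "dim (set ?bs) = length es"
    using dual_frame_basis[OF d] by (simp add: ordered_basis_iff)
  moreover have "span (set ?bs) \<subseteq> V" using b V(1) by (intro span_minimal) auto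
  ultimately have "span (set ?bs) = V"
    using subspace_dim_equal[of "span (set ?bs)" V] V by auto
  then have "ordered_basis V ?bs" using dual_frame_basis[OF d] by metis
  then show ?thesis using that d by blast
qed

lemma dual_frame_exists_nonzero:
  assumes es: "orthonormal_frame es" and vs: "ordered_basis V vs" "length vs = length es"
    and K: "kvector_inner es vs \<noteq> 0"
  obtains bs where "dual_frame es bs" "ordered_basis V bs"
proof (rule dual_frame_exists[OF es])
  show "subspace V" using vs by (metis ordered_basis_def subspace_span)
  show "dim V = length es" using vs by (simp add: ordered_basis_iff)
  fix v assume "v \<in> V" "proj es v = 0"
  then show "v = 0" using K kvector_inner_eq_0[OF vs(1), of es v] vs proj_eq_0_iff[OF es]
    by (metis inner_commute)
qed (use that in blast)

text \<open>Relative to an orthonormal basis of \<open>V\<close> with ratio \<open>r\<close>, the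
  value is the square of \<open>r\<close>.\<close>

lemma kvector_inner_self_pos:
  assumes "ordered_basis V vs"
  shows "kvector_inner vs vs > 0"
proof -
  obtain es where es: "orthonormal_frame es" "span (set es) = V" "length es = dim V"
    using orthonormal_frame_exists assms by (metis ordered_basis_def subspace_span)
  obtain r where r: "frame_ratio r es vs" using frame_ratio_exists[of V es vs] es assms orthonormal_frame_basis by blast
  have l: "length vs = length es" using assms es by (simp add: ordered_basis_iff)
  have "kvector_inner vs vs = r * kvector_inner vs es"
    using frame_ratio_form[OF r] alternating_form_kvector_inner[of vs] l by simp
  also have "kvector_inner vs es = kvector_inner es vs" using l by (rule kvector_inner_commute)
  also have "\<dots> = r * kvector_inner es es"
    using frame_ratio_form[OF r] alternating_form_kvector_inner[of es] by simp
  also have "kvector_inner es es = 1" by (rule kvector_inner_dual[OF dual_frame_self[OF es(1)]])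
  finally show ?thesis using frame_ratio_nonzero[OF r] by (simp add: zero_less_mult_iff linorder_neq_iff) linarith
qed

text \<open>The projection carries the parametrisation by \<open>bs\<close> to the one by
  \<open>es\<close>, so \<open>lift\<close> reproduces it. The base point \<open>proj es p\<close>
  may be replaced by 0, as this is a shift inside the span of \<open>es\<close>.\<close>

lemma frame_measure_lift:
  assumes es: "orthonormal_frame es" and bs: "dual_frame es bs"
    and f [measurable]: "f \<in> borel_measurable borel"
  shows "(\<integral>\<^sup>+ x. f x \<partial>frame_measure p bs) = (\<integral>\<^sup>+ y. f (lift es p bs y) \<partial>frame_measure 0 es)"
proof -
  have l: "length bs = length es" using bs by (simp add: dual_frame_def)
  have 1: "proj es (frame_point p bs t) = frame_point (proj es p) es t" for t
    unfolding frame_point_def l by (simp add: linear_add[OF linear_proj] proj_sum_dual[OF bs])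
  have 2: "frame_point p bs t = lift es p bs (frame_point (proj es p) es t)" for t
    unfolding 1[symmetric]
    by (rule lift_proj[OF es bs, symmetric]) (simp add: frame_point_def, intro span_sum span_mul span_base, simp)
  have "(\<integral>\<^sup>+ x. f x \<partial>frame_measure p bs) =
      (\<integral>\<^sup>+ t. f (lift es p bs (frame_point (proj es p) es t)) \<partial>(\<Pi>\<^sub>M i\<in>{..<length es}. lborel))"
    by (simp only: nn_integral_frame_measure[OF f] l 2)
  also have "\<dots> = (\<integral>\<^sup>+ y. f (lift es p bs y) \<partial>frame_measure (0 + proj es p) es)"
    by (subst nn_integral_frame_measure) auto
  also have "\<dots> = (\<integral>\<^sup>+ y. f (lift es p bs y) \<partial>frame_measure 0 es)"
    by (rule nn_integral_frame_measure_span[OF _ proj_in_span]) measurable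
  finally show ?thesis .
qed

lemma nn_integral_frame_measure_insert':
  assumes [measurable]: "f \<in> borel_measurable borel"
  shows "(\<integral>\<^sup>+ x. f x \<partial>frame_measure p (us @ v # ws)) =
    (\<integral>\<^sup>+ x. (\<integral>\<^sup>+ t. f (x + t *\<^sub>R v) \<partial>lborel) \<partial>frame_measure p (us @ ws))"
proof -
  let ?vs = "us @ ws"
  let ?P = "\<Pi>\<^sub>M i\<in>{..<length ?vs}. lborel :: real measure"
  interpret P: sigma_finite_measure ?P
    by (rule lborel_product.sigma_finite) simp
  interpret pair_sigma_finite ?P lborel ..
  have [measurable]: "(\<lambda>x. \<integral>\<^sup>+ t. f (x + t *\<^sub>R v) \<partial>lborel) \<in> borel_measurable borel"
    by (intro lborel.borel_measurable_nn_integral) measurable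
  have m: "(\<lambda>(s, t). f (frame_point p ?vs s + t *\<^sub>R v)) \<in> borel_measurable (?P \<Otimes>\<^sub>M lborel)"
    by measurable
  have "(\<integral>\<^sup>+ x. f x \<partial>frame_measure p (us @ v # ws)) =
    (\<integral>\<^sup>+ t. (\<integral>\<^sup>+ s. f (frame_point p ?vs s + t *\<^sub>R v) \<partial>?P) \<partial>lborel)"
    unfolding nn_integral_frame_measure_insert[OF assms] nn_integral_frame_measure_translate[OF assms]
    by (subst nn_integral_frame_measure) auto
  also have "\<dots> = (\<integral>\<^sup>+ s. (\<integral>\<^sup>+ t. f (frame_point p ?vs s + t *\<^sub>R v) \<partial>lborel) \<partial>?P)"
    by (rule Fubini') (use m in simp)
  also have "\<dots> = (\<integral>\<^sup>+ x. (\<integral>\<^sup>+ t. f (x + t *\<^sub>R v) \<partial>lborel) \<partial>frame_measure p ?vs)"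
    by (subst nn_integral_frame_measure) auto
  finally show ?thesis .
qed

section \<open>Null sets and finiteness for the measures of planes\<close>

lemma emeasure_frame_measure_hyperplane:
  assumes "v \<in> set vs" "v \<bullet> e \<noteq> 0"
  shows "emeasure (frame_measure p vs) {x. x \<bullet> e = c} = 0"
proof -
  obtain us ws where vs: "vs = us @ v # ws" using assms(1) by (auto simp: in_set_conv_decomp)
  have [measurable]: "{x. x \<bullet> e = c} \<in> sets borel"
    by (intro borel_closed closed_Collect_eq continuous_intros)
  have z: "(\<integral>\<^sup>+ t. indicator {x. x \<bullet> e = c} (x + t *\<^sub>R v) \<partial>lborel) = 0" for x
  proof -
    have "indicator {x. x \<bullet> e = c} (x + t *\<^sub>R v) = (indicator {(c - x \<bullet> e) / (v \<bullet> e)} t :: ennreal)" for t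
      using assms(2) by (auto simp: indicator_def inner_add_left field_simps)
    then show ?thesis by simp
  qed
  have "emeasure (frame_measure p vs) {x. x \<bullet> e = c} = (\<integral>\<^sup>+ x. indicator {x. x \<bullet> e = c} x \<partial>frame_measure p vs)"
    by simp
  also have "\<dots> = 0"
    unfolding vs by (subst nn_integral_frame_measure_insert') (simp_all add: z)
  finally show ?thesis .
qed

text \<open>A proper subspace of \<open>V\<close> lies in a hyperplane whose normal \<open>e\<close>
  is in \<open>V\<close>. Some frame vector is not orthogonal to \<open>e\<close>, and lines in its
  direction meet the hyperplane in single points.\<close>

lemma AE_frame_measure_small:
  assumes vs: "ordered_basis V vs" and U: "subspace U" "dim U < length vs" "U \<subseteq> V"
  shows "AE x in frame_measure p vs. x - q \<notin> U"
proof -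
  have "U \<noteq> V" using vs U by (auto simp: ordered_basis_iff)
  have sV: "span V = V" "span U = U" using vs U by (auto simp: ordered_basis_def span_span span_eq_iff)
  obtain e where e: "e \<noteq> 0" "e \<in> span V" "\<And>y. y \<in> span U \<Longrightarrow> orthogonal e y"
    using orthogonal_to_subspace_exists_gen[of U V] U \<open>U \<noteq> V\<close> sV by auto
  have "\<exists>v\<in>set vs. v \<bullet> e \<noteq> 0"
  proof (rule ccontr)
    assume "\<not> ?thesis"
    then have "orthogonal e y" if "y \<in> span (set vs)" for y
      using orthogonal_to_span[OF that, of e] by (auto simp: orthogonal_def inner_commute)
    then have "orthogonal e e" using e vs sV by (simp add: ordered_basis_def)
    then show False using e by (simp add: orthogonal_def)
  qed
  then obtain v where v: "v \<in> set vs" "v \<bullet> e \<noteq> 0" by blast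
  have "{x. x \<bullet> e = q \<bullet> e} \<in> null_sets (frame_measure p vs)"
    using emeasure_frame_measure_hyperplane[OF v, of p "q \<bullet> e"]
    by (auto simp: null_sets_def intro!: borel_closed closed_Collect_eq continuous_intros)
  then have "AE x in frame_measure p vs. x \<notin> {x. x \<bullet> e = q \<bullet> e}"
    by (rule AE_not_in)
  then show ?thesis
  proof (rule AE_mp, intro AE_I2 impI notI)
    fix x assume "x \<notin> {x. x \<bullet> e = q \<bullet> e}" "x - q \<in> U"
    then show False using e(3)[of "x - q"] by (auto simp: orthogonal_def inner_diff_right inner_commute span_base)
  qed
qed

text \<open>The quantifier form that recurs below: one exceptional set of fibres, and a property of
  all points above the remaining \<open>y\<close>. A plane of dimension below
  \<open>length es\<close> has an image of smaller dimension, which is a null set.\<close>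

lemma AE_proj_small:
  assumes es: "orthonormal_frame es" and U: "subspace U" "dim U < length es"
  shows "AE y in frame_measure 0 es. \<forall>x. proj es x = y \<longrightarrow> x - q \<notin> U"
proof -
  have "dim (proj es ` U) \<le> dim U" by (rule dim_image_le[OF linear_proj])
  then have "AE y in frame_measure 0 es. y - proj es q \<notin> proj es ` U"
    using U proj_in_span
    by (intro AE_frame_measure_small[OF orthonormal_frame_basis[OF es]] linear_subspace_image[OF linear_proj]) auto
  then show ?thesis
    by eventually_elim (auto simp: linear_diff[OF linear_proj, symmetric])
qed

lemma emeasure_frame_measure_bounded:
  assumes vs: "ordered_basis V vs" and B: "bounded B"
  shows "emeasure (frame_measure p vs) B < \<infinity>"
proof -
  obtain R where R: "B \<subseteq> cball 0 R" using B unfolding bounded_iff by (auto simp: subset_iff)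
  have c: "emeasure (frame_measure p es) (cball 0 R) < \<infinity>" if es: "orthonormal_frame es" for es
  proof -
    \<comment> \<open>In an orthonormal frame the coordinates of a point are inner products with
      unit vectors, so a ball lies in a box of half side \<open>?c\<close>. A general basis is
      reduced to this by its ratio to an orthonormal one.\<close>
    let ?c = "norm p + \<bar>R\<bar>"
    let ?I = "Pi\<^sub>E {..<length es} (\<lambda>_. {- ?c .. ?c})"
    let ?P = "\<Pi>\<^sub>M i\<in>{..<length es}. lborel :: real measure"
    have "emeasure (frame_measure p es) (cball 0 R) = emeasure ?P (frame_point p es -` cball 0 R \<inter> space ?P)"
      unfolding frame_measure_def by (rule emeasure_distr) auto
    also have "\<dots> \<le> emeasure ?P ?I"
    proof (rule emeasure_mono)
      show "frame_point p es -` cball 0 R \<inter> space ?P \<subseteq> ?I"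
      proof
        fix t assume t: "t \<in> frame_point p es -` cball 0 R \<inter> space ?P"
        have "\<bar>t i\<bar> \<le> ?c" if i: "i < length es" for i
        proof -
          have "t i = (frame_point p es t - p) \<bullet> es ! i"
            using inner_sum_dual[OF dual_frame_self[OF es] i] by (simp add: frame_point_def)
          moreover have "norm (es ! i) = 1" using es i by (simp add: orthonormal_frame_def norm_eq_sqrt_inner)
          ultimately have "\<bar>t i\<bar> \<le> norm (frame_point p es t - p)"
            using Cauchy_Schwarz_ineq2[of "frame_point p es t - p" "es ! i"] by simp
          also have "\<dots> \<le> ?c" using t norm_triangle_ineq4[of "frame_point p es t" p] by auto
          finally show ?thesis .
        qed
        then have "t i \<in> {- ?c .. ?c}" if "i < length es" for i
          using that by (metis abs_le_iff atLeastAtMost_iff minus_le_iff)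
        moreover have "t i = undefined" if "i \<notin> {..<length es}" for i
          using t that by (auto simp: space_PiM PiE_def extensional_def)
        ultimately show "t \<in> ?I" by auto
      qed
    qed (auto intro!: sets_PiM_I_finite)
    also have "\<dots> = (\<Prod>i<length es. emeasure lborel {- ?c .. ?c})"
      by (rule lborel_product.emeasure_PiM) auto
    also have "\<dots> = (\<Prod>i<length es. ennreal (?c - (- ?c)))" by (intro prod.cong refl emeasure_lborel_Icc) simp
    also have "\<dots> = ennreal ((?c - (- ?c)) ^ length es)" by (simp only: prod_constant card_lessThan, rule ennreal_power) simp
    also have "\<dots> < \<infinity>" by simp
    finally show ?thesis .
  qed
  obtain es where es: "orthonormal_frame es" "span (set es) = V" "length es = dim V"
    using orthonormal_frame_exists vs by (metis ordered_basis_def subspace_span)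
  obtain r where r: "frame_ratio r vs es" using frame_ratio_exists[of V vs es] es vs orthonormal_frame_basis by blast
  have "emeasure (frame_measure p vs) (cball 0 R) = (\<integral>\<^sup>+ x. indicator (cball 0 R) x \<partial>frame_measure p vs)" by simp
  also have "\<dots> = ennreal \<bar>r\<bar> * (\<integral>\<^sup>+ x. indicator (cball 0 R) x \<partial>frame_measure p es)"
    by (rule frame_ratio_integral[OF r]) (intro borel_measurable_indicator borel_closed closed_cball)
  also have "\<dots> < \<infinity>" using c[OF es(1)] by (simp add: ennreal_mult_less_top)
  finally have "emeasure (frame_measure p vs) (cball 0 R) < \<infinity>" .
  then show ?thesis
    using emeasure_mono[OF R, of "frame_measure p vs"] by (simp add: le_less_trans)
qed

lemma sigma_finite_frame_measure:
  assumes "ordered_basis V vs"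
  shows "sigma_finite_measure (frame_measure p vs)"
proof
  show "\<exists>A. countable A \<and> A \<subseteq> sets (frame_measure p vs) \<and> \<Union>A = space (frame_measure p vs) \<and>
      (\<forall>a\<in>A. emeasure (frame_measure p vs) a \<noteq> \<infinity>)"
  proof (intro exI conjI)
    show "countable (range (\<lambda>n. cball 0 (real n) :: (real^3) set))" by simp
    show "\<Union>(range (\<lambda>n. cball 0 (real n))) = space (frame_measure p vs)"
    proof -
      have "x \<in> \<Union>(range (\<lambda>n. cball 0 (real n)))" for x :: "real^3"
        using real_arch_simple[of "norm x"] by auto
      then show ?thesis by auto
    qed
    show "\<forall>a\<in>range (\<lambda>n. cball 0 (real n)). emeasure (frame_measure p vs) a \<noteq> \<infinity>"
    proof
      fix a assume "a \<in> range (\<lambda>n. cball 0 (real n) :: (real^3) set)"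
      then have "bounded a" by auto
      from emeasure_frame_measure_bounded[OF assms this, of p] show "emeasure (frame_measure p vs) a \<noteq> \<infinity>"
        by (rule less_imp_neq)
    qed
  qed auto
qed

section \<open>Hausdorff measure on planes\<close>

lemma hausdorff_pre_le:
  assumes "A \<subseteq> (\<Union>i. U i)" "\<And>i. bounded (U i)" "\<And>i. diameter (U i) \<le> d"
  shows "hausdorff_pre k d A \<le> (suminf (\<lambda>i. if U i = {} then 0
            else ennreal (unit_ball_vol (real k) * (diameter (U i) / 2) ^ k)))"
  unfolding hausdorff_pre_def using assms by (intro INF_lower) auto

lemma hausdorff_pre_le_measure: "0 < d \<Longrightarrow> hausdorff_pre k d A \<le> hausdorff_measure k A"
  unfolding hausdorff_measure_def by (rule SUP_upper) simp

lemma hausdorff_pre_mono: "A \<subseteq> B \<Longrightarrow> hausdorff_pre k d A \<le> hausdorff_pre k d B"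
  unfolding hausdorff_pre_def by (rule INF_superset_mono) auto

lemma hausdorff_measure_mono: "A \<subseteq> B \<Longrightarrow> hausdorff_measure k A \<le> hausdorff_measure k B"
  unfolding hausdorff_measure_def by (rule SUP_mono) (auto intro: hausdorff_pre_mono)

lemma ennreal_le_INF_add_INF:
  fixes c :: ennreal
  assumes "\<And>i j. i \<in> I \<Longrightarrow> j \<in> J \<Longrightarrow> c \<le> f i + g j"
  shows "c \<le> (INF i\<in>I. f i) + (INF j\<in>J. g j)"
proof -
  have le: "c \<le> (INF i\<in>I. h i) + b" if "\<And>i. i \<in> I \<Longrightarrow> c \<le> h i + b" for h b I
  proof (cases "b = top")
    case False
    then have "c - b \<le> (INF i\<in>I. h i)"
      using that by (intro INF_greatest) (simp add: ennreal_minus_le_iff add.commute)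
    then show ?thesis using False by (simp add: ennreal_minus_le_iff add.commute)
  qed simp
  have "c \<le> g j + (INF i\<in>I. f i)" if "j \<in> J" for j
    using le[of I f "g j"] assms that by (simp add: add.commute)
  then show ?thesis using le[of J g "INF i\<in>I. f i"] by (simp add: add.commute)
qed

lemma hausdorff_pre_Un: "hausdorff_pre k d (A \<union> B) \<le> hausdorff_pre k d A + hausdorff_pre k d B"
proof -
  let ?t = "\<lambda>U :: 'a set. if U = {} then 0 else ennreal (unit_ball_vol (real k) * (diameter U / 2) ^ k)"
  let ?C = "\<lambda>A. {U :: nat \<Rightarrow> 'a set. A \<subseteq> (\<Union>i. U i) \<and> (\<forall>i. bounded (U i) \<and> diameter (U i) \<le> d)}"
  have *: "hausdorff_pre k d (A \<union> B) \<le> (suminf (\<lambda>i. ?t (U i))) + (suminf (\<lambda>i. ?t (V i)))"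
    if U: "U \<in> ?C A" and V: "V \<in> ?C B" for U V
  proof -
    \<comment> \<open>The two covers are interleaved. The sum of the new terms is then split as an
      integral over counting measure, where no summability has to be checked.\<close>
    define W where "W n = (if even n then U (n div 2) else V (n div 2))" for n
    have W [simp]: "W (2 * i) = U i" "W (Suc (2 * i)) = V i" for i by (simp_all add: W_def)
    have "A \<union> B \<subseteq> (\<Union>i. W i)"
    proof
      fix x assume "x \<in> A \<union> B"
      then obtain i where "x \<in> U i \<or> x \<in> V i" using U V by blast
      then have "x \<in> W (2 * i) \<or> x \<in> W (2 * i + 1)" by (auto simp: W_def)
      then show "x \<in> (\<Union>i. W i)" by blast
    qed
    then have "hausdorff_pre k d (A \<union> B) \<le> (suminf (\<lambda>i. ?t (W i)))"
      using U V by (intro hausdorff_pre_le) (auto simp: W_def)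
    also have "\<dots> = (\<integral>\<^sup>+ i. ?t (W i) \<partial>count_space UNIV)"
      by (simp add: nn_integral_count_space_nat)
    also have "\<dots> = (\<integral>\<^sup>+ i. ?t (W i) \<partial>count_space (range (\<lambda>i. 2 * i) \<union> range (\<lambda>i. 2 * i + 1)))"
    proof -
      have "(UNIV :: nat set) = range (\<lambda>i. 2 * i) \<union> range (\<lambda>i. 2 * i + 1)"
      proof -
        have "n \<in> range (\<lambda>i. 2 * i) \<union> range (\<lambda>i. 2 * i + 1)" for n :: nat
        proof (cases "even n")
          case True
          then show ?thesis by (elim evenE) (rule UnI1, rule range_eqI)
        next
          case False
          then show ?thesis by (elim oddE) (rule UnI2, rule range_eqI)
        qed
        then show ?thesis by blast
      qed
      then show ?thesis by simp
    qed
    also have "\<dots> \<le> (\<integral>\<^sup>+ i. ?t (W i) \<partial>count_space (range (\<lambda>i. 2 * i))) + (\<integral>\<^sup>+ i. ?t (W i) \<partial>count_space (range (\<lambda>i. 2 * i + 1)))"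
    proof -
      have "(\<integral>\<^sup>+ i. ?t (W i) \<partial>count_space (S \<union> T)) \<le>
          (\<integral>\<^sup>+ i. ?t (W i) \<partial>count_space S) + (\<integral>\<^sup>+ i. ?t (W i) \<partial>count_space T)" for S T :: "nat set"
      proof -
        have eq: "(\<integral>\<^sup>+ i. ?t (W i) \<partial>count_space S) = (\<integral>\<^sup>+ i. ?t (W i) * indicator S i \<partial>count_space UNIV)" for S
          by (rule nn_integral_count_space_indicator) simp
        show ?thesis
          unfolding eq[of S] eq[of T] eq[of "S \<union> T"]
          by (subst nn_integral_add[symmetric]) (auto intro!: nn_integral_mono simp: indicator_def)
      qed
      then show ?thesis .
    qed
    also have "(\<integral>\<^sup>+ i. ?t (W i) \<partial>count_space (range (\<lambda>i. 2 * i))) = (suminf (\<lambda>i. ?t (U i)))"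
      by (subst nn_integral_bij_count_space[symmetric, of "\<lambda>i. 2 * i" UNIV])
        (auto simp: bij_betw_def inj_on_def nn_integral_count_space_nat cong: if_cong)
    also have "(\<integral>\<^sup>+ i. ?t (W i) \<partial>count_space (range (\<lambda>i. 2 * i + 1))) = (suminf (\<lambda>i. ?t (V i)))"
      by (subst nn_integral_bij_count_space[symmetric, of "\<lambda>i. 2 * i + 1" UNIV])
        (auto simp: bij_betw_def inj_on_def nn_integral_count_space_nat cong: if_cong)
    finally show ?thesis .
  qed
  show ?thesis
    unfolding hausdorff_pre_def[of k d A] hausdorff_pre_def[of k d B]
    by (rule ennreal_le_INF_add_INF) (rule *)
qed

lemma hausdorff_measure_Un: "hausdorff_measure k (A \<union> B) \<le> hausdorff_measure k A + hausdorff_measure k B"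
  unfolding hausdorff_measure_def[of k "A \<union> B"]
proof (rule SUP_least)
  fix d :: real assume "d \<in> {0<..}"
  then show "hausdorff_pre k d (A \<union> B) \<le> hausdorff_measure k A + hausdorff_measure k B"
    using hausdorff_pre_Un[of k d A B] hausdorff_pre_le_measure[of d k A] hausdorff_pre_le_measure[of d k B]
    by (meson add_mono greaterThan_iff order_trans)
qed

lemma hausdorff_measure_empty [simp]: "hausdorff_measure k {} = 0"
proof -
  have "hausdorff_pre k d {} \<le> 0" if "d \<in> {0<..}" for d
    using hausdorff_pre_le[of "{}" "\<lambda>_. {}" d k] that by simp
  then have "hausdorff_measure k {} \<le> 0"
    unfolding hausdorff_measure_def by (rule SUP_least)
  then show ?thesis by simp
qed

lemma hausdorff_measure_UN:
  "finite I \<Longrightarrow> hausdorff_measure k (\<Union>i\<in>I. A i) \<le> (\<Sum>i\<in>I. hausdorff_measure k (A i))"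
proof (induction rule: finite_induct)
  case (insert i I)
  then show ?case using hausdorff_measure_Un[of k "A i" "\<Union>i\<in>I. A i"]
    by (auto intro: order_trans add_left_mono)
qed simp

lemma diameter_image_lipschitz:
  assumes "\<And>x y. x \<in> S \<Longrightarrow> y \<in> S \<Longrightarrow> dist (f x) (f y) \<le> L * dist x y" "0 \<le> L" "bounded S"
  shows "bounded (f ` S)" "diameter (f ` S) \<le> L * diameter S"
proof -
  have d: "dist (f x) (f y) \<le> L * diameter S" if "x \<in> S" "y \<in> S" for x y
    using assms(1)[OF that] diameter_bounded_bound[OF assms(3) that] assms(2)
    by (meson mult_left_mono order_trans)
  show "bounded (f ` S)"
  proof (cases "S = {}")
    case False
    then obtain a where "a \<in> S" by blast
    then show ?thesis using d unfolding bounded_def by (intro exI[of _ "f a"] exI[of _ "L * diameter S"]) auto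
  qed simp
  show "diameter (f ` S) \<le> L * diameter S"
  proof (cases "S = {}")
    case False
    then have "(SUP (x, y)\<in>f ` S \<times> f ` S. dist x y) \<le> L * diameter S"
      using d by (intro cSUP_least) auto
    then show ?thesis using False by (simp add: diameter_def[of "f ` S"])
  qed (simp add: diameter_def)
qed

lemma hausdorff_measure_lipschitz_le:
  fixes f :: "'a::metric_space \<Rightarrow> 'b::metric_space"
  assumes f: "\<And>x y. x \<in> A \<Longrightarrow> y \<in> A \<Longrightarrow> dist (f x) (f y) \<le> L * dist x y" and L: "0 < L"
  shows "hausdorff_measure k (f ` A) \<le> ennreal (L ^ k) * hausdorff_measure k A"
proof -
  let ?t = "\<lambda>d. if d = None then 0 else ennreal (unit_ball_vol (real k) * (the d / 2) ^ k)"
  have pre: "hausdorff_pre k (L * d) (f ` A) \<le> ennreal (L ^ k) * hausdorff_pre k d A" for d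
  proof -
    have "hausdorff_pre k (L * d) (f ` A) \<le> ennreal (L ^ k) * (suminf (\<lambda>i. if U i = {} then 0
            else ennreal (unit_ball_vol (real k) * (diameter (U i) / 2) ^ k)))"
      if U: "A \<subseteq> (\<Union>i. U i)" "\<And>i. bounded (U i)" "\<And>i. diameter (U i) \<le> d" for U
    proof -
      \<comment> \<open>\<open>f\<close> is Lipschitz only on \<open>A\<close>, so the covering sets
        are cut down to \<open>A\<close> before they are mapped.\<close>
      let ?V = "\<lambda>i. f ` (U i \<inter> A)"
      have bV: "bounded (U i \<inter> A)" for i using U(2) by (meson bounded_Int)
      have dV: "diameter (?V i) \<le> L * diameter (U i)" for i
      proof -
        have "diameter (?V i) \<le> L * diameter (U i \<inter> A)"
          using f L bV by (intro diameter_image_lipschitz) auto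
        also have "\<dots> \<le> L * diameter (U i)"
          using L U(2) by (intro mult_left_mono diameter_subset) auto
        finally show ?thesis .
      qed
      have "hausdorff_pre k (L * d) (f ` A) \<le> (suminf (\<lambda>i. if ?V i = {} then 0
            else ennreal (unit_ball_vol (real k) * (diameter (?V i) / 2) ^ k)))"
      proof (rule hausdorff_pre_le)
        show "f ` A \<subseteq> (\<Union>i. ?V i)" using U(1) by blast
        show "bounded (?V i)" for i
          using f L bV by (intro diameter_image_lipschitz[where L = L]) auto
        show "diameter (?V i) \<le> L * d" for i
          using dV[of i] U(3)[of i] L by (meson mult_left_mono order_trans less_imp_le)
      qed
      also have "\<dots> \<le> (suminf (\<lambda>i. ennreal (L ^ k) * (if U i = {} then 0
            else ennreal (unit_ball_vol (real k) * (diameter (U i) / 2) ^ k))))"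
      proof (rule suminf_le)
        fix i
        have bV': "bounded (?V i)" using f L bV by (intro diameter_image_lipschitz[where L = L]) auto
        have "(diameter (?V i) / 2) ^ k \<le> (L * diameter (U i) / 2) ^ k"
          using dV[of i] diameter_ge_0[OF bV'] by (intro power_mono) auto
        also have "\<dots> = L ^ k * (diameter (U i) / 2) ^ k" by (simp add: power_mult_distrib[symmetric])
        finally have "unit_ball_vol (real k) * (diameter (?V i) / 2) ^ k
            \<le> L ^ k * (unit_ball_vol (real k) * (diameter (U i) / 2) ^ k)"
          using unit_ball_vol_nonneg[of "real k"]
          by (simp add: mult.left_commute mult_left_mono)
        then show "(if ?V i = {} then 0 else ennreal (unit_ball_vol (real k) * (diameter (?V i) / 2) ^ k)) \<le>
            ennreal (L ^ k) * (if U i = {} then 0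
              else ennreal (unit_ball_vol (real k) * (diameter (U i) / 2) ^ k))"
          using L by (auto simp: ennreal_mult'[symmetric] intro!: ennreal_leI)
      qed auto
      also have "\<dots> = ennreal (L ^ k) * (suminf (\<lambda>i. if U i = {} then 0
            else ennreal (unit_ball_vol (real k) * (diameter (U i) / 2) ^ k)))"
        by (rule ennreal_suminf_cmult)
      finally show ?thesis .
    qed
    \<comment> \<open>Dividing by the constant turns the bound for each cover into a lower bound of
      the infimum.\<close>
    then have "hausdorff_pre k (L * d) (f ` A) / ennreal (L ^ k) \<le> hausdorff_pre k d A"
      unfolding hausdorff_pre_def[of k d A] using L
      by (intro INF_greatest divide_le_posI_ennreal) (auto simp: mult.commute)
    then have "ennreal (L ^ k) * (hausdorff_pre k (L * d) (f ` A) / ennreal (L ^ k))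
        \<le> ennreal (L ^ k) * hausdorff_pre k d A"
      by (rule mult_left_mono) simp
    then show ?thesis
      using L by (simp add: ennreal_times_divide mult.commute[of "ennreal (L ^ k)"] mult_divide_eq_ennreal)
  qed
  show ?thesis
    unfolding hausdorff_measure_def[of k "f ` A"]
  proof (rule SUP_least)
    fix d :: real assume d: "d \<in> {0<..}"
    have "hausdorff_pre k d (f ` A) = hausdorff_pre k (L * (d / L)) (f ` A)" using L by simp
    also have "\<dots> \<le> ennreal (L ^ k) * hausdorff_pre k (d / L) A" by (rule pre)
    also have "\<dots> \<le> ennreal (L ^ k) * hausdorff_measure k A"
      using d L by (intro mult_left_mono hausdorff_pre_le_measure) auto
    finally show "hausdorff_pre k d (f ` A) \<le> ennreal (L ^ k) * hausdorff_measure k A" .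
  qed
qed

section \<open>Cubes, and the comparison of Hausdorff with Lebesgue measure\<close>

definition frame_cube :: "real^3 \<Rightarrow> (real^3) list \<Rightarrow> real \<Rightarrow> (real^3) set" where
  "frame_cube p es s = frame_point p es ` {t. \<forall>i<length es. 0 \<le> t i \<and> t i \<le> s}"

lemma inner_frame_point:
  assumes "orthonormal_frame es" "j < length es"
  shows "(frame_point p es t - p) \<bullet> es ! j = t j"
  using inner_sum_dual[OF dual_frame_self[OF assms(1)] assms(2)] by (simp add: frame_point_def)

lemma frame_point_inner:
  assumes "orthonormal_frame es" "x - p \<in> span (set es)"
  shows "frame_point p es (\<lambda>i. (x - p) \<bullet> es ! i) = x"
  using proj_eq_self[OF assms] by (simp add: frame_point_def proj_def)

lemma frame_point_in_plane: "frame_point p es t - p \<in> span (set es)"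
  by (simp add: frame_point_def, intro span_sum span_mul span_base, simp)

lemma frame_cube_iff:
  assumes "orthonormal_frame es"
  shows "x \<in> frame_cube p es s \<longleftrightarrow>
    x - p \<in> span (set es) \<and> (\<forall>i<length es. 0 \<le> (x - p) \<bullet> es ! i \<and> (x - p) \<bullet> es ! i \<le> s)"
proof
  assume "x \<in> frame_cube p es s"
  then show "x - p \<in> span (set es) \<and> (\<forall>i<length es. 0 \<le> (x - p) \<bullet> es ! i \<and> (x - p) \<bullet> es ! i \<le> s)"
    unfolding frame_cube_def using inner_frame_point[OF assms] frame_point_in_plane by auto
next
  assume "x - p \<in> span (set es) \<and> (\<forall>i<length es. 0 \<le> (x - p) \<bullet> es ! i \<and> (x - p) \<bullet> es ! i \<le> s)"
  then show "x \<in> frame_cube p es s"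
    unfolding frame_cube_def using frame_point_inner[OF assms, of x p]
    by (intro image_eqI[of _ _ "\<lambda>i. (x - p) \<bullet> es ! i"]) auto
qed

lemma norm_plane_le_sum:
  assumes "orthonormal_frame es" "z \<in> span (set es)"
  shows "norm z \<le> (\<Sum>i<length es. \<bar>z \<bullet> es ! i\<bar>)"
proof -
  have "z = (\<Sum>i<length es. (z \<bullet> es ! i) *\<^sub>R es ! i)" using proj_eq_self[OF assms] by (simp add: proj_def)
  then have "norm z \<le> (\<Sum>i<length es. norm ((z \<bullet> es ! i) *\<^sub>R es ! i))" by (metis norm_sum)
  also have "\<dots> = (\<Sum>i<length es. \<bar>z \<bullet> es ! i\<bar>)"
    using assms(1) by (intro sum.cong) (auto simp: orthonormal_frame_def norm_eq_sqrt_inner)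
  finally show ?thesis .
qed

lemma norm_plane_sum:
  assumes es: "orthonormal_frame es"
  shows "(norm (\<Sum>i<length es. c i *\<^sub>R es ! i))\<^sup>2 = (\<Sum>i<length es. (c i)\<^sup>2)"
proof -
  have "(norm (\<Sum>i<length es. c i *\<^sub>R es ! i))\<^sup>2 = (\<Sum>j<length es. (\<Sum>i<length es. c i *\<^sub>R es ! i) \<bullet> (c j *\<^sub>R es ! j))"
    by (simp add: power2_norm_eq_inner inner_sum_right)
  also have "\<dots> = (\<Sum>j<length es. (c j)\<^sup>2)"
    using inner_sum_dual[OF dual_frame_self[OF es], of _ c]
    by (intro sum.cong) (auto simp: power2_eq_square)
  finally show ?thesis .
qed

text \<open>The two cubes are similar, by a map that multiplies distances by
  \<open>r / s\<close>.\<close>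

lemma frame_cube_hausdorff:
  assumes es: "orthonormal_frame es" and fs: "orthonormal_frame fs" and l: "length fs = length es"
    and s: "0 < s" "0 < r"
  shows "hausdorff_measure k (frame_cube q fs r) \<le> ennreal ((r / s) ^ k) * hausdorff_measure k (frame_cube p es s)"
proof -
  let ?f = "\<lambda>x. q + (r / s) *\<^sub>R (\<Sum>i<length es. ((x - p) \<bullet> es ! i) *\<^sub>R fs ! i)"
  have im: "frame_cube q fs r = ?f ` frame_cube p es s"
  proof (intro equalityI subsetI)
    fix x assume "x \<in> frame_cube q fs r"
    then obtain t where t: "x = frame_point q fs t" "\<And>i. i < length es \<Longrightarrow> 0 \<le> t i \<and> t i \<le> r"
      unfolding frame_cube_def l by blast
    let ?t = "\<lambda>i. s / r * t i"
    have "s / r * t i \<le> s / r * r" if "i < length es" for i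
      using t(2)[OF that] s by (intro mult_left_mono) auto
    then have "frame_point p es ?t \<in> frame_cube p es s"
      unfolding frame_cube_def using t(2) s by (intro imageI) auto
    moreover have "?f (frame_point p es ?t) = x"
      unfolding t(1) using s by (simp add: inner_frame_point[OF es] frame_point_def[of q] l scaleR_sum_right)
    ultimately show "x \<in> ?f ` frame_cube p es s" by force
  next
    fix x assume "x \<in> ?f ` frame_cube p es s"
    then obtain t where t: "x = ?f (frame_point p es t)" "\<And>i. i < length es \<Longrightarrow> 0 \<le> t i \<and> t i \<le> s"
      unfolding frame_cube_def by blast
    have "r / s * t i \<le> r / s * s" if "i < length es" for i
      using t(2)[OF that] s by (intro mult_left_mono) auto
    then have "frame_point q fs (\<lambda>i. r / s * t i) \<in> frame_cube q fs r"
      unfolding frame_cube_def using t(2) s l by (intro imageI) auto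
    moreover have "frame_point q fs (\<lambda>i. r / s * t i) = x"
      unfolding t(1) by (simp add: inner_frame_point[OF es] frame_point_def[of q] l scaleR_sum_right)
    ultimately show "x \<in> frame_cube q fs r" by simp
  qed
  show ?thesis
    unfolding im
  proof (rule hausdorff_measure_lipschitz_le)
    show "0 < r / s" using s by simp
    fix x y assume x: "x \<in> frame_cube p es s" and y: "y \<in> frame_cube p es s"
    let ?c = "\<lambda>i. (x - y) \<bullet> es ! i"
    have d: "?f x - ?f y = (r / s) *\<^sub>R (\<Sum>i<length es. ?c i *\<^sub>R fs ! i)"
      by (simp add: scaleR_diff_right[symmetric] sum_subtractf[symmetric] inner_diff_left scaleR_diff_left)
    have "x - y \<in> span (set es)"
      using x y span_diff[of "x - p" "set es" "y - p"] by (auto simp: frame_cube_iff[OF es])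
    then have xy: "x - y = (\<Sum>i<length es. ?c i *\<^sub>R es ! i)" using proj_eq_self[OF es] by (simp add: proj_def)
    have "(norm (\<Sum>i<length es. ?c i *\<^sub>R fs ! i))\<^sup>2 = (norm (\<Sum>i<length es. ?c i *\<^sub>R es ! i))\<^sup>2"
      using norm_plane_sum[OF fs, of ?c] norm_plane_sum[OF es, of ?c] l by simp
    then have "norm (\<Sum>i<length es. ?c i *\<^sub>R fs ! i) = norm (x - y)"
      unfolding xy[symmetric] by simp
    then show "dist (?f x) (?f y) \<le> r / s * dist x y"
      unfolding dist_norm d using s by simp
  qed
qed

lemma emeasure_frame_measure_box:
  assumes es: "orthonormal_frame es" and S: "\<And>i. i < length es \<Longrightarrow> S i \<in> sets borel"
  shows "{x. \<forall>i<length es. (x - p) \<bullet> es ! i \<in> S i} \<in> sets borel"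
    and "emeasure (frame_measure p es) {x. \<forall>i<length es. (x - p) \<bullet> es ! i \<in> S i} =
      (\<Prod>i<length es. emeasure lborel (S i))"
proof -
  let ?P = "\<Pi>\<^sub>M i\<in>{..<length es}. lborel :: real measure"
  let ?B = "{x. \<forall>i<length es. (x - p) \<bullet> es ! i \<in> S i}"
  show m: "?B \<in> sets borel"
  proof -
    have "?B = (\<Inter>i\<in>{..<length es}. {x. (x - p) \<bullet> es ! i \<in> S i})" by auto
    also have "\<dots> \<in> sets borel"
    proof (cases "length es = 0")
      case False
      have "{x. (x - p) \<bullet> es ! i \<in> S i} \<in> sets borel" if "i < length es" for i
      proof -
        have "(\<lambda>x. (x - p) \<bullet> es ! i) -` S i \<inter> space borel \<in> sets borel"
          by (rule measurable_sets[of _ _ borel]) (use S[OF that] in auto)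
        then show ?thesis by (simp add: vimage_def)
      qed
      then show ?thesis using False by (intro sets.finite_INT) auto
    qed simp
    finally show ?thesis .
  qed
  have "emeasure (frame_measure p es) ?B = emeasure ?P (frame_point p es -` ?B \<inter> space ?P)"
    unfolding frame_measure_def by (rule emeasure_distr[OF frame_point_measurable m])
  also have "frame_point p es -` ?B \<inter> space ?P = Pi\<^sub>E {..<length es} S"
    by (simp add: set_eq_iff inner_frame_point[OF es] space_PiM PiE_iff Ball_def conj_commute)
  also have "emeasure ?P \<dots> = (\<Prod>i<length es. emeasure lborel (S i))"
    by (rule lborel_product.emeasure_PiM) (use S in auto)
  finally show "emeasure (frame_measure p es) ?B = (\<Prod>i<length es. emeasure lborel (S i))" .
qed

lemma AE_frame_measure_plane: "AE x in frame_measure p vs. x - p \<in> span (set vs)"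
proof -
  have m: "{x. x - p \<in> span (set vs)} \<in> sets borel"
  proof -
    have "{x. x - p \<in> span (set vs)} = (\<lambda>x. x - p) -` span (set vs) \<inter> space borel" by auto
    also have "\<dots> \<in> sets borel"
      by (rule measurable_sets[of _ _ borel]) (auto intro: borel_closed closed_span)
    finally show ?thesis .
  qed
  show ?thesis
    unfolding frame_measure_def
    by (subst AE_distr_iff) (use m in \<open>auto simp: frame_point_in_plane\<close>)
qed

lemma dist_frame_cube:
  assumes es: "orthonormal_frame es" and xy: "x \<in> frame_cube p es s" "y \<in> frame_cube p es s"
  shows "dist x y \<le> real (length es) * s"
proof -
  have "x - y \<in> span (set es)"
    using xy span_diff[of "x - p" "set es" "y - p"] by (auto simp: frame_cube_iff[OF es])
  then have "dist x y \<le> (\<Sum>i<length es. \<bar>(x - y) \<bullet> es ! i\<bar>)"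
    unfolding dist_norm by (rule norm_plane_le_sum[OF es])
  also have "\<dots> \<le> (\<Sum>i<length es. s)"
  proof (rule sum_mono)
    fix i assume "i \<in> {..<length es}"
    then have "0 \<le> (x - p) \<bullet> es ! i \<and> (x - p) \<bullet> es ! i \<le> s" "0 \<le> (y - p) \<bullet> es ! i \<and> (y - p) \<bullet> es ! i \<le> s"
      using xy by (auto simp: frame_cube_iff[OF es])
    then show "\<bar>(x - y) \<bullet> es ! i\<bar> \<le> s" unfolding inner_diff_left by linarith
  qed
  finally show ?thesis by simp
qed

text \<open>Half-open grid boxes of side \<open>1 / m\<close> are disjoint, and inside the plane a
  box that contains a point of \<open>X\<close> stays within distance \<open>length es / m\<close>
  of it; so the number of such boxes is bounded by the volume of that neighbourhood. The closed
  cubes at the same grid points cover \<open>X\<close>.\<close>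

lemma grid_cover:
  fixes m :: nat
  assumes es: "orthonormal_frame es" and X: "\<And>x. x \<in> X \<Longrightarrow> x - p \<in> span (set es)" "bounded X"
    and m: "m > 0"
  shows "\<exists>Z q. finite (Z :: (nat \<Rightarrow> int) set) \<and> X \<subseteq> (\<Union>z\<in>Z. frame_cube (q z) es (1 / real m)) \<and>
    ennreal (real (card Z) * (1 / real m) ^ length es) \<le>
      emeasure (frame_measure p es) {x. infdist x X \<le> real (length es) / real m}"
proof -
  let ?k = "length es"
  \<comment> \<open>The grid index of \<open>x\<close>. The value 0 past the dimension leaves only
    finitely many indices for a bounded set and makes an index depend on its box alone.\<close>
  define c where "c x = (\<lambda>i. if i < ?k then \<lfloor>real m * ((x - p) \<bullet> es ! i)\<rfloor> else 0)" for x
  define Z where "Z = c ` X"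
  define q where "q z = frame_point p es (\<lambda>i. real_of_int (z i) / real m)" for z :: "nat \<Rightarrow> int"
  define B where "B z = {x. \<forall>i<?k. (x - p) \<bullet> es ! i \<in> {real_of_int (z i) / real m..<(real_of_int (z i) + 1) / real m}}"
    for z :: "nat \<Rightarrow> int"
  have cB: "x \<in> B z \<longleftrightarrow> (\<forall>i<?k. c x i = z i)" for x z
    unfolding B_def c_def using m by (auto simp: floor_eq_iff field_simps)
  have Bmeas: "B z \<in> sets borel" and Bem: "emeasure (frame_measure p es) (B z) = ennreal ((1 / real m) ^ ?k)" for z
  proof -
    show "B z \<in> sets borel"
      unfolding B_def by (rule emeasure_frame_measure_box(1)[OF es]) auto
    have "emeasure (frame_measure p es) (B z) = (\<Prod>i<?k. emeasure lborel {real_of_int (z i) / real m..<(real_of_int (z i) + 1) / real m})"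
      unfolding B_def by (rule emeasure_frame_measure_box(2)[OF es]) auto
    also have "\<dots> = (\<Prod>i<?k. ennreal (1 / real m))"
      using m by (intro prod.cong refl) (simp add: divide_right_mono diff_divide_distrib[symmetric])
    finally show "emeasure (frame_measure p es) (B z) = ennreal ((1 / real m) ^ ?k)"
      by (simp add: ennreal_power)
  qed
  have finZ: "finite Z"
  proof -
    obtain R where R: "\<And>x. x \<in> X \<Longrightarrow> norm x \<le> R" using X(2) unfolding bounded_iff by blast
    let ?M = "\<lceil>real m * (R + norm p)\<rceil> + 1"
    have "c x \<in> {f. \<forall>i. (i \<in> {..<?k} \<longrightarrow> f i \<in> {- ?M..?M}) \<and> (i \<notin> {..<?k} \<longrightarrow> f i = 0)}" if x: "x \<in> X" for x
    proof -
      have "\<bar>(x - p) \<bullet> es ! i\<bar> \<le> R + norm p" if "i < ?k" for i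
      proof -
        have "norm (es ! i) = 1" using es that by (simp add: orthonormal_frame_def norm_eq_sqrt_inner)
        then have "\<bar>(x - p) \<bullet> es ! i\<bar> \<le> norm (x - p)" using Cauchy_Schwarz_ineq2[of "x - p" "es ! i"] by simp
        also have "\<dots> \<le> R + norm p" using R[OF x] norm_triangle_ineq4[of x p] by simp
        finally show ?thesis .
      qed
      then have "\<bar>real m * ((x - p) \<bullet> es ! i)\<bar> \<le> real m * (R + norm p)" if "i < ?k" for i
        using that m by (simp add: abs_mult mult_left_mono)
      then have "- ?M \<le> \<lfloor>real m * ((x - p) \<bullet> es ! i)\<rfloor> \<and> \<lfloor>real m * ((x - p) \<bullet> es ! i)\<rfloor> \<le> ?M" if "i < ?k" for i
        using that by (smt (verit) le_of_int_ceiling floor_le_iff le_floor_iff of_int_add of_int_minus of_int_1)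
      then show ?thesis by (auto simp: c_def)
    qed
    then have "Z \<subseteq> {f. \<forall>i. (i \<in> {..<?k} \<longrightarrow> f i \<in> {- ?M..?M}) \<and> (i \<notin> {..<?k} \<longrightarrow> f i = 0)}"
      unfolding Z_def by blast
    then show ?thesis by (rule finite_subset) (intro finite_set_of_finite_funs; simp)
  qed
  have cover: "X \<subseteq> (\<Union>z\<in>Z. frame_cube (q z) es (1 / real m))"
  proof
    fix x assume x: "x \<in> X"
    let ?z = "c x"
    have xp: "x - p \<in> span (set es)" by (rule X(1)[OF x])
    have qp: "q ?z - p \<in> span (set es)" unfolding q_def by (rule frame_point_in_plane)
    have "x - q ?z \<in> span (set es)" using span_diff[OF xp qp] by simp
    moreover have "0 \<le> (x - q ?z) \<bullet> es ! i \<and> (x - q ?z) \<bullet> es ! i \<le> 1 / real m" if i: "i < ?k" for i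
    proof -
      have "(x - q ?z) \<bullet> es ! i = (x - p) \<bullet> es ! i - (q ?z - p) \<bullet> es ! i" by (simp add: inner_diff_left)
      also have "(q ?z - p) \<bullet> es ! i = real_of_int (c x i) / real m"
        unfolding q_def by (rule inner_frame_point[OF es i])
      finally have e: "(x - q ?z) \<bullet> es ! i = (x - p) \<bullet> es ! i - real_of_int (c x i) / real m" .
      have "x \<in> B ?z" by (simp add: cB)
      then have "(x - p) \<bullet> es ! i \<in> {real_of_int (c x i) / real m..<(real_of_int (c x i) + 1) / real m}"
        using i by (simp add: B_def)
      then show ?thesis unfolding e by (simp add: add_divide_distrib)
    qed
    ultimately have "x \<in> frame_cube (q ?z) es (1 / real m)" by (simp add: frame_cube_iff[OF es])
    then show "x \<in> (\<Union>z\<in>Z. frame_cube (q z) es (1 / real m))" using x by (auto simp: Z_def)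
  qed
  have disj: "disjoint_family_on B Z"
  proof (unfold disjoint_family_on_def, intro ballI impI)
    fix z z' assume zz: "z \<in> Z" "z' \<in> Z" "z \<noteq> z'"
    have "z = z'" if x: "x \<in> B z" "x \<in> B z'" for x
    proof
      fix i show "z i = z' i"
      proof (cases "i < ?k")
        case True
        then show ?thesis using x by (simp add: cB)
      next
        case False
        then show ?thesis using zz by (auto simp: Z_def c_def)
      qed
    qed
    then show "B z \<inter> B z' = {}" using zz by blast
  qed
  have "ennreal (real (card Z) * (1 / real m) ^ ?k) = (\<Sum>z\<in>Z. emeasure (frame_measure p es) (B z))"
    by (simp add: Bem ennreal_mult' ennreal_of_nat_eq_real_of_nat)
  also have "\<dots> = emeasure (frame_measure p es) (\<Union>z\<in>Z. B z)"
    by (rule sum_emeasure[OF _ disj finZ]) (use Bmeas in auto)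
  also have "\<dots> \<le> emeasure (frame_measure p es) {x. infdist x X \<le> real ?k / real m}"
  proof (rule emeasure_mono_AE)
    show "AE x in frame_measure p es. x \<in> (\<Union>z\<in>Z. B z) \<longrightarrow> x \<in> {x. infdist x X \<le> real ?k / real m}"
      using AE_frame_measure_plane[of p es]
    proof (eventually_elim, intro impI)
      fix x assume xp: "x - p \<in> span (set es)" and "x \<in> (\<Union>z\<in>Z. B z)"
      then obtain y where y: "y \<in> X" "x \<in> B (c y)" by (auto simp: Z_def)
      have yp: "y - p \<in> span (set es)" by (rule X(1)[OF y(1)])
      have "x - y \<in> span (set es)" using span_diff[OF xp yp] by simp
      then have "dist x y \<le> (\<Sum>i<?k. \<bar>(x - y) \<bullet> es ! i\<bar>)"
        unfolding dist_norm by (rule norm_plane_le_sum[OF es])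
      also have "\<dots> \<le> (\<Sum>i<?k. 1 / real m)"
      proof (rule sum_mono)
        fix i assume i: "i \<in> {..<?k}"
        have "y \<in> B (c y)" by (simp add: cB)
        then have "(y - p) \<bullet> es ! i \<in> {real_of_int (c y i) / real m..<(real_of_int (c y i) + 1) / real m}"
          "(x - p) \<bullet> es ! i \<in> {real_of_int (c y i) / real m..<(real_of_int (c y i) + 1) / real m}"
          using i y(2) by (simp_all add: B_def)
        moreover have "(x - y) \<bullet> es ! i = (x - p) \<bullet> es ! i - (y - p) \<bullet> es ! i" by (simp add: inner_diff_left)
        ultimately show "\<bar>(x - y) \<bullet> es ! i\<bar> \<le> 1 / real m" by (simp add: add_divide_distrib abs_le_iff)
      qed
      also have "\<dots> = real ?k / real m" by simp
      finally show "x \<in> {x. infdist x X \<le> real ?k / real m}"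
        using infdist_le[OF y(1), of x] by simp
    qed
    show "{x. infdist x X \<le> real ?k / real m} \<in> sets (frame_measure p es)"
      by (simp, intro borel_closed closed_Collect_le continuous_intros)
  qed
  finally show ?thesis using finZ cover by blast
qed

lemma hausdorff_pre_UN:
  assumes "finite I" "0 \<le> d"
  shows "hausdorff_pre k d (\<Union>i\<in>I. A i) \<le> (\<Sum>i\<in>I. hausdorff_pre k d (A i))"
  using assms(1)
proof (induction rule: finite_induct)
  case empty
  show ?case using hausdorff_pre_le[of "{}" "\<lambda>_. {}" d k] assms(2) by simp
next
  case (insert i I)
  then show ?case using hausdorff_pre_Un[of k d "A i" "\<Union>i\<in>I. A i"]
    by (auto intro: order_trans add_left_mono)
qed

lemma hausdorff_pre_single:
  assumes "\<And>x y. x \<in> A \<Longrightarrow> y \<in> A \<Longrightarrow> dist x y \<le> r" "0 \<le> r" "r \<le> d"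
  shows "hausdorff_pre k d A \<le> ennreal (unit_ball_vol (real k) * (r / 2) ^ k)"
proof (cases "A = {}")
  case False
  then obtain a where a: "a \<in> A" by blast
  have b: "bounded A" unfolding bounded_def using assms(1) a by blast
  have "(SUP (x, y)\<in>A \<times> A. dist x y) \<le> r"
    using False assms(1) by (intro cSUP_least) auto
  then have dr: "diameter A \<le> r" using False by (simp add: diameter_def)
  have "hausdorff_pre k d A \<le> (suminf (\<lambda>i::nat. if (if i = 0 then A else {}) = {} then 0
            else ennreal (unit_ball_vol (real k) * (diameter (if i = 0 then A else {}) / 2) ^ k)))"
  proof (rule hausdorff_pre_le)
    show "A \<subseteq> (\<Union>i::nat. if i = 0 then A else {})" by auto
    show "bounded (if i = 0 then A else {})" for i :: nat using b by simp
    show "diameter (if i = 0 then A else {}) \<le> d" for i :: nat using dr assms by simp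
  qed
  also have "\<dots> = (\<Sum>i\<in>{0::nat}. if (if i = 0 then A else {}) = {} then 0
            else ennreal (unit_ball_vol (real k) * (diameter (if i = 0 then A else {}) / 2) ^ k))"
    by (rule suminf_finite) auto
  also have "\<dots> \<le> ennreal (unit_ball_vol (real k) * (r / 2) ^ k)"
    using False dr diameter_ge_0[OF b]
    by (auto intro!: ennreal_leI mult_left_mono power_mono)
  finally show ?thesis .
next
  case True
  have "hausdorff_pre k d A \<le> 0"
    unfolding True using hausdorff_pre_le[of "{} :: 'a set" "\<lambda>_. {}" d k] assms(2,3) by simp
  then show ?thesis by (rule order_trans) simp
qed

text \<open>The ratio of Hausdorff to Lebesgue measure on \<open>k\<close>-planes, taken from one
  unit cube. It stays in the later estimates as a factor without being evaluated; for this it has to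
  be positive and finite.\<close>

definition hausdorff_factor :: "nat \<Rightarrow> ennreal" where
  "hausdorff_factor k =
     hausdorff_measure k (frame_cube 0 (SOME es. orthonormal_frame es \<and> length es = k) 1)"

lemma hausdorff_measure_cube:
  assumes es: "orthonormal_frame es" "length es = k" and s: "0 < s"
  shows "hausdorff_measure k (frame_cube p es s) = ennreal (s ^ k) * hausdorff_factor k"
proof -
  let ?fs = "SOME es. orthonormal_frame es \<and> length es = k"
  have "orthonormal_frame ?fs \<and> length ?fs = k"
    by (rule someI_ex) (use es in blast)
  then have fs: "orthonormal_frame ?fs" "length ?fs = k" by auto
  have "hausdorff_measure k (frame_cube p es s) \<le> ennreal (s ^ k) * hausdorff_factor k"
    using frame_cube_hausdorff[OF fs(1) es(1), of 1 s k p 0] fs es s by (simp add: hausdorff_factor_def)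
  moreover have "hausdorff_factor k \<le> ennreal ((1 / s) ^ k) * hausdorff_measure k (frame_cube p es s)"
    using frame_cube_hausdorff[OF es(1) fs(1), of s 1 k 0 p] fs es s by (simp add: hausdorff_factor_def)
  then have "ennreal (s ^ k) * hausdorff_factor k \<le> ennreal (s ^ k) * (ennreal ((1 / s) ^ k) * hausdorff_measure k (frame_cube p es s))"
    by (rule mult_left_mono) simp
  moreover have "ennreal (s ^ k) * (ennreal ((1 / s) ^ k) * X) = X" for X
    using s by (simp add: mult.assoc[symmetric] ennreal_mult'[symmetric] power_mult_distrib[symmetric])
  ultimately show ?thesis by (metis antisym)
qed

text \<open>Cover the unit cube by grid cubes of side \<open>1 / m\<close>. Each has diameter at
  most \<open>k / m\<close>, and as \<open>m\<close> is at least 1, their number times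
  \<open>(1 / m) ^ k\<close> is bounded by the volume of the neighbourhood of radius
  \<open>k\<close>, uniformly in \<open>m\<close>.\<close>

lemma hausdorff_factor_finite:
  assumes es: "orthonormal_frame es" "length es = k"
  shows "hausdorff_factor k < \<infinity>"
proof -
  let ?Q = "frame_cube 0 es 1"
  let ?F = "emeasure (frame_measure 0 es) {x. infdist x ?Q \<le> real k}"
  have bQ: "bounded ?Q"
  proof -
    have "0 \<in> ?Q" by (simp add: frame_cube_iff[OF es(1)] span_zero)
    then show ?thesis unfolding bounded_def using dist_frame_cube[OF es(1)] by blast
  qed
  have ne: "?Q \<noteq> {}"
  proof -
    have "0 \<in> ?Q" by (simp add: frame_cube_iff[OF es(1)] span_zero)
    then show ?thesis by blast
  qed
  have "bounded {x. infdist x ?Q \<le> real k}"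
  proof -
    obtain R where R: "\<And>x. x \<in> ?Q \<Longrightarrow> norm x \<le> R" using bQ unfolding bounded_iff by blast
    have "norm x \<le> R + real k + 1" if "infdist x ?Q \<le> real k" for x
    proof -
      have "(INF a\<in>?Q. dist x a) < real k + 1" using that ne by (simp add: infdist_def)
      then obtain a where a: "a \<in> ?Q" "dist x a < real k + 1"
        using cINF_less_iff[OF ne bdd_belowI2[of ?Q 0 "dist x"]] by auto
      have "norm x \<le> norm a + dist x a" using norm_triangle_sub[of x a] by (simp add: dist_norm)
      then show ?thesis using a R[OF a(1)] by linarith
    qed
    then show ?thesis unfolding bounded_iff by blast
  qed
  then have F: "?F < \<infinity>"
    by (rule emeasure_frame_measure_bounded[OF orthonormal_frame_basis[OF es(1)]])
  have "hausdorff_pre k d ?Q \<le> ennreal (unit_ball_vol (real k) * (real k / 2) ^ k) * ?F" if d: "0 < d" for d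
  proof -
    obtain m :: nat where m: "0 < m" "real k / real m < d"
    proof -
      obtain n :: nat where n: "real k / d < real n" using reals_Archimedean2 by blast
      have "0 \<le> real k / d" using d by simp
      then have "0 < n" using n by linarith
      then show ?thesis using that[of n] n d by (simp add: field_simps)
    qed
    obtain Z :: "(nat \<Rightarrow> int) set" and q where Z: "finite Z" "?Q \<subseteq> (\<Union>z\<in>Z. frame_cube (q z) es (1 / real m))"
      "ennreal (real (card Z) * (1 / real m) ^ k) \<le> emeasure (frame_measure 0 es) {x. infdist x ?Q \<le> real k / real m}"
      using grid_cover[OF es(1) _ bQ m(1), of 0] es(2) by (auto simp: frame_cube_iff[OF es(1)])
    have "emeasure (frame_measure 0 es) {x. infdist x ?Q \<le> real k / real m} \<le> ?F"
    proof (rule emeasure_mono)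
      have "real k / real m \<le> real k" using m(1) by (simp add: field_simps mult_le_cancel_left1)
      then show "{x. infdist x ?Q \<le> real k / real m} \<subseteq> {x. infdist x ?Q \<le> real k}" by auto
      show "{x. infdist x ?Q \<le> real k} \<in> sets (frame_measure 0 es)"
        by (simp, intro borel_closed closed_Collect_le continuous_intros)
    qed
    with Z(3) have cZ: "ennreal (real (card Z) * (1 / real m) ^ k) \<le> ?F" by (rule order_trans)
    have "hausdorff_pre k d ?Q \<le> (\<Sum>z\<in>Z. hausdorff_pre k d (frame_cube (q z) es (1 / real m)))"
      by (rule order_trans[OF hausdorff_pre_mono[OF Z(2)] hausdorff_pre_UN[OF Z(1)]]) (use d in simp)
    also have "\<dots> \<le> (\<Sum>z\<in>Z. ennreal (unit_ball_vol (real k) * ((real k / real m) / 2) ^ k))"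
      using dist_frame_cube[OF es(1), of _ _ "1 / real m"] m es(2)
      by (intro sum_mono hausdorff_pre_single) (auto simp: field_simps)
    also have "\<dots> = ennreal (unit_ball_vol (real k) * (real k / 2) ^ k) * ennreal (real (card Z) * (1 / real m) ^ k)"
    proof -
      have "real (card Z) * (unit_ball_vol (real k) * ((real k / real m) / 2) ^ k) =
        (unit_ball_vol (real k) * (real k / 2) ^ k) * (real (card Z) * (1 / real m) ^ k)"
        by (simp add: power_divide mult_ac)
      then show ?thesis
        by (simp add: ennreal_of_nat_eq_real_of_nat ennreal_mult[symmetric] unit_ball_vol_nonneg del: ennreal_mult')
    qed
    also have "\<dots> \<le> ennreal (unit_ball_vol (real k) * (real k / 2) ^ k) * ?F"
      by (rule mult_left_mono[OF cZ]) simp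
    finally show ?thesis .
  qed
  then have "hausdorff_measure k ?Q \<le> ennreal (unit_ball_vol (real k) * (real k / 2) ^ k) * ?F"
    unfolding hausdorff_measure_def by (intro SUP_least) simp
  also have "\<dots> < \<infinity>" using F by (simp add: ennreal_mult_less_top)
  finally show ?thesis using hausdorff_measure_cube[OF es, of 1 0] by simp
qed

text \<open>A set of diameter \<open>d\<close> lies, as seen in the frame, in a box of sides
  \<open>2 * d\<close>. The boxes of a cover have total volume at least 1, and
  \<open>(2 * d) ^ k\<close> is \<open>4 ^ k\<close> times \<open>(d / 2) ^ k\<close>; this is the
  origin of the lower bound \<open>?w / 4 ^ k\<close>.\<close>

lemma hausdorff_factor_pos:
  assumes es: "orthonormal_frame es" "length es = k"
  shows "0 < hausdorff_factor k"
proof -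
  let ?Q = "frame_cube 0 es 1"
  let ?w = "unit_ball_vol (real k)"
  have w: "0 < ?w" by simp
  have "ennreal (?w / 4 ^ k) \<le> hausdorff_pre k 1 ?Q"
    unfolding hausdorff_pre_def
  proof (rule INF_greatest)
    fix U :: "nat \<Rightarrow> (real^3) set"
    assume "U \<in> {U. ?Q \<subseteq> (\<Union>i. U i) \<and> (\<forall>i. bounded (U i) \<and> diameter (U i) \<le> 1)}"
    then have U: "?Q \<subseteq> (\<Union>i. U i)" "\<And>i. bounded (U i)" by auto
    define u where "u i = (SOME x. x \<in> U i)" for i
    \<comment> \<open>For \<open>k = 0\<close> the box condition is empty and a box has measure 1,
      so an empty set of the cover has to be given the empty box.\<close>
    define B where "B i = (if U i = {} then {} else
      {x. \<forall>j<length es. (x - 0) \<bullet> es ! j \<in> {u i \<bullet> es ! j - diameter (U i) .. u i \<bullet> es ! j + diameter (U i)}})" for i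
    have Bm: "B i \<in> sets borel" for i
      unfolding B_def using emeasure_frame_measure_box(1)[OF es(1), of "\<lambda>j. {u i \<bullet> es ! j - diameter (U i) .. u i \<bullet> es ! j + diameter (U i)}" 0]
      by simp
    have Be: "emeasure (frame_measure 0 es) (B i) = (if U i = {} then 0 else ennreal ((2 * diameter (U i)) ^ k))" for i
    proof (cases "U i = {}")
      case False
      have "emeasure (frame_measure 0 es) (B i) = (\<Prod>j<length es. emeasure lborel {u i \<bullet> es ! j - diameter (U i) .. u i \<bullet> es ! j + diameter (U i)})"
        unfolding B_def if_not_P[OF False] by (rule emeasure_frame_measure_box(2)[OF es(1)]) simp
      also have "\<dots> = (\<Prod>j<length es. ennreal (2 * diameter (U i)))"
        using diameter_ge_0[OF U(2)[of i]] by (intro prod.cong refl) simp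
      finally show ?thesis using False es(2) diameter_ge_0[OF U(2)[of i]] by (simp add: ennreal_power del: ennreal_mult')
    qed (simp add: B_def)
    have UB: "U i \<subseteq> B i" for i
    proof
      fix x assume x: "x \<in> U i"
      then have ne: "U i \<noteq> {}" by blast
      have ui: "u i \<in> U i" unfolding u_def using x by (rule someI)
      have *: "\<bar>(x - u i) \<bullet> es ! j\<bar> \<le> diameter (U i)" if "j < length es" for j
      proof -
        have "norm (es ! j) = 1" using es that by (simp add: orthonormal_frame_def norm_eq_sqrt_inner)
        then have "\<bar>(x - u i) \<bullet> es ! j\<bar> \<le> dist x (u i)"
          using Cauchy_Schwarz_ineq2[of "x - u i" "es ! j"] by (simp add: dist_norm)
        also have "\<dots> \<le> diameter (U i)" by (rule diameter_bounded_bound[OF U(2) x ui])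
        finally show ?thesis .
      qed
      then have "x \<bullet> es ! j \<in> {u i \<bullet> es ! j - diameter (U i) .. u i \<bullet> es ! j + diameter (U i)}"
        if "j < length es" for j
      proof -
        from *[OF that] show ?thesis unfolding inner_diff_left atLeastAtMost_iff by linarith
      qed
      then show "x \<in> B i" using ne by (simp add: B_def)
    qed
    have "1 = emeasure (frame_measure 0 es) {x. \<forall>j<length es. (x - 0) \<bullet> es ! j \<in> {0..1}}"
      by (subst emeasure_frame_measure_box(2)[OF es(1)]) auto
    also have "\<dots> \<le> emeasure (frame_measure 0 es) (\<Union>i. B i)"
    proof (rule emeasure_mono_AE)
      show "AE x in frame_measure 0 es. x \<in> {x. \<forall>j<length es. (x - 0) \<bullet> es ! j \<in> {0..1}} \<longrightarrow> x \<in> (\<Union>i. B i)"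
        using AE_frame_measure_plane[of 0 es]
      proof (eventually_elim, intro impI)
        fix x assume "x - 0 \<in> span (set es)" "x \<in> {x. \<forall>j<length es. (x - 0) \<bullet> es ! j \<in> {0..1}}"
        then have "x \<in> ?Q" by (simp add: frame_cube_iff[OF es(1)])
        then show "x \<in> (\<Union>i. B i)" using U(1) UB by blast
      qed
      show "(\<Union>i. B i) \<in> sets (frame_measure 0 es)" using Bm by auto
    qed
    also have "\<dots> \<le> suminf (\<lambda>i. emeasure (frame_measure 0 es) (B i))"
      by (rule emeasure_subadditive_countably) (use Bm in auto)
    finally have 1: "1 \<le> suminf (\<lambda>i. emeasure (frame_measure 0 es) (B i))" .
    have "ennreal (?w / 4 ^ k) * 1 \<le> ennreal (?w / 4 ^ k) * suminf (\<lambda>i. emeasure (frame_measure 0 es) (B i))"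
      by (rule mult_left_mono[OF 1]) simp
    also have "\<dots> = suminf (\<lambda>i. ennreal (?w / 4 ^ k) * emeasure (frame_measure 0 es) (B i))" by simp
    also have "\<dots> = suminf (\<lambda>i. if U i = {} then 0 else ennreal (?w * (diameter (U i) / 2) ^ k))"
    proof (intro arg_cong[where f = suminf] ext)
      fix i
      have "?w / 4 ^ k * (2 * diameter (U i)) ^ k = ?w * (diameter (U i) / 2) ^ k"
      proof -
        have "(2 * diameter (U i)) ^ k = (4 * (diameter (U i) / 2)) ^ k" by simp
        also have "\<dots> = 4 ^ k * (diameter (U i) / 2) ^ k" by (rule power_mult_distrib)
        finally show ?thesis by simp
      qed
      then show "ennreal (?w / 4 ^ k) * emeasure (frame_measure 0 es) (B i) =
          (if U i = {} then 0 else ennreal (?w * (diameter (U i) / 2) ^ k))"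
        using w diameter_ge_0[OF U(2)[of i]] by (simp add: Be ennreal_mult[symmetric] del: ennreal_mult')
    qed
    finally show "ennreal (?w / 4 ^ k) \<le> suminf (\<lambda>i. if U i = {} then 0 else ennreal (?w * (diameter (U i) / 2) ^ k))"
      by simp
  qed
  also have "\<dots> \<le> hausdorff_factor k"
    using hausdorff_pre_le_measure[of 1 k ?Q] hausdorff_measure_cube[OF es, of 1 0] by simp
  finally show ?thesis using w by (auto simp: less_le_trans[of 0 "ennreal (?w / 4 ^ k)"])
qed

text \<open>Grid covers bound the Hausdorff measure by the volume of the neighbourhood of radius
  \<open>k / Suc m\<close>, and these neighbourhoods decrease to the compact set.\<close>

lemma hausdorff_measure_compact_le:
  assumes es: "orthonormal_frame es" "length es = k"
    and X: "compact X" "\<And>x. x \<in> X \<Longrightarrow> x - p \<in> span (set es)"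
  shows "hausdorff_measure k X \<le> hausdorff_factor k * emeasure (frame_measure p es) X"
proof (cases "X = {}")
  case False
  let ?N = "\<lambda>m::nat. {x. infdist x X \<le> real k / real (Suc m)}"
  have bX: "bounded X" using X(1) by (rule compact_imp_bounded)
  have Nm: "?N m \<in> sets borel" for m by (intro borel_closed closed_Collect_le continuous_intros)
  have le: "hausdorff_measure k X \<le> hausdorff_factor k * emeasure (frame_measure p es) (?N m)" for m
  proof -
    obtain Z :: "(nat \<Rightarrow> int) set" and q where Z: "finite Z" "X \<subseteq> (\<Union>z\<in>Z. frame_cube (q z) es (1 / real (Suc m)))"
      "ennreal (real (card Z) * (1 / real (Suc m)) ^ k) \<le> emeasure (frame_measure p es) (?N m)"
      using grid_cover[OF es(1) X(2) bX, of "Suc m"] es(2) by auto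
    have "hausdorff_measure k X \<le> (\<Sum>z\<in>Z. hausdorff_measure k (frame_cube (q z) es (1 / real (Suc m))))"
      using hausdorff_measure_mono[OF Z(2)] hausdorff_measure_UN[OF Z(1)] by (rule order_trans)
    also have "\<dots> = (\<Sum>z\<in>Z. ennreal ((1 / real (Suc m)) ^ k) * hausdorff_factor k)"
      by (intro sum.cong refl hausdorff_measure_cube[OF es]) simp
    also have "\<dots> = hausdorff_factor k * ennreal (real (card Z) * (1 / real (Suc m)) ^ k)"
      by (simp add: ennreal_mult' ennreal_of_nat_eq_real_of_nat ac_simps)
    also have "\<dots> \<le> hausdorff_factor k * emeasure (frame_measure p es) (?N m)"
      by (rule mult_left_mono[OF Z(3)]) simp
    finally show ?thesis .
  qed
  have INT: "(\<Inter>m. ?N m) = X"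
  proof
    show "X \<subseteq> (\<Inter>m. ?N m)" by auto
    show "(\<Inter>m. ?N m) \<subseteq> X"
    proof
      fix x assume x: "x \<in> (\<Inter>m. ?N m)"
      have "(\<lambda>m. real k / real (Suc m)) \<longlonglongrightarrow> 0" by (rule LIMSEQ_Suc[OF lim_const_over_n])
      then have "infdist x X \<le> 0"
        by (rule LIMSEQ_le_const) (use x in auto)
      then have "infdist x X = 0" using infdist_nonneg[of x X] by simp
      then show "x \<in> X" using in_closed_iff_infdist_zero[OF compact_imp_closed[OF X(1)] False] by simp
    qed
  qed
  have b0: "bounded (?N 0)"
  proof -
    obtain R where R: "\<And>x. x \<in> X \<Longrightarrow> norm x \<le> R" using bX unfolding bounded_iff by blast
    have "norm x \<le> R + real k" if "x \<in> ?N 0" for x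
    proof -
      obtain a where a: "a \<in> X" "infdist x X = dist x a"
        using infdist_attains_inf[OF compact_imp_closed[OF X(1)] False] by blast
      have "norm x \<le> norm a + dist x a" using norm_triangle_sub[of x a] by (simp add: dist_norm)
      then show ?thesis using a that R[OF a(1)] by simp
    qed
    then show ?thesis unfolding bounded_iff by blast
  qed
  have sub: "?N m \<subseteq> ?N n" if "n \<le> m" for m n
  proof -
    have "real k / real (Suc m) \<le> real k / real (Suc n)" using that by (intro divide_left_mono) auto
    then show ?thesis by auto
  qed
  have "(\<lambda>m. emeasure (frame_measure p es) (?N m)) \<longlonglongrightarrow> emeasure (frame_measure p es) (\<Inter>m. ?N m)"
  proof (rule Lim_emeasure_decseq)
    show "range ?N \<subseteq> sets (frame_measure p es)" using Nm by auto
    show "decseq ?N" unfolding decseq_def using sub by blast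
    fix m
    have "bounded (?N m)" using b0 sub[of 0 m] bounded_subset by blast
    then have "emeasure (frame_measure p es) (?N m) < \<infinity>"
      by (rule emeasure_frame_measure_bounded[OF orthonormal_frame_basis[OF es(1)]])
    then show "emeasure (frame_measure p es) (?N m) \<noteq> \<infinity>" by (rule less_imp_neq)
  qed
  then have "(\<lambda>m. hausdorff_factor k * emeasure (frame_measure p es) (?N m)) \<longlonglongrightarrow>
      hausdorff_factor k * emeasure (frame_measure p es) X"
    unfolding INT using hausdorff_factor_finite[OF es] by (intro ennreal_tendsto_cmult) auto
  then show ?thesis by (rule LIMSEQ_le_const) (use le in blast)
qed simp

lemma frame_cube_compact:
  assumes "orthonormal_frame es"
  shows "compact (frame_cube p es s)"
proof -
  have "frame_cube p es s = {x. x - p \<in> span (set es)} \<inter>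
      (\<Inter>i\<in>{..<length es}. {x. 0 \<le> (x - p) \<bullet> es ! i} \<inter> {x. (x - p) \<bullet> es ! i \<le> s})"
    by (auto simp: frame_cube_iff[OF assms])
  moreover have "closed {x. x - p \<in> span (set es)}"
  proof -
    have "closed ((\<lambda>x. x - p) -` span (set es))"
      by (intro continuous_closed_vimage closed_span) (auto intro: continuous_intros)
    then show ?thesis by (simp add: vimage_def)
  qed
  ultimately have "closed (frame_cube p es s)"
    by (auto intro!: closed_Int closed_INT closed_Collect_le continuous_intros)
  moreover have "bounded (frame_cube p es s)"
    using dist_frame_cube[OF assms] unfolding bounded_def by (cases "frame_cube p es s = {}") blast+
  ultimately show ?thesis by (simp add: compact_eq_bounded_closed)
qed

lemma emeasure_frame_cube:
  assumes es: "orthonormal_frame es" and s: "0 \<le> s"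
  shows "emeasure (frame_measure p es) (frame_cube p es s) = ennreal (s ^ length es)"
proof -
  have B: "{x. \<forall>j<length es. (x - p) \<bullet> es ! j \<in> {0..s}} \<in> sets borel"
    by (rule emeasure_frame_measure_box(1)[OF es]) simp
  have "emeasure (frame_measure p es) (frame_cube p es s) =
      emeasure (frame_measure p es) {x. \<forall>j<length es. (x - p) \<bullet> es ! j \<in> {0..s}}"
  proof (rule emeasure_eq_AE)
    show "AE x in frame_measure p es. x \<in> frame_cube p es s \<longleftrightarrow> x \<in> {x. \<forall>j<length es. (x - p) \<bullet> es ! j \<in> {0..s}}"
      using AE_frame_measure_plane[of p es] by eventually_elim (simp add: frame_cube_iff[OF es])
  qed (use B in \<open>auto intro: borel_closed compact_imp_closed frame_cube_compact[OF es]\<close>)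
  also have "\<dots> = (\<Prod>j<length es. emeasure lborel {0..s})"
    by (rule emeasure_frame_measure_box(2)[OF es]) simp
  finally show ?thesis using s by (simp add: ennreal_power)
qed

text \<open>The upper bound is the one for the compact closure. For the lower bound, enclose
  \<open>A\<close> in a cube, where the ratio is exact, and apply the upper bound to the rest of the
  cube, which is compact; by subadditivity \<open>A\<close> must make up the difference.\<close>

lemma hausdorff_measure_relative_open:
  assumes es: "orthonormal_frame es" "length es = k" and A: "bounded A"
    and AG: "A = {x. x - p \<in> span (set es)} \<inter> G" "open G"
    and null: "emeasure (frame_measure p es) (closure A - A) = 0"
  shows "hausdorff_measure k A = hausdorff_factor k * emeasure (frame_measure p es) A"
proof (rule antisym)
  let ?L = "{x. x - p \<in> span (set es)}"
  let ?\<mu> = "frame_measure p es"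
  let ?c = "hausdorff_factor k"
  have L: "closed ?L"
  proof -
    have "closed ((\<lambda>x. x - p) -` span (set es))"
      by (intro continuous_closed_vimage closed_span) (auto intro: continuous_intros)
    then show ?thesis by (simp add: vimage_def)
  qed
  have Am [measurable]: "A \<in> sets borel" using AG L by (auto intro: borel_open borel_closed)
  have clA: "closure A \<subseteq> ?L" using AG(1) L by (metis Int_lower1 closure_minimal)
  have cc: "compact (closure A)" using A by (simp add: compact_closure)
  have "hausdorff_measure k A \<le> hausdorff_measure k (closure A)"
    by (rule hausdorff_measure_mono[OF closure_subset])
  also have "\<dots> \<le> ?c * emeasure ?\<mu> (closure A)"
    using clA by (intro hausdorff_measure_compact_le[OF es cc]) auto
  also have "emeasure ?\<mu> (closure A) = emeasure ?\<mu> A"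
  proof -
    have "emeasure ?\<mu> (A \<union> (closure A - A)) = emeasure ?\<mu> A"
      using null by (intro emeasure_Un_null_set) (auto simp: null_sets_def)
    then show ?thesis using closure_subset[of A] by (simp add: Un_absorb1)
  qed
  finally show "hausdorff_measure k A \<le> ?c * emeasure ?\<mu> A" .
  obtain R where R: "\<And>x. x \<in> A \<Longrightarrow> norm (x - p) \<le> R" "0 < R"
  proof -
    obtain r where r: "\<And>x. x \<in> A \<Longrightarrow> norm x \<le> r" using A unfolding bounded_iff by blast
    have le: "norm (x - p) \<le> \<bar>r\<bar> + norm p + 1" if "x \<in> A" for x
      using r[OF that] norm_triangle_ineq4[of x p] by linarith
    have pos: "0 < \<bar>r\<bar> + norm p + 1" using norm_ge_zero[of p] abs_ge_zero[of r] by linarith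
    show ?thesis by (rule that[OF le pos])
  qed
  \<comment> \<open>The corner for which the cube of side \<open>2 * R\<close> is centred at
    \<open>p\<close>.\<close>
  define q where "q = frame_point p es (\<lambda>_. - R)"
  have qp: "q - p \<in> span (set es)" unfolding q_def by (rule frame_point_in_plane)
  let ?Q = "frame_cube q es (2 * R)"
  have AQ: "A \<subseteq> ?Q"
  proof
    fix x assume x: "x \<in> A"
    have xp: "x - p \<in> span (set es)" using x AG by auto
    have "0 \<le> (x - q) \<bullet> es ! i \<and> (x - q) \<bullet> es ! i \<le> 2 * R" if i: "i < length es" for i
    proof -
      have "norm (es ! i) = 1" using es i by (simp add: orthonormal_frame_def norm_eq_sqrt_inner)
      then have "\<bar>(x - p) \<bullet> es ! i\<bar> \<le> R"
        using Cauchy_Schwarz_ineq2[of "x - p" "es ! i"] R(1)[OF x] by simp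
      moreover have "(q - p) \<bullet> es ! i = - R" unfolding q_def by (rule inner_frame_point[OF es(1) i])
      moreover have "(x - q) \<bullet> es ! i = (x - p) \<bullet> es ! i - (q - p) \<bullet> es ! i" by (simp add: inner_diff_left)
      ultimately show ?thesis by linarith
    qed
    then show "x \<in> ?Q" using span_diff[OF xp qp] by (simp add: frame_cube_iff[OF es(1)])
  qed
  have \<mu>q: "emeasure (frame_measure q es) S = emeasure ?\<mu> S" if "S \<in> sets borel" for S
  proof -
    have "emeasure (frame_measure q es) S = (\<integral>\<^sup>+ x. indicator S x \<partial>frame_measure (p + (q - p)) es)"
      using that by simp
    also have "\<dots> = (\<integral>\<^sup>+ x. indicator S x \<partial>?\<mu>)"
      by (rule nn_integral_frame_measure_span[OF _ qp]) (use that in simp)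
    finally show ?thesis using that by simp
  qed
  have Qm: "?Q \<in> sets borel" by (intro borel_closed compact_imp_closed frame_cube_compact[OF es(1)])
  have QA: "compact (?Q - A)"
  proof -
    have "?Q - A = ?Q - G" using AG qp span_add[of _ "set es" "q - p"]
      by (force simp: frame_cube_iff[OF es(1)] algebra_simps)
    then show ?thesis using compact_diff[OF frame_cube_compact[OF es(1)] AG(2)] by simp
  qed
  have QAL: "x - p \<in> span (set es)" if "x \<in> ?Q - A" for x
    using that qp span_add[of "x - q" "set es" "q - p"] by (auto simp: frame_cube_iff[OF es(1)])
  have f: "emeasure ?\<mu> S < \<infinity>" if "bounded S" for S
    by (rule emeasure_frame_measure_bounded[OF orthonormal_frame_basis[OF es(1)] that])
  have bQ: "bounded ?Q" by (intro compact_imp_bounded frame_cube_compact[OF es(1)])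
  have "?c * emeasure ?\<mu> A + ?c * emeasure ?\<mu> (?Q - A) = ?c * emeasure ?\<mu> ?Q"
    unfolding distrib_left[symmetric] using AQ Qm
    by (subst plus_emeasure) (auto simp: Un_absorb1)
  also have "\<dots> = hausdorff_measure k ?Q"
    using hausdorff_measure_cube[OF es, of "2 * R" q] emeasure_frame_cube[OF es(1), of "2 * R" q] R(2) \<mu>q[OF Qm] es(2)
    by (simp add: mult.commute)
  also have "\<dots> \<le> hausdorff_measure k A + hausdorff_measure k (?Q - A)"
    using hausdorff_measure_Un[of k A "?Q - A"] AQ by (simp add: Un_absorb1)
  also have "\<dots> \<le> hausdorff_measure k A + ?c * emeasure ?\<mu> (?Q - A)"
    by (rule add_left_mono[OF hausdorff_measure_compact_le[OF es QA QAL]])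
  finally have "?c * emeasure ?\<mu> A + ?c * emeasure ?\<mu> (?Q - A) \<le> hausdorff_measure k A + ?c * emeasure ?\<mu> (?Q - A)" .
  moreover have "?c * emeasure ?\<mu> (?Q - A) \<noteq> \<infinity>"
    using f[of "?Q - A"] bQ hausdorff_factor_finite[OF es] by (simp add: bounded_diff ennreal_mult_eq_top_iff less_top)
  ultimately show "?c * emeasure ?\<mu> A \<le> hausdorff_measure k A"
    by (simp add: ennreal_add_left_cancel_le add.commute[of _ "?c * emeasure ?\<mu> (?Q - A)"])
qed

section \<open>Cells\<close>

lemma direction_space_eq_span:
  assumes "p \<in> S"
  shows "direction_space S = span ((\<lambda>x. x - p) ` S)"
proof (rule subset_antisym)
  have "x - y \<in> span ((\<lambda>x. x - p) ` S)" if "x \<in> S" "y \<in> S" for x y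
    using span_diff[of "x - p" "(\<lambda>x. x - p) ` S" "y - p"] that by (simp add: span_base)
  then show "direction_space S \<subseteq> span ((\<lambda>x. x - p) ` S)"
    unfolding direction_space_def by (intro span_minimal) auto
  show "span ((\<lambda>x. x - p) ` S) \<subseteq> direction_space S"
    unfolding direction_space_def using assms by (intro span_mono) auto
qed

lemma affine_hull_iff_direction_space:
  assumes "p \<in> S"
  shows "x \<in> affine hull S \<longleftrightarrow> x - p \<in> direction_space S"
proof -
  have "span ((\<lambda>x. x - p) ` (S - {p})) = span ((\<lambda>x. x - p) ` S)"
  proof -
    have "(\<lambda>x. x - p) ` S = insert 0 ((\<lambda>x. x - p) ` (S - {p}))" using assms by auto
    then show ?thesis by (simp add: span_insert_0)
  qed
  then have "affine hull S = (+) p ` direction_space S"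
    unfolding direction_space_eq_span[OF assms] using affine_hull_span2[OF assms] by simp
  then show ?thesis by (auto simp: image_iff algebra_simps intro: bexI[of _ "x - p"])
qed

lemma subspace_direction_space [simp]: "subspace (direction_space S)"
  by (simp add: direction_space_def)

lemma aff_dim_direction_space:
  assumes "p \<in> S"
  shows "aff_dim S = int (dim (direction_space S))"
  using aff_dim_eq_dim_subtract[of p S] assms by (simp add: direction_space_eq_span hull_inc)

lemma direction_space_affine_hull:
  assumes p: "p \<in> S"
  shows "direction_space (affine hull S) = direction_space S"
proof (rule set_eqI)
  fix v
  have "p \<in> affine hull S" by (rule hull_inc[OF p])
  from affine_hull_iff_direction_space[OF this, of "p + v"] affine_hull_iff_direction_space[OF p, of "p + v"]
  show "v \<in> direction_space (affine hull S) \<longleftrightarrow> v \<in> direction_space S" by (simp add: hull_hull)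
qed

lemma direction_space_mono: "S \<subseteq> T \<Longrightarrow> direction_space S \<subseteq> direction_space T"
  unfolding direction_space_def by (intro span_mono) auto

lemma AE_proj_aff_dim:
  assumes es: "orthonormal_frame es" and S: "aff_dim S < int (length es)"
  shows "AE y in frame_measure 0 es. \<forall>x. proj es x = y \<longrightarrow> x \<notin> S"
proof (cases "S = {}")
  case False
  then obtain p where p: "p \<in> S" by blast
  have "AE y in frame_measure 0 es. \<forall>x. proj es x = y \<longrightarrow> x - p \<notin> direction_space S"
    using S aff_dim_direction_space[OF p] by (intro AE_proj_small[OF es]) auto
  then show ?thesis
  proof eventually_elim
    case (elim y)
    then show ?case using affine_hull_iff_direction_space[OF p] hull_inc[of _ S] by blast
  qed
qed simp

lemma AE_frame_aff_dim:
  assumes vs: "ordered_basis V vs" and S: "aff_dim S < int (length vs)" "direction_space S \<subseteq> V"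
  shows "AE x in frame_measure p vs. x \<notin> S"
proof (cases "S = {}")
  case False
  then obtain q where q: "q \<in> S" by blast
  have "AE x in frame_measure p vs. x - q \<notin> direction_space S"
    using S aff_dim_direction_space[OF q] by (intro AE_frame_measure_small[OF vs]) auto
  then show ?thesis
  proof eventually_elim
    case (elim x)
    then show ?case using affine_hull_iff_direction_space[OF q] hull_inc[of _ S] by blast
  qed
qed simp

text \<open>The closure is the polyhedron with the weak inequalities, because moving any of its
  points towards a point of \<open>A\<close> makes all inequalities strict at once. So facts about
  polytopes and their facets apply to the closure, and \<open>A\<close> is recovered as its relative
  interior.\<close>

lemma is_cell_structure:
  assumes "is_cell k A"
  shows "A \<noteq> {}" "bounded A" "convex A" "aff_dim A = int k" "rel_interior A = A"
    "polytope (closure A)" "rel_interior (closure A) = A"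
    "\<exists>G. open G \<and> A = affine hull A \<inter> G"
    "\<exists>\<C>. finite \<C> \<and> A = affine hull A \<inter> (\<Inter>(a, b)\<in>\<C>. {x. a \<bullet> x < b})"
proof -
  from assms obtain L \<H> where L: "affine L" "aff_dim L = int k" and fin: "finite \<H>"
    and half: "\<forall>H\<in>\<H>. open_half_space_of L H" and A: "A = L \<inter> \<Inter>\<H>"
    unfolding is_cell_def by blast
  show ne: "A \<noteq> {}" and bd: "bounded A" using assms unfolding is_cell_def by auto
  from half obtain a b where ab: "\<And>H. H \<in> \<H> \<Longrightarrow> H = {x \<in> L. a H \<bullet> x < b H}"
    unfolding open_half_space_of_def by metis
  let ?\<C> = "(\<lambda>H. (a H, b H)) ` \<H>"
  let ?G = "\<Inter>(a, b)\<in>?\<C>. {x. a \<bullet> x < b}"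
  have AG: "A = L \<inter> ?G" unfolding A using ab by auto
  have G: "open ?G" using fin by (auto intro!: open_INT open_halfspace_lt)
  have cG: "convex ?G" by (auto intro!: convex_INT convex_halfspace_lt)
  show cA: "convex A" unfolding AG by (intro convex_Int affine_imp_convex L cG)
  have LL: "affine hull L = L" using L by (simp add: affine_hull_eq)
  have op: "openin (top_of_set (affine hull L)) A"
    unfolding LL using AG G by (auto simp: openin_open)
  have hull: "affine hull A = L" using affine_hull_openin[OF op ne] LL by simp
  show "aff_dim A = int k" using hull L(2) by (metis aff_dim_affine_hull)
  show ri: "rel_interior A = A" using op hull LL by (simp add: rel_interior_eq)
  show "\<exists>G. open G \<and> A = affine hull A \<inter> G" using G AG hull by blast
  show "\<exists>\<C>. finite \<C> \<and> A = affine hull A \<inter> (\<Inter>(a, b)\<in>\<C>. {x. a \<bullet> x < b})"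
    by (intro exI[of _ ?\<C>] conjI finite_imageI fin) (simp only: hull, rule AG)
  let ?P = "L \<inter> (\<Inter>(a, b)\<in>?\<C>. {x. a \<bullet> x \<le> b})"
  have P: "polyhedron ?P"
  proof (rule polyhedron_Int[OF affine_imp_polyhedron[OF L(1)] polyhedron_Inter])
    show "finite ((\<lambda>(a, b). {x. a \<bullet> x \<le> b}) ` ?\<C>)" using fin by simp
  qed (auto intro: polyhedron_halfspace_le)
  have "closure A = ?P"
  proof
    show "closure A \<subseteq> ?P"
      using AG polyhedron_imp_closed[OF P] by (intro closure_minimal) force+
    show "?P \<subseteq> closure A"
    proof
      fix x assume x: "x \<in> ?P"
      obtain p where p: "p \<in> A" using ne by blast
      have in_A: "x + t *\<^sub>R (p - x) \<in> A" if t: "0 < t" "t \<le> 1" for t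
      proof -
        have e: "x + t *\<^sub>R (p - x) = (1 - t) *\<^sub>R x + t *\<^sub>R p" by (simp add: algebra_simps)
        have "x + t *\<^sub>R (p - x) \<in> L"
          unfolding e using p x A L(1) by (intro mem_affine) auto
        moreover have "c \<bullet> (x + t *\<^sub>R (p - x)) < d" if cd: "(c, d) \<in> ?\<C>" for c d
        proof -
          have "c \<bullet> x \<le> d" "c \<bullet> p < d" using x p cd AG by auto
          then have "(1 - t) * (c \<bullet> x) + t * (c \<bullet> p) < (1 - t) * d + t * d"
            using t by (intro add_le_less_mono mult_left_mono mult_strict_left_mono) auto
          then show ?thesis unfolding e by (simp add: inner_add_right algebra_simps)
        qed
        ultimately show ?thesis unfolding AG by auto
      qed
      have "(\<lambda>n. x + (1 / real (Suc n)) *\<^sub>R (p - x)) \<longlonglongrightarrow> x + 0 *\<^sub>R (p - x)"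
        by (intro tendsto_intros LIMSEQ_Suc[OF lim_1_over_n])
      moreover have "x + (1 / real (Suc n)) *\<^sub>R (p - x) \<in> A" for n
        by (rule in_A) auto
      ultimately show "x \<in> closure A" unfolding closure_sequential by (intro exI conjI allI) auto
    qed
  qed
  then have "polyhedron (closure A)" using P by (simp only:)
  then show pt: "polytope (closure A)"
    using bounded_closure[OF bd] by (simp add: polytope_eq_bounded_polyhedron)
  show "rel_interior (closure A) = A" using convex_rel_interior_closure[OF cA] ri by simp
qed

text \<open>In an irredundant description of a polytope by half spaces, the strict inequalities
  describe the relative interior. This makes the relative interiors of facets cells again.\<close>

lemma is_cell_rel_interior_polytope:
  assumes P: "polytope P" "aff_dim P = int k"
  shows "is_cell k (rel_interior P)"
proof -
  have cP: "convex P" by (rule polytope_imp_convex[OF P(1)])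
  have ne: "P \<noteq> {}" using P(2) by auto
  have ri: "rel_interior P \<noteq> {}" using ne rel_interior_eq_empty[OF cP] by simp
  have poly: "polyhedron P" using P(1) by (simp add: polytope_eq_bounded_polyhedron)
  obtain F where F: "finite F" "P = affine hull P \<inter> \<Inter>F" "\<forall>h\<in>F. \<exists>a b. a \<noteq> 0 \<and> h = {x. a \<bullet> x \<le> b}"
      "\<forall>F'. F' \<subset> F \<longrightarrow> P \<subset> affine hull P \<inter> \<Inter>F'"
    using poly unfolding polyhedron_Int_affine_minimal by metis
  from F(3) obtain a b where ab: "\<And>h. h \<in> F \<Longrightarrow> a h \<noteq> 0 \<and> h = {x. a h \<bullet> x \<le> b h}" by metis
  have r: "rel_interior P = {x \<in> P. \<forall>h\<in>F. a h \<bullet> x < b h}"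
    by (rule rel_interior_polyhedron_explicit[OF F(1,2) ab]) (use F(4) in auto)
  let ?L = "affine hull P"
  \<comment> \<open>\<open>open_half_space_of\<close> admits only proper subsets of the plane, so a
    set equal to the whole plane is left out.\<close>
  let ?\<H> = "(\<lambda>h. {x \<in> ?L. a h \<bullet> x < b h}) ` F - {?L}"
  have eq: "rel_interior P = ?L \<inter> \<Inter>?\<H>"
  proof
    show "rel_interior P \<subseteq> ?L \<inter> \<Inter>?\<H>" unfolding r using hull_subset[of P affine] by blast
    show "?L \<inter> \<Inter>?\<H> \<subseteq> rel_interior P"
    proof
      fix x assume x: "x \<in> ?L \<inter> \<Inter>?\<H>"
      have *: "a h \<bullet> x < b h" if "h \<in> F" for h
        using x that by (cases "{x \<in> ?L. a h \<bullet> x < b h} = ?L") blast+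
      then have "x \<in> h" if "h \<in> F" for h using ab[OF that] * that by (metis less_imp_le mem_Collect_eq)
      then have "x \<in> \<Inter>F" by (rule InterI)
      moreover have "x \<in> ?L" using x by (rule IntD1)
      ultimately have "x \<in> P" by (subst F(2)) (rule IntI)
      then show "x \<in> rel_interior P" unfolding r using * by blast
    qed
  qed
  show ?thesis
    unfolding is_cell_def
  proof (intro conjI exI)
    show "rel_interior P \<noteq> {}" by (rule ri)
    show "bounded (rel_interior P)"
      using polytope_imp_bounded[OF P(1)] rel_interior_subset bounded_subset by blast
    show "affine ?L" by simp
    show "aff_dim ?L = int k" using P(2) by simp
    show "finite ?\<H>" using F(1) by simp
    show "\<forall>H\<in>?\<H>. open_half_space_of ?L H"
    proof
      fix H assume H: "H \<in> ?\<H>"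
      then have "rel_interior P \<subseteq> H" using eq by blast
      then have "H \<noteq> {}" using ri by blast
      then show "open_half_space_of ?L H" unfolding open_half_space_of_def using H by blast
    qed
    show "rel_interior P = ?L \<inter> \<Inter>?\<H>" by (rule eq)
  qed
qed

lemma cell_facets:
  assumes "is_cell k A" "F facet_of closure A"
  shows "polytope F" "F \<noteq> {}" "F \<subseteq> closure A" "F \<inter> A = {}" "k > 0" "is_cell (k - 1) (rel_interior F)"
    "affine hull (rel_interior F) = affine hull F" "aff_dim F = int k - 1"
    "direction_space (rel_interior F) = direction_space F" "direction_space F \<subseteq> direction_space A"
    "F face_of closure A" "rel_interior F \<noteq> {}"
proof -
  note A = is_cell_structure[OF assms(1)]
  show face: "F face_of closure A" and ne: "F \<noteq> {}" and ad: "aff_dim F = int k - 1"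
    using assms(2) A(4) by (auto simp: facet_of_def)
  show pF: "polytope F" by (rule face_of_polytope_polytope[OF A(6) face])
  show sub: "F \<subseteq> closure A" by (rule face_of_imp_subset[OF face])
  have "F \<noteq> closure A" using ad A(4) by auto
  then show "F \<inter> A = {}" using face_of_disjoint_rel_interior[OF face] A(7) by simp
  have "aff_dim F \<ge> 0" using ne aff_dim_negative_iff[of F] by linarith
  then show k: "k > 0" using ad by simp
  then show "is_cell (k - 1) (rel_interior F)"
    using ad by (intro is_cell_rel_interior_polytope[OF pF]) (simp add: of_nat_diff)
  have cF: "convex F" by (rule polytope_imp_convex[OF pF])
  show h: "affine hull (rel_interior F) = affine hull F"
    by (rule rel_interior_same_affine_hull[OF cF])
  show ri: "rel_interior F \<noteq> {}" using ne rel_interior_eq_empty[OF cF] by simp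
  then obtain q where q: "q \<in> rel_interior F" by blast
  show "direction_space (rel_interior F) = direction_space F"
    using direction_space_affine_hull[OF q] direction_space_affine_hull[of q F] h q rel_interior_subset by force
  obtain p where p: "p \<in> A" using A(1) by blast
  have "affine hull (closure A) = affine hull A"
    by (rule closure_same_affine_hull)
  then have "direction_space (closure A) = direction_space A"
    using direction_space_affine_hull[OF p] direction_space_affine_hull[of p "closure A"] p closure_subset by force
  then show "direction_space F \<subseteq> direction_space A" using direction_space_mono[OF sub] by simp
qed

lemma cell_closure_eq:
  assumes "is_cell k A"
  shows "closure A - A = \<Union>{F. F facet_of closure A}" "finite {F. F facet_of closure A}"
proof -
  note A = is_cell_structure[OF assms]
  show "closure A - A = \<Union>{F. F facet_of closure A}"
    using rel_boundary_of_polyhedron[of "closure A"] A(6,7) by (simp add: polytope_eq_bounded_polyhedron)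
  show "finite {F. F facet_of closure A}"
    by (rule finite_polytope_facets[OF A(6)])
qed

lemma AE_cell_closure:
  assumes A: "is_cell k A" and vs: "ordered_basis (direction_space A) vs" "length vs = k"
  shows "AE x in frame_measure p vs. x \<notin> closure A - A"
proof -
  have "AE x in frame_measure p vs. \<forall>F\<in>{F. F facet_of closure A}. x \<notin> F"
    using cell_closure_eq(2)[OF A] cell_facets[OF A] vs
    by (intro AE_finite_allI AE_frame_aff_dim[OF vs(1)]) auto
  then show ?thesis unfolding cell_closure_eq(1)[OF A] by eventually_elim blast
qed

lemma cell_plane:
  assumes "p \<in> A"
  shows "x \<in> affine hull A \<longleftrightarrow> x - p \<in> direction_space A"
  by (rule affine_hull_iff_direction_space[OF assms])

lemma is_cell_borel:
  assumes "is_cell k A"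
  shows "A \<in> sets borel"
proof -
  obtain G where "open G" "A = affine hull A \<inter> G" using is_cell_structure(8)[OF assms] by blast
  then show ?thesis by (metis borel_closed borel_open closed_affine_hull sets.Int)
qed

text \<open>A cell is relatively open in its plane, and the rest of its closure, a finite union of
  facets, is a null set.\<close>

lemma hausdorff_measure_cell:
  assumes A: "is_cell k A" and es: "orthonormal_frame es" "span (set es) = direction_space A" and p: "p \<in> A"
  shows "hausdorff_measure k A = hausdorff_factor k * emeasure (frame_measure p es) A"
proof -
  note S = is_cell_structure[OF A]
  have ob: "ordered_basis (direction_space A) es" using orthonormal_frame_basis[OF es(1)] es(2) by simp
  have l: "length es = k"
    using ob aff_dim_direction_space[OF p] S(4) by (simp add: ordered_basis_iff)
  obtain G where G: "open G" "A = affine hull A \<inter> G" using S(8) by blast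
  show ?thesis
  proof (rule hausdorff_measure_relative_open[OF es(1) l S(2) _ G(1)])
    show "A = {x. x - p \<in> span (set es)} \<inter> G"
      using G(2) cell_plane[OF p] es(2) by auto
    have "closure A - A \<in> null_sets (frame_measure p es)"
      using AE_cell_closure[OF A ob l, of p] is_cell_borel[OF A]
      by (subst AE_iff_null_sets) (auto intro: borel_closed)
    then show "emeasure (frame_measure p es) (closure A - A) = 0" by (simp add: null_sets_def)
  qed
qed

section \<open>Oriented cells and their mass\<close>

lemma oriented_cell_props:
  "is_cell (cell_dim \<sigma>) (cell_set \<sigma>)" "ordered_basis (direction_space (cell_set \<sigma>)) (cell_frame \<sigma>)"
  "length (cell_frame \<sigma>) = cell_dim \<sigma>"
  using Rep_oriented_cell[of \<sigma>] by (auto simp: cell_set_def cell_frame_def cell_dim_def)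

lemma oriented_cell_Abs:
  assumes "is_cell (length vs) A" "ordered_basis (direction_space A) vs"
  shows "cell_set (Abs_oriented_cell (A, vs)) = A" "cell_frame (Abs_oriented_cell (A, vs)) = vs"
    "cell_dim (Abs_oriented_cell (A, vs)) = length vs"
  using Abs_oriented_cell_inverse[of "(A, vs)"] assms
  by (auto simp: cell_set_def cell_frame_def cell_dim_def)

lemma emeasure_cell_finite:
  assumes "ordered_basis V vs" "is_cell k A"
  shows "emeasure (frame_measure p vs) A < \<infinity>"
  by (rule emeasure_frame_measure_bounded[OF assms(1) is_cell_structure(2)[OF assms(2)]])

lemma cell_mass_eq:
  assumes es: "orthonormal_frame es" "span (set es) = direction_space (cell_set \<sigma>)" and p: "p \<in> cell_set \<sigma>"
  shows "ennreal (cell_mass \<sigma>) = hausdorff_factor (cell_dim \<sigma>) * emeasure (frame_measure p es) (cell_set \<sigma>)"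
proof -
  note A = oriented_cell_props(1)[of \<sigma>]
  have ob: "ordered_basis (direction_space (cell_set \<sigma>)) es" using orthonormal_frame_basis[OF es(1)] es(2) by simp
  have l: "length es = cell_dim \<sigma>"
    using ob oriented_cell_props(2,3)[of \<sigma>] by (simp add: ordered_basis_iff)
  have "hausdorff_factor (cell_dim \<sigma>) * emeasure (frame_measure p es) (cell_set \<sigma>) < \<infinity>"
    using hausdorff_factor_finite[OF es(1) l] emeasure_cell_finite[OF ob A] by (simp add: ennreal_mult_less_top)
  then show ?thesis
    unfolding cell_mass_def hausdorff_measure_cell[OF A es p] by simp
qed

section \<open>Multiplicity of an integral chain\<close>

text \<open>Whether the projection to the span of \<open>es\<close> preserves or reverses the
  orientation of the cell. The value is 0 for cells of another dimension and for cells whose plane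
  has a nonzero direction orthogonal to all of \<open>es\<close>.\<close>

definition cell_sign :: "(real^3) list \<Rightarrow> oriented_cell \<Rightarrow> int" where
  "cell_sign es \<sigma> = (if cell_dim \<sigma> = length es
     then (if kvector_inner es (cell_frame \<sigma>) > 0 then 1 else if kvector_inner es (cell_frame \<sigma>) < 0 then - 1 else 0)
     else 0)"

text \<open>A pointwise value of the formal sum itself; formal sums of the same class agree in it
  only on almost all fibres.\<close>

definition mult :: "(real^3) list \<Rightarrow> (oriented_cell \<Rightarrow>\<^sub>0 int) \<Rightarrow> real^3 \<Rightarrow> int" where
  "mult es c x = (\<Sum>\<sigma>\<in>Poly_Mapping.keys c.
     if x \<in> cell_set \<sigma> then Poly_Mapping.lookup c \<sigma> * cell_sign es \<sigma> else 0)"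

lemma mult_superset:
  assumes "finite S" "Poly_Mapping.keys c \<subseteq> S"
  shows "mult es c x = (\<Sum>\<sigma>\<in>S. if x \<in> cell_set \<sigma> then Poly_Mapping.lookup c \<sigma> * cell_sign es \<sigma> else 0)"
  unfolding mult_def by (rule sum.mono_neutral_left) (use assms in \<open>auto simp: in_keys_iff\<close>)

lemma mult_add: "mult es (a + b) x = mult es a x + mult es b x"
proof -
  let ?S = "Poly_Mapping.keys a \<union> Poly_Mapping.keys b"
  show ?thesis
    by (subst (1 2 3) mult_superset[where S = ?S])
      (auto simp: Poly_Mapping.keys_add lookup_add algebra_simps simp flip: sum.distrib intro!: sum.cong)
qed

lemma mult_uminus: "mult es (- a) x = - mult es a x"
proof -
  have "mult es (a + - a) x = mult es a x + mult es (- a) x" by (rule mult_add)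
  then show ?thesis by (simp add: mult_def)
qed

lemma mult_diff: "mult es (a - b) x = mult es a x - mult es b x"
  using mult_add[of es a "- b" x] by (simp add: mult_uminus)

lemma mult_zero [simp]: "mult es 0 x = 0"
  by (simp add: mult_def)

lemma mult_frag_cmul: "mult es (frag_cmul k c) x = k * mult es c x"
  by (subst mult_superset[of "Poly_Mapping.keys c"])
    (auto simp: keys_cmul mult_def sum_distrib_left intro!: sum.cong)

lemma mult_sum: "mult es (\<Sum>i\<in>I. c i) x = (\<Sum>i\<in>I. mult es (c i) x)"
  by (induction I rule: infinite_finite_induct) (auto simp: mult_add)

lemma mult_frag_of: "mult es (frag_of \<sigma>) x = (if x \<in> cell_set \<sigma> then cell_sign es \<sigma> else 0)"
  by (subst mult_superset[of "{\<sigma>}"]) auto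

lemma mult_measurable [measurable]: "(\<lambda>x. real_of_int (mult es c x)) \<in> borel_measurable borel"
proof -
  have [measurable]: "cell_set \<sigma> \<in> sets borel" for \<sigma>
    by (rule is_cell_borel[OF oriented_cell_props(1)])
  have "(\<lambda>x. real_of_int (mult es c x)) = (\<lambda>x. \<Sum>\<sigma>\<in>Poly_Mapping.keys c.
     real_of_int (Poly_Mapping.lookup c \<sigma> * cell_sign es \<sigma>) * indicat_real (cell_set \<sigma>) x)"
    unfolding mult_def of_int_sum by (intro ext sum.cong refl) simp
  then show ?thesis by (simp only:) measurable
qed

section \<open>Integrals of forms through the projection, and the multiplicities they
  determine\<close>

lemma cell_sign_dual:
  assumes es: "orthonormal_frame es" and s: "cell_sign es \<sigma> \<noteq> 0"
  obtains bs where "dual_frame es bs" "ordered_basis (direction_space (cell_set \<sigma>)) bs"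
    "length es = cell_dim \<sigma>" "kvector_inner es (cell_frame \<sigma>) \<noteq> 0"
proof -
  have "length es = cell_dim \<sigma>" "kvector_inner es (cell_frame \<sigma>) \<noteq> 0"
    using s by (auto simp: cell_sign_def split: if_splits)
  then show ?thesis
    using dual_frame_exists_nonzero[OF es oriented_cell_props(2)[of \<sigma>]] oriented_cell_props(3)[of \<sigma>] that by metis
qed

text \<open>Evaluating the form \<open>kvector_inner es\<close> on the dual frame shows that the
  ratio \<open>r\<close> is the reciprocal of \<open>kvector_inner es vs\<close>; so the Jacobian
  cancels this factor up to its sign.\<close>

lemma integral_frame_measure_lift:
  assumes es: "orthonormal_frame es" and bs: "dual_frame es bs" "ordered_basis V bs"
    and vs: "ordered_basis V vs" and K: "kvector_inner es vs \<noteq> 0"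
    and f [measurable]: "(f :: real^3 \<Rightarrow> real) \<in> borel_measurable borel"
  shows "kvector_inner es vs * (\<integral>x. f x \<partial>frame_measure p vs)
     = sgn (kvector_inner es vs) * (\<integral>y. f (lift es p bs y) \<partial>frame_measure 0 es)"
proof -
  let ?K = "kvector_inner es vs"
  have l: "length vs = length es"
    using bs vs by (auto simp: ordered_basis_iff dual_frame_def)
  obtain r where r: "frame_ratio r vs bs" using frame_ratio_exists[OF vs bs(2)] .
  have "1 = r * ?K"
    using frame_ratio_form[OF r] alternating_form_kvector_inner[of es] l kvector_inner_dual[OF bs(1)] by simp
  then have r1: "\<bar>r\<bar> = 1 / \<bar>?K\<bar>" using K by (auto simp: abs_mult[symmetric] field_simps)
  let ?M = "distr (frame_measure 0 es) borel (lift es p bs)"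
  have lm: "lift es p bs \<in> measurable (frame_measure 0 es) borel"
    unfolding measurable_cong_sets[OF sets_frame_measure refl] by (rule lift_measurable)
  have "frame_measure p vs = density ?M (\<lambda>_. ennreal \<bar>r\<bar>)"
  proof (rule measure_eqI)
    show "sets (frame_measure p vs) = sets (density ?M (\<lambda>_. ennreal \<bar>r\<bar>))" by simp
    fix A assume "A \<in> sets (frame_measure p vs)"
    then have A [measurable]: "A \<in> sets borel" by simp
    have ind: "(indicator A :: _ \<Rightarrow> ennreal) \<in> borel_measurable borel" by simp
    have "emeasure (frame_measure p vs) A = (\<integral>\<^sup>+ x. indicator A x \<partial>frame_measure p vs)" by simp
    also have "\<dots> = ennreal \<bar>r\<bar> * (\<integral>\<^sup>+ y. indicator A (lift es p bs y) \<partial>frame_measure 0 es)"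
      by (simp only: frame_ratio_integral[OF r ind] frame_measure_lift[OF es bs(1) ind])
    also have "(\<integral>\<^sup>+ y. indicator A (lift es p bs y) \<partial>frame_measure 0 es) = (\<integral>\<^sup>+ y. indicator A y \<partial>?M)"
      by (rule nn_integral_distr[OF lm, symmetric]) (simp add: ind)
    also have "ennreal \<bar>r\<bar> * (\<integral>\<^sup>+ y. indicator A y \<partial>?M) = emeasure (density ?M (\<lambda>_. ennreal \<bar>r\<bar>)) A"
      by (simp add: emeasure_density nn_integral_cmult)
    finally show "emeasure (frame_measure p vs) A = emeasure (density ?M (\<lambda>_. ennreal \<bar>r\<bar>)) A" .
  qed
  then have "(\<integral>x. f x \<partial>frame_measure p vs) = (\<integral>x. \<bar>r\<bar> *\<^sub>R f x \<partial>?M)"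
    by (simp add: integral_density)
  also have "\<dots> = \<bar>r\<bar> * (\<integral>x. f x \<partial>?M)" by simp
  also have "(\<integral>x. f x \<partial>?M) = (\<integral>y. f (lift es p bs y) \<partial>frame_measure 0 es)"
    by (rule integral_distr[OF lm f])
  finally show ?thesis using r1 K by (simp add: sgn_real_def)
qed

lemma cell_integral_eq:
  assumes m: "(\<lambda>x. \<omega> x (cell_frame \<sigma>)) \<in> borel_measurable borel"
  shows "cell_integral \<omega> \<sigma> =
    (\<integral>x. indicat_real (cell_set \<sigma>) x * \<omega> x (cell_frame \<sigma>) \<partial>frame_measure (SOME p. p \<in> cell_set \<sigma>) (cell_frame \<sigma>))"
proof -
  have [measurable]: "cell_set \<sigma> \<in> sets borel" by (rule is_cell_borel[OF oriented_cell_props(1)])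
  note m [measurable]
  have "cell_point \<sigma> = frame_point (SOME p. p \<in> cell_set \<sigma>) (cell_frame \<sigma>)"
    by (simp add: fun_eq_iff cell_point_def frame_point_def oriented_cell_props(3))
  then show ?thesis
    unfolding cell_integral_def frame_measure_def oriented_cell_props(3)[symmetric]
    by (subst integral_distr[OF frame_point_measurable]) simp_all
qed

lemma some_in_cell: "(SOME p. p \<in> cell_set \<sigma>) \<in> cell_set \<sigma>"
  using is_cell_structure(1)[OF oriented_cell_props(1)[of \<sigma>]] by (simp add: some_in_eq)

text \<open>Stone-Weierstrass on the ball leads from polynomials to continuous functions, dominated
  convergence from these to closed sets, and the closed sets are an intersection-stable generator of
  the Borel sets. The combination of finite measures stands for a signed measure.\<close>

lemma signed_measures_eq_0:
  fixes \<nu> :: "'i \<Rightarrow> (real^3) measure" and c :: "'i \<Rightarrow> real"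
  assumes I: "finite I" and fm: "\<And>i. i \<in> I \<Longrightarrow> finite_measure (\<nu> i)"
    and s: "\<And>i. i \<in> I \<Longrightarrow> sets (\<nu> i) = sets borel"
    and b: "\<And>i. i \<in> I \<Longrightarrow> AE x in \<nu> i. x \<in> cball 0 R"
    and poly: "\<And>h. real_polynomial_function h \<Longrightarrow> (\<Sum>i\<in>I. c i * (\<integral>x. h x \<partial>\<nu> i)) = 0"
    and E: "E \<in> sets borel"
  shows "(\<Sum>i\<in>I. c i * measure (\<nu> i) E) = 0"
proof -
  have mb: "f \<in> borel_measurable (\<nu> i)" if "f \<in> borel_measurable borel" "i \<in> I" for f :: "real^3 \<Rightarrow> real" and i
    using that(1) unfolding measurable_cong_sets[OF s[OF that(2)] refl] .
  have int: "integrable (\<nu> i) f" if f: "continuous_on UNIV f" and i: "i \<in> I" for f :: "real^3 \<Rightarrow> real" and i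
  proof -
    have "compact (f ` cball 0 R)"
      by (intro compact_continuous_image continuous_on_subset[OF f]) auto
    from compact_imp_bounded[OF this] obtain B where B: "\<And>x. x \<in> cball 0 R \<Longrightarrow> norm (f x) \<le> B"
      unfolding bounded_iff by (metis imageI)
    have "AE x in \<nu> i. norm (f x) \<le> B" using b[OF i] by eventually_elim (rule B)
    then show ?thesis
      by (rule finite_measure.integrable_const_bound[OF fm[OF i]])
        (rule mb[OF borel_measurable_continuous_onI[OF f] i])
  qed
  have cont: "(\<Sum>i\<in>I. c i * (\<integral>x. f x \<partial>\<nu> i)) = 0" if f: "continuous_on UNIV f" for f :: "real^3 \<Rightarrow> real"
  proof (rule ccontr)
    let ?S = "\<lambda>f. \<Sum>i\<in>I. c i * (\<integral>x. f x \<partial>\<nu> i)"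
    let ?T = "(\<Sum>i\<in>I. \<bar>c i\<bar> * measure (\<nu> i) UNIV)"
    assume "?S f \<noteq> 0"
    then have pos: "0 < \<bar>?S f\<bar>" by simp
    have T0: "0 \<le> ?T" by (intro sum_nonneg) auto
    \<comment> \<open>Half of the supposed nonzero value, divided by a bound of the total variation;
      the added 1 keeps the denominator positive.\<close>
    define e where "e = \<bar>?S f\<bar> / (2 * (?T + 1))"
    have e: "0 < e" unfolding e_def using pos T0 by simp
    obtain h where h: "real_polynomial_function h" "\<And>x. x \<in> cball 0 R \<Longrightarrow> \<bar>f x - h x\<bar> < e"
      using Stone_Weierstrass_real_polynomial_function[of "cball 0 R" f e] continuous_on_subset[OF f] e by auto
    have hc: "continuous_on UNIV h" using h(1) by (intro continuous_on_polymonial_function) (simp add: real_polynomial_function_eq)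
    have "\<bar>?S f\<bar> = \<bar>?S f - ?S h\<bar>" using poly[OF h(1)] by simp
    also have "\<dots> = \<bar>\<Sum>i\<in>I. c i * (\<integral>x. f x - h x \<partial>\<nu> i)\<bar>"
      unfolding sum_subtractf[symmetric] right_diff_distrib[symmetric]
      by (intro arg_cong[where f = abs] sum.cong refl) (simp add: int[OF f] int[OF hc])
    also have "\<dots> \<le> (\<Sum>i\<in>I. \<bar>c i\<bar> * (e * measure (\<nu> i) UNIV))"
    proof (rule order_trans[OF sum_abs], rule sum_mono)
      fix i assume i: "i \<in> I"
      have sp: "space (\<nu> i) = UNIV" using sets_eq_imp_space_eq[OF s[OF i]] by simp
      interpret finite_measure "\<nu> i" by (rule fm[OF i])
      have "\<bar>\<integral>x. f x - h x \<partial>\<nu> i\<bar> \<le> (\<integral>x. \<bar>f x - h x\<bar> \<partial>\<nu> i)"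
        using integral_norm_bound[of "\<nu> i" "\<lambda>x. f x - h x"] by simp
      also have "\<dots> \<le> (\<integral>x. e \<partial>\<nu> i)"
      proof (rule integral_mono_AE)
        show "AE x in \<nu> i. \<bar>f x - h x\<bar> \<le> e"
          using b[OF i] by eventually_elim (use h(2) less_imp_le in blast)
      qed (simp_all add: int[OF f i] int[OF hc i])
      also have "\<dots> = e * measure (\<nu> i) UNIV" by (simp add: sp)
      finally show "\<bar>c i * (\<integral>x. f x - h x \<partial>\<nu> i)\<bar> \<le> \<bar>c i\<bar> * (e * measure (\<nu> i) UNIV)"
        by (simp add: abs_mult mult_left_mono)
    qed
    also have "\<dots> = e * ?T" by (simp add: sum_distrib_left mult_ac)
    also have "\<dots> < \<bar>?S f\<bar>"
    proof -
      have "e * ?T \<le> e * (?T + 1)" using e by simp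
      also have "\<dots> = \<bar>?S f\<bar> / 2" unfolding e_def using T0 by (simp add: field_simps)
      finally show ?thesis using pos by linarith
    qed
    finally show False by simp
  qed
  have closed: "(\<Sum>i\<in>I. c i * measure (\<nu> i) C) = 0" if C: "closed C" for C
  proof (cases "C = {}")
    case False
    \<comment> \<open>Continuous functions that decrease to the indicator of the closed set.\<close>
    define f where "f n x = max 0 (1 - real n * infdist x C)" for n x
    have fc: "continuous_on UNIV (f n)" for n unfolding f_def by (intro continuous_intros)
    have lim: "(\<lambda>n. f n x) \<longlonglongrightarrow> indicat_real C x" for x
    proof (cases "x \<in> C")
      case True
      then have "f n x = 1" for n by (simp add: f_def)
      then show ?thesis using True by simp
    next
      case F: False
      then have d: "infdist x C > 0" using infdist_pos_not_in_closed[OF C False] by simp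
      obtain N :: nat where N: "1 / infdist x C < real N" using reals_Archimedean2 by blast
      have "f n x = 0" if "N \<le> n" for n
      proof -
        have "1 < real N * infdist x C" using N d by (simp add: field_simps)
        also have "\<dots> \<le> real n * infdist x C" using that d by (intro mult_right_mono) auto
        finally show ?thesis by (simp add: f_def)
      qed
      then have "(\<lambda>n. f n x) \<longlonglongrightarrow> 0" by (intro tendsto_eventually eventually_sequentiallyI[of N])
      then show ?thesis using F by simp
    qed
    have "(\<lambda>n. \<integral>x. f n x \<partial>\<nu> i) \<longlonglongrightarrow> measure (\<nu> i) C" if i: "i \<in> I" for i
    proof -
      interpret finite_measure "\<nu> i" by (rule fm[OF i])
      have "(\<lambda>n. \<integral>x. f n x \<partial>\<nu> i) \<longlonglongrightarrow> (\<integral>x. indicat_real C x \<partial>\<nu> i)"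
      proof (rule integral_dominated_convergence[where w = "\<lambda>_. 1"])
        show "AE x in \<nu> i. (\<lambda>n. f n x) \<longlonglongrightarrow> indicat_real C x" using lim by simp
        show "AE x in \<nu> i. norm (f n x) \<le> 1" for n
          by (rule AE_I2) (auto simp: f_def infdist_nonneg)
        show "f n \<in> borel_measurable (\<nu> i)" for n
          by (rule mb[OF borel_measurable_continuous_onI[OF fc] i])
        show "indicat_real C \<in> borel_measurable (\<nu> i)"
          using C s[OF i] by (intro borel_measurable_indicator) simp
      qed simp
      then show ?thesis using C s[OF i] by simp
    qed
    then have "(\<lambda>n. \<Sum>i\<in>I. c i * (\<integral>x. f n x \<partial>\<nu> i)) \<longlonglongrightarrow> (\<Sum>i\<in>I. c i * measure (\<nu> i) C)"
      by (intro tendsto_sum tendsto_mult_left)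
    then show ?thesis using cont[OF fc] by (simp add: LIMSEQ_const_iff)
  qed simp
  have bsets: "sets borel = sigma_sets UNIV (Collect closed :: (real^3) set set)"
    by (simp add: borel_eq_closed)
  have "Int_stable (Collect closed :: (real^3) set set)" "Collect closed \<subseteq> Pow (UNIV :: (real^3) set)"
    "E \<in> sigma_sets UNIV (Collect closed)"
    using E bsets by (auto simp: Int_stable_def)
  then show ?thesis
  proof (induction rule: sigma_sets_induct_disjoint)
    case (compl A)
    have "measure (\<nu> i) (UNIV - A) = measure (\<nu> i) UNIV - measure (\<nu> i) A" if i: "i \<in> I" for i
    proof -
      have "space (\<nu> i) = UNIV" using sets_eq_imp_space_eq[OF s[OF i]] by simp
      then show ?thesis
        using finite_measure.finite_measure_compl[OF fm[OF i], of A] compl(1) s[OF i] bsets by simp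
    qed
    then have "(\<Sum>i\<in>I. c i * measure (\<nu> i) (UNIV - A)) =
        (\<Sum>i\<in>I. c i * measure (\<nu> i) UNIV) - (\<Sum>i\<in>I. c i * measure (\<nu> i) A)"
      by (simp add: right_diff_distrib sum_subtractf)
    then show ?case using compl(2) closed[of UNIV] by simp
  next
    case (union A)
    have "(\<lambda>n. measure (\<nu> i) (A n)) sums measure (\<nu> i) (\<Union>n. A n)" if i: "i \<in> I" for i
    proof -
      have "range A \<subseteq> sets (\<nu> i)" using union s[OF i] bsets by auto
      then show ?thesis
        using finite_measure.finite_measure_UNION[OF fm[OF i]] union(1) by simp
    qed
    then have "(\<lambda>n. \<Sum>i\<in>I. c i * measure (\<nu> i) (A n)) sums (\<Sum>i\<in>I. c i * measure (\<nu> i) (\<Union>n. A n))"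
      by (intro sums_sum sums_mult)
    then show ?case using union(3) by (simp add: sums_0 sums_unique2[OF _ sums_zero])
  qed (use closed in simp_all)
qed

text \<open>Test with the Borel set \<open>E\<close> of all points of positive multiplicity. On a
  fibre the tested sum is the sum of the positive multiplicities, hence nonnegative; its integral
  vanishes, so almost every fibre contains no point of \<open>E\<close>.\<close>

lemma mult_AE_nonpos:
  assumes es: "orthonormal_frame es"
    and poly: "\<And>h. real_polynomial_function h \<Longrightarrow>
      formal_integral (length es) (\<lambda>x vs. h x * kvector_inner es vs) c = 0"
  shows "AE y in frame_measure 0 es. \<forall>x. proj es x = y \<longrightarrow> mult es c x \<le> 0"
proof -
  let ?\<mu> = "frame_measure 0 es"
  define I where "I = {\<sigma> \<in> Poly_Mapping.keys c. cell_sign es \<sigma> \<noteq> 0}"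
  have I: "finite I" by (simp add: I_def)
  have "\<exists>bs. dual_frame es bs \<and> ordered_basis (direction_space (cell_set \<sigma>)) bs" if "\<sigma> \<in> I" for \<sigma>
    using cell_sign_dual[OF es] that unfolding I_def by blast
  then obtain bs where bs: "\<And>\<sigma>. \<sigma> \<in> I \<Longrightarrow> dual_frame es (bs \<sigma>)"
    "\<And>\<sigma>. \<sigma> \<in> I \<Longrightarrow> ordered_basis (direction_space (cell_set \<sigma>)) (bs \<sigma>)" by metis
  define p where "p \<sigma> = (SOME p. p \<in> cell_set \<sigma>)" for \<sigma>
  define L where "L \<sigma> = lift es (p \<sigma>) (bs \<sigma>)" for \<sigma>
  have Lm [measurable]: "L \<sigma> \<in> borel_measurable borel" for \<sigma> unfolding L_def by simp
  have cm [measurable]: "cell_set \<sigma> \<in> sets borel" for \<sigma>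
    by (rule is_cell_borel[OF oriented_cell_props(1)])
  let ?g = "\<lambda>\<sigma> y. indicat_real (cell_set \<sigma>) (L \<sigma> y)"
  \<comment> \<open>Lebesgue measure on the shadow of the cell, moved up to the cell. The form with
    coefficient \<open>h\<close> integrates over the cell to plus or minus the integral of
    \<open>h\<close> against this measure.\<close>
  define \<nu> where "\<nu> \<sigma> = distr (density ?\<mu> (\<lambda>y. ennreal (?g \<sigma> y))) borel (L \<sigma>)" for \<sigma>
  define a where "a \<sigma> = real_of_int (Poly_Mapping.lookup c \<sigma> * cell_sign es \<sigma>)" for \<sigma>
  have em\<nu>: "emeasure (\<nu> \<sigma>) E = (\<integral>\<^sup>+ y. indicator (cell_set \<sigma> \<inter> E) (L \<sigma> y) \<partial>?\<mu>)" if [measurable]: "E \<in> sets borel" for \<sigma> E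
  proof -
    have "emeasure (\<nu> \<sigma>) E = emeasure (density ?\<mu> (\<lambda>y. ennreal (?g \<sigma> y))) (L \<sigma> -` E)"
      unfolding \<nu>_def by (subst emeasure_distr) auto
    also have "\<dots> = (\<integral>\<^sup>+ y. ennreal (?g \<sigma> y) * indicator (L \<sigma> -` E) y \<partial>?\<mu>)"
    proof (rule emeasure_density)
      have "L \<sigma> -` E \<inter> space borel \<in> sets borel" by measurable
      then show "L \<sigma> -` E \<in> sets ?\<mu>" by simp
    qed measurable
    also have "\<dots> = (\<integral>\<^sup>+ y. indicator (cell_set \<sigma> \<inter> E) (L \<sigma> y) \<partial>?\<mu>)"
      by (intro nn_integral_cong) (auto simp: indicator_def)
    finally show ?thesis .
  qed
  have fin: "finite_measure (\<nu> \<sigma>)" if \<sigma>: "\<sigma> \<in> I" for \<sigma>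
  proof
    have ind: "(indicator (cell_set \<sigma>) :: _ \<Rightarrow> ennreal) \<in> borel_measurable borel" by simp
    have "emeasure (\<nu> \<sigma>) (space (\<nu> \<sigma>)) = (\<integral>\<^sup>+ y. indicator (cell_set \<sigma>) (L \<sigma> y) \<partial>?\<mu>)"
      using em\<nu>[of UNIV \<sigma>] by (simp add: \<nu>_def)
    also have "\<dots> = (\<integral>\<^sup>+ x. indicator (cell_set \<sigma>) x \<partial>frame_measure (p \<sigma>) (bs \<sigma>))"
      unfolding L_def using frame_measure_lift[OF es bs(1)[OF \<sigma>] ind] by simp
    also have "\<dots> = emeasure (frame_measure (p \<sigma>) (bs \<sigma>)) (cell_set \<sigma>)" by simp
    also have "\<dots> < \<infinity>" by (rule emeasure_cell_finite[OF bs(2)[OF \<sigma>] oriented_cell_props(1)])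
    finally show "emeasure (\<nu> \<sigma>) (space (\<nu> \<sigma>)) \<noteq> \<infinity>" by simp
  qed
  have "bounded (\<Union>\<sigma>\<in>I. cell_set \<sigma>)"
    using I is_cell_structure(2)[OF oriented_cell_props(1)] by (intro bounded_UN) auto
  then obtain R where R: "\<And>x \<sigma>. \<sigma> \<in> I \<Longrightarrow> x \<in> cell_set \<sigma> \<Longrightarrow> norm x \<le> R"
    unfolding bounded_iff by blast
  have supp: "AE x in \<nu> \<sigma>. x \<in> cball 0 R" if \<sigma>: "\<sigma> \<in> I" for \<sigma>
  proof -
    have "- cball 0 R \<in> sets (borel :: (real^3) measure)" by (intro borel_open) (simp add: open_Compl)
    moreover have "cell_set \<sigma> \<inter> - cball 0 R = {}" using R[OF \<sigma>] by auto
    ultimately have "emeasure (\<nu> \<sigma>) (- cball 0 R) = 0"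
      by (simp only: em\<nu>) simp
    then have "- cball 0 R \<in> null_sets (\<nu> \<sigma>)"
      by (auto simp: null_sets_def \<nu>_def intro!: borel_open open_Compl)
    then have "AE x in \<nu> \<sigma>. x \<notin> - cball 0 R" by (rule AE_not_in)
    then show ?thesis by simp
  qed
  have int\<nu>: "(\<integral>x. h x \<partial>\<nu> \<sigma>) = (\<integral>y. ?g \<sigma> y * h (L \<sigma> y) \<partial>?\<mu>)" if [measurable]: "h \<in> borel_measurable borel" for h :: "real^3 \<Rightarrow> real" and \<sigma>
  proof -
    have Lm': "L \<sigma> \<in> density ?\<mu> (\<lambda>y. ennreal (?g \<sigma> y)) \<rightarrow>\<^sub>M borel" by measurable
    have "(\<integral>x. h x \<partial>\<nu> \<sigma>) = (\<integral>y. h (L \<sigma> y) \<partial>density ?\<mu> (\<lambda>y. ennreal (?g \<sigma> y)))"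
      unfolding \<nu>_def by (rule integral_distr[OF Lm' that])
    also have "\<dots> = (\<integral>y. ?g \<sigma> y *\<^sub>R h (L \<sigma> y) \<partial>?\<mu>)"
    proof (rule integral_density)
      show "(\<lambda>y. h (L \<sigma> y)) \<in> borel_measurable ?\<mu>" "?g \<sigma> \<in> borel_measurable ?\<mu>" by measurable
    qed simp
    finally show ?thesis by simp
  qed
  have zero: "(\<Sum>\<sigma>\<in>I. a \<sigma> * (\<integral>x. h x \<partial>\<nu> \<sigma>)) = 0" if h: "real_polynomial_function h" for h
  proof -
    have hm [measurable]: "h \<in> borel_measurable borel"
      using h by (intro borel_measurable_continuous_onI continuous_on_polymonial_function) (simp add: real_polynomial_function_eq)
    let ?\<omega> = "\<lambda>x vs. h x * kvector_inner es vs"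
    have ci: "cell_integral ?\<omega> \<sigma> = kvector_inner es (cell_frame \<sigma>) *
        (\<integral>x. indicat_real (cell_set \<sigma>) x * h x \<partial>frame_measure (p \<sigma>) (cell_frame \<sigma>))" for \<sigma>
      unfolding p_def by (subst cell_integral_eq) (simp_all add: mult_ac flip: integral_mult_right_zero)
    have "0 = formal_integral (length es) ?\<omega> c" using poly[OF h] by simp
    also have "\<dots> = (\<Sum>\<sigma>\<in>I. a \<sigma> * (\<integral>x. h x \<partial>\<nu> \<sigma>))"
      unfolding formal_integral_def
    proof (rule sum.mono_neutral_cong_right)
      show "I \<subseteq> Poly_Mapping.keys c" by (auto simp: I_def)
      show "\<forall>\<sigma>\<in>Poly_Mapping.keys c - I. (if cell_dim \<sigma> = length es
          then real_of_int (Poly_Mapping.lookup c \<sigma>) * cell_integral ?\<omega> \<sigma> else 0) = 0"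
        unfolding I_def cell_sign_def ci by (auto split: if_splits)
      fix \<sigma> assume \<sigma>: "\<sigma> \<in> I"
      let ?K = "kvector_inner es (cell_frame \<sigma>)"
      have K: "?K \<noteq> 0" "cell_dim \<sigma> = length es" "real_of_int (cell_sign es \<sigma>) = sgn ?K"
        using \<sigma> by (auto simp: I_def cell_sign_def split: if_splits)
      have "cell_integral ?\<omega> \<sigma> = sgn ?K * (\<integral>y. ?g \<sigma> y * h (L \<sigma> y) \<partial>?\<mu>)"
        unfolding ci L_def
        by (rule integral_frame_measure_lift[OF es bs[OF \<sigma>] oriented_cell_props(2) K(1)]) measurable
      then show "(if cell_dim \<sigma> = length es then real_of_int (Poly_Mapping.lookup c \<sigma>) * cell_integral ?\<omega> \<sigma> else 0) =
          a \<sigma> * (\<integral>x. h x \<partial>\<nu> \<sigma>)"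
        unfolding int\<nu>[OF hm] a_def using K by simp
    qed simp
    finally show ?thesis by simp
  qed
  define E where "E = {x. 0 < real_of_int (mult es c x)}"
  have E [measurable]: "E \<in> sets borel" unfolding E_def by measurable
  have "(\<Sum>\<sigma>\<in>I. a \<sigma> * measure (\<nu> \<sigma>) E) = 0"
    by (rule signed_measures_eq_0[OF I fin _ supp zero E]) (auto simp: \<nu>_def)
  let ?G = "\<lambda>y. \<Sum>\<sigma>\<in>I. a \<sigma> * indicat_real (cell_set \<sigma> \<inter> E) (L \<sigma> y)"
  have intg: "integrable ?\<mu> (\<lambda>y. indicat_real (cell_set \<sigma> \<inter> E) (L \<sigma> y))"
    and meas: "measure (\<nu> \<sigma>) E = (\<integral>y. indicat_real (cell_set \<sigma> \<inter> E) (L \<sigma> y) \<partial>?\<mu>)" if \<sigma>: "\<sigma> \<in> I" for \<sigma>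
  proof -
    interpret finite_measure "\<nu> \<sigma>" by (rule fin[OF \<sigma>])
    have e: "(\<integral>\<^sup>+ y. ennreal (indicat_real (cell_set \<sigma> \<inter> E) (L \<sigma> y)) \<partial>?\<mu>) = emeasure (\<nu> \<sigma>) E"
      by (simp add: em\<nu>[OF E] ennreal_indicator)
    show i: "integrable ?\<mu> (\<lambda>y. indicat_real (cell_set \<sigma> \<inter> E) (L \<sigma> y))"
    proof (rule integrableI_nonneg)
      show "(\<integral>\<^sup>+ y. ennreal (indicat_real (cell_set \<sigma> \<inter> E) (L \<sigma> y)) \<partial>?\<mu>) < \<infinity>"
        unfolding e using emeasure_finite[of E] by (simp only: less_top infinity_ennreal_def)
    qed simp_all
    show "measure (\<nu> \<sigma>) E = (\<integral>y. indicat_real (cell_set \<sigma> \<inter> E) (L \<sigma> y) \<partial>?\<mu>)"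
      using nn_integral_eq_integral[OF i] e by (simp add: measure_def integral_eq_nn_integral)
  qed
  have int0: "(\<integral>y. ?G y \<partial>?\<mu>) = 0"
    using \<open>(\<Sum>\<sigma>\<in>I. a \<sigma> * measure (\<nu> \<sigma>) E) = 0\<close> by (simp add: intg meas)
  have intG: "integrable ?\<mu> ?G" by (intro Bochner_Integration.integrable_sum integrable_mult_right intg)
  have span: "AE y in ?\<mu>. y \<in> span (set es)" using AE_frame_measure_plane[of 0 es] by simp
  \<comment> \<open>The sum over cells is regrouped by points. A transversal cell can contribute
    only at \<open>L \<sigma> y\<close>, its one candidate point above \<open>y\<close>, and several
    cells may share that point.\<close>
  have Gsum: "?G y = (\<Sum>x\<in>(\<lambda>\<sigma>. L \<sigma> y) ` I \<inter> E. real_of_int (mult es c x))" if y: "y \<in> span (set es)" for y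
  proof -
    let ?X = "(\<lambda>\<sigma>. L \<sigma> y) ` I \<inter> E"
    have up: "proj es (L \<sigma> y) = y" if "\<sigma> \<in> I" for \<sigma>
      unfolding L_def by (rule proj_lift[OF es bs(1)[OF that] y])
    have uniq: "x = L \<sigma> y" if "\<sigma> \<in> I" "x \<in> cell_set \<sigma>" "proj es x = y" for x \<sigma>
    proof -
      have "x - p \<sigma> \<in> span (set (bs \<sigma>))"
        using affine_hull_iff_direction_space[of "p \<sigma>" "cell_set \<sigma>" x] some_in_cell that bs(2)
        by (simp add: p_def hull_inc ordered_basis_def)
      from lift_proj[OF es bs(1)[OF that(1)] this] that(3) show ?thesis by (simp add: L_def)
    qed
    have "(\<Sum>x\<in>?X. real_of_int (mult es c x)) = (\<Sum>x\<in>?X. \<Sum>\<sigma>\<in>I. a \<sigma> * indicat_real (cell_set \<sigma>) x)"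
      unfolding mult_def of_int_sum
      by (intro sum.cong[OF refl] sum.mono_neutral_cong_right) (auto simp: I_def a_def)
    also have "\<dots> = (\<Sum>\<sigma>\<in>I. \<Sum>x\<in>?X. a \<sigma> * indicat_real (cell_set \<sigma>) x)" by (rule sum.swap)
    also have "\<dots> = ?G y"
    proof (rule sum.cong[OF refl])
      fix \<sigma> assume \<sigma>: "\<sigma> \<in> I"
      have z: "indicat_real (cell_set \<sigma>) x = (if x = L \<sigma> y then indicat_real (cell_set \<sigma>) x else 0)" if "x \<in> ?X" for x
        using that uniq[OF \<sigma>, of x] up by (auto simp: indicator_def)
      have "(\<Sum>x\<in>?X. a \<sigma> * indicat_real (cell_set \<sigma>) x) = a \<sigma> * (\<Sum>x\<in>?X. (if x = L \<sigma> y then indicat_real (cell_set \<sigma>) x else 0))"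
        unfolding sum_distrib_left using z by (intro sum.cong) auto
      also have "(\<Sum>x\<in>?X. (if x = L \<sigma> y then indicat_real (cell_set \<sigma>) x else 0)) = indicat_real (cell_set \<sigma> \<inter> E) (L \<sigma> y)"
        using \<sigma> I by (subst sum.delta) (auto simp: indicator_def)
      finally show "(\<Sum>x\<in>?X. a \<sigma> * indicat_real (cell_set \<sigma>) x) = a \<sigma> * indicat_real (cell_set \<sigma> \<inter> E) (L \<sigma> y)" .
    qed
    finally show ?thesis by simp
  qed
  have nn: "AE y in ?\<mu>. 0 \<le> ?G y"
    using span by eventually_elim (simp only: Gsum, intro sum_nonneg, auto simp: E_def)
  have "AE y in ?\<mu>. ?G y = 0"
    using integral_nonneg_eq_0_iff_AE[OF intG nn] int0 by blast
  then show ?thesis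
    using span
  proof eventually_elim
    case (elim y)
    show ?case
    proof (intro allI impI, rule ccontr)
      fix x assume x: "proj es x = y" "\<not> mult es c x \<le> 0"
      then have xE: "x \<in> E" by (simp add: E_def)
      have "\<exists>\<sigma>\<in>Poly_Mapping.keys c. (if x \<in> cell_set \<sigma> then Poly_Mapping.lookup c \<sigma> * cell_sign es \<sigma> else 0) \<noteq> 0"
      proof (rule ccontr)
        assume "\<not> ?thesis"
        then have "mult es c x = 0" unfolding mult_def by (intro sum.neutral) blast
        with x(2) show False by simp
      qed
      then obtain \<sigma> where \<sigma>: "\<sigma> \<in> I" "x \<in> cell_set \<sigma>" by (auto simp: I_def split: if_splits)
      have "x - p \<sigma> \<in> span (set (bs \<sigma>))"
        using affine_hull_iff_direction_space[of "p \<sigma>" "cell_set \<sigma>" x] some_in_cell \<sigma> bs(2)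
        by (simp add: p_def hull_inc ordered_basis_def)
      from lift_proj[OF es bs(1)[OF \<sigma>(1)] this] x(1) have "x \<in> (\<lambda>\<sigma>. L \<sigma> y) ` I \<inter> E"
        using \<sigma> xE by (auto simp: L_def)
      then have "0 < (\<Sum>x\<in>(\<lambda>\<sigma>. L \<sigma> y) ` I \<inter> E. real_of_int (mult es c x))"
        using I by (intro sum_pos2[of _ x]) (auto simp: E_def)
      then show False using elim Gsum by simp
    qed
  qed
qed

lemma mult_AE_zero:
  assumes es: "orthonormal_frame es"
    and poly: "\<And>h. real_polynomial_function h \<Longrightarrow>
      formal_integral (length es) (\<lambda>x vs. h x * kvector_inner es vs) c = 0"
  shows "AE y in frame_measure 0 es. \<forall>x. proj es x = y \<longrightarrow> mult es c x = 0"
proof -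
  have "AE y in frame_measure 0 es. \<forall>x. proj es x = y \<longrightarrow> mult es (- c) x \<le> 0"
    by (rule mult_AE_nonpos[OF es]) (simp add: formal_integral_uminus poly)
  moreover have "AE y in frame_measure 0 es. \<forall>x. proj es x = y \<longrightarrow> mult es c x \<le> 0"
    by (rule mult_AE_nonpos[OF es poly])
  ultimately show ?thesis
    by eventually_elim (auto simp: mult_uminus intro: antisym)
qed

text \<open>Polynomials are closed under differentiation in a fixed direction, which is what the
  recursion of \<open>n_smooth\<close> asks for.\<close>

lemma real_polynomial_derivative:
  assumes "real_polynomial_function (h :: real^3 \<Rightarrow> real)"
  shows "\<exists>h'. (\<forall>x. (h has_derivative h' x) (at x)) \<and> (\<forall>v. real_polynomial_function (\<lambda>x. h' x v))"
  using assms
proof (induction rule: real_polynomial_function.induct)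
  case (linear f)
  show ?case
    by (rule exI[of _ "\<lambda>_. f"]) (auto intro: bounded_linear_imp_has_derivative linear real_polynomial_function.intros(2))
next
  case (const c)
  show ?case by (rule exI[of _ "\<lambda>_ _. 0"]) (auto intro: real_polynomial_function.intros(2))
next
  case (add f g)
  then obtain f' g' where "\<forall>x. (f has_derivative f' x) (at x)" "\<forall>v. real_polynomial_function (\<lambda>x. f' x v)"
    "\<forall>x. (g has_derivative g' x) (at x)" "\<forall>v. real_polynomial_function (\<lambda>x. g' x v)" by blast
  then show ?case
    by (intro exI[of _ "\<lambda>x v. f' x v + g' x v"]) (auto intro: has_derivative_add real_polynomial_function.intros(3))
next
  case (mult f g)
  then obtain f' g' where "\<forall>x. (f has_derivative f' x) (at x)" "\<forall>v. real_polynomial_function (\<lambda>x. f' x v)"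
    "\<forall>x. (g has_derivative g' x) (at x)" "\<forall>v. real_polynomial_function (\<lambda>x. g' x v)" by blast
  then show ?case
    by (intro exI[of _ "\<lambda>x v. f x * g' x v + f' x v * g x"] conjI allI)
      (blast intro: has_derivative_mult,
        intro real_polynomial_function.intros(3,4) mult(1,2), blast+)
qed

lemma smooth_polynomial:
  assumes "real_polynomial_function (h :: real^3 \<Rightarrow> real)"
  shows "smooth h"
proof -
  have "n_smooth n h" for n
    using assms
  proof (induction n arbitrary: h)
    case 0
    then show ?case by (simp add: continuous_on_polymonial_function real_polynomial_function_eq)
  next
    case (Suc n)
    then show ?case using real_polynomial_derivative[OF Suc.prems] by simp blast
  qed
  then show ?thesis by (simp add: smooth_def)
qed

lemma alternating_form_scale: "alternating_form k \<alpha> \<Longrightarrow> alternating_form k (\<lambda>vs. c * \<alpha> vs)"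
  unfolding alternating_form_def by (simp add: linear_iff algebra_simps)

lemma alternating_form_sum:
  "finite I \<Longrightarrow> (\<And>i. i \<in> I \<Longrightarrow> alternating_form k (\<alpha> i)) \<Longrightarrow> alternating_form k (\<lambda>vs. \<Sum>i\<in>I. \<alpha> i vs)"
  unfolding alternating_form_def by (auto intro!: linear_compose_sum sum.neutral)

lemma smooth_form_polynomial:
  assumes h: "real_polynomial_function h"
  shows "smooth_form (length es) (\<lambda>x vs. h x * kvector_inner es vs)"
  unfolding smooth_form_def
proof (intro conjI allI impI)
  fix x show "alternating_form (length es) (\<lambda>vs. h x * kvector_inner es vs)"
    by (intro alternating_form_scale alternating_form_kvector_inner)
next
  fix vs show "smooth (\<lambda>x. h x * kvector_inner es vs)"
    by (intro smooth_polynomial real_polynomial_function.intros(4) h real_polynomial_function.intros(2))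
qed

lemma mult_same_integrals:
  assumes es: "orthonormal_frame es" and c: "same_integrals c c'"
  shows "AE y in frame_measure 0 es. \<forall>x. proj es x = y \<longrightarrow> mult es c x = mult es c' x"
proof -
  have "AE y in frame_measure 0 es. \<forall>x. proj es x = y \<longrightarrow> mult es (c - c') x = 0"
  proof (rule mult_AE_zero[OF es])
    fix h :: "real^3 \<Rightarrow> real" assume "real_polynomial_function h"
    from c smooth_form_polynomial[OF this, of es]
    show "formal_integral (length es) (\<lambda>x vs. h x * kvector_inner es vs) (c - c') = 0"
      unfolding same_integrals_def
      using formal_integral_add[of _ _ c "- c'"] by (simp add: formal_integral_uminus)
  qed
  then show ?thesis by (simp add: mult_diff)
qed

section \<open>Facets and the fibres of a projection\<close>

lemma alternating_form_Cons:
  assumes "alternating_form (Suc k) \<beta>"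
  shows "alternating_form k (\<lambda>ws. \<beta> (l # ws))"
  unfolding alternating_form_def
proof (intro allI impI conjI)
  fix vs :: "(real^3) list" assume l: "length vs = k"
  fix i assume i: "i < k"
  {
    have "linear (\<lambda>v. \<beta> ((l # vs)[Suc i := v]))"
      using assms l i unfolding alternating_form_def by (metis Suc_less_eq length_Cons)
    then show "linear (\<lambda>v. \<beta> (l # vs[i := v]))" by simp
  next
    fix j assume "j < i" "vs ! j = vs ! i"
    then show "\<beta> (l # vs) = 0"
      using assms[unfolded alternating_form_def, rule_format, of "l # vs"] l i
      by (metis Suc_less_eq length_Cons nth_Cons_Suc)
  }
qed

lemma ordered_basis_Cons:
  assumes ws: "ordered_basis W ws" and W: "W \<subseteq> V" "subspace V" "dim V = Suc (length ws)"
    and v: "v \<in> V" "v \<notin> W"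
  shows "ordered_basis V (v # ws)"
proof -
  have sp: "span (set ws) = W" and ind: "independent (set ws)" "distinct ws"
    using ws by (auto simp: ordered_basis_def)
  have nv: "v \<notin> span (set ws)" using v sp by simp
  then have "v \<notin> set ws" using span_base by blast
  then have d: "distinct (v # ws)" using ind by simp
  have i: "independent (set (v # ws))" using ind nv by (simp add: independent_insert)
  have sub: "span (set (v # ws)) \<subseteq> V"
    using v W sp span_superset[of "set ws"] by (intro span_minimal) auto
  have "dim (span (set (v # ws))) = Suc (length ws)"
    using i d by (metis dim_span dim_eq_card_independent distinct_card length_Cons)
  then have "span (set (v # ws)) = V"
    using subspace_dim_equal[of "span (set (v # ws))" V] sub W by simp
  then show ?thesis using d i by (simp add: ordered_basis_def)
qed

lemma facet_frame_basis: "ordered_basis (direction_space F) (facet_frame F)"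
proof -
  obtain es where "orthonormal_frame es" "span (set es) = direction_space F"
    using orthonormal_frame_exists[OF subspace_direction_space] by metis
  then have "ordered_basis (direction_space F) es" using orthonormal_frame_basis by metis
  then show ?thesis unfolding facet_frame_def by (rule someI)
qed

definition facet_cell :: "(real^3) set \<Rightarrow> oriented_cell" where
  "facet_cell F = Abs_oriented_cell (rel_interior F, facet_frame F)"

lemma facet_cell_props:
  assumes "F facet_of closure (cell_set \<tau>)"
  shows "cell_set (facet_cell F) = rel_interior F" "cell_frame (facet_cell F) = facet_frame F"
    "Suc (cell_dim (facet_cell F)) = cell_dim \<tau>" "length (facet_frame F) = cell_dim (facet_cell F)"
proof -
  note A = oriented_cell_props(1)[of \<tau>]
  note F = cell_facets[OF A assms]
  obtain q where q: "q \<in> F" using F(2) by blast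
  have l: "length (facet_frame F) = cell_dim \<tau> - 1"
    using facet_frame_basis[of F] aff_dim_direction_space[OF q] F(5,8) by (simp add: ordered_basis_iff)
  have c: "is_cell (length (facet_frame F)) (rel_interior F)" using F(6) l by simp
  have b: "ordered_basis (direction_space (rel_interior F)) (facet_frame F)"
    using facet_frame_basis F(9) by simp
  note abs = oriented_cell_Abs[OF c b]
  show "cell_set (facet_cell F) = rel_interior F" "cell_frame (facet_cell F) = facet_frame F"
    "Suc (cell_dim (facet_cell F)) = cell_dim \<tau>" "length (facet_frame F) = cell_dim (facet_cell F)"
    using abs l F(5) by (auto simp: facet_cell_def)
qed

lemma mult_cell_boundary:
  "mult es (cell_boundary \<tau>) x = (\<Sum>F | F facet_of closure (cell_set \<tau>).
     if x \<in> rel_interior F then facet_sign \<tau> F * cell_sign es (facet_cell F) else 0)"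
  unfolding cell_boundary_def mult_sum mult_frag_cmul mult_frag_of facet_cell_def[symmetric]
  by (intro sum.cong refl) (auto simp: facet_cell_props)

text \<open>The vector \<open>a\<close> serves as an outward conormal of the facet in the
  computations of signs.\<close>

lemma facet_hyperplane:
  assumes A: "is_cell k A" and F: "F facet_of closure A"
  obtains a b where "F = closure A \<inter> {x. a \<bullet> x = b}" "\<And>x. x \<in> closure A \<Longrightarrow> a \<bullet> x \<le> b"
    "\<And>x. x \<in> A \<Longrightarrow> a \<bullet> x < b" "\<And>w. w \<in> direction_space F \<Longrightarrow> a \<bullet> w = 0"
proof -
  have "polyhedron (closure A)"
    using is_cell_structure(6)[OF A] by (simp add: polytope_eq_bounded_polyhedron)
  from facet_of_polyhedron[OF this F] obtain a b where
    ab: "closure A \<subseteq> {x. a \<bullet> x \<le> b}" "F = closure A \<inter> {x. a \<bullet> x = b}" by blast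
  have lt: "a \<bullet> x < b" if "x \<in> A" for x
  proof -
    have "x \<in> closure A" using that closure_subset by blast
    then have "a \<bullet> x \<le> b" "a \<bullet> x = b \<longrightarrow> x \<in> F" using ab by auto
    moreover have "x \<notin> F" using cell_facets(4)[OF A F] that by blast
    ultimately show ?thesis by linarith
  qed
  have "direction_space F \<subseteq> {w. a \<bullet> w = 0}"
    unfolding direction_space_def using ab(2)
    by (intro span_minimal subspace_hyperplane) (auto simp: inner_diff_right)
  then show ?thesis using that[of a b] ab lt by blast
qed

text \<open>On a dual frame of \<open>W\<close> both sides are 1, the left one because
  \<open>l\<close> is a unit vector orthogonal to \<open>es\<close>. Under a change of the basis of
  \<open>W\<close> both sides are multiplied by the same ratio.\<close>

lemma kvector_inner_Cons_self:
  assumes es: "orthonormal_frame es" and l: "proj es l = 0" "norm l = 1"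
    and ws: "ordered_basis W ws" and K: "kvector_inner es ws \<noteq> 0" "length ws = length es"
  shows "kvector_inner (l # es) (l # ws) = kvector_inner es ws"
proof -
  obtain bs where bs: "dual_frame es bs" "ordered_basis W bs"
    using dual_frame_exists_nonzero[OF es ws K(2,1)] by blast
  obtain r where r: "frame_ratio r ws bs" using frame_ratio_exists[OF ws bs(2)] .
  have "1 = r * kvector_inner es ws"
    using frame_ratio_form[OF r] alternating_form_kvector_inner[of es] K(2) kvector_inner_dual[OF bs(1)] by simp
  moreover have "kvector_inner (l # es) (l # bs) = r * kvector_inner (l # es) (l # ws)"
    using frame_ratio_form[OF r, of "\<lambda>ws. kvector_inner (l # es) (l # ws)"]
      alternating_form_Cons[of "length es" "kvector_inner (l # es)" l] alternating_form_kvector_inner[of "l # es"] K(2)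
    by simp
  moreover have "kvector_inner (l # es) (l # bs) = 1"
  proof -
    have "es ! i \<bullet> l = 0" if "i < length es" for i
      using l(1) proj_eq_0_iff[OF es] that by (simp add: inner_commute)
    then show ?thesis using kvector_inner_Cons_dual[OF bs(1), of l l] l(2) by (simp add: dot_square_norm)
  qed
  ultimately have "r * kvector_inner (l # es) (l # ws) = r * kvector_inner es ws" by simp
  then show ?thesis using frame_ratio_nonzero[OF r] by simp
qed

text \<open>Three bases of the plane of the cell are compared: its frame, the outward vector
  \<open>u\<close> before the facet frame, and \<open>l\<close> before the facet frame. Modulo
  directions of the facet \<open>u\<close> is a multiple \<open>c\<close> of \<open>l\<close>, and
  the conormal shows that \<open>c\<close> has the sign of \<open>a \<bullet> l\<close>. So a facet
  counts according to whether \<open>l\<close> points out of the cell there.\<close>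

lemma facet_sign_eq:
  assumes es: "orthonormal_frame es" "cell_dim \<tau> = Suc (length es)"
    and l: "l \<in> direction_space (cell_set \<tau>)" "proj es l = 0" "norm l = 1"
    and F: "F facet_of closure (cell_set \<tau>)" and K: "kvector_inner es (facet_frame F) \<noteq> 0"
    and a: "\<And>w. w \<in> direction_space F \<Longrightarrow> a \<bullet> w = 0" "\<And>x y. x \<in> cell_set \<tau> \<Longrightarrow> y \<in> F \<Longrightarrow> a \<bullet> x < a \<bullet> y"
  shows "l \<notin> direction_space F" "a \<bullet> l \<noteq> 0"
    "real_of_int (facet_sign \<tau> F * cell_sign es (facet_cell F)) =
      sgn (a \<bullet> l) * sgn (kvector_inner (l # es) (cell_frame \<tau>))"
proof -
  let ?A = "cell_set \<tau>" and ?vs = "cell_frame \<tau>" and ?ws = "facet_frame F"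
  let ?V = "direction_space ?A" and ?W = "direction_space F"
  note A = oriented_cell_props[of \<tau>]
  note cF = cell_facets[OF A(1) F]
  note fc = facet_cell_props[OF F]
  have lw: "length ?ws = length es" using fc es(2) by simp
  have wsb: "ordered_basis ?W ?ws" by (rule facet_frame_basis)
  have dV: "dim ?V = Suc (length ?ws)" using A(2,3) es(2) lw by (simp add: ordered_basis_iff)
  show lW: "l \<notin> ?W"
  proof
    assume "l \<in> ?W"
    moreover have "l \<noteq> 0" using l(3) by auto
    ultimately have "kvector_inner es ?ws = 0"
      using l kvector_inner_eq_0[OF wsb, of es l] lw proj_eq_0_iff[OF es(1)] by (auto simp: inner_commute)
    with K show False by simp
  qed
  define u where "u = (SOME y. y \<in> rel_interior F) - (SOME x. x \<in> ?A)"
  have y: "(SOME y. y \<in> rel_interior F) \<in> rel_interior F" using cF(12) by (simp add: some_in_eq)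
  have x: "(SOME x. x \<in> ?A) \<in> ?A" by (rule some_in_cell)
  have au: "a \<bullet> u > 0" unfolding u_def using a(2)[OF x] y rel_interior_subset by (force simp: inner_diff_right)
  then have uW: "u \<notin> ?W" using a(1) by force
  have uV: "u \<in> ?V"
  proof -
    have "(SOME y. y \<in> rel_interior F) \<in> closure ?A" using y rel_interior_subset cF(3) by blast
    then have "(SOME y. y \<in> rel_interior F) \<in> affine hull ?A" using closure_affine_hull by blast
    then show ?thesis unfolding u_def using affine_hull_iff_direction_space[OF x] by blast
  qed
  have ob1: "ordered_basis ?V (u # ?ws)" by (rule ordered_basis_Cons[OF wsb cF(10) _ dV uV uW]) simp
  have ob2: "ordered_basis ?V (l # ?ws)" by (rule ordered_basis_Cons[OF wsb cF(10) _ dV l(1) lW]) simp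
  obtain r where r: "frame_ratio r ?vs (u # ?ws)" using frame_ratio_exists[OF A(2) ob1] .
  have lv: "length ?vs = Suc (length es)" using A(3) es(2) by simp
  have "0 < kvector_inner (u # ?ws) (u # ?ws)" by (rule kvector_inner_self_pos[OF ob1])
  also have "\<dots> = r * kvector_inner (u # ?ws) ?vs"
    using frame_ratio_form[OF r] alternating_form_kvector_inner[of "u # ?ws"] lw lv by simp
  finally have pos: "0 < r * kvector_inner (u # ?ws) ?vs" .
  \<comment> \<open>\<open>facet_sign\<close> is the sign of the determinant of
    \<open>u # ?ws\<close> against the frame. This is also the sign of \<open>r\<close>, because the
    Gram determinant of \<open>u # ?ws\<close> is positive.\<close>
  have fs: "real_of_int (facet_sign \<tau> F) = sgn r"
    unfolding facet_sign_def u_def[symmetric] using pos by (auto simp: zero_less_mult_iff sgn_real_def)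
  have "u \<in> span (set (l # ?ws))" using ob2 uV by (simp add: ordered_basis_def)
  then obtain c where c: "u - c *\<^sub>R l \<in> span (set ?ws)" using span_breakdown_eq[of u l "set ?ws"] by auto
  then have cW: "u - c *\<^sub>R l \<in> ?W" using wsb by (simp add: ordered_basis_def)
  then have acl: "a \<bullet> u = c * (a \<bullet> l)" using a(1)[OF cW] by (simp add: inner_diff_right)
  then show al: "a \<bullet> l \<noteq> 0" using au by auto
  have c0: "c \<noteq> 0" using acl au by auto
  have sc: "sgn c = sgn (a \<bullet> l)" using acl au by (auto simp: zero_less_mult_iff sgn_real_def)
  have rc: "frame_ratio c (l # ?ws) (u # ?ws)"
    using frame_ratio_replace[OF c0, of "u - c *\<^sub>R l" "[]" ?ws l] c by simp
  have "r * kvector_inner (l # es) ?vs = kvector_inner (l # es) (u # ?ws)"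
    using frame_ratio_form[OF r] alternating_form_kvector_inner[of "l # es"] lv by simp
  also have "\<dots> = c * kvector_inner (l # es) (l # ?ws)"
    using frame_ratio_form[OF rc] alternating_form_kvector_inner[of "l # es"] lw by simp
  also have "\<dots> = c * kvector_inner es ?ws"
    using kvector_inner_Cons_self[OF es(1) l(2,3) wsb K lw] by simp
  finally have e: "sgn r * sgn (kvector_inner (l # es) ?vs) = sgn c * sgn (kvector_inner es ?ws)"
    by (metis sgn_mult)
  have cs: "real_of_int (cell_sign es (facet_cell F)) = sgn (kvector_inner es ?ws)"
    using fc es(2) by (auto simp: cell_sign_def sgn_real_def)
  have "sgn r = 1 \<or> sgn r = - 1" "sgn c = 1 \<or> sgn c = - 1" using frame_ratio_nonzero[OF r] c0 by (auto simp: sgn_real_def)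
  then have "sgn r * sgn (kvector_inner es ?ws) = sgn c * sgn (kvector_inner (l # es) ?vs)"
    using e by (elim disjE) simp_all
  then show "real_of_int (facet_sign \<tau> F * cell_sign es (facet_cell F)) =
      sgn (a \<bullet> l) * sgn (kvector_inner (l # es) ?vs)"
    by (simp add: fs cs sc)
qed

section \<open>The kernel direction of a cell of one dimension more, and generic fibres\<close>

lemma facet_kernel_direction_exists:
  assumes es: "orthonormal_frame es" and \<tau>: "cell_dim \<tau> = Suc (length es)"
  obtains l where "l \<in> direction_space (cell_set \<tau>)" "proj es l = 0" "norm l = 1"
proof -
  let ?V = "direction_space (cell_set \<tau>)"
  have dV: "dim ?V = Suc (length es)"
    using oriented_cell_props[of \<tau>] \<tau> by (simp add: ordered_basis_iff)
  have "\<not> inj_on (proj es) ?V"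
  proof
    assume "inj_on (proj es) ?V"
    then have "inj_on (proj es) (span ?V)" by (simp add: span_eq_iff[THEN iffD2])
    then have "dim (proj es ` ?V) = dim ?V" by (rule dim_image_eq[OF linear_proj])
    moreover have "dim (proj es ` ?V) \<le> dim (span (set es))"
      using proj_in_span by (intro dim_subset) auto
    moreover have "dim (span (set es)) = length es"
      using orthonormal_frame_basis[OF es] by (simp add: ordered_basis_iff)
    ultimately show False using dV by simp
  qed
  then obtain v where v: "v \<in> ?V" "proj es v = 0" "v \<noteq> 0"
    using linear_injective_on_subspace_0[OF linear_proj subspace_direction_space] by blast
  show ?thesis
  proof (rule that[of "(1 / norm v) *\<^sub>R v"])
    show "(1 / norm v) *\<^sub>R v \<in> ?V" using v by (intro subspace_scale subspace_direction_space)
    show "proj es ((1 / norm v) *\<^sub>R v) = 0" using v by (simp add: linear_scale[OF linear_proj])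
    show "norm ((1 / norm v) *\<^sub>R v) = 1" using v by simp
  qed
qed

text \<open>The formula for the facet signs contains the sign of the vanishing determinant.
  Geometrically, this is the case in which the kernel of the projection in the plane of the cell has
  dimension greater than 1.\<close>

lemma mult_boundary_degenerate:
  assumes es: "orthonormal_frame es" "cell_dim \<tau> = Suc (length es)"
    and l: "l \<in> direction_space (cell_set \<tau>)" "proj es l = 0" "norm l = 1"
    and K: "kvector_inner (l # es) (cell_frame \<tau>) = 0"
  shows "mult es (cell_boundary \<tau>) x = 0"
proof -
  have "facet_sign \<tau> F * cell_sign es (facet_cell F) = 0" if F: "F facet_of closure (cell_set \<tau>)" for F
  proof (cases "kvector_inner es (facet_frame F) = 0")
    case True
    then show ?thesis using facet_cell_props[OF F] by (simp add: cell_sign_def)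
  next
    case False
    obtain a b where ab: "F = closure (cell_set \<tau>) \<inter> {x. a \<bullet> x = b}" "\<And>x. x \<in> cell_set \<tau> \<Longrightarrow> a \<bullet> x < b"
      "\<And>w. w \<in> direction_space F \<Longrightarrow> a \<bullet> w = 0"
      using facet_hyperplane[OF oriented_cell_props(1) F] by metis
    have "a \<bullet> x < a \<bullet> y" if "x \<in> cell_set \<tau>" "y \<in> F" for x y using ab(1) ab(2)[OF that(1)] that(2) by auto
    from facet_sign_eq(3)[OF es l F False ab(3) this] K
    have "real_of_int (facet_sign \<tau> F * cell_sign es (facet_cell F)) = 0" by simp
    then show ?thesis by linarith
  qed
  then show ?thesis unfolding mult_cell_boundary by (intro sum.neutral) auto
qed

text \<open>Another kernel direction, made orthogonal to \<open>l\<close>, would be orthogonal to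
  all of \<open>l # es\<close> and force the determinant to vanish.\<close>

lemma kernel_line:
  assumes es: "orthonormal_frame es" "cell_dim \<tau> = Suc (length es)"
    and l: "l \<in> direction_space (cell_set \<tau>)" "proj es l = 0" "norm l = 1"
    and K: "kvector_inner (l # es) (cell_frame \<tau>) \<noteq> 0"
    and v: "v \<in> direction_space (cell_set \<tau>)" "proj es v = 0"
  shows "v = (v \<bullet> l) *\<^sub>R l"
proof (rule ccontr)
  let ?w = "v - (v \<bullet> l) *\<^sub>R l"
  assume "v \<noteq> (v \<bullet> l) *\<^sub>R l"
  then have w0: "?w \<noteq> 0" by simp
  have wV: "?w \<in> direction_space (cell_set \<tau>)"
    using v l by (intro subspace_diff subspace_scale subspace_direction_space)
  have wl: "l \<bullet> ?w = 0" using l(3) by (simp add: inner_diff_right dot_square_norm inner_commute)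
  have "proj es ?w = 0" using v l by (simp add: linear_diff[OF linear_proj] linear_scale[OF linear_proj])
  then have "es ! i \<bullet> ?w = 0" if "i < length es" for i
    using proj_eq_0_iff[OF es(1)] that by (simp add: inner_commute)
  then have "(l # es) ! i \<bullet> ?w = 0" if "i < length (l # es)" for i
    using wl that by (cases i) auto
  then have "kvector_inner (l # es) (cell_frame \<tau>) = 0"
    using kvector_inner_eq_0[OF oriented_cell_props(2)[of \<tau>] _ wV w0, of "l # es"] oriented_cell_props(3)[of \<tau>] es(2) by simp
  with K show False by simp
qed

text \<open>The projection collapses \<open>W\<close> along \<open>l\<close>: its image is that of
  the orthogonal complement of \<open>l\<close> in \<open>W\<close>, whose dimension is below
  \<open>length es\<close>.\<close>

lemma AE_proj_direction:
  assumes es: "orthonormal_frame es" and W: "subspace W" "dim W = length es" "l \<in> W" "proj es l = 0" "norm l = 1"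
    and F: "\<And>x. x \<in> F \<Longrightarrow> x - q \<in> W"
  shows "AE y in frame_measure 0 es. \<forall>x. proj es x = y \<longrightarrow> x \<notin> F"
proof -
  let ?U = "{w \<in> W. l \<bullet> w = 0}"
  have U: "subspace ?U"
  proof -
    have "?U = W \<inter> {w. l \<bullet> w = 0}" by auto
    then show ?thesis using subspace_inter[OF W(1) subspace_hyperplane] by simp
  qed
  have "l \<notin> ?U" using W(5) by (simp add: dot_square_norm)
  then have "?U \<noteq> W" using W(3) by blast
  moreover have UW: "?U \<subseteq> W" by blast
  ultimately have "\<not> dim W \<le> dim ?U" using subspace_dim_equal[OF U W(1) UW] by blast
  then have "dim ?U < dim W" by simp
  then have "dim (proj es ` ?U) < length es"
    using dim_image_le[OF linear_proj, of es ?U] W(2) by linarith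
  then have "AE y in frame_measure 0 es. y - proj es q \<notin> proj es ` ?U"
    using proj_in_span
    by (intro AE_frame_measure_small[OF orthonormal_frame_basis[OF es]] linear_subspace_image[OF linear_proj] U) auto
  then show ?thesis
  proof eventually_elim
    case (elim y)
    show ?case
    proof (intro allI impI notI)
      fix x assume x: "proj es x = y" "x \<in> F"
      let ?w = "(x - q) - ((x - q) \<bullet> l) *\<^sub>R l"
      have "?w \<in> ?U"
        using F[OF x(2)] W by (auto simp: inner_diff_right dot_square_norm inner_commute intro!: subspace_diff subspace_scale)
      moreover have "proj es ?w = y - proj es q"
        using x(1) W(4) by (simp add: linear_diff[OF linear_proj] linear_scale[OF linear_proj])
      moreover have "proj es ?w \<in> proj es ` ?U" by (rule imageI) fact
      ultimately show False using elim by simp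
    qed
  qed
qed

text \<open>The parameters of the points in \<open>A\<close> form a bounded open interval around 0;
  its ends are the infimum and the supremum.\<close>

lemma convex_open_line_segment:
  fixes x0 l :: "real^3"
  assumes cv: "convex A" and bd: "bounded A" and x0: "x0 \<in> A" and l: "norm l = 1"
    and op: "open {t. x0 + t *\<^sub>R l \<in> A}"
  obtains t1 t2 where "t1 < 0" "0 < t2" "\<And>t. x0 + t *\<^sub>R l \<in> A \<longleftrightarrow> t1 < t \<and> t < t2"
proof -
  let ?T = "{t. x0 + t *\<^sub>R l \<in> A}"
  have T0: "0 \<in> ?T" using x0 by simp
  have cT: "convex ?T"
  proof (rule convexI)
    fix s t u v :: real assume *: "s \<in> ?T" "t \<in> ?T" "0 \<le> u" "0 \<le> v" "u + v = 1"
    have "x0 + (u *\<^sub>R s + v *\<^sub>R t) *\<^sub>R l = u *\<^sub>R (x0 + s *\<^sub>R l) + v *\<^sub>R (x0 + t *\<^sub>R l)"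
      using *(5) by (simp add: algebra_simps flip: scaleR_add_left)
    then show "u *\<^sub>R s + v *\<^sub>R t \<in> ?T" using convexD[OF cv _ _ *(3,4,5)] *(1,2) by simp
  qed
  obtain R where R: "\<And>x. x \<in> A \<Longrightarrow> norm x \<le> R" using bd unfolding bounded_iff by blast
  have bT: "\<bar>t\<bar> \<le> R + norm x0" if "t \<in> ?T" for t
  proof -
    have "\<bar>t\<bar> = norm ((x0 + t *\<^sub>R l) - x0)" using l by simp
    also have "\<dots> \<le> norm (x0 + t *\<^sub>R l) + norm x0" by (rule norm_triangle_ineq4)
    also have "\<dots> \<le> R + norm x0" using R that by simp
    finally show ?thesis .
  qed
  have ba: "bdd_above ?T" "bdd_below ?T"
    using bT by (auto intro!: bdd_aboveI[of _ "R + norm x0"] bdd_belowI[of _ "- (R + norm x0)"] simp: abs_le_iff)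
       (smt (verit) bT mem_Collect_eq)+
  have ne: "?T \<noteq> {}" using T0 by blast
  have lt: "Inf ?T < t \<and> t < Sup ?T" if t: "t \<in> ?T" for t
  proof -
    obtain e where e: "0 < e" "ball t e \<subseteq> ?T" using op t open_contains_ball by blast
    have "t + e / 2 \<in> ball t e" "t - e / 2 \<in> ball t e" using e(1) by (auto simp: dist_real_def)
    then have "t + e / 2 \<in> ?T" "t - e / 2 \<in> ?T" using e(2) by blast+
    then have "t + e / 2 \<le> Sup ?T" "Inf ?T \<le> t - e / 2"
      using cSup_upper[OF _ ba(1)] cInf_lower[OF _ ba(2)] by blast+
    then show ?thesis using e(1) by linarith
  qed
  have in_T: "t \<in> ?T" if t: "Inf ?T < t" "t < Sup ?T" for t
  proof -
    obtain a where a: "a \<in> ?T" "a < t" using t(1) cInf_less_iff[OF ne ba(2)] by blast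
    obtain b where b: "b \<in> ?T" "t < b" using t(2) less_cSup_iff[OF ne ba(1)] by blast
    show ?thesis using mem_is_interval_1_I[of ?T a b t] cT a b is_interval_convex_1 by (metis less_imp_le)
  qed
  show ?thesis
  proof (rule that[of "Inf ?T" "Sup ?T"])
    show "Inf ?T < 0" "0 < Sup ?T" using lt[OF T0] by auto
    show "x0 + t *\<^sub>R l \<in> A \<longleftrightarrow> Inf ?T < t \<and> t < Sup ?T" for t using lt[of t] in_T[of t] by blast
  qed
qed

text \<open>The facets of the facets have too small a dimension, and the facets parallel to
  \<open>l\<close> too small an image, to be met by a generic fibre.\<close>

lemma AE_facets_generic:
  assumes es: "orthonormal_frame es" "cell_dim \<tau> = Suc (length es)"
    and l: "proj es l = 0" "norm l = 1"
  shows "AE y in frame_measure 0 es. \<forall>F\<in>{F. F facet_of closure (cell_set \<tau>)}. \<forall>x\<in>F. proj es x = y \<longrightarrow>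
     x \<in> rel_interior F \<and> l \<notin> direction_space F"
proof (rule AE_finite_allI)
  let ?A = "cell_set \<tau>"
  note A = oriented_cell_props(1)[of \<tau>]
  show "finite {F. F facet_of closure ?A}" by (rule cell_closure_eq(2)[OF A])
  fix F assume "F \<in> {F. F facet_of closure ?A}"
  then have F: "F facet_of closure ?A" by simp
  note cF = cell_facets[OF A F]
  have cl: "closure (rel_interior F) = F"
    using convex_closure_rel_interior[OF polytope_imp_convex[OF cF(1)]] compact_imp_closed[OF polytope_imp_compact[OF cF(1)]]
    by simp
  have "AE y in frame_measure 0 es. \<forall>G\<in>{G. G facet_of F}. \<forall>x. proj es x = y \<longrightarrow> x \<notin> G"
  proof (rule AE_finite_allI)
    show "finite {G. G facet_of F}" using cell_closure_eq(2)[OF cF(6)] cl by simp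
    fix G assume "G \<in> {G. G facet_of F}"
    then have "aff_dim G < int (length es)"
      using cF(8) es(2) by (auto simp: facet_of_def)
    then show "AE y in frame_measure 0 es. \<forall>x. proj es x = y \<longrightarrow> x \<notin> G"
      by (rule AE_proj_aff_dim[OF es(1)])
  qed
  moreover have "AE y in frame_measure 0 es. l \<in> direction_space F \<longrightarrow> (\<forall>x. proj es x = y \<longrightarrow> x \<notin> F)"
  proof (cases "l \<in> direction_space F")
    case True
    obtain q where q: "q \<in> F" using cF(2) by blast
    have "dim (direction_space F) = length es" using aff_dim_direction_space[OF q] cF(8) es(2) by simp
    moreover have "x - q \<in> direction_space F" if "x \<in> F" for x
      using affine_hull_iff_direction_space[OF q, of x] hull_inc[OF that] by blast
    ultimately have "AE y in frame_measure 0 es. \<forall>x. proj es x = y \<longrightarrow> x \<notin> F"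
      by (rule AE_proj_direction[OF es(1) subspace_direction_space _ True l])
    then show ?thesis by simp
  qed simp
  ultimately show "AE y in frame_measure 0 es. \<forall>x\<in>F. proj es x = y \<longrightarrow> x \<in> rel_interior F \<and> l \<notin> direction_space F"
  proof eventually_elim
    case (elim y)
    have "F - rel_interior F = \<Union>{G. G facet_of F}" using cell_closure_eq(1)[OF cF(6)] cl by simp
    then show ?case using elim by blast
  qed
qed

text \<open>A generic fibre meets facets only transversally and in their relative interiors. If it
  passes through the cell, it does so in one segment, and the facet signs at the ends are opposite,
  as \<open>l\<close> points outward at one end and inward at the other. If it misses the cell, it
  cannot meet a facet in this way, since it would enter the cell next to the meeting point.\<close>

lemma boundary_fibre:
  assumes es: "orthonormal_frame es" "cell_dim \<tau> = Suc (length es)"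
    and l: "l \<in> direction_space (cell_set \<tau>)" "proj es l = 0" "norm l = 1"
    and K: "kvector_inner (l # es) (cell_frame \<tau>) \<noteq> 0"
  shows "AE y in frame_measure 0 es.
    ((\<forall>x\<in>cell_set \<tau>. proj es x \<noteq> y) \<longrightarrow> (\<forall>x. proj es x = y \<longrightarrow> mult es (cell_boundary \<tau>) x = 0)) \<and>
    (\<forall>x0\<in>cell_set \<tau>. proj es x0 = y \<longrightarrow>
      (\<exists>t1 t2. t1 < 0 \<and> 0 < t2 \<and> (\<forall>t. x0 + t *\<^sub>R l \<in> cell_set \<tau> \<longleftrightarrow> t1 < t \<and> t < t2) \<and>
        (\<forall>x. proj es x = y \<longrightarrow> real_of_int (mult es (cell_boundary \<tau>) x) =
          sgn (kvector_inner (l # es) (cell_frame \<tau>)) *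
            ((if x = x0 + t2 *\<^sub>R l then 1 else 0) - (if x = x0 + t1 *\<^sub>R l then 1 else 0)))))"
  using AE_facets_generic[OF es l(2,3)]
proof eventually_elim
  case (elim y)
  let ?A = "cell_set \<tau>" and ?V = "direction_space (cell_set \<tau>)"
  let ?\<FF> = "{F. F facet_of closure ?A}"
  let ?s = "sgn (kvector_inner (l # es) (cell_frame \<tau>))"
  note A = oriented_cell_props[of \<tau>]
  note S = is_cell_structure[OF A(1)]
  have cvx: "convex (closure ?A)" using S(3) by (rule convex_closure)
  have shrink: "a + t *\<^sub>R (x - a) \<in> ?A" if "a \<in> ?A" "x \<in> closure ?A" "0 \<le> t" "t < 1" for a x t
  proof -
    have "x - (1 - t) *\<^sub>R (x - a) \<in> rel_interior (closure ?A)"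
      using that S(7) by (intro rel_interior_convex_shrink[OF cvx]) auto
    moreover have "x - (1 - t) *\<^sub>R (x - a) = a + t *\<^sub>R (x - a)" by (simp add: algebra_simps)
    ultimately show ?thesis using S(7) by simp
  qed
  have nz: "\<exists>F\<in>?\<FF>. x \<in> rel_interior F \<and> cell_sign es (facet_cell F) \<noteq> 0" if "mult es (cell_boundary \<tau>) x \<noteq> 0" for x
  proof (rule ccontr)
    assume "\<not> ?thesis"
    then have "mult es (cell_boundary \<tau>) x = 0" unfolding mult_cell_boundary by (intro sum.neutral) auto
    with that show False by simp
  qed
  have single: "mult es (cell_boundary \<tau>) x = facet_sign \<tau> F * cell_sign es (facet_cell F)"
    if F: "F facet_of closure ?A" and x: "x \<in> rel_interior F" for F x
  proof -
    have "F' = F" if "F' facet_of closure ?A" "x \<in> rel_interior F'" for F'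
      using face_of_eq[of F' "closure ?A" F] F x that by (auto simp: facet_of_def)
    then have "mult es (cell_boundary \<tau>) x = (\<Sum>F'\<in>{F}. if x \<in> rel_interior F'
        then facet_sign \<tau> F' * cell_sign es (facet_cell F') else 0)"
      unfolding mult_cell_boundary using F cell_closure_eq(2)[OF A(1)]
      by (intro sum.mono_neutral_right) auto
    then show ?thesis using x by simp
  qed
  have transv: "kvector_inner es (facet_frame F) \<noteq> 0" if F: "F facet_of closure ?A" and lF: "l \<notin> direction_space F" for F
  proof -
    note cF = cell_facets[OF A(1) F]
    note fc = facet_cell_props[OF F]
    have inj: "v = 0" if "v \<in> direction_space F" "proj es v = 0" for v
    proof (rule ccontr)
      assume "v \<noteq> 0"
      have "v \<in> ?V" using that cF(10) by blast
      from kernel_line[OF es l K this that(2)] have e: "v = (v \<bullet> l) *\<^sub>R l" .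
      then have "v \<bullet> l \<noteq> 0" using \<open>v \<noteq> 0\<close> by auto
      then have "l = (1 / (v \<bullet> l)) *\<^sub>R v" using e by (metis divide_inverse mult_1 scaleR_left.minus scaleR_one scaleR_scaleR right_inverse mult.commute)
      then have "l \<in> direction_space F" using that(1) subspace_scale[OF subspace_direction_space] by metis
      with lF show False by simp
    qed
    have d: "dim (direction_space F) = length es"
      using facet_frame_basis[of F] fc es(2) by (simp add: ordered_basis_iff)
    obtain bs where bs: "dual_frame es bs" "ordered_basis (direction_space F) bs"
      using dual_frame_exists[OF es(1) inj subspace_direction_space d] by blast
    obtain r where r: "frame_ratio r (facet_frame F) bs" using frame_ratio_exists[OF facet_frame_basis bs(2)] .
    have "1 = r * kvector_inner es (facet_frame F)"
      using frame_ratio_form[OF r] alternating_form_kvector_inner[of es] fc es(2) kvector_inner_dual[OF bs(1)] by simp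
    then show ?thesis by auto
  qed
  show ?case
  proof (intro conjI impI ballI)
    assume none: "\<forall>x\<in>?A. proj es x \<noteq> y"
    show "\<forall>x. proj es x = y \<longrightarrow> mult es (cell_boundary \<tau>) x = 0"
    proof (intro allI impI, rule ccontr)
      fix x assume x: "proj es x = y" "mult es (cell_boundary \<tau>) x \<noteq> 0"
      obtain F where F: "F facet_of closure ?A" "x \<in> rel_interior F" using nz[OF x(2)] by blast
      note cF = cell_facets[OF A(1) F(1)]
      have xF: "x \<in> F" using F(2) rel_interior_subset by blast
      have lF: "l \<notin> direction_space F" using elim F(1) xF x(1) by blast
      let ?ws = "facet_frame F"
      have "dim ?V = Suc (length ?ws)" using A(2,3) facet_cell_props[OF F(1)] by (simp add: ordered_basis_iff)
      then have ob: "ordered_basis ?V (l # ?ws)"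
        by (intro ordered_basis_Cons[OF facet_frame_basis cF(10) _ _ l(1) lF]) auto
      obtain a0 where a0: "a0 \<in> ?A" using S(1) by blast
      have "x \<in> affine hull ?A" using xF cF(3) closure_affine_hull by blast
      then have "x - a0 \<in> ?V" using affine_hull_iff_direction_space[OF a0] by blast
      then have "- (x - a0) \<in> ?V" by (rule subspace_neg[OF subspace_direction_space])
      then have "a0 - x \<in> span (insert l (set ?ws))" using ob by (simp add: ordered_basis_def)
      then obtain c where c: "a0 - x - c *\<^sub>R l \<in> span (set ?ws)" using span_breakdown_eq by blast
      \<comment> \<open>The way from \<open>x\<close> to \<open>a0\<close> is
        \<open>c *\<^sub>R l\<close> plus a vector \<open>f\<close> along the facet. Starting
        instead from a point of the facet displaced by a multiple of \<open>f\<close> in the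
        opposite direction, one reaches a point of the cell on the fibre of
        \<open>x\<close>.\<close>
      define f where "f = a0 - x - c *\<^sub>R l"
      have fW: "f \<in> direction_space F" using c facet_frame_basis[of F] by (simp add: f_def ordered_basis_def)
      obtain e where e: "0 < e" "ball x e \<inter> affine hull F \<subseteq> F" using F(2) by (auto simp: mem_rel_interior_ball)
      \<comment> \<open>Small enough for the displacement along \<open>f\<close> to stay in the ball
        of radius \<open>e\<close>, where the facet fills its affine hull.\<close>
      define t where "t = min (1/2) (e / (4 * (norm f + 1)))"
      have "0 < 4 * (norm f + 1)" by (intro mult_pos_pos add_nonneg_pos) auto
      then have "0 < e / (4 * (norm f + 1))" using e(1) by (rule divide_pos_pos[rotated])
      then have t: "0 < t" "t \<le> 1/2" unfolding t_def by (auto simp: min_def)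
      \<comment> \<open>Determined by \<open>(1 - t) * s = t\<close>, which cancels \<open>f\<close>
        below.\<close>
      define s where "s = t / (1 - t)"
      have s: "0 < s" "s \<le> 2 * t" unfolding s_def using t by (auto simp: field_simps)
      have "s * norm f < e"
      proof -
        have "s * norm f \<le> 2 * t * (norm f + 1)" using s t by (intro mult_mono) auto
        also have "\<dots> \<le> 2 * (e / (4 * (norm f + 1))) * (norm f + 1)" unfolding t_def by (intro mult_right_mono mult_left_mono) auto
        also have "\<dots> = e / 2" by (simp add: field_simps add_nonneg_eq_0_iff)
        finally show ?thesis using e(1) by simp
      qed
      then have "x - s *\<^sub>R f \<in> ball x e" using s by (simp add: dist_norm)
      moreover have "x - s *\<^sub>R f \<in> affine hull F"
        using affine_hull_iff_direction_space[OF xF, of "x - s *\<^sub>R f"] subspace_scale[OF subspace_direction_space fW, of "- s"] by simp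
      ultimately have z: "x - s *\<^sub>R f \<in> closure ?A" using e(2) cF(3) by blast
      have "a0 + (1 - t) *\<^sub>R ((x - s *\<^sub>R f) - a0) \<in> ?A" using shrink[OF a0 z, of "1 - t"] t by simp
      moreover have "a0 + (1 - t) *\<^sub>R ((x - s *\<^sub>R f) - a0) = x + (t * c) *\<^sub>R l"
      proof -
        have st: "(1 - t) * s = t" unfolding s_def using t by simp
        have "a0 + (1 - t) *\<^sub>R ((x - s *\<^sub>R f) - a0) = x + t *\<^sub>R (a0 - x) - ((1 - t) * s) *\<^sub>R f"
          by (simp add: algebra_simps)
        also have "\<dots> = x + t *\<^sub>R (a0 - x - f)" unfolding st by (simp add: algebra_simps)
        finally show ?thesis by (simp add: f_def)
      qed
      ultimately have "x + (t * c) *\<^sub>R l \<in> ?A" by simp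
      moreover have "proj es (x + (t * c) *\<^sub>R l) = y"
        using x(1) l(2) by (simp add: linear_add[OF linear_proj] linear_scale[OF linear_proj])
      ultimately show False using none by blast
    qed
  next
    fix x0 assume x0: "x0 \<in> ?A" "proj es x0 = y"
    obtain G where G: "open G" "?A = affine hull ?A \<inter> G" using S(8) by blast
    have aff: "x0 + t *\<^sub>R l \<in> affine hull ?A" for t
      using affine_hull_iff_direction_space[OF x0(1)] subspace_scale[OF subspace_direction_space l(1)] by simp
    have op: "open {t. x0 + t *\<^sub>R l \<in> ?A}"
    proof -
      have "{t. x0 + t *\<^sub>R l \<in> ?A} = (\<lambda>t. x0 + t *\<^sub>R l) -` G" using G(2) aff by auto
      also have "open \<dots>" by (intro open_vimage G(1) continuous_intros)
      finally show ?thesis .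
    qed
    obtain t1 t2 where t: "t1 < 0" "0 < t2" "\<And>t. x0 + t *\<^sub>R l \<in> ?A \<longleftrightarrow> t1 < t \<and> t < t2"
      using convex_open_line_segment[OF S(3,2) x0(1) l(3) op] by blast
    have py: "proj es (x0 + t *\<^sub>R l) = y" for t
      using x0(2) l(2) by (simp add: linear_add[OF linear_proj] linear_scale[OF linear_proj])
    have inseg: "t1 \<le> t \<and> t \<le> t2" if "x0 + t *\<^sub>R l \<in> closure ?A" for t
    proof (rule ccontr)
      assume n: "\<not> ?thesis"
      \<comment> \<open>The end that \<open>t\<close> has overrun. It lies between 0 and
        \<open>t\<close>, so by convexity its point would belong to the cell.\<close>
      define e where "e = (if t2 < t then t2 else t1)"
      have e: "0 \<le> e / t" "e / t < 1" "t \<noteq> 0" using n t(1,2) by (auto simp: e_def field_simps split: if_splits)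
      have "x0 + (e / t) *\<^sub>R ((x0 + t *\<^sub>R l) - x0) \<in> ?A" by (rule shrink[OF x0(1) that e(1,2)])
      then have "x0 + e *\<^sub>R l \<in> ?A" using e(3) by simp
      then show False using t(3)[of e] by (auto simp: e_def split: if_splits)
    qed
    have endp: "real_of_int (mult es (cell_boundary \<tau>) (x0 + e *\<^sub>R l)) = ?s * sgn e" if e: "e = t1 \<or> e = t2" for e
    proof -
      let ?x = "x0 + e *\<^sub>R l"
      have nA: "?x \<notin> ?A" using t(3)[of e] e by auto
      \<comment> \<open>With \<open>Suc (Suc n)\<close> the factor lies strictly between 0 and 1, so
        the points approach the end from inside the segment.\<close>
      have "(\<lambda>n. x0 + ((1 - 1 / real (Suc (Suc n))) * e) *\<^sub>R l) \<longlonglongrightarrow> x0 + ((1 - 0) * e) *\<^sub>R l"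
        by (intro tendsto_intros LIMSEQ_Suc[OF LIMSEQ_Suc[OF lim_1_over_n]])
      moreover have "x0 + ((1 - 1 / real (Suc (Suc n))) * e) *\<^sub>R l \<in> ?A" for n
      proof -
        have q: "0 < 1 - 1 / real (Suc (Suc n))" "1 - 1 / real (Suc (Suc n)) < 1" by auto
        have "t1 < (1 - 1 / real (Suc (Suc n))) * e \<and> (1 - 1 / real (Suc (Suc n))) * e < t2"
        proof (cases "e = t2")
          case True
          then show ?thesis using q t(1,2) by (auto intro: less_trans[OF t(1)] mult_pos_pos)
        next
          case False
          then have e1: "e = t1" using e by blast
          have "(1 - 1 / real (Suc (Suc n))) * t1 < 0" using q(1) t(1) by (rule mult_pos_neg)
          moreover have "t1 < (1 - 1 / real (Suc (Suc n))) * t1" using q(2) t(1) by (simp add: mult_less_cancel_right2)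
          ultimately show ?thesis unfolding e1 using t(2) by (meson less_trans)
        qed
        then show ?thesis using t(3) by blast
      qed
      ultimately have cl: "?x \<in> closure ?A" unfolding closure_sequential by (intro exI conjI allI) auto
      then obtain F where F: "F facet_of closure ?A" "?x \<in> F" using nA cell_closure_eq(1)[OF A(1)] by blast
      have ri: "?x \<in> rel_interior F" and lF: "l \<notin> direction_space F" using elim F py by blast+
      obtain a b where ab: "F = closure ?A \<inter> {x. a \<bullet> x = b}" "\<And>x. x \<in> ?A \<Longrightarrow> a \<bullet> x < b"
        "\<And>w. w \<in> direction_space F \<Longrightarrow> a \<bullet> w = 0"
        using facet_hyperplane[OF A(1) F(1)] by metis
      have lt: "a \<bullet> x < a \<bullet> y" if "x \<in> ?A" "y \<in> F" for x y using ab(1) ab(2)[OF that(1)] that(2) by auto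
      have "0 < e * (a \<bullet> l)" using lt[OF x0(1) F(2)] by (simp add: inner_add_right)
      then have "sgn (a \<bullet> l) = sgn e" by (auto simp: zero_less_mult_iff sgn_real_def)
      then show ?thesis
        using facet_sign_eq(3)[OF es l F(1) transv[OF F(1) lF] ab(3) lt] single[OF F(1) ri] by simp
    qed
    have "real_of_int (mult es (cell_boundary \<tau>) x) =
        ?s * ((if x = x0 + t2 *\<^sub>R l then 1 else 0) - (if x = x0 + t1 *\<^sub>R l then 1 else 0))" if x: "proj es x = y" for x
    proof -
      have l0: "l \<noteq> 0" using l(3) by auto
      have ne: "x0 + t1 *\<^sub>R l \<noteq> x0 + t2 *\<^sub>R l" using t(1,2) l0 by auto
      consider "x = x0 + t1 *\<^sub>R l" | "x = x0 + t2 *\<^sub>R l" | "x \<noteq> x0 + t1 *\<^sub>R l" "x \<noteq> x0 + t2 *\<^sub>R l" by blast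
      then show ?thesis
      proof cases
        case 1
        then show ?thesis using endp[of t1] ne t(1) by simp
      next
        case 2
        then show ?thesis using endp[of t2] ne t(2) by simp
      next
        case 3
        have "mult es (cell_boundary \<tau>) x = 0"
        proof (rule ccontr)
          assume "mult es (cell_boundary \<tau>) x \<noteq> 0"
          then obtain F where F: "F facet_of closure ?A" "x \<in> rel_interior F" using nz by blast
          have xF: "x \<in> F" using F(2) rel_interior_subset by blast
          then have xc: "x \<in> closure ?A" and xA: "x \<notin> ?A" using cell_facets(3,4)[OF A(1) F(1)] by blast+
          have "x - x0 \<in> ?V" using xc closure_affine_hull affine_hull_iff_direction_space[OF x0(1)] by blast
          moreover have "proj es (x - x0) = 0" using x x0(2) by (simp add: linear_diff[OF linear_proj])
          ultimately have "x - x0 = ((x - x0) \<bullet> l) *\<^sub>R l" by (rule kernel_line[OF es l K])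
          then obtain u where u: "x = x0 + u *\<^sub>R l" by (metis add.commute diff_add_cancel)
          have "t1 \<le> u \<and> u \<le> t2" using inseg xc u by blast
          moreover have "\<not> (t1 < u \<and> u < t2)" using xA u t(3) by blast
          ultimately have "u = t1 \<or> u = t2" by linarith
          then show False using 3 u by blast
        qed
        then show ?thesis using 3 by simp
      qed
    qed
    then show "\<exists>t1 t2. t1 < 0 \<and> 0 < t2 \<and> (\<forall>t. x0 + t *\<^sub>R l \<in> ?A \<longleftrightarrow> t1 < t \<and> t < t2) \<and>
        (\<forall>x. proj es x = y \<longrightarrow> real_of_int (mult es (cell_boundary \<tau>) x) =
          ?s * ((if x = x0 + t2 *\<^sub>R l then 1 else 0) - (if x = x0 + t1 *\<^sub>R l then 1 else 0)))"
      using t by blast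
  qed
qed

section \<open>Stokes' theorem and slices\<close>

text \<open>The point above \<open>y\<close> in the plane of the cell. The choice of a dual frame is
  meaningful only if \<open>cell_sign es \<sigma>\<close> is nonzero; otherwise
  \<open>fibre_sum\<close> multiplies the value by 0.\<close>

definition cell_lift :: "(real^3) list \<Rightarrow> oriented_cell \<Rightarrow> real^3 \<Rightarrow> real^3" where
  "cell_lift es \<sigma> = lift es (SOME p. p \<in> cell_set \<sigma>)
     (SOME bs. dual_frame es bs \<and> ordered_basis (direction_space (cell_set \<sigma>)) bs)"

text \<open>For \<open>y\<close> in the span of \<open>es\<close>, this is the sum of multiplicity
  times \<open>w\<close> over the points above \<open>y\<close>. It is written cell by cell so that
  measurability in \<open>y\<close> is visible.\<close>

definition fibre_sum :: "(real^3) list \<Rightarrow> (oriented_cell \<Rightarrow>\<^sub>0 int) \<Rightarrow> (real^3 \<Rightarrow> real) \<Rightarrow> real^3 \<Rightarrow> real" where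
  "fibre_sum es c w y = (\<Sum>\<sigma>\<in>Poly_Mapping.keys c. real_of_int (Poly_Mapping.lookup c \<sigma> * cell_sign es \<sigma>) *
     (indicat_real (cell_set \<sigma>) (cell_lift es \<sigma> y) * w (cell_lift es \<sigma> y)))"

lemma cell_lift_frame:
  assumes es: "orthonormal_frame es" and s: "cell_sign es \<sigma> \<noteq> 0"
  obtains bs where "dual_frame es bs" "ordered_basis (direction_space (cell_set \<sigma>)) bs"
    "cell_lift es \<sigma> = lift es (SOME p. p \<in> cell_set \<sigma>) bs"
proof -
  let ?P = "\<lambda>bs. dual_frame es bs \<and> ordered_basis (direction_space (cell_set \<sigma>)) bs"
  have "\<exists>bs. ?P bs" using cell_sign_dual[OF es s] by metis
  then have "?P (SOME bs. ?P bs)" by (rule someI_ex)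
  then show ?thesis by (intro that[of "SOME bs. ?P bs"]) (auto simp: cell_lift_def)
qed

lemma cell_lift_measurable [measurable]: "cell_lift es \<sigma> \<in> borel_measurable borel"
  by (simp add: cell_lift_def)

lemma cell_set_borel [measurable, simp]: "cell_set \<sigma> \<in> sets borel"
  by (rule is_cell_borel[OF oriented_cell_props(1)])

lemma proj_cell_lift:
  assumes "orthonormal_frame es" "cell_sign es \<sigma> \<noteq> 0" "y \<in> span (set es)"
  shows "proj es (cell_lift es \<sigma> y) = y"
  using cell_lift_frame[OF assms(1,2)] proj_lift[OF assms(1) _ assms(3)] by metis

lemma cell_lift_proj:
  assumes "orthonormal_frame es" "cell_sign es \<sigma> \<noteq> 0" "x \<in> cell_set \<sigma>"
  shows "cell_lift es \<sigma> (proj es x) = x"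
proof -
  obtain bs where bs: "dual_frame es bs" "ordered_basis (direction_space (cell_set \<sigma>)) bs"
    "cell_lift es \<sigma> = lift es (SOME p. p \<in> cell_set \<sigma>) bs" by (rule cell_lift_frame[OF assms(1,2)])
  have "x - (SOME p. p \<in> cell_set \<sigma>) \<in> span (set bs)"
    using affine_hull_iff_direction_space[OF some_in_cell[of \<sigma>], of x] assms(3) bs(2)
    by (simp add: hull_inc ordered_basis_def)
  then show ?thesis unfolding bs(3) by (rule lift_proj[OF assms(1) bs(1)])
qed

lemma fibre_sum_eq:
  assumes es: "orthonormal_frame es" and y: "y \<in> span (set es)"
    and X: "finite X" "\<And>x. x \<in> X \<Longrightarrow> proj es x = y"
      "\<And>x. proj es x = y \<Longrightarrow> mult es c x \<noteq> 0 \<Longrightarrow> x \<in> X"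
  shows "fibre_sum es c w y = (\<Sum>x\<in>X. real_of_int (mult es c x) * w x)"
proof -
  let ?I = "{\<sigma>\<in>Poly_Mapping.keys c. cell_sign es \<sigma> \<noteq> 0}"
  let ?a = "\<lambda>\<sigma>. real_of_int (Poly_Mapping.lookup c \<sigma> * cell_sign es \<sigma>)"
  \<comment> \<open>The lifts of all transversal cells are added to \<open>X\<close>. The
    multiplicity vanishes at the new points, and the sums over cells and points can now be
    exchanged.\<close>
  let ?Y = "X \<union> (\<lambda>\<sigma>. cell_lift es \<sigma> y) ` ?I"
  have fin: "finite ?Y" using X by simp
  have py: "proj es x = y" if "x \<in> ?Y" for x
    using that X(2) proj_cell_lift[OF es _ y] by auto
  have "(\<Sum>x\<in>X. real_of_int (mult es c x) * w x) = (\<Sum>x\<in>?Y. real_of_int (mult es c x) * w x)"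
    using X(3) py fin by (intro sum.mono_neutral_left) auto
  also have "\<dots> = (\<Sum>x\<in>?Y. \<Sum>\<sigma>\<in>?I. ?a \<sigma> * (indicat_real (cell_set \<sigma>) x * w x))"
  proof (rule sum.cong[OF refl])
    fix x
    have *: "real_of_int (mult es c x) = (\<Sum>\<sigma>\<in>?I. ?a \<sigma> * indicat_real (cell_set \<sigma>) x)"
      unfolding mult_def of_int_sum by (intro sum.mono_neutral_cong_right) auto
    then show "real_of_int (mult es c x) * w x = (\<Sum>\<sigma>\<in>?I. ?a \<sigma> * (indicat_real (cell_set \<sigma>) x * w x))"
      unfolding * sum_distrib_right by (intro sum.cong refl) (simp only: mult.assoc)
  qed
  also have "\<dots> = (\<Sum>\<sigma>\<in>?I. \<Sum>x\<in>?Y. ?a \<sigma> * (indicat_real (cell_set \<sigma>) x * w x))" by (rule sum.swap)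
  also have "\<dots> = (\<Sum>\<sigma>\<in>?I. ?a \<sigma> * (indicat_real (cell_set \<sigma>) (cell_lift es \<sigma> y) * w (cell_lift es \<sigma> y)))"
  proof (rule sum.cong[OF refl])
    fix \<sigma> assume \<sigma>: "\<sigma> \<in> ?I"
    have "x = cell_lift es \<sigma> y" if "x \<in> cell_set \<sigma>" "x \<in> ?Y" for x
      using cell_lift_proj[OF es _ that(1)] \<sigma> py[OF that(2)] by simp
    then have "(\<Sum>x\<in>?Y. ?a \<sigma> * (indicat_real (cell_set \<sigma>) x * w x)) =
        (\<Sum>x\<in>{cell_lift es \<sigma> y}. ?a \<sigma> * (indicat_real (cell_set \<sigma>) x * w x))"
      using fin \<sigma> by (intro sum.mono_neutral_right) (auto simp: indicator_def)
    then show "(\<Sum>x\<in>?Y. ?a \<sigma> * (indicat_real (cell_set \<sigma>) x * w x)) =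
        ?a \<sigma> * (indicat_real (cell_set \<sigma>) (cell_lift es \<sigma> y) * w (cell_lift es \<sigma> y))" by simp
  qed
  also have "\<dots> = fibre_sum es c w y"
    unfolding fibre_sum_def by (intro sum.mono_neutral_left) auto
  finally show ?thesis by simp
qed

lemma integrable_frame_measure_cell:
  assumes vs: "ordered_basis V vs" and h: "continuous_on UNIV h"
  shows "integrable (frame_measure p vs) (\<lambda>x. indicat_real (cell_set \<sigma>) x * h x)"
proof -
  have b: "bounded (cell_set \<sigma>)" by (rule is_cell_structure(2)[OF oriented_cell_props(1)])
  have "compact (h ` closure (cell_set \<sigma>))"
    using b by (intro compact_continuous_image continuous_on_subset[OF h]) (auto simp: compact_closure)
  from compact_imp_bounded[OF this] obtain B where B: "\<And>x. x \<in> closure (cell_set \<sigma>) \<Longrightarrow> norm (h x) \<le> B"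
    unfolding bounded_iff by (metis imageI)
  have hm [measurable]: "h \<in> borel_measurable borel" by (rule borel_measurable_continuous_onI[OF h])
  have "integrable (frame_measure p vs) (\<lambda>x. B *\<^sub>R indicat_real (cell_set \<sigma>) x)"
    using emeasure_cell_finite[OF vs oriented_cell_props(1)[of \<sigma>], of p]
    by (intro integrable_scaleR_right integrable_real_indicator) auto
  then show ?thesis
  proof (rule Bochner_Integration.integrable_bound)
    show "(\<lambda>x. indicat_real (cell_set \<sigma>) x * h x) \<in> borel_measurable (frame_measure p vs)" by measurable
    show "AE x in frame_measure p vs. norm (indicat_real (cell_set \<sigma>) x * h x) \<le> norm (B *\<^sub>R indicat_real (cell_set \<sigma>) x)"
      using B closure_subset by (intro AE_I2) (fastforce simp: indicator_def)
  qed
qed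

lemma continuous_on_real_polynomial: "real_polynomial_function (h :: real^3 \<Rightarrow> real) \<Longrightarrow> continuous_on S h"
  by (intro continuous_on_polymonial_function) (simp add: real_polynomial_function_eq)

lemma integrable_cell_lift:
  assumes es: "orthonormal_frame es" and s: "cell_sign es \<sigma> \<noteq> 0" and h: "continuous_on UNIV h"
  shows "integrable (frame_measure 0 es) (\<lambda>y. indicat_real (cell_set \<sigma>) (cell_lift es \<sigma> y) * h (cell_lift es \<sigma> y))"
proof -
  obtain bs where bs: "dual_frame es bs" "ordered_basis (direction_space (cell_set \<sigma>)) bs"
    "cell_lift es \<sigma> = lift es (SOME p. p \<in> cell_set \<sigma>) bs" by (rule cell_lift_frame[OF es s])
  let ?p = "SOME p. p \<in> cell_set \<sigma>"
  have lm: "lift es ?p bs \<in> measurable (frame_measure 0 es) borel"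
    unfolding measurable_cong_sets[OF sets_frame_measure refl] by (rule lift_measurable)
  have eq: "frame_measure ?p bs = distr (frame_measure 0 es) borel (lift es ?p bs)"
  proof (rule measure_eqI)
    fix A assume "A \<in> sets (frame_measure ?p bs)"
    then have ind: "(indicator A :: _ \<Rightarrow> ennreal) \<in> borel_measurable borel" and A: "A \<in> sets borel" by auto
    have "emeasure (frame_measure ?p bs) A = (\<integral>\<^sup>+ x. indicator A x \<partial>frame_measure ?p bs)" using A by simp
    also have "\<dots> = (\<integral>\<^sup>+ y. indicator A (lift es ?p bs y) \<partial>frame_measure 0 es)" by (rule frame_measure_lift[OF es bs(1) ind])
    also have "\<dots> = (\<integral>\<^sup>+ y. indicator A y \<partial>distr (frame_measure 0 es) borel (lift es ?p bs))"
      by (rule nn_integral_distr[OF lm, symmetric]) (simp add: ind)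
    finally show "emeasure (frame_measure ?p bs) A = emeasure (distr (frame_measure 0 es) borel (lift es ?p bs)) A"
      using A by simp
  qed simp
  have [measurable]: "h \<in> borel_measurable borel" by (rule borel_measurable_continuous_onI[OF h])
  from integrable_frame_measure_cell[OF bs(2) h, of ?p \<sigma>] show ?thesis
    unfolding eq bs(3) by (subst (asm) integrable_distr_eq[OF lm]) simp_all
qed

text \<open>Each transversal cell is integrated over its shadow, where determinant and Jacobian
  reduce to the sign; for the other cells of this dimension the determinant is 0.\<close>

lemma formal_integral_fibre_sum:
  assumes es: "orthonormal_frame es" and h: "real_polynomial_function h"
  shows "formal_integral (length es) (\<lambda>x vs. h x * kvector_inner es vs) c = (\<integral>y. fibre_sum es c h y \<partial>frame_measure 0 es)"
proof -
  have hc: "continuous_on UNIV h" by (rule continuous_on_real_polynomial[OF h])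
  have hm [measurable]: "h \<in> borel_measurable borel" by (rule borel_measurable_continuous_onI[OF hc])
  let ?\<omega> = "\<lambda>x vs. h x * kvector_inner es vs"
  let ?I = "{\<sigma>\<in>Poly_Mapping.keys c. cell_sign es \<sigma> \<noteq> 0}"
  let ?f = "\<lambda>\<sigma> y. indicat_real (cell_set \<sigma>) (cell_lift es \<sigma> y) * h (cell_lift es \<sigma> y)"
  let ?a = "\<lambda>\<sigma>. real_of_int (Poly_Mapping.lookup c \<sigma> * cell_sign es \<sigma>)"
  have ci: "cell_integral ?\<omega> \<sigma> = kvector_inner es (cell_frame \<sigma>) *
        (\<integral>x. indicat_real (cell_set \<sigma>) x * h x \<partial>frame_measure (SOME p. p \<in> cell_set \<sigma>) (cell_frame \<sigma>))" for \<sigma>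
    by (subst cell_integral_eq) (simp_all add: mult_ac flip: integral_mult_right_zero)
  have "formal_integral (length es) ?\<omega> c = (\<Sum>\<sigma>\<in>?I. ?a \<sigma> * (\<integral>y. ?f \<sigma> y \<partial>frame_measure 0 es))"
    unfolding formal_integral_def
  proof (rule sum.mono_neutral_cong_right)
    show "\<forall>\<sigma>\<in>Poly_Mapping.keys c - ?I. (if cell_dim \<sigma> = length es
        then real_of_int (Poly_Mapping.lookup c \<sigma>) * cell_integral ?\<omega> \<sigma> else 0) = 0"
      unfolding cell_sign_def ci by (auto split: if_splits)
    fix \<sigma> assume \<sigma>: "\<sigma> \<in> ?I"
    then have sg: "cell_sign es \<sigma> \<noteq> 0" by simp
    let ?K = "kvector_inner es (cell_frame \<sigma>)"
    have K: "?K \<noteq> 0" "cell_dim \<sigma> = length es" "real_of_int (cell_sign es \<sigma>) = sgn ?K"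
      using sg by (auto simp: cell_sign_def split: if_splits)
    obtain bs where bs: "dual_frame es bs" "ordered_basis (direction_space (cell_set \<sigma>)) bs"
      "cell_lift es \<sigma> = lift es (SOME p. p \<in> cell_set \<sigma>) bs" by (rule cell_lift_frame[OF es sg])
    have "cell_integral ?\<omega> \<sigma> = sgn ?K * (\<integral>y. ?f \<sigma> y \<partial>frame_measure 0 es)"
      unfolding ci bs(3)
      by (rule integral_frame_measure_lift[OF es bs(1,2) oriented_cell_props(2) K(1)]) measurable
    then show "(if cell_dim \<sigma> = length es then real_of_int (Poly_Mapping.lookup c \<sigma>) * cell_integral ?\<omega> \<sigma> else 0) =
        ?a \<sigma> * (\<integral>y. ?f \<sigma> y \<partial>frame_measure 0 es)"
      using K by simp
  qed auto
  also have "\<dots> = (\<integral>y. (\<Sum>\<sigma>\<in>?I. ?a \<sigma> * ?f \<sigma> y) \<partial>frame_measure 0 es)"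
    by (subst Bochner_Integration.integral_sum) (auto intro!: integrable_cell_lift[OF es _ hc])
  also have "\<dots> = (\<integral>y. fibre_sum es c h y \<partial>frame_measure 0 es)"
    unfolding fibre_sum_def
    by (intro Bochner_Integration.integral_cong refl sum.mono_neutral_left) auto
  finally show ?thesis .
qed

text \<open>On the orthogonal complement of \<open>l\<close> in the plane of the cell the projection
  is injective, so this complement has a dual frame.\<close>

lemma transversal_frame:
  assumes es: "orthonormal_frame es" "cell_dim \<tau> = Suc (length es)"
    and l: "l \<in> direction_space (cell_set \<tau>)" "proj es l = 0" "norm l = 1"
    and ker: "\<And>v. v \<in> direction_space (cell_set \<tau>) \<Longrightarrow> proj es v = 0 \<Longrightarrow> v = (v \<bullet> l) *\<^sub>R l"
  obtains bs where "dual_frame es bs" "ordered_basis (direction_space (cell_set \<tau>)) (l # bs)"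
    "set bs \<subseteq> direction_space (cell_set \<tau>)"
proof -
  let ?V = "direction_space (cell_set \<tau>)"
  let ?W = "{y \<in> ?V. \<forall>x\<in>span {l}. orthogonal x y}"
  have l0: "l \<noteq> 0" using l(3) by auto
  have dV: "dim ?V = Suc (length es)"
    using oriented_cell_props[of \<tau>] es(2) by (simp add: ordered_basis_iff)
  have "span {l} \<subseteq> ?V" using l(1) by (intro span_minimal) auto
  then have "dim ?W + dim (span {l}) = dim ?V"
    by (intro dim_subspace_orthogonal_to_vectors) auto
  moreover have "dim (span {l}) = 1" using l0 by (simp add: dim_insert)
  ultimately have dW: "dim ?W = length es" using dV by simp
  have W: "subspace ?W"
    unfolding subspace_def
    by (auto simp: orthogonal_def inner_add_right intro: subspace_0 subspace_add subspace_scale)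
  have orth: "l \<bullet> v = 0" if "v \<in> ?W" for v
    using that span_base[of l "{l}"] by (auto simp: orthogonal_def)
  have inj: "v = 0" if "v \<in> ?W" "proj es v = 0" for v
    using ker[of v] that orth[OF that(1)] by (auto simp: inner_commute)
  obtain bs where bs: "dual_frame es bs" "ordered_basis ?W bs"
    by (rule dual_frame_exists[OF es(1) inj W dW])
  have lW: "l \<notin> ?W" using orth[of l] l(3) by (auto simp: dot_square_norm)
  have lb: "length bs = length es" using bs(1) by (simp add: dual_frame_def)
  have "ordered_basis ?V (l # bs)"
    by (rule ordered_basis_Cons[OF bs(2) _ subspace_direction_space _ l(1) lW]) (use dV lb in auto)
  moreover have "set bs \<subseteq> ?V" using bs(2) span_superset[of "set bs"] by (auto simp: ordered_basis_def)
  ultimately show ?thesis using that bs(1) by blast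
qed

lemma kvector_inner_transversal:
  assumes es: "orthonormal_frame es" and l: "proj es l = 0" and bs: "dual_frame es bs"
  shows "kvector_inner (b # es) (l # bs) = b \<bullet> l"
  using kvector_inner_Cons_dual[OF bs, of l b] proj_eq_0_iff[OF es] l by (simp add: inner_commute)

text \<open>If the kernel in the plane of the cell were the line of \<open>l\<close>, the
  determinant with \<open>l\<close> would not vanish. So the kernel contains two independent
  vectors, and a combination \<open>u\<close> of them is orthogonal to \<open>b\<close> too.\<close>

lemma kvector_inner_degenerate:
  assumes es: "orthonormal_frame es" "cell_dim \<tau> = Suc (length es)"
    and l: "l \<in> direction_space (cell_set \<tau>)" "proj es l = 0" "norm l = 1"
    and K: "kvector_inner (l # es) (cell_frame \<tau>) = 0"
  shows "kvector_inner (b # es) (cell_frame \<tau>) = 0"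
proof -
  let ?V = "direction_space (cell_set \<tau>)"
  note A = oriented_cell_props[of \<tau>]
  have l0: "l \<noteq> 0" using l(3) by auto
  have "\<exists>v\<in>?V. proj es v = 0 \<and> v \<noteq> (v \<bullet> l) *\<^sub>R l"
  proof (rule ccontr)
    assume "\<not> ?thesis"
    then have ker: "v = (v \<bullet> l) *\<^sub>R l" if "v \<in> ?V" "proj es v = 0" for v using that by blast
    obtain bs where bs: "dual_frame es bs" "ordered_basis ?V (l # bs)" "set bs \<subseteq> ?V"
      by (rule transversal_frame[OF es l ker])
    obtain r where r: "frame_ratio r (cell_frame \<tau>) (l # bs)" using frame_ratio_exists[OF A(2) bs(2)] .
    have "1 = r * kvector_inner (l # es) (cell_frame \<tau>)"
      using frame_ratio_form[OF r] alternating_form_kvector_inner[of "l # es"] A(3) es(2)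
        kvector_inner_transversal[OF es(1) l(2) bs(1), of l] l(3) by (simp add: dot_square_norm)
    with K show False by simp
  qed
  then obtain v where v: "v \<in> ?V" "proj es v = 0" "v \<noteq> (v \<bullet> l) *\<^sub>R l" by blast
  define u where "u = (if l \<bullet> b = 0 then l else (v \<bullet> b) *\<^sub>R l - (l \<bullet> b) *\<^sub>R v)"
  have uV: "u \<in> ?V" unfolding u_def using v l by (auto intro!: subspace_diff subspace_scale)
  have pu: "proj es u = 0"
    unfolding u_def using v l by (simp add: linear_diff[OF linear_proj] linear_scale[OF linear_proj])
  have u0: "u \<noteq> 0"
  proof (cases "l \<bullet> b = 0")
    case False
    show ?thesis
    proof
      assume "u = 0"
      then have e: "(l \<bullet> b) *\<^sub>R v = (v \<bullet> b) *\<^sub>R l" using False by (simp add: u_def)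
      define c where "c = (v \<bullet> b) / (l \<bullet> b)"
      have "v = (1 / (l \<bullet> b)) *\<^sub>R ((l \<bullet> b) *\<^sub>R v)" using False by simp
      then have "v = c *\<^sub>R l" unfolding e c_def by simp
      then have "v = (v \<bullet> l) *\<^sub>R l" using l(3) by (simp add: dot_square_norm)
      with v(3) show False by simp
    qed
  qed (use l0 in \<open>simp add: u_def\<close>)
  have bu: "b \<bullet> u = 0" unfolding u_def by (auto simp: inner_diff_right inner_commute)
  have "es ! i \<bullet> u = 0" if "i < length es" for i
    using pu proj_eq_0_iff[OF es(1)] that by (simp add: inner_commute)
  then have "(b # es) ! i \<bullet> u = 0" if "i < length (b # es)" for i
    using bu that by (cases i) auto
  then show ?thesis
    using kvector_inner_eq_0[OF A(2) _ uV u0, of "b # es"] A(3) es(2) by simp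
qed

lemma frame_ratio_density:
  assumes r: "frame_ratio r vs ws"
  shows "frame_measure p vs = density (frame_measure p ws) (\<lambda>_. ennreal \<bar>r\<bar>)"
proof (rule measure_eqI)
  fix A assume "A \<in> sets (frame_measure p vs)"
  then have A: "A \<in> sets borel" and ind: "(indicator A :: _ \<Rightarrow> ennreal) \<in> borel_measurable borel" by auto
  have "emeasure (frame_measure p vs) A = (\<integral>\<^sup>+ x. indicator A x \<partial>frame_measure p vs)" using A by simp
  also have "\<dots> = ennreal \<bar>r\<bar> * (\<integral>\<^sup>+ x. indicator A x \<partial>frame_measure p ws)" by (rule frame_ratio_integral[OF r ind])
  finally show "emeasure (frame_measure p vs) A = emeasure (density (frame_measure p ws) (\<lambda>_. ennreal \<bar>r\<bar>)) A"
    using A by (simp add: emeasure_density nn_integral_cmult)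
qed simp

section \<open>Stokes' theorem by integration along the fibres\<close>

lemma nn_integral_transversal:
  assumes es: "orthonormal_frame es" and bs: "dual_frame es bs" and f [measurable]: "f \<in> borel_measurable borel"
  shows "(\<integral>\<^sup>+ x. f x \<partial>frame_measure p (l # bs)) =
    (\<integral>\<^sup>+ y. (\<integral>\<^sup>+ t. f (lift es p bs y + t *\<^sub>R l) \<partial>lborel) \<partial>frame_measure 0 es)"
proof -
  have m: "(\<lambda>x. \<integral>\<^sup>+ t. f (x + t *\<^sub>R l) \<partial>lborel) \<in> borel_measurable borel"
    by (intro lborel.borel_measurable_nn_integral) measurable
  show ?thesis
    using nn_integral_frame_measure_insert'[OF f, of p "[]" l bs] frame_measure_lift[OF es bs m, of p] by simp
qed

text \<open>The measure of the frame \<open>l # bs\<close> is the image of the product of the base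
  measure and Lebesgue measure along \<open>l\<close>, so Fubini's theorem for integrable functions
  applies.\<close>

lemma integral_transversal:
  assumes es: "orthonormal_frame es" and bs: "dual_frame es bs" and f: "integrable (frame_measure p (l # bs)) (f :: real^3 \<Rightarrow> real)"
  shows "(\<integral>x. f x \<partial>frame_measure p (l # bs)) =
      (\<integral>y. (\<integral>t. f (lift es p bs y + t *\<^sub>R l) \<partial>lborel) \<partial>frame_measure 0 es)"
proof -
  let ?\<mu> = "frame_measure 0 es"
  let ?T = "\<lambda>(y, t). lift es p bs y + t *\<^sub>R l"
  interpret S: sigma_finite_measure ?\<mu> by (rule sigma_finite_frame_measure[OF orthonormal_frame_basis[OF es]])
  interpret pair_sigma_finite ?\<mu> lborel ..
  have T: "?T \<in> ?\<mu> \<Otimes>\<^sub>M lborel \<rightarrow>\<^sub>M borel" by measurable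
  have eq: "frame_measure p (l # bs) = distr (?\<mu> \<Otimes>\<^sub>M lborel) borel ?T"
  proof (rule measure_eqI)
    fix A assume "A \<in> sets (frame_measure p (l # bs))"
    then have A [measurable]: "A \<in> sets borel" by simp
    have ind: "(indicator A :: _ \<Rightarrow> ennreal) \<in> borel_measurable borel" by simp
    have "emeasure (frame_measure p (l # bs)) A = (\<integral>\<^sup>+ x. indicator A x \<partial>frame_measure p (l # bs))" by simp
    also have "\<dots> = (\<integral>\<^sup>+ y. (\<integral>\<^sup>+ t. indicator A (?T (y, t)) \<partial>lborel) \<partial>?\<mu>)"
      using nn_integral_transversal[OF es bs ind, of p l] by simp
    also have "\<dots> = (\<integral>\<^sup>+ z. indicator A (?T z) \<partial>(?\<mu> \<Otimes>\<^sub>M lborel))"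
      by (rule lborel.nn_integral_fst) (rule measurable_compose[OF T ind])
    also have "\<dots> = (\<integral>\<^sup>+ z. indicator A z \<partial>distr (?\<mu> \<Otimes>\<^sub>M lborel) borel ?T)"
      by (rule nn_integral_distr[OF T, symmetric]) (simp add: ind)
    finally show "emeasure (frame_measure p (l # bs)) A = emeasure (distr (?\<mu> \<Otimes>\<^sub>M lborel) borel ?T) A" by simp
  qed simp
  have fm: "f \<in> borel_measurable borel"
    using borel_measurable_integrable[OF f] unfolding measurable_cong_sets[OF sets_frame_measure refl] .
  have int: "integrable (?\<mu> \<Otimes>\<^sub>M lborel) (\<lambda>z. f (?T z))"
    using f unfolding eq by (subst (asm) integrable_distr_eq[OF T fm])
  have "(\<integral>x. f x \<partial>frame_measure p (l # bs)) = (\<integral>z. f (?T z) \<partial>(?\<mu> \<Otimes>\<^sub>M lborel))"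
    unfolding eq by (rule integral_distr[OF T fm])
  also have "\<dots> = (\<integral>y. (\<integral>t. f (?T (y, t)) \<partial>lborel) \<partial>?\<mu>)"
    by (rule integral_fst'[OF int, symmetric])
  finally show ?thesis by simp
qed

text \<open>The fundamental theorem of calculus on the segment that \<open>S\<close> cuts out of a
  line. The integral starts from another point \<open>z\<close> of the line, whence the translation
  by \<open>t0\<close>.\<close>

lemma integral_line_derivative:
  fixes h :: "real^3 \<Rightarrow> real"
  assumes h: "\<And>x. (h has_derivative h' x) (at x)" and c: "continuous_on UNIV (\<lambda>x. h' x l)" and t: "t1 \<le> t2"
    and z: "z = x0 + t0 *\<^sub>R l" and S: "\<And>t. x0 + t *\<^sub>R l \<in> S \<longleftrightarrow> t1 < t \<and> t < t2"
  shows "(\<integral>t. indicat_real S (z + t *\<^sub>R l) * h' (z + t *\<^sub>R l) l \<partial>lborel) = h (x0 + t2 *\<^sub>R l) - h (x0 + t1 *\<^sub>R l)"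
proof -
  let ?g = "\<lambda>t. indicat_real {t1<..<t2} t * h' (x0 + t *\<^sub>R l) l"
  have "(\<integral>t. indicat_real S (z + t *\<^sub>R l) * h' (z + t *\<^sub>R l) l \<partial>lborel) = (\<integral>t. ?g (t0 + 1 * t) \<partial>lborel)"
  proof (rule Bochner_Integration.integral_cong[OF refl])
    fix t
    have e: "z + t *\<^sub>R l = x0 + (t0 + 1 * t) *\<^sub>R l" unfolding z by (simp add: algebra_simps)
    show "indicat_real S (z + t *\<^sub>R l) * h' (z + t *\<^sub>R l) l = ?g (t0 + 1 * t)"
      unfolding e using S[of "t0 + 1 * t"] by (simp add: indicator_def)
  qed
  also have "\<dots> = (\<integral>t. ?g t \<partial>lborel)"
    using lborel_integral_real_affine[of 1 ?g t0] by simp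
  also have "\<dots> = (\<integral>t. indicat_real {t1..t2} t *\<^sub>R h' (x0 + t *\<^sub>R l) l \<partial>lborel)"
  proof (rule integral_cong_AE)
    have hm: "(\<lambda>t. h' (x0 + t *\<^sub>R l) l) \<in> borel_measurable borel"
      by (intro borel_measurable_continuous_onI continuous_on_compose2[OF c]) (auto intro!: continuous_intros)
    then show "?g \<in> borel_measurable lborel" "(\<lambda>t. indicat_real {t1..t2} t *\<^sub>R h' (x0 + t *\<^sub>R l) l) \<in> borel_measurable lborel"
      by measurable
    show "AE t in lborel. ?g t = indicat_real {t1..t2} t *\<^sub>R h' (x0 + t *\<^sub>R l) l"
      using AE_lborel_singleton[of t1] AE_lborel_singleton[of t2] by eventually_elim (auto simp: indicator_def)
  qed
  also have "\<dots> = h (x0 + t2 *\<^sub>R l) - h (x0 + t1 *\<^sub>R l)"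
  proof (rule integral_FTC_atLeastAtMost[OF t])
    show "continuous_on {t1..t2} (\<lambda>t. h' (x0 + t *\<^sub>R l) l)"
      by (intro continuous_on_compose2[OF c]) (auto intro!: continuous_intros)
    fix t assume "t1 \<le> t" "t \<le> t2"
    have "((\<lambda>t. x0 + t *\<^sub>R l) has_derivative (\<lambda>s. s *\<^sub>R l)) (at t within {t1..t2})"
      by (auto intro!: derivative_eq_intros)
    from has_derivative_compose[OF this h[of "x0 + t *\<^sub>R l"]]
    have "((\<lambda>t. h (x0 + t *\<^sub>R l)) has_derivative (\<lambda>s. h' (x0 + t *\<^sub>R l) (s *\<^sub>R l))) (at t within {t1..t2})" .
    then show "((\<lambda>t. h (x0 + t *\<^sub>R l)) has_vector_derivative h' (x0 + t *\<^sub>R l) l) (at t within {t1..t2})"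
      unfolding has_vector_derivative_def
      by (simp add: linear_scale[OF has_derivative_linear[OF h]] mult.commute)
  qed
  finally show ?thesis .
qed

text \<open>For \<open>d(h \<and> dx\<^sub>1 \<and> \<dots> \<and> dx\<^sub>k)\<close>, the forms that see a chain through the projection.\<close>

definition exterior_form :: "(real^3) list \<Rightarrow> (real^3 \<Rightarrow> real^3 \<Rightarrow> real) \<Rightarrow> real^3 \<Rightarrow> (real^3) list \<Rightarrow> real" where
  "exterior_form es h' x vs = (\<Sum>b\<in>Basis. h' x b * kvector_inner (b # es) vs)"

lemma smooth_form_exterior:
  assumes "\<And>v. real_polynomial_function (\<lambda>x. h' x v)"
  shows "smooth_form (Suc (length es)) (exterior_form es h')"
  unfolding smooth_form_def exterior_form_def
proof (intro conjI allI impI)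
  fix x :: "real^3"
  show "alternating_form (Suc (length es)) (\<lambda>vs. \<Sum>b\<in>Basis. h' x b * kvector_inner (b # es) vs)"
    using alternating_form_kvector_inner[of "_ # es"] by (intro alternating_form_sum alternating_form_scale) auto
next
  fix vs
  show "smooth (\<lambda>x. \<Sum>b\<in>Basis. h' x b * kvector_inner (b # es) vs)"
    by (intro smooth_polynomial real_polynomial_function_sum real_polynomial_function.intros(2,4) assms finite_Basis)
qed

text \<open>The determinant with first vector \<open>b\<close> reduces to
  \<open>b \<bullet> l\<close>, and the sum over the standard basis reassembles \<open>l\<close>. So
  on a frame that starts with the fibre direction the form is the derivative along the
  fibre.\<close>

lemma exterior_form_transversal:
  assumes es: "orthonormal_frame es" and l: "proj es l = 0" and bs: "dual_frame es bs" and h: "linear (h' x)"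
  shows "exterior_form es h' x (l # bs) = h' x l"
proof -
  have "exterior_form es h' x (l # bs) = (\<Sum>b\<in>Basis. (l \<bullet> b) * h' x b)"
    unfolding exterior_form_def kvector_inner_transversal[OF es l bs] by (simp add: inner_commute mult.commute)
  also have "\<dots> = h' x (\<Sum>b\<in>Basis. (l \<bullet> b) *\<^sub>R b)"
    by (simp add: linear_sum[OF h] linear_scale[OF h])
  finally show ?thesis by (simp add: euclidean_representation)
qed

text \<open>In the degenerate case both sides vanish. Otherwise integrate first along the fibres:
  the inner integral is the difference of \<open>h\<close> at the two ends of the segment, and up to
  the common sign this is the fibre sum of the boundary.\<close>

lemma stokes_cell:
  assumes es: "orthonormal_frame es" "cell_dim \<tau> = Suc (length es)"
    and h: "real_polynomial_function h" "\<And>x. (h has_derivative h' x) (at x)" "\<And>v. real_polynomial_function (\<lambda>x. h' x v)"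
  shows "formal_integral (length es) (\<lambda>x vs. h x * kvector_inner es vs) (cell_boundary \<tau>) =
    cell_integral (exterior_form es h') \<tau>"
proof -
  let ?A = "cell_set \<tau>" and ?V = "direction_space (cell_set \<tau>)" and ?vs = "cell_frame \<tau>"
  let ?\<mu> = "frame_measure 0 es"
  let ?c = "cell_boundary \<tau>"
  note A = oriented_cell_props[of \<tau>]
  obtain l where l: "l \<in> ?V" "proj es l = 0" "norm l = 1" by (rule facet_kernel_direction_exists[OF es])
  have span: "AE y in ?\<mu>. y \<in> span (set es)" using AE_frame_measure_plane[of 0 es] by simp
  have lv: "length ?vs = Suc (length es)" using A(3) es(2) by simp
  have hl: "linear (h' x)" for x by (rule has_derivative_linear[OF h(2)])
  have hm [measurable]: "(\<lambda>x. h' x v) \<in> borel_measurable borel" for v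
    by (intro borel_measurable_continuous_onI continuous_on_real_polynomial h(3))
  have [measurable]: "h \<in> borel_measurable borel"
    by (intro borel_measurable_continuous_onI continuous_on_real_polynomial h(1))
  have wm: "(\<lambda>x. exterior_form es h' x vs) \<in> borel_measurable borel" for vs
    unfolding exterior_form_def by measurable
  have fi: "formal_integral (length es) (\<lambda>x vs. h x * kvector_inner es vs) ?c = (\<integral>y. fibre_sum es ?c h y \<partial>?\<mu>)"
    by (rule formal_integral_fibre_sum[OF es(1) h(1)])
  have ci: "cell_integral (exterior_form es h') \<tau> =
      (\<integral>x. indicat_real ?A x * exterior_form es h' x ?vs \<partial>frame_measure (SOME p. p \<in> ?A) ?vs)"
    by (rule cell_integral_eq[OF wm])
  show ?thesis
  proof (cases "kvector_inner (l # es) ?vs = 0")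
    case True
    have m0: "mult es ?c x = 0" for x by (rule mult_boundary_degenerate[OF es l True])
    have "(\<integral>y. fibre_sum es ?c h y \<partial>?\<mu>) = (\<integral>y. 0 \<partial>?\<mu>)"
    proof (rule integral_cong_AE)
      show "AE y in ?\<mu>. fibre_sum es ?c h y = 0"
        using span
      proof eventually_elim
        case (elim y)
        then show ?case using fibre_sum_eq[OF es(1) elim, of "{}" ?c h] m0 by simp
      qed
      show "fibre_sum es ?c h \<in> borel_measurable ?\<mu>" unfolding fibre_sum_def by measurable
    qed simp
    moreover have "exterior_form es h' x ?vs = 0" for x
      unfolding exterior_form_def using kvector_inner_degenerate[OF es l True] by simp
    ultimately show ?thesis unfolding fi ci by simp
  next
    case K: False
    let ?s = "sgn (kvector_inner (l # es) ?vs)"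
    let ?p = "SOME p. p \<in> ?A"
    obtain bs where bs: "dual_frame es bs" "ordered_basis ?V (l # bs)" "set bs \<subseteq> ?V"
      by (rule transversal_frame[OF es l kernel_line[OF es l K]])
    obtain r where r: "frame_ratio r ?vs (l # bs)" using frame_ratio_exists[OF A(2) bs(2)] .
    have r0: "r \<noteq> 0" by (rule frame_ratio_nonzero[OF r])
    have "1 = r * kvector_inner (l # es) ?vs"
      using frame_ratio_form[OF r] alternating_form_kvector_inner[of "l # es"] lv
        kvector_inner_transversal[OF es(1) l(2) bs(1), of l] l(3) by (simp add: dot_square_norm)
    then have sr: "sgn r = ?s" by (metis mult_cancel_right2 sgn_mult sgn_1 mult.commute sgn_real_def mult_minus_left mult_1 r0 minus_minus K)
    have w: "exterior_form es h' x ?vs = h' x l / r" for x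
    proof -
      have "alternating_form (length ?vs) (exterior_form es h' x)"
        using smooth_form_exterior[of h' es] h(3) lv by (simp add: smooth_form_def)
      from frame_ratio_form[OF r this] exterior_form_transversal[OF es(1) l(2) bs(1) hl]
      show ?thesis using r0 by (simp add: field_simps)
    qed
    let ?L = "lift es ?p bs"
    let ?f = "\<lambda>x. indicat_real ?A x * h' x l"
    have int: "integrable (frame_measure ?p (l # bs)) ?f"
      by (rule integrable_frame_measure_cell[OF bs(2)]) (intro continuous_on_real_polynomial h(3))
    have "cell_integral (exterior_form es h') \<tau> = (\<integral>x. ?f x / r \<partial>frame_measure ?p ?vs)"
      unfolding ci w by simp
    also have "\<dots> = (\<integral>x. \<bar>r\<bar> *\<^sub>R (?f x / r) \<partial>frame_measure ?p (l # bs))"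
      unfolding frame_ratio_density[OF r] by (rule integral_density) simp_all
    also have "\<dots> = ?s * (\<integral>x. ?f x \<partial>frame_measure ?p (l # bs))"
    proof -
      have "\<bar>r\<bar> *\<^sub>R (?f x / r) = ?s * ?f x" for x
        unfolding sr[symmetric] using r0 by (simp add: sgn_real_def)
      then show ?thesis by simp
    qed
    also have "\<dots> = (\<integral>y. ?s * (\<integral>t. ?f (?L y + t *\<^sub>R l) \<partial>lborel) \<partial>?\<mu>)"
      unfolding integral_transversal[OF es(1) bs(1) int] by simp
    also have "\<dots> = (\<integral>y. fibre_sum es ?c h y \<partial>?\<mu>)"
    proof (rule integral_cong_AE)
      have "(\<lambda>y. \<integral>t. ?f (?L y + t *\<^sub>R l) \<partial>lborel) \<in> borel_measurable borel"
        by (intro lborel.borel_measurable_lebesgue_integral) measurable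
      then show "(\<lambda>y. ?s * (\<integral>t. ?f (?L y + t *\<^sub>R l) \<partial>lborel)) \<in> borel_measurable ?\<mu>" by measurable
      show "fibre_sum es ?c h \<in> borel_measurable ?\<mu>" unfolding fibre_sum_def by measurable
      show "AE y in ?\<mu>. ?s * (\<integral>t. ?f (?L y + t *\<^sub>R l) \<partial>lborel) = fibre_sum es ?c h y"
        using span boundary_fibre[OF es l K]
      proof eventually_elim
        case (elim y)
        have pL: "proj es (?L y + t *\<^sub>R l) = y" for t
          using proj_lift[OF es(1) bs(1) elim(1)] l(2) by (simp add: linear_add[OF linear_proj] linear_scale[OF linear_proj])
        show ?case
        proof (cases "\<exists>x0\<in>?A. proj es x0 = y")
          case False
          then have "indicat_real ?A (?L y + t *\<^sub>R l) = 0" for t using pL by (auto simp: indicator_def)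
          moreover have "fibre_sum es ?c h y = 0"
            using fibre_sum_eq[OF es(1) elim(1), of "{}" ?c h] elim(2) False by simp
          ultimately show ?thesis by simp
        next
          case True
          then obtain x0 where x0: "x0 \<in> ?A" "proj es x0 = y" by blast
          obtain t1 t2 where t: "t1 < 0" "0 < t2" "\<And>t. x0 + t *\<^sub>R l \<in> ?A \<longleftrightarrow> t1 < t \<and> t < t2"
            and m: "\<And>x. proj es x = y \<Longrightarrow> real_of_int (mult es ?c x) =
              ?s * ((if x = x0 + t2 *\<^sub>R l then 1 else 0) - (if x = x0 + t1 *\<^sub>R l then 1 else 0))"
            using elim(2) x0 by blast
          have "?L y - ?p \<in> span (set bs)" by (rule lift_in_plane) (use bs(1) in \<open>simp add: dual_frame_def\<close>)
          then have Lp: "?L y - ?p \<in> ?V" using span_minimal[OF bs(3) subspace_direction_space] by blast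
          have "x0 - ?p \<in> ?V"
            using affine_hull_iff_direction_space[OF some_in_cell[of \<tau>], of x0] x0(1) by (simp add: hull_inc)
          from subspace_diff[OF subspace_direction_space Lp this] have "?L y - x0 \<in> ?V" by simp
          moreover have "proj es (?L y - x0) = 0" using pL[of 0] x0(2) by (simp add: linear_diff[OF linear_proj])
          ultimately have "?L y - x0 = ((?L y - x0) \<bullet> l) *\<^sub>R l" by (rule kernel_line[OF es l K])
          then have z: "?L y = x0 + ((?L y - x0) \<bullet> l) *\<^sub>R l" by (simp add: algebra_simps)
          have J: "(\<integral>t. ?f (?L y + t *\<^sub>R l) \<partial>lborel) = h (x0 + t2 *\<^sub>R l) - h (x0 + t1 *\<^sub>R l)"
            by (rule integral_line_derivative[OF h(2) _ _ z t(3)])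
              (use t(1,2) in \<open>auto intro: continuous_on_real_polynomial h(3)\<close>)
          have l0: "l \<noteq> 0" using l(3) by auto
          have ne: "x0 + t1 *\<^sub>R l \<noteq> x0 + t2 *\<^sub>R l" using t(1,2) l0 by auto
          have pe: "proj es (x0 + e *\<^sub>R l) = y" for e
            using x0(2) l(2) by (simp add: linear_add[OF linear_proj] linear_scale[OF linear_proj])
          have "fibre_sum es ?c h y = (\<Sum>x\<in>{x0 + t1 *\<^sub>R l, x0 + t2 *\<^sub>R l}. real_of_int (mult es ?c x) * h x)"
          proof (rule fibre_sum_eq[OF es(1) elim(1)])
            fix x assume "proj es x = y" "mult es ?c x \<noteq> 0"
            then show "x \<in> {x0 + t1 *\<^sub>R l, x0 + t2 *\<^sub>R l}" using m[of x] by (auto split: if_splits)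
          qed (use pe in auto)
          also have "\<dots> = ?s * (h (x0 + t2 *\<^sub>R l) - h (x0 + t1 *\<^sub>R l))"
            using ne by (simp add: m[OF pe] algebra_simps)
          finally show ?thesis unfolding J by simp
        qed
      qed
    qed
    finally show ?thesis unfolding fi by simp
  qed
qed

lemma formal_integral_zero [simp]: "formal_integral k \<omega> 0 = 0"
  by (simp add: formal_integral_def)

lemma formal_integral_sum: "formal_integral k \<omega> (\<Sum>i\<in>I. c i) = (\<Sum>i\<in>I. formal_integral k \<omega> (c i))"
  by (induction I rule: infinite_finite_induct) (auto simp: formal_integral_add)

lemma formal_integral_cmul: "formal_integral k \<omega> (frag_cmul a c) = of_int a * formal_integral k \<omega> c"
proof -
  have "Poly_Mapping.keys (frag_cmul a c) \<subseteq> Poly_Mapping.keys c" by (simp add: keys_cmul)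
  then show ?thesis
    by (subst formal_integral_superset[of "Poly_Mapping.keys c"])
      (auto simp: formal_integral_def sum_distrib_left intro!: sum.cong)
qed

lemma formal_integral_frag_of:
  "formal_integral k \<omega> (frag_of \<sigma>) = (if cell_dim \<sigma> = k then cell_integral \<omega> \<sigma> else 0)"
  by (subst formal_integral_superset[of "{\<sigma>}"]) auto

lemma cell_boundary_facet_cells:
  "cell_boundary \<tau> = (\<Sum>F | F facet_of closure (cell_set \<tau>). frag_cmul (facet_sign \<tau> F) (frag_of (facet_cell F)))"
  by (simp add: cell_boundary_def facet_cell_def)

lemma formal_integral_boundary_dim:
  assumes "cell_dim \<tau> \<noteq> Suc k"
  shows "formal_integral k \<omega> (cell_boundary \<tau>) = 0"
  unfolding cell_boundary_facet_cells formal_integral_sum formal_integral_cmul formal_integral_frag_of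
  using facet_cell_props(3)[of _ \<tau>] assms by (intro sum.neutral) auto

lemma stokes_chain:
  assumes es: "orthonormal_frame es"
    and h: "real_polynomial_function h" "\<And>x. (h has_derivative h' x) (at x)" "\<And>v. real_polynomial_function (\<lambda>x. h' x v)"
  shows "formal_integral (length es) (\<lambda>x vs. h x * kvector_inner es vs) (frag_extend cell_boundary c) =
    formal_integral (Suc (length es)) (exterior_form es h') c"
proof -
  have "formal_integral (length es) (\<lambda>x vs. h x * kvector_inner es vs) (frag_extend cell_boundary c) =
      (\<Sum>\<tau>\<in>Poly_Mapping.keys c. of_int (Poly_Mapping.lookup c \<tau>) *
        formal_integral (length es) (\<lambda>x vs. h x * kvector_inner es vs) (cell_boundary \<tau>))"
    by (simp add: frag_extend_def formal_integral_sum formal_integral_cmul)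
  also have "\<dots> = formal_integral (Suc (length es)) (exterior_form es h') c"
    unfolding formal_integral_def[of _ _ c]
    by (intro sum.cong refl) (auto simp: stokes_cell[OF es _ h] formal_integral_boundary_dim)
  finally show ?thesis .
qed

text \<open>By Stokes' theorem, integrals of test forms over the boundary depend only on integrals
  over the chain, although the boundary is formed from formal sums.\<close>

lemma mult_boundary_same_integrals:
  assumes es: "orthonormal_frame es" and c: "same_integrals c c'"
  shows "AE y in frame_measure 0 es. \<forall>x. proj es x = y \<longrightarrow>
    mult es (frag_extend cell_boundary c) x = mult es (frag_extend cell_boundary c') x"
proof -
  have "AE y in frame_measure 0 es. \<forall>x. proj es x = y \<longrightarrow> mult es (frag_extend cell_boundary (c - c')) x = 0"
  proof (rule mult_AE_zero[OF es])
    fix h :: "real^3 \<Rightarrow> real" assume h: "real_polynomial_function h"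
    obtain h' where h': "\<And>x. (h has_derivative h' x) (at x)" "\<And>v. real_polynomial_function (\<lambda>x. h' x v)"
      using real_polynomial_derivative[OF h] by blast
    have "formal_integral (Suc (length es)) (exterior_form es h') c =
        formal_integral (Suc (length es)) (exterior_form es h') c'"
      using c smooth_form_exterior[of h' es] h'(2) unfolding same_integrals_def by blast
    then show "formal_integral (length es) (\<lambda>x vs. h x * kvector_inner es vs) (frag_extend cell_boundary (c - c')) = 0"
      unfolding stokes_chain[OF es h h'] using formal_integral_add[of _ _ c "- c'"]
      by (simp add: formal_integral_uminus)
  qed
  then show ?thesis by (simp add: frag_extend_diff mult_diff)
qed

section \<open>Projections do not increase mass; slices of boundaries\<close>

lemma norm_proj_le:
  assumes es: "orthonormal_frame es"
  shows "norm (proj es x) \<le> norm x"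
proof -
  have "(norm (proj es x))\<^sup>2 = (\<Sum>i<length es. (x \<bullet> es ! i)\<^sup>2)"
    unfolding proj_def by (rule norm_plane_sum[OF es])
  also have "\<dots> = proj es x \<bullet> x"
    unfolding proj_def inner_sum_left by (simp add: power2_eq_square inner_commute[of x])
  also have "\<dots> \<le> norm (proj es x) * norm x" by (rule norm_cauchy_schwarz)
  finally show ?thesis by (cases "norm (proj es x) = 0") (auto simp: power2_eq_square)
qed

text \<open>Cauchy-Schwarz for simple unit multivectors, by volume: the unit balls of the two planes
  have equal volume in orthonormal coordinates, the projection maps the one into the other, and it
  scales volume by the absolute value of the determinant.\<close>

lemma kvector_inner_orthonormal_le:
  assumes es: "orthonormal_frame es" and fs: "orthonormal_frame fs" and l: "length fs = length es"
  shows "\<bar>kvector_inner es fs\<bar> \<le> 1"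
proof (cases "kvector_inner es fs = 0")
  case False
  let ?B = "cball (0::real^3) 1"
  have Bm: "?B \<in> sets borel" by simp
  have ind: "(indicator ?B :: _ \<Rightarrow> ennreal) \<in> borel_measurable borel"
    by (intro borel_measurable_indicator Bm)
  obtain bs where bs: "dual_frame es bs" "ordered_basis (span (set fs)) bs"
    using dual_frame_exists_nonzero[OF es orthonormal_frame_basis[OF fs] l False] by blast
  obtain r where r: "frame_ratio r fs bs" using frame_ratio_exists[OF orthonormal_frame_basis[OF fs] bs(2)] .
  have rK: "1 = r * kvector_inner es fs"
    using frame_ratio_form[OF r] alternating_form_kvector_inner[of es] l kvector_inner_dual[OF bs(1)] by simp
  have ball: "emeasure (frame_measure 0 gs) ?B = emeasure (\<Pi>\<^sub>M i\<in>{..<length es}. lborel :: real measure)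
      ({t. (\<Sum>i<length es. (t i)\<^sup>2) \<le> 1} \<inter> space (\<Pi>\<^sub>M i\<in>{..<length es}. lborel))"
    if gs: "orthonormal_frame gs" "length gs = length es" for gs
  proof -
    have *: "frame_point 0 gs t \<in> ?B \<longleftrightarrow> (\<Sum>i<length es. (t i)\<^sup>2) \<le> 1" for t
    proof -
      have "(norm (frame_point 0 gs t))\<^sup>2 = (\<Sum>i<length es. (t i)\<^sup>2)"
        using norm_plane_sum[OF gs(1), of t] gs(2) by (simp add: frame_point_def)
      moreover have "(norm (frame_point 0 gs t) \<le> 1) = ((norm (frame_point 0 gs t))\<^sup>2 \<le> 1)"
        using abs_square_le_1[of "norm (frame_point 0 gs t)"] by simp
      ultimately show ?thesis by simp
    qed
    have "frame_point 0 gs -` ?B = {t. (\<Sum>i<length es. (t i)\<^sup>2) \<le> 1}"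
      by (rule set_eqI) (simp only: vimage_eq mem_Collect_eq *)
    moreover have "emeasure (frame_measure 0 gs) ?B =
        emeasure (\<Pi>\<^sub>M i\<in>{..<length gs}. lborel) (frame_point 0 gs -` ?B \<inter> space (\<Pi>\<^sub>M i\<in>{..<length gs}. lborel))"
      unfolding frame_measure_def by (rule emeasure_distr[OF frame_point_measurable Bm])
    ultimately show ?thesis using gs(2) by simp
  qed
  let ?m = "emeasure (frame_measure 0 es) ?B"
  have fin: "?m < \<infinity>" by (rule emeasure_frame_measure_bounded[OF orthonormal_frame_basis[OF es] bounded_cball])
  have pos: "0 < ?m"
  proof -
    \<comment> \<open>A cube of this side with a corner at the centre lies in the unit ball;
      \<open>Suc\<close> keeps the denominator positive for the empty frame.\<close>
    let ?d = "1 / real (Suc (length es))"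
    let ?S = "{x. \<forall>j<length es. (x - 0) \<bullet> es ! j \<in> {0..?d}}"
    have "0 < ennreal (?d ^ length es)" by simp
    also have "ennreal (?d ^ length es) = (\<Prod>j<length es. emeasure lborel {0..?d})" by (simp add: ennreal_power)
    also have "\<dots> = emeasure (frame_measure 0 es) ?S"
      by (rule emeasure_frame_measure_box(2)[OF es, symmetric]) simp
    also have "\<dots> \<le> ?m"
    proof (rule emeasure_mono_AE)
      show "AE x in frame_measure 0 es. x \<in> ?S \<longrightarrow> x \<in> ?B"
        using AE_frame_measure_plane[of 0 es]
      proof (eventually_elim, intro impI)
        fix x assume x: "x - 0 \<in> span (set es)" "x \<in> ?S"
        have "norm x \<le> (\<Sum>i<length es. \<bar>x \<bullet> es ! i\<bar>)" using norm_plane_le_sum[OF es, of x] x(1) by simp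
        also have "\<dots> \<le> (\<Sum>i<length es. ?d)" using x(2) by (intro sum_mono) auto
        also have "\<dots> \<le> 1" by simp
        finally show "x \<in> ?B" by simp
      qed
    qed (use Bm in simp)
    finally show ?thesis .
  qed
  have "?m = emeasure (frame_measure 0 fs) ?B" using ball[OF es] ball[OF fs l] by simp
  also have "\<dots> = (\<integral>\<^sup>+ x. indicator ?B x \<partial>frame_measure 0 fs)" by simp
  also have "\<dots> = ennreal \<bar>r\<bar> * (\<integral>\<^sup>+ x. indicator ?B x \<partial>frame_measure 0 bs)" by (rule frame_ratio_integral[OF r ind])
  also have "(\<integral>\<^sup>+ x. indicator ?B x \<partial>frame_measure 0 bs) = (\<integral>\<^sup>+ y. indicator ?B (lift es 0 bs y) \<partial>frame_measure 0 es)"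
    by (rule frame_measure_lift[OF es bs(1) ind])
  also have "\<dots> \<le> (\<integral>\<^sup>+ y. indicator ?B y \<partial>frame_measure 0 es)"
  proof (rule nn_integral_mono_AE)
    show "AE y in frame_measure 0 es. (indicator ?B (lift es 0 bs y) :: ennreal) \<le> indicator ?B y"
      using AE_frame_measure_plane[of 0 es]
    proof eventually_elim
      fix y assume "y - 0 \<in> span (set es)"
      then have "norm y \<le> norm (lift es 0 bs y)"
        using norm_proj_le[OF es, of "lift es 0 bs y"] proj_lift[OF es bs(1), of y 0] by simp
      then show "(indicator ?B (lift es 0 bs y) :: ennreal) \<le> indicator ?B y" by (simp add: indicator_def)
    qed
  qed
  also have "\<dots> = ?m" by simp
  finally have "?m \<le> ennreal \<bar>r\<bar> * ?m" by (simp add: mult_left_mono)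
  then have "1 \<le> \<bar>r\<bar>"
  proof -
    obtain m where m: "?m = ennreal m" "0 < m" using pos fin by (cases ?m) auto
    from \<open>?m \<le> ennreal \<bar>r\<bar> * ?m\<close> have "m \<le> \<bar>r\<bar> * m"
      unfolding m(1) using m(2) by (simp add: ennreal_mult'[symmetric])
    then show ?thesis using m(2) by simp
  qed
  moreover have "\<bar>r\<bar> * \<bar>kvector_inner es fs\<bar> = 1" using rK by (metis abs_mult abs_one)
  ultimately show ?thesis by (metis abs_ge_zero mult_right_mono mult_1)
qed simp

lemma orthonormal_frame_Cons:
  assumes es: "orthonormal_frame es" and l: "proj es l = 0" "norm l = 1"
  shows "orthonormal_frame (l # es)"
  unfolding orthonormal_frame_def
proof (intro allI impI)
  fix i j assume "i < length (l # es)" "j < length (l # es)"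
  then show "(l # es) ! i \<bullet> (l # es) ! j = (if i = j then 1 else 0)"
    using es l(1) proj_eq_0_iff[OF es, of l] l(2)
    by (cases i; cases j) (auto simp: orthonormal_frame_def inner_commute dot_square_norm)
qed

text \<open>The Hausdorff measure of the parts of a cell.\<close>

definition cell_measure :: "oriented_cell \<Rightarrow> (real^3) measure" where
  "cell_measure \<sigma> = density
     (frame_measure (SOME p. p \<in> cell_set \<sigma>)
       (SOME fs. orthonormal_frame fs \<and> span (set fs) = direction_space (cell_set \<sigma>)))
     (\<lambda>x. hausdorff_factor (cell_dim \<sigma>) * indicator (cell_set \<sigma>) x)"

lemma sets_cell_measure [simp, measurable_cong]: "sets (cell_measure \<sigma>) = sets borel"
  by (simp add: cell_measure_def)

lemma cell_measure_frame:
  obtains p fs where "p \<in> cell_set \<sigma>" "orthonormal_frame fs" "span (set fs) = direction_space (cell_set \<sigma>)"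
    "length fs = cell_dim \<sigma>" "ordered_basis (direction_space (cell_set \<sigma>)) fs" "p = (SOME p. p \<in> cell_set \<sigma>)"
    "\<forall>B\<in>sets borel. emeasure (cell_measure \<sigma>) B =
      hausdorff_factor (cell_dim \<sigma>) * emeasure (frame_measure p fs) (cell_set \<sigma> \<inter> B)"
proof -
  define p where "p = (SOME p. p \<in> cell_set \<sigma>)"
  define fs where "fs = (SOME fs. orthonormal_frame fs \<and> span (set fs) = direction_space (cell_set \<sigma>))"
  have "\<exists>fs. orthonormal_frame fs \<and> span (set fs) = direction_space (cell_set \<sigma>)"
    using orthonormal_frame_exists[OF subspace_direction_space] by metis
  from someI_ex[OF this] have P: "orthonormal_frame fs" "span (set fs) = direction_space (cell_set \<sigma>)"
    by (simp_all add: fs_def)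
  have ob: "ordered_basis (direction_space (cell_set \<sigma>)) fs"
    using orthonormal_frame_basis[OF P(1)] P(2) by simp
  have l: "length fs = cell_dim \<sigma>" using ob oriented_cell_props(2,3)[of \<sigma>] by (simp add: ordered_basis_iff)
  have e: "emeasure (cell_measure \<sigma>) B =
      hausdorff_factor (cell_dim \<sigma>) * emeasure (frame_measure p fs) (cell_set \<sigma> \<inter> B)" if B [measurable]: "B \<in> sets borel" for B
  proof -
    have "emeasure (cell_measure \<sigma>) B = (\<integral>\<^sup>+ x. hausdorff_factor (cell_dim \<sigma>) * indicator (cell_set \<sigma>) x * indicator B x \<partial>frame_measure p fs)"
      unfolding cell_measure_def p_def[symmetric] fs_def[symmetric] by (rule emeasure_density) (use B in simp_all)
    also have "\<dots> = (\<integral>\<^sup>+ x. hausdorff_factor (cell_dim \<sigma>) * indicator (cell_set \<sigma> \<inter> B) x \<partial>frame_measure p fs)"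
      by (intro nn_integral_cong) (auto simp: indicator_def)
    also have "\<dots> = hausdorff_factor (cell_dim \<sigma>) * emeasure (frame_measure p fs) (cell_set \<sigma> \<inter> B)"
      by (rule nn_integral_cmult_indicator) simp
    finally show ?thesis .
  qed
  have p: "p \<in> cell_set \<sigma>" unfolding p_def by (rule some_in_cell)
  show ?thesis by (rule that[OF p P l ob p_def]) (use e in blast)
qed

lemma emeasure_cell_measure_UNIV: "emeasure (cell_measure \<sigma>) UNIV = ennreal (cell_mass \<sigma>)"
proof -
  obtain p fs where "p \<in> cell_set \<sigma>" "orthonormal_frame fs" "span (set fs) = direction_space (cell_set \<sigma>)"
    "\<forall>B\<in>sets borel. emeasure (cell_measure \<sigma>) B =
      hausdorff_factor (cell_dim \<sigma>) * emeasure (frame_measure p fs) (cell_set \<sigma> \<inter> B)"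
    using cell_measure_frame[of \<sigma>] by metis
  then show ?thesis using cell_mass_eq[of fs \<sigma> p] by simp
qed

lemma finite_measure_cell_measure: "finite_measure (cell_measure \<sigma>)"
proof
  have "space (cell_measure \<sigma>) = UNIV" by (simp add: cell_measure_def)
  then show "emeasure (cell_measure \<sigma>) (space (cell_measure \<sigma>)) \<noteq> \<infinity>"
    by (simp add: emeasure_cell_measure_UNIV)
qed

text \<open>The ratio of an orthonormal frame of the plane to the dual frame is the reciprocal of a
  determinant of absolute value at most 1.\<close>

lemma cell_shadow_le:
  assumes es: "orthonormal_frame es" and s: "cell_sign es \<sigma> \<noteq> 0" and B: "B \<in> sets borel"
  shows "hausdorff_factor (length es) * (\<integral>\<^sup>+ y. indicator (cell_set \<sigma> \<inter> B) (cell_lift es \<sigma> y) \<partial>frame_measure 0 es)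
    \<le> emeasure (cell_measure \<sigma>) B"
proof -
  obtain p fs where fs: "p \<in> cell_set \<sigma>" "orthonormal_frame fs" "span (set fs) = direction_space (cell_set \<sigma>)"
    "length fs = cell_dim \<sigma>" "ordered_basis (direction_space (cell_set \<sigma>)) fs" "p = (SOME p. p \<in> cell_set \<sigma>)"
    "\<forall>B\<in>sets borel. emeasure (cell_measure \<sigma>) B =
      hausdorff_factor (cell_dim \<sigma>) * emeasure (frame_measure p fs) (cell_set \<sigma> \<inter> B)"
    by (rule cell_measure_frame[of \<sigma>])
  obtain bs where bs: "dual_frame es bs" "ordered_basis (direction_space (cell_set \<sigma>)) bs"
    "cell_lift es \<sigma> = lift es (SOME p. p \<in> cell_set \<sigma>) bs" by (rule cell_lift_frame[OF es s])
  have d: "cell_dim \<sigma> = length es" using s by (auto simp: cell_sign_def split: if_splits)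
  obtain r where r: "frame_ratio r fs bs" using frame_ratio_exists[OF fs(5) bs(2)] .
  have rK: "1 = r * kvector_inner es fs"
    using frame_ratio_form[OF r] alternating_form_kvector_inner[of es] fs(4) d kvector_inner_dual[OF bs(1)] by simp
  have r1: "1 \<le> \<bar>r\<bar>"
  proof -
    have "1 = \<bar>r\<bar> * \<bar>kvector_inner es fs\<bar>" using rK by (metis abs_mult abs_one)
    also have "\<dots> \<le> \<bar>r\<bar> * 1" using kvector_inner_orthonormal_le[OF es fs(2)] fs(4) d by (intro mult_left_mono) auto
    finally show ?thesis by simp
  qed
  have ind: "(indicator (cell_set \<sigma> \<inter> B) :: _ \<Rightarrow> ennreal) \<in> borel_measurable borel" using B by simp
  let ?J = "\<integral>\<^sup>+ y. indicator (cell_set \<sigma> \<inter> B) (cell_lift es \<sigma> y) \<partial>frame_measure 0 es"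
  have "?J = 1 * (\<integral>\<^sup>+ x. indicator (cell_set \<sigma> \<inter> B) x \<partial>frame_measure p bs)"
    unfolding bs(3) fs(6) frame_measure_lift[OF es bs(1) ind] by simp
  also have "\<dots> \<le> ennreal \<bar>r\<bar> * (\<integral>\<^sup>+ x. indicator (cell_set \<sigma> \<inter> B) x \<partial>frame_measure p bs)"
    using ennreal_leI[OF r1] by (intro mult_right_mono) simp_all
  also have "\<dots> = (\<integral>\<^sup>+ x. indicator (cell_set \<sigma> \<inter> B) x \<partial>frame_measure p fs)"
    by (rule frame_ratio_integral[OF r ind, symmetric])
  also have "\<dots> = emeasure (frame_measure p fs) (cell_set \<sigma> \<inter> B)" using B by simp
  finally have "hausdorff_factor (length es) * ?J \<le> hausdorff_factor (length es) * emeasure (frame_measure p fs) (cell_set \<sigma> \<inter> B)"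
    by (intro mult_left_mono) auto
  then show ?thesis using bspec[OF fs(7) B] d by simp
qed

lemma fibre_sum_measurable_pair:
  assumes "(u :: real^3 \<Rightarrow> real) \<in> borel_measurable borel"
  shows "(\<lambda>(s, y). fibre_sum es c (\<lambda>x. indicat_real {x. u x < s} x) y) \<in> borel_measurable (borel \<Otimes>\<^sub>M borel)"
proof -
  note assms [measurable]
  have e: "indicat_real {x. u x < s} z = indicat_real {0<..} (s - u z)" for s :: real and z by (simp add: indicator_def)
  show ?thesis unfolding fibre_sum_def e by measurable
qed

text \<open>A coarea inequality. The ends of a fibre segment have opposite signs, so the fibre sum
  over \<open>u < s\<close> is nonzero only for \<open>s\<close> between the values of
  \<open>u\<close> at the ends; such \<open>s\<close> have total length at most that of the segment.
  The lengths of the segments integrate to at most the volume of the cell.\<close>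

lemma boundary_slice:
  fixes u :: "real^3 \<Rightarrow> real"
  assumes es: "orthonormal_frame es" "cell_dim \<tau> = Suc (length es)"
    and u: "\<And>x y. \<bar>u x - u y\<bar> \<le> dist x y"
  shows "hausdorff_factor (Suc (length es)) *
    (\<integral>\<^sup>+ s. (\<integral>\<^sup>+ y. ennreal \<bar>fibre_sum es (cell_boundary \<tau>) (\<lambda>x. indicat_real {x. u x < s} x) y\<bar> \<partial>frame_measure 0 es) \<partial>lborel)
    \<le> ennreal (cell_mass \<tau>)"
proof -
  let ?A = "cell_set \<tau>" and ?V = "direction_space (cell_set \<tau>)" and ?vs = "cell_frame \<tau>"
  let ?\<mu> = "frame_measure 0 es"
  let ?c = "cell_boundary \<tau>"
  let ?\<phi> = "\<lambda>s y. fibre_sum es ?c (\<lambda>x. indicat_real {x. u x < s} x) y"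
  note A = oriented_cell_props[of \<tau>]
  have uc: "continuous_on UNIV u"
    unfolding continuous_on_iff using u by (metis dist_real_def le_less_trans)
  have um [measurable]: "u \<in> borel_measurable borel" by (rule borel_measurable_continuous_onI[OF uc])
  obtain l where l: "l \<in> ?V" "proj es l = 0" "norm l = 1" by (rule facet_kernel_direction_exists[OF es])
  have span: "AE y in ?\<mu>. y \<in> span (set es)" using AE_frame_measure_plane[of 0 es] by simp
  have lv: "length ?vs = Suc (length es)" using A(3) es(2) by simp
  interpret S: sigma_finite_measure ?\<mu> by (rule sigma_finite_frame_measure[OF orthonormal_frame_basis[OF es(1)]])
  interpret P: pair_sigma_finite lborel ?\<mu> ..
  have pm: "(\<lambda>(s, y). ennreal \<bar>?\<phi> s y\<bar>) \<in> borel_measurable (lborel \<Otimes>\<^sub>M ?\<mu>)"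
  proof -
    have [measurable]: "(\<lambda>z. ?\<phi> (fst z) (snd z)) \<in> borel_measurable (borel \<Otimes>\<^sub>M borel)"
      using fibre_sum_measurable_pair[OF um, of es ?c] by (simp add: split_beta)
    have "(\<lambda>z. ennreal \<bar>?\<phi> (fst z) (snd z)\<bar>) \<in> borel_measurable (borel \<Otimes>\<^sub>M borel)" by measurable
    then show ?thesis
      by (simp add: split_beta measurable_cong_sets[OF sets_pair_measure_cong[OF sets_lborel sets_frame_measure] refl])
  qed
  show ?thesis
  proof (cases "kvector_inner (l # es) ?vs = 0")
    case True
    have m0: "mult es ?c x = 0" for x by (rule mult_boundary_degenerate[OF es l True])
    have "(\<integral>\<^sup>+ y. ennreal \<bar>?\<phi> s y\<bar> \<partial>?\<mu>) = (\<integral>\<^sup>+ y. 0 \<partial>?\<mu>)" for s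
    proof (rule nn_integral_cong_AE)
      show "AE y in ?\<mu>. ennreal \<bar>?\<phi> s y\<bar> = 0"
        using span
      proof eventually_elim
        case (elim y)
        then show ?case using fibre_sum_eq[OF es(1) elim, of "{}" ?c] m0 by simp
      qed
    qed
    then show ?thesis by simp
  next
    case K: False
    obtain p fs where fs: "p \<in> cell_set \<tau>" "orthonormal_frame fs" "span (set fs) = direction_space (cell_set \<tau>)"
      "length fs = cell_dim \<tau>" "ordered_basis (direction_space (cell_set \<tau>)) fs" "p = (SOME p. p \<in> cell_set \<tau>)"
      "\<forall>B\<in>sets borel. emeasure (cell_measure \<tau>) B =
        hausdorff_factor (cell_dim \<tau>) * emeasure (frame_measure p fs) (cell_set \<tau> \<inter> B)"
      by (rule cell_measure_frame[of \<tau>])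
    obtain bs where bs: "dual_frame es bs" "ordered_basis ?V (l # bs)" "set bs \<subseteq> ?V"
      by (rule transversal_frame[OF es l kernel_line[OF es l K]])
    obtain r where r: "frame_ratio r fs (l # bs)" using frame_ratio_exists[OF fs(5) bs(2)] .
    have rK: "1 = r * kvector_inner (l # es) fs"
      using frame_ratio_form[OF r] alternating_form_kvector_inner[of "l # es"] fs(4) es(2)
        kvector_inner_transversal[OF es(1) l(2) bs(1), of l] l(3) by (simp add: dot_square_norm)
    have r1: "1 \<le> \<bar>r\<bar>"
    proof -
      have "1 = \<bar>r\<bar> * \<bar>kvector_inner (l # es) fs\<bar>" using rK by (metis abs_mult abs_one)
      also have "\<dots> \<le> \<bar>r\<bar> * 1"
        using kvector_inner_orthonormal_le[OF orthonormal_frame_Cons[OF es(1) l(2,3)] fs(2)] fs(4) es(2)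
        by (intro mult_left_mono) auto
      finally show ?thesis by simp
    qed
    let ?L = "lift es p bs"
    have ind: "(indicator ?A :: _ \<Rightarrow> ennreal) \<in> borel_measurable borel" by simp
    have "(\<integral>\<^sup>+ s. (\<integral>\<^sup>+ y. ennreal \<bar>?\<phi> s y\<bar> \<partial>?\<mu>) \<partial>lborel) = (\<integral>\<^sup>+ y. (\<integral>\<^sup>+ s. ennreal \<bar>?\<phi> s y\<bar> \<partial>lborel) \<partial>?\<mu>)"
      by (rule P.Fubini'[OF pm, symmetric])
    also have "\<dots> \<le> (\<integral>\<^sup>+ y. (\<integral>\<^sup>+ t. indicator ?A (?L y + t *\<^sub>R l) \<partial>lborel) \<partial>?\<mu>)"
    proof (rule nn_integral_mono_AE)
      show "AE y in ?\<mu>. (\<integral>\<^sup>+ s. ennreal \<bar>?\<phi> s y\<bar> \<partial>lborel) \<le> (\<integral>\<^sup>+ t. indicator ?A (?L y + t *\<^sub>R l) \<partial>lborel)"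
        using span boundary_fibre[OF es l K]
      proof eventually_elim
        case (elim y)
        show ?case
        proof (cases "\<exists>x0\<in>?A. proj es x0 = y")
          case False
          have "?\<phi> s y = 0" for s
            using fibre_sum_eq[OF es(1) elim(1), of "{}" ?c] elim(2) False by simp
          then show ?thesis by simp
        next
          case True
          then obtain x0 where x0: "x0 \<in> ?A" "proj es x0 = y" by blast
          obtain t1 t2 where t: "t1 < 0" "0 < t2" "\<And>t. x0 + t *\<^sub>R l \<in> ?A \<longleftrightarrow> t1 < t \<and> t < t2"
            and m: "\<And>x. proj es x = y \<Longrightarrow> real_of_int (mult es ?c x) =
              sgn (kvector_inner (l # es) ?vs) * ((if x = x0 + t2 *\<^sub>R l then 1 else 0) - (if x = x0 + t1 *\<^sub>R l then 1 else 0))"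
            using elim(2) x0 by blast
          let ?e1 = "x0 + t1 *\<^sub>R l" and ?e2 = "x0 + t2 *\<^sub>R l"
          have l0: "l \<noteq> 0" using l(3) by auto
          have ne: "?e1 \<noteq> ?e2" using t(1,2) l0 by auto
          have pe: "proj es (x0 + e *\<^sub>R l) = y" for e
            using x0(2) l(2) by (simp add: linear_add[OF linear_proj] linear_scale[OF linear_proj])
          have two: "(\<Sum>x\<in>{?e1, ?e2}. f x) = f ?e1 + f ?e2" for f :: "real^3 \<Rightarrow> real" using ne by simp
          have fs: "?\<phi> s y = sgn (kvector_inner (l # es) ?vs) * (indicat_real {x. u x < s} ?e2 - indicat_real {x. u x < s} ?e1)" for s
          proof -
            have "?\<phi> s y = (\<Sum>x\<in>{?e1, ?e2}. real_of_int (mult es ?c x) * indicat_real {x. u x < s} x)"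
            proof (rule fibre_sum_eq[OF es(1) elim(1)])
              fix x assume "proj es x = y" "mult es ?c x \<noteq> 0"
              then show "x \<in> {?e1, ?e2}" using m[of x] by (auto split: if_splits)
            qed (use pe in auto)
            also have "\<dots> = sgn (kvector_inner (l # es) ?vs) * (indicat_real {x. u x < s} ?e2 - indicat_real {x. u x < s} ?e1)"
              unfolding two m[OF pe] using ne by (simp add: algebra_simps)
            finally show ?thesis .
          qed
          let ?a = "min (u ?e1) (u ?e2)" and ?b = "max (u ?e1) (u ?e2)"
          have "ennreal \<bar>?\<phi> s y\<bar> \<le> indicator {?a..?b} s" for s
            unfolding fs using K by (auto simp: abs_mult indicator_def sgn_real_def min_def max_def)
          then have "(\<integral>\<^sup>+ s. ennreal \<bar>?\<phi> s y\<bar> \<partial>lborel) \<le> (\<integral>\<^sup>+ s. indicator {?a..?b} s \<partial>lborel)"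
            by (intro nn_integral_mono)
          also have "\<dots> = ennreal (?b - ?a)" by (simp add: emeasure_lborel_Icc_eq)
          also have "\<dots> \<le> ennreal (t2 - t1)"
          proof (rule ennreal_leI)
            have "?b - ?a = \<bar>u ?e2 - u ?e1\<bar>" by (auto simp: min_def max_def)
            also have "\<dots> \<le> dist ?e2 ?e1" by (rule u)
            also have "?e2 - ?e1 = (t2 - t1) *\<^sub>R l" by (simp add: algebra_simps)
            then have "dist ?e2 ?e1 = t2 - t1" unfolding dist_norm using t l(3) by simp
            finally show "?b - ?a \<le> t2 - t1" .
          qed
          also have "\<dots> = (\<integral>\<^sup>+ t. indicator {t1<..<t2} t \<partial>lborel)" using t(1,2) by simp
          also have "\<dots> = (\<integral>\<^sup>+ t. indicator ?A (?L y + t *\<^sub>R l) \<partial>lborel)"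
          proof -
            have pL: "proj es (?L y) = y" by (rule proj_lift[OF es(1) bs(1) elim(1)])
            have "?L y - p \<in> span (set bs)" by (rule lift_in_plane) (use bs(1) in \<open>simp add: dual_frame_def\<close>)
            then have Lp: "?L y - p \<in> ?V" using span_minimal[OF bs(3) subspace_direction_space] by blast
            have "x0 - p \<in> ?V"
              using affine_hull_iff_direction_space[OF \<open>p \<in> ?A\<close>, of x0] x0(1) by (simp add: hull_inc)
            from subspace_diff[OF subspace_direction_space Lp this] have "?L y - x0 \<in> ?V" by simp
            moreover have "proj es (?L y - x0) = 0" using pL x0(2) by (simp add: linear_diff[OF linear_proj])
            ultimately have "?L y - x0 = ((?L y - x0) \<bullet> l) *\<^sub>R l" by (rule kernel_line[OF es l K])
            then obtain t0 where z: "?L y = x0 + t0 *\<^sub>R l" by (metis add.commute diff_add_cancel)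
            have "(\<integral>\<^sup>+ t. indicator {t1<..<t2} t \<partial>lborel) = ennreal \<bar>1\<bar> * (\<integral>\<^sup>+ t. indicator {t1<..<t2} (t0 + 1 * t) \<partial>lborel)"
              by (rule nn_integral_real_affine) auto
            also have "\<dots> = (\<integral>\<^sup>+ t. indicator ?A (?L y + t *\<^sub>R l) \<partial>lborel)"
            proof -
              have "indicator {t1<..<t2} (t0 + 1 * s) = (indicator ?A (?L y + s *\<^sub>R l) :: ennreal)" for s
              proof -
                have e: "?L y + s *\<^sub>R l = x0 + (t0 + 1 * s) *\<^sub>R l" unfolding z by (simp add: algebra_simps)
                show ?thesis unfolding e using t(3)[of "t0 + 1 * s"] by (simp add: indicator_def)
              qed
              then show ?thesis by simp
            qed
            finally show ?thesis .
          qed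
          finally show ?thesis .
        qed
      qed
    qed
    also have "\<dots> = 1 * (\<integral>\<^sup>+ x. indicator ?A x \<partial>frame_measure p (l # bs))"
      unfolding nn_integral_transversal[OF es(1) bs(1) ind] by simp
    also have "\<dots> \<le> ennreal \<bar>r\<bar> * (\<integral>\<^sup>+ x. indicator ?A x \<partial>frame_measure p (l # bs))"
      using ennreal_leI[OF r1] by (intro mult_right_mono) simp_all
    also have "\<dots> = (\<integral>\<^sup>+ x. indicator ?A x \<partial>frame_measure p fs)"
      by (rule frame_ratio_integral[OF r ind, symmetric])
    also have "\<dots> = emeasure (frame_measure p fs) ?A" by simp
    finally have "hausdorff_factor (Suc (length es)) * (\<integral>\<^sup>+ s. (\<integral>\<^sup>+ y. ennreal \<bar>?\<phi> s y\<bar> \<partial>?\<mu>) \<partial>lborel)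
      \<le> hausdorff_factor (Suc (length es)) * emeasure (frame_measure p fs) ?A"
      by (intro mult_left_mono) auto
    also have "\<dots> = ennreal (cell_mass \<tau>)"
      using bspec[OF fs(7), of UNIV] es(2) by (simp add: emeasure_cell_measure_UNIV)
    finally show ?thesis .
  qed
qed

section \<open>Common refinements\<close>

text \<open>The face containing \<open>x\<close> of a hyperplane arrangement. A pair
  \<open>(a, b)\<close> stands for the equation \<open>a \<bullet> z = b\<close>; \<open>sgn\<close>
  distinguishes the hyperplane and its two sides.\<close>

definition sign_region :: "((real^3) \<times> real) set \<Rightarrow> real^3 \<Rightarrow> (real^3) set" where
  "sign_region HS x = {z. \<forall>h\<in>HS. sgn (fst h \<bullet> z - snd h) = sgn (fst h \<bullet> x - snd h)}"

lemma sign_region_self: "x \<in> sign_region HS x"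
  by (auto simp: sign_region_def)

lemma sign_region_eq: "z \<in> sign_region HS x \<Longrightarrow> sign_region HS z = sign_region HS x"
  by (auto simp: sign_region_def)

lemma sign_region_mono: "HS \<subseteq> HS' \<Longrightarrow> sign_region HS' x \<subseteq> sign_region HS x"
  by (auto simp: sign_region_def)

lemma finite_sign_regions:
  assumes "finite HS"
  shows "finite (range (sign_region HS))"
proof -
  define F where "F = {f :: (real^3) \<times> real \<Rightarrow> real. \<forall>h. (h \<in> HS \<longrightarrow> f h \<in> {-1, 0, 1}) \<and> (h \<notin> HS \<longrightarrow> f h = 0)}"
  have "finite F" unfolding F_def by (intro finite_set_of_finite_funs assms) simp
  define s where "s x = (\<lambda>h. if h \<in> HS then sgn (fst h \<bullet> x - snd h) else 0)" for x :: "real^3"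
  have "s x \<in> F" for x by (auto simp: F_def s_def sgn_real_def)
  moreover have "sign_region HS x = (\<lambda>f. {z. \<forall>h\<in>HS. sgn (fst h \<bullet> z - snd h) = f h}) (s x)" for x
    by (auto simp: sign_region_def s_def)
  ultimately have "range (sign_region HS) \<subseteq> (\<lambda>f. {z. \<forall>h\<in>HS. sgn (fst h \<bullet> z - snd h) = f h}) ` F" by blast
  then show ?thesis using finite_subset \<open>finite F\<close> by blast
qed

text \<open>Zero signs cut out the plane \<open>L\<close>, the other signs half spaces in it. Those
  equal to \<open>L\<close> are removed because \<open>open_half_space_of\<close> excludes
  them.\<close>

lemma sign_region_cell:
  assumes fin: "finite HS" and bd: "bounded (sign_region HS x)"
  shows "\<exists>k. is_cell k (sign_region HS x)"
proof -
  let ?s = "\<lambda>h. sgn (fst h \<bullet> x - snd h)"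
  define L where "L = (\<Inter>h\<in>{h\<in>HS. ?s h = 0}. {z. fst h \<bullet> z = snd h})"
  define S where "S h = {z \<in> L. (- ?s h *\<^sub>R fst h) \<bullet> z < - ?s h * snd h}" for h :: "(real^3) \<times> real"
  define \<H> where "\<H> = S ` {h\<in>HS. ?s h \<noteq> 0} - {L}"
  have aff: "affine L" unfolding L_def by (intro affine_Inter) (auto intro: affine_hyperplane)
  have xL: "x \<in> L" by (auto simp: L_def sgn_zero_iff)
  have S: "z \<in> S h \<longleftrightarrow> z \<in> L \<and> sgn (fst h \<bullet> z - snd h) = ?s h" if "?s h \<noteq> 0" for h z
    using that unfolding S_def by (auto simp: sgn_real_def split: if_splits)
  have eq: "sign_region HS x = L \<inter> \<Inter>\<H>"
  proof
    show "sign_region HS x \<subseteq> L \<inter> \<Inter>\<H>"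
    proof
      fix z assume z: "z \<in> sign_region HS x"
      then have zs: "sgn (fst h \<bullet> z - snd h) = ?s h" if "h \<in> HS" for h
        using that by (auto simp: sign_region_def)
      have "fst h \<bullet> z = snd h" if "h \<in> HS" "?s h = 0" for h
        using zs[OF that(1)] that(2) by (simp add: sgn_zero_iff)
      then have zL: "z \<in> L" by (auto simp: L_def)
      then show "z \<in> L \<inter> \<Inter>\<H>" using zs S by (auto simp: \<H>_def)
    qed
    show "L \<inter> \<Inter>\<H> \<subseteq> sign_region HS x"
    proof
      fix z assume z: "z \<in> L \<inter> \<Inter>\<H>"
      have "sgn (fst h \<bullet> z - snd h) = ?s h" if h: "h \<in> HS" for h
      proof (cases "?s h = 0")
        case True
        then have "fst h \<bullet> z = snd h" using z h by (auto simp: L_def)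
        then show ?thesis using True by simp
      next
        case False
        then have "z \<in> S h" using z h by (cases "S h = L") (auto simp: \<H>_def)
        then show ?thesis using S[OF False] by blast
      qed
      then show "z \<in> sign_region HS x" by (auto simp: sign_region_def)
    qed
  qed
  have "open_half_space_of L H" if H: "H \<in> \<H>" for H
  proof -
    obtain h where h: "H = S h" using H by (auto simp: \<H>_def)
    have "x \<in> H" using eq sign_region_self H by blast
    then have "H \<noteq> {}" by blast
    moreover have "H \<noteq> L" using H by (simp add: \<H>_def)
    moreover have "\<exists>a b. H = {x \<in> L. a \<bullet> x < b}" unfolding h S_def by blast
    ultimately show ?thesis unfolding open_half_space_of_def by blast
  qed
  moreover have "finite \<H>" using fin by (simp add: \<H>_def)
  moreover have "aff_dim L = int (nat (aff_dim L))"
    using xL aff_dim_negative_iff[of L] by (metis empty_iff int_nat_eq not_le)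
  ultimately have "is_cell (nat (aff_dim L)) (sign_region HS x)"
    unfolding is_cell_def using aff eq bd sign_region_self by (metis empty_iff)
  then show ?thesis by blast
qed

text \<open>The normals form a basis of the orthogonal complement of the direction space.\<close>

lemma affine_hull_hyperplanes:
  assumes p: "(p :: real^3) \<in> S"
  shows "\<exists>N. finite N \<and> (\<forall>z. z \<in> affine hull S \<longleftrightarrow> (\<forall>n\<in>N. n \<bullet> z = n \<bullet> p))"
proof -
  let ?V = "direction_space S"
  obtain N where N: "N \<subseteq> orthogonal_comp ?V" "independent N" "orthogonal_comp ?V \<subseteq> span N"
    using maximal_independent_subset[of "orthogonal_comp ?V"] by metis
  have "z \<in> affine hull S \<longleftrightarrow> (\<forall>n\<in>N. n \<bullet> z = n \<bullet> p)" for z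
  proof -
    have "z - p \<in> ?V \<longleftrightarrow> z - p \<in> orthogonal_comp (orthogonal_comp ?V)"
      by (simp add: orthogonal_comp_self)
    also have "\<dots> \<longleftrightarrow> (\<forall>n\<in>N. orthogonal n (z - p))"
    proof
      assume "z - p \<in> orthogonal_comp (orthogonal_comp ?V)"
      then show "\<forall>n\<in>N. orthogonal n (z - p)" using N(1) by (auto simp: orthogonal_comp_def)
    next
      assume *: "\<forall>n\<in>N. orthogonal n (z - p)"
      have "orthogonal n (z - p)" if "n \<in> orthogonal_comp ?V" for n
      proof -
        have "orthogonal (z - p) n"
          by (rule orthogonal_to_span[of n N]) (use * N(3) that in \<open>auto simp: orthogonal_commute\<close>)
        then show ?thesis by (simp add: orthogonal_commute)
      qed
      then show "z - p \<in> orthogonal_comp (orthogonal_comp ?V)" by (auto simp: orthogonal_comp_def)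
    qed
    finally show ?thesis
      unfolding affine_hull_iff_direction_space[OF p] by (auto simp: orthogonal_def inner_diff_right)
  qed
  then show ?thesis using independent_imp_finite[OF N(2)] by blast
qed

text \<open>The half spaces of the cell, together with hyperplanes that cut out its affine hull,
  form an arrangement whose signs decide membership in the cell.\<close>

lemma cell_union_of_regions:
  assumes "is_cell k A"
  shows "\<exists>HS. finite HS \<and> (\<forall>x\<in>A. sign_region HS x \<subseteq> A)"
proof -
  note S = is_cell_structure[OF assms]
  obtain p where p: "p \<in> A" using S(1) by blast
  obtain \<C> where C: "finite \<C>" "A = affine hull A \<inter> (\<Inter>(a, b)\<in>\<C>. {x. a \<bullet> x < b})" using S(9) by blast
  obtain N where N: "finite N" "\<And>z. z \<in> affine hull A \<longleftrightarrow> (\<forall>n\<in>N. n \<bullet> z = n \<bullet> p)"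
    using affine_hull_hyperplanes[OF p] by blast
  let ?HS = "\<C> \<union> (\<lambda>n. (n, n \<bullet> p)) ` N"
  have "sign_region ?HS x \<subseteq> A" if x: "x \<in> A" for x
  proof
    fix z assume "z \<in> sign_region ?HS x"
    then have zz: "\<forall>h\<in>?HS. sgn (fst h \<bullet> z - snd h) = sgn (fst h \<bullet> x - snd h)"
      unfolding sign_region_def by (rule CollectD)
    have z: "sgn (a \<bullet> z - b) = sgn (a \<bullet> x - b)" if "(a, b) \<in> ?HS" for a b
      using bspec[OF zz that] by simp
    have xa: "x \<in> affine hull A" and xc: "\<And>a b. (a, b) \<in> \<C> \<Longrightarrow> a \<bullet> x < b" using x C(2) by auto
    have "n \<bullet> z = n \<bullet> p" if n: "n \<in> N" for n
    proof -
      have "sgn (n \<bullet> z - n \<bullet> p) = sgn (n \<bullet> x - n \<bullet> p)" using z[of n "n \<bullet> p"] n by blast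
      also have "\<dots> = 0" using N(2) xa n by simp
      finally show ?thesis by (simp add: sgn_zero_iff)
    qed
    then have "z \<in> affine hull A" using N(2) by blast
    moreover have "a \<bullet> z < b" if c: "(a, b) \<in> \<C>" for a b
      using z[of a b] xc[OF c] c by (auto simp: sgn_real_def split: if_splits)
    ultimately show "z \<in> A" by (subst C(2)) auto
  qed
  moreover have "finite ?HS" using C(1) N(1) by simp
  ultimately show ?thesis by blast
qed

lemma frame_measure_base_point:
  assumes "q - p \<in> span (set vs)"
  shows "frame_measure q vs = frame_measure p vs"
proof (rule measure_eqI)
  fix A assume "A \<in> sets (frame_measure q vs)"
  then have A: "A \<in> sets borel" and ind: "(indicator A :: _ \<Rightarrow> ennreal) \<in> borel_measurable borel" by auto
  show "emeasure (frame_measure q vs) A = emeasure (frame_measure p vs) A"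
    using nn_integral_frame_measure_span[OF ind assms, of p] A by simp
qed simp

lemma smooth_form_continuous:
  assumes "smooth_form k \<omega>" "length vs = k"
  shows "continuous_on UNIV (\<lambda>x. \<omega> x vs)"
proof -
  have "n_smooth 0 (\<lambda>x. \<omega> x vs)" using assms unfolding smooth_form_def smooth_def by blast
  then show ?thesis by simp
qed

text \<open>The ratio compares the two frames: its absolute value is absorbed by the change of
  measure, and its sign remains as the relative orientation.\<close>

lemma cell_integral_subcell:
  assumes \<omega>: "smooth_form (cell_dim \<sigma>) \<omega>" and d: "cell_dim \<rho> = cell_dim \<sigma>" and sub: "cell_set \<rho> \<subseteq> cell_set \<sigma>"
    and p: "p \<in> cell_set \<sigma>" and r: "frame_ratio r (cell_frame \<sigma>) (cell_frame \<rho>)"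
  shows "(\<integral>x. indicat_real (cell_set \<rho>) x * \<omega> x (cell_frame \<sigma>) \<partial>frame_measure p (cell_frame \<sigma>)) =
    sgn r * cell_integral \<omega> \<rho>"
proof -
  let ?vs = "cell_frame \<sigma>" and ?ws = "cell_frame \<rho>"
  have lv: "length ?vs = cell_dim \<sigma>" "length ?ws = cell_dim \<sigma>" using oriented_cell_props(3) d by simp_all
  have wm [measurable]: "(\<lambda>x. \<omega> x vs) \<in> borel_measurable borel" if "length vs = cell_dim \<sigma>" for vs
    by (intro borel_measurable_continuous_onI smooth_form_continuous[OF \<omega> that])
  have r0: "r \<noteq> 0" by (rule frame_ratio_nonzero[OF r])
  have w: "\<omega> x ?vs = \<omega> x ?ws / r" for x
    using frame_ratio_form[OF r, of "\<omega> x"] \<omega> lv r0 by (simp add: smooth_form_def field_simps)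
  let ?q = "SOME p. p \<in> cell_set \<rho>"
  have q: "?q \<in> cell_set \<rho>" by (rule some_in_cell)
  have "direction_space (cell_set \<rho>) = direction_space (cell_set \<sigma>)"
  proof -
    have "dim (direction_space (cell_set \<rho>)) = dim (direction_space (cell_set \<sigma>))"
      using oriented_cell_props(2,3)[of \<rho>] oriented_cell_props(2,3)[of \<sigma>] d by (simp add: ordered_basis_iff)
    then show ?thesis
      using subspace_dim_equal[OF subspace_direction_space subspace_direction_space direction_space_mono[OF sub]] by simp
  qed
  then have "?q - p \<in> span (set ?ws)"
    using affine_hull_iff_direction_space[OF p, of ?q] q sub oriented_cell_props(2)[of \<rho>]
    by (auto simp: ordered_basis_def hull_inc)
  then have mu: "frame_measure ?q ?ws = frame_measure p ?ws" by (rule frame_measure_base_point)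
  have "(\<integral>x. indicat_real (cell_set \<rho>) x * \<omega> x ?vs \<partial>frame_measure p ?vs) =
      (\<integral>x. \<bar>r\<bar> *\<^sub>R (indicat_real (cell_set \<rho>) x * \<omega> x ?vs) \<partial>frame_measure p ?ws)"
    unfolding frame_ratio_density[OF r] by (rule integral_density) (use lv in simp_all)
  also have "\<dots> = (\<integral>x. sgn r * (indicat_real (cell_set \<rho>) x * \<omega> x ?ws) \<partial>frame_measure p ?ws)"
    unfolding w using r0 by (intro Bochner_Integration.integral_cong refl) (simp add: sgn_real_def)
  also have "\<dots> = sgn r * cell_integral \<omega> \<rho>"
    unfolding cell_integral_eq[where \<omega> = \<omega> and \<sigma> = \<rho>, OF wm[OF lv(2)]] mu by simp
  finally show ?thesis .
qed

text \<open>The arrangements of all the cells are merged, and each cell is a union of faces of the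
  result. The faces of dimension \<open>k\<close> supply \<open>Q\<close>; the others inside a cell
  are null sets for its integrals.\<close>

lemma common_refinement:
  assumes S: "finite S" "\<And>\<sigma>. \<sigma> \<in> S \<Longrightarrow> cell_dim \<sigma> = k"
  obtains Q where "finite Q" "\<And>\<rho>. \<rho> \<in> Q \<Longrightarrow> cell_dim \<rho> = k"
    "\<And>\<rho> \<rho>'. \<rho> \<in> Q \<Longrightarrow> \<rho>' \<in> Q \<Longrightarrow> \<rho> \<noteq> \<rho>' \<Longrightarrow> cell_set \<rho> \<inter> cell_set \<rho>' = {}"
    "\<And>\<sigma>. \<sigma> \<in> S \<Longrightarrow> \<exists>c. Poly_Mapping.keys c \<subseteq> Q \<and> same_integrals (frag_of \<sigma>) c"
proof -
  have "\<exists>HS. \<forall>\<sigma>\<in>S. finite (HS \<sigma>) \<and> (\<forall>x\<in>cell_set \<sigma>. sign_region (HS \<sigma>) x \<subseteq> cell_set \<sigma>)"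
    using cell_union_of_regions[OF oriented_cell_props(1)] by (intro bchoice) blast
  then obtain H where H: "\<And>\<sigma>. \<sigma> \<in> S \<Longrightarrow> finite (H \<sigma>)" "\<And>\<sigma> x. \<sigma> \<in> S \<Longrightarrow> x \<in> cell_set \<sigma> \<Longrightarrow> sign_region (H \<sigma>) x \<subseteq> cell_set \<sigma>"
    by metis
  define HS where "HS = (\<Union>\<sigma>\<in>S. H \<sigma>)"
  have finH: "finite HS" using S H(1) by (simp add: HS_def)
  have reg: "sign_region HS x \<subseteq> cell_set \<sigma>" if "\<sigma> \<in> S" "x \<in> cell_set \<sigma>" for \<sigma> x
  proof -
    have "H \<sigma> \<subseteq> HS" using that(1) by (auto simp: HS_def)
    then show ?thesis using sign_region_mono H(2)[OF that] by blast
  qed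
  \<comment> \<open>A face receives an arbitrary orientation; the sign \<open>e R\<close> below
    compares it with that of the given cell.\<close>
  define oc where "oc R = Abs_oriented_cell (R, facet_frame R)" for R
  define \<R> where "\<R> = {R \<in> range (sign_region HS). is_cell k R}"
  have fin\<R>: "finite \<R>" using finite_sign_regions[OF finH] by (simp add: \<R>_def)
  have oc: "cell_set (oc R) = R" "cell_dim (oc R) = k" if R: "R \<in> \<R>" for R
  proof -
    have c: "is_cell k R" using R by (simp add: \<R>_def)
    obtain q where q: "q \<in> R" using is_cell_structure(1)[OF c] by blast
    have l: "length (facet_frame R) = k"
      using facet_frame_basis[of R] aff_dim_direction_space[OF q] is_cell_structure(4)[OF c] by (simp add: ordered_basis_iff)
    then show "cell_set (oc R) = R" "cell_dim (oc R) = k"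
      using oriented_cell_Abs[of "facet_frame R" R] facet_frame_basis[of R] c by (auto simp: oc_def)
  qed
  let ?Q = "oc ` \<R>"
  show ?thesis
  proof (rule that[of ?Q])
    show "finite ?Q" using fin\<R> by simp
    show "cell_dim \<rho> = k" if "\<rho> \<in> ?Q" for \<rho> using that oc by auto
    show "cell_set \<rho> \<inter> cell_set \<rho>' = {}" if Q: "\<rho> \<in> ?Q" "\<rho>' \<in> ?Q" "\<rho> \<noteq> \<rho>'" for \<rho> \<rho>'
    proof -
      obtain R R' where R: "R \<in> \<R>" "R' \<in> \<R>" "\<rho> = oc R" "\<rho>' = oc R'" using Q by blast
      then have "R \<noteq> R'" using Q(3) by blast
      moreover obtain x x' where "R = sign_region HS x" "R' = sign_region HS x'" using R by (auto simp: \<R>_def)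
      ultimately have "R \<inter> R' = {}" using sign_region_eq by (metis disjoint_iff)
      then show ?thesis using R oc by simp
    qed
    fix \<sigma> assume \<sigma>: "\<sigma> \<in> S"
    have d\<sigma>: "cell_dim \<sigma> = k" by (rule S(2)[OF \<sigma>])
    let ?A = "cell_set \<sigma>" and ?vs = "cell_frame \<sigma>" and ?V = "direction_space (cell_set \<sigma>)"
    let ?p = "SOME p. p \<in> ?A"
    have p: "?p \<in> ?A" by (rule some_in_cell)
    define \<R>A where "\<R>A = {R \<in> \<R>. R \<subseteq> ?A}"
    have fA: "finite \<R>A" using fin\<R> by (simp add: \<R>A_def)
    have ocA: "cell_set (oc R) = R" "cell_dim (oc R) = k" "R \<subseteq> ?A" if "R \<in> \<R>A" for R
      using that oc by (auto simp: \<R>A_def)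
    have "\<exists>r. frame_ratio r ?vs (cell_frame (oc R))" if R: "R \<in> \<R>A" for R
    proof -
      have "dim (direction_space R) = dim ?V"
        using oriented_cell_props(2,3)[of "oc R"] oriented_cell_props(2,3)[of \<sigma>] ocA[OF R] d\<sigma>
        by (simp add: ordered_basis_iff)
      then have "direction_space R = ?V"
        using subspace_dim_equal[OF subspace_direction_space subspace_direction_space direction_space_mono[OF ocA(3)[OF R]]] by simp
      then have "ordered_basis ?V (cell_frame (oc R))" using oriented_cell_props(2)[of "oc R"] ocA[OF R] by simp
      from frame_ratio_exists[OF oriented_cell_props(2) this] show ?thesis by blast
    qed
    then obtain r where r: "\<And>R. R \<in> \<R>A \<Longrightarrow> frame_ratio (r R) ?vs (cell_frame (oc R))" by metis
    define e where "e R = (if r R > 0 then 1 else - 1 :: int)" for R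
    have er: "real_of_int (e R) = sgn (r R)" if "R \<in> \<R>A" for R
      using frame_ratio_nonzero[OF r[OF that]] by (simp add: e_def sgn_real_def)
    let ?c = "\<Sum>R\<in>\<R>A. frag_cmul (e R) (frag_of (oc R))"
    have "Poly_Mapping.keys ?c \<subseteq> (\<Union>R\<in>\<R>A. Poly_Mapping.keys (frag_cmul (e R) (frag_of (oc R))))"
      by (rule keys_sum)
    also have "\<dots> \<subseteq> ?Q" using keys_cmul by (fastforce simp: \<R>A_def)
    finally have keys: "Poly_Mapping.keys ?c \<subseteq> ?Q" .
    have "same_integrals (frag_of \<sigma>) ?c"
      unfolding same_integrals_def
    proof (intro allI impI)
      fix j \<omega> assume \<omega>: "smooth_form j \<omega>"
      show "formal_integral j \<omega> (frag_of \<sigma>) = formal_integral j \<omega> ?c"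
      proof (cases "j = k")
        case False
        then show ?thesis
          unfolding formal_integral_sum formal_integral_cmul formal_integral_frag_of
          using ocA d\<sigma> by (auto intro!: sum.neutral[symmetric])
      next
        case True
        have wc: "continuous_on UNIV (\<lambda>x. \<omega> x ?vs)"
          using smooth_form_continuous[OF \<omega>] oriented_cell_props(3)[of \<sigma>] d\<sigma> True by simp
        have wm [measurable]: "(\<lambda>x. \<omega> x ?vs) \<in> borel_measurable borel" by (rule borel_measurable_continuous_onI[OF wc])
        let ?\<mu> = "frame_measure ?p ?vs"
        have Rm: "R \<in> sets borel" if "R \<in> \<R>A" for R
          using is_cell_borel[of k R] that by (simp add: \<R>A_def \<R>_def)
        \<comment> \<open>A face inside the cell that is not a \<open>k\<close>-cell has smaller
          dimension. So almost every point of the cell lies in a chosen face, and only in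
          one.\<close>
        have small: "AE x in ?\<mu>. \<forall>R\<in>{R \<in> range (sign_region HS). R \<subseteq> ?A \<and> \<not> is_cell k R}. x \<notin> R"
        proof (rule AE_finite_allI)
          show "finite {R \<in> range (sign_region HS). R \<subseteq> ?A \<and> \<not> is_cell k R}" using finite_sign_regions[OF finH] by simp
          fix R assume R: "R \<in> {R \<in> range (sign_region HS). R \<subseteq> ?A \<and> \<not> is_cell k R}"
          then obtain x where x: "R = sign_region HS x" by blast
          have "bounded R" using R is_cell_structure(2)[OF oriented_cell_props(1)[of \<sigma>]] bounded_subset by blast
          then obtain i where i: "is_cell i R" using sign_region_cell[OF finH] x by blast
          have "aff_dim R \<le> aff_dim ?A" using R by (intro aff_dim_subset) auto
          then have "i \<le> k" using is_cell_structure(4)[OF i] is_cell_structure(4)[OF oriented_cell_props(1)[of \<sigma>]] d\<sigma> by simp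
          moreover have "i \<noteq> k" using i R by blast
          ultimately have "aff_dim R < int (length ?vs)"
            using is_cell_structure(4)[OF i] oriented_cell_props(3)[of \<sigma>] d\<sigma> by simp
          moreover have "direction_space R \<subseteq> ?V" using R by (intro direction_space_mono) auto
          ultimately show "AE x in ?\<mu>. x \<notin> R" by (rule AE_frame_aff_dim[OF oriented_cell_props(2)])
        qed
        have "formal_integral j \<omega> (frag_of \<sigma>) = (\<integral>x. indicat_real ?A x * \<omega> x ?vs \<partial>?\<mu>)"
          using True d\<sigma> by (simp add: formal_integral_frag_of cell_integral_eq[where \<omega> = \<omega> and \<sigma> = \<sigma>, OF wm])
        also have "\<dots> = (\<integral>x. (\<Sum>R\<in>\<R>A. indicat_real R x * \<omega> x ?vs) \<partial>?\<mu>)"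
        proof (rule integral_cong_AE)
          show "(\<lambda>x. \<Sum>R\<in>\<R>A. indicat_real R x * \<omega> x ?vs) \<in> borel_measurable ?\<mu>"
            unfolding measurable_cong_sets[OF sets_frame_measure refl]
            by (intro borel_measurable_sum borel_measurable_times borel_measurable_indicator Rm wm)
          show "AE x in ?\<mu>. indicat_real ?A x * \<omega> x ?vs = (\<Sum>R\<in>\<R>A. indicat_real R x * \<omega> x ?vs)"
            using small
          proof eventually_elim
            case (elim x)
            show ?case
            proof (cases "x \<in> ?A")
              case False
              then have "indicat_real R x = 0" if "R \<in> \<R>A" for R using ocA(3)[OF that] by (auto simp: indicator_def)
              then show ?thesis using False by simp
            next
              case T: True
              let ?R = "sign_region HS x"
              have "?R \<subseteq> ?A" by (rule reg[OF \<sigma> T])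
              then have RA: "?R \<in> \<R>A" using elim sign_region_self[of x HS] by (auto simp: \<R>A_def \<R>_def)
              have "indicat_real R x = (if R = ?R then 1 else 0)" if "R \<in> \<R>A" for R
              proof (cases "x \<in> R")
                case True
                obtain z where "R = sign_region HS z" using \<open>R \<in> \<R>A\<close> by (auto simp: \<R>A_def \<R>_def)
                then have "R = ?R" using sign_region_eq[of x HS z] True by simp
                then show ?thesis using True by simp
              next
                case False
                then show ?thesis using sign_region_self[of x HS] by auto
              qed
              then have "(\<Sum>R\<in>\<R>A. indicat_real R x * \<omega> x ?vs) = (\<Sum>R\<in>\<R>A. if R = ?R then \<omega> x ?vs else 0)"
                by (intro sum.cong refl) simp
              also have "\<dots> = \<omega> x ?vs" using RA fA by simp
              finally show ?thesis using T by simp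
            qed
          qed
        qed measurable
        also have "\<dots> = (\<Sum>R\<in>\<R>A. (\<integral>x. indicat_real R x * \<omega> x ?vs \<partial>?\<mu>))"
        proof (rule Bochner_Integration.integral_sum)
          fix R assume R: "R \<in> \<R>A"
          show "integrable ?\<mu> (\<lambda>x. indicat_real R x * \<omega> x ?vs)"
            using integrable_frame_measure_cell[OF oriented_cell_props(2)[of \<sigma>] wc, of ?p "oc R"] ocA(1)[OF R] by simp
        qed
        also have "\<dots> = (\<Sum>R\<in>\<R>A. sgn (r R) * cell_integral \<omega> (oc R))"
        proof (rule sum.cong[OF refl])
          fix R assume R: "R \<in> \<R>A"
          show "(\<integral>x. indicat_real R x * \<omega> x ?vs \<partial>?\<mu>) = sgn (r R) * cell_integral \<omega> (oc R)"
            using cell_integral_subcell[of \<sigma> \<omega> "oc R" ?p "r R"] \<omega> True d\<sigma> ocA[OF R] p r[OF R] by simp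
        qed
        also have "\<dots> = formal_integral j \<omega> ?c"
          unfolding formal_integral_sum formal_integral_cmul formal_integral_frag_of
          using ocA True er by (intro sum.cong refl) simp
        finally show ?thesis .
      qed
    qed
    then show "\<exists>c. Poly_Mapping.keys c \<subseteq> ?Q \<and> same_integrals (frag_of \<sigma>) c" using keys by blast
  qed
qed

section \<open>Multiplicity of a chain with coefficients\<close>

definition zmul :: "int \<Rightarrow> 'a::ab_group_add \<Rightarrow> 'a" where
  "zmul n a = (\<Sum>i<nat n. a) - (\<Sum>i<nat (- n). a)"

lemma zmul_zero [simp]: "zmul 0 a = 0"
  by (simp add: zmul_def)

lemma zmul_one [simp]: "zmul 1 a = a"
  by (simp add: zmul_def)

lemma zmul_succ: "zmul (n + 1) a = zmul n a + a"
proof (cases "0 \<le> n")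
  case True
  then have "nat (n + 1) = Suc (nat n)" "nat (- n) = 0" "nat (- (n + 1)) = 0" by auto
  then show ?thesis by (simp add: zmul_def)
next
  case False
  then have e: "nat (- n) = Suc (nat (- (n + 1)))" "nat n = 0" "nat (n + 1) = 0" by auto
  show ?thesis unfolding zmul_def e by simp
qed

lemma zmul_pred: "zmul (n - 1) a = zmul n a - a"
  using zmul_succ[of "n - 1" a] by simp

lemma zmul_add_left: "zmul (m + n) a = zmul m a + zmul n a"
proof (induction n rule: int_induct[where k = 0])
  case (step1 i)
  have "zmul (m + (i + 1)) a = zmul ((m + i) + 1) a" by (simp only: add.assoc)
  also have "\<dots> = zmul m a + zmul (i + 1) a" unfolding zmul_succ step1(2) by (simp only: add.assoc)
  finally show ?case .
next
  case (step2 i)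
  have "zmul (m + (i - 1)) a = zmul ((m + i) - 1) a" by (simp only: add_diff_eq)
  also have "\<dots> = zmul m a + zmul (i - 1) a" unfolding zmul_pred step2(2) by (simp only: add_diff_eq)
  finally show ?case .
qed simp

lemma zmul_add_right: "zmul n (a + b) = zmul n a + zmul n b"
proof (induction n rule: int_induct[where k = 0])
  case (step1 i)
  show ?case unfolding zmul_succ step1(2) by (simp add: algebra_simps)
next
  case (step2 i)
  show ?case unfolding zmul_pred step2(2) by (simp add: algebra_simps)
qed simp

lemma zmul_uminus: "zmul (- n) a = - zmul n a"
  using zmul_add_left[of "- n" n a] by (simp add: eq_neg_iff_add_eq_0)

lemma zmul_diff_left: "zmul (m - n) a = zmul m a - zmul n a"
  using zmul_add_left[of m "- n" a] by (simp add: zmul_uminus)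

lemma zmul_sum: "zmul (\<Sum>i\<in>I. f i) a = (\<Sum>i\<in>I. zmul (f i) a)"
  by (induction I rule: infinite_finite_induct) (auto simp: zmul_add_left)

lemma zmul_mult: "zmul (m * n) a = zmul m (zmul n a)"
proof (induction m rule: int_induct[where k = 0])
  case (step1 i)
  then show ?case by (simp add: zmul_succ zmul_add_left distrib_right)
next
  case (step2 i)
  then show ?case by (simp add: zmul_pred zmul_diff_left left_diff_distrib)
qed simp

text \<open>The value at \<open>x\<close> of \<open>\<Sum>g \<otimes> z\<close> when \<open>m z x\<close> is the value of \<open>z\<close>.\<close>

definition tensor_value ::
    "('b \<Rightarrow> real^3 \<Rightarrow> int) \<Rightarrow> real^3 \<Rightarrow> (('a::ab_group_add \<times> 'b) \<Rightarrow>\<^sub>0 int) \<Rightarrow> 'a" where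
  "tensor_value m x X = (\<Sum>p\<in>Poly_Mapping.keys X. zmul (Poly_Mapping.lookup X p * m (snd p) x) (fst p))"

lemma tensor_value_superset:
  assumes "finite S" "Poly_Mapping.keys X \<subseteq> S"
  shows "tensor_value m x X = (\<Sum>p\<in>S. zmul (Poly_Mapping.lookup X p * m (snd p) x) (fst p))"
  unfolding tensor_value_def by (rule sum.mono_neutral_left) (use assms in \<open>auto simp: in_keys_iff\<close>)

lemma tensor_value_add: "tensor_value m x (a + b) = tensor_value m x a + tensor_value m x b"
proof -
  let ?S = "Poly_Mapping.keys a \<union> Poly_Mapping.keys b"
  show ?thesis
    by (subst (1 2 3) tensor_value_superset[where S = ?S])
      (auto simp: Poly_Mapping.keys_add lookup_add distrib_right zmul_add_left simp flip: sum.distrib)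
qed

lemma tensor_value_zero [simp]: "tensor_value m x 0 = 0"
  by (simp add: tensor_value_def)

lemma tensor_value_diff: "tensor_value m x (a - b) = tensor_value m x a - tensor_value m x b"
  using tensor_value_add[of m x "a - b" b] by (simp add: eq_diff_eq)

lemma tensor_value_frag_of: "tensor_value m x (frag_of (a, b)) = zmul (m b x) a"
  by (subst tensor_value_superset[of "{(a, b)}"]) auto

lemma tensor_value_sum: "tensor_value m x (\<Sum>i\<in>I. X i) = (\<Sum>i\<in>I. tensor_value m x (X i))"
  by (induction I rule: infinite_finite_induct) (auto simp: tensor_value_add)

lemma tensor_value_cmul: "tensor_value m x (frag_cmul n X) = zmul n (tensor_value m x X)"
proof (induction n rule: int_induct[where k = 0])
  case (step1 i)
  then show ?case by (simp add: frag_cmul_distrib tensor_value_add zmul_succ)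
next
  case (step2 i)
  have "frag_cmul i X = frag_cmul (i - 1) X + X" using frag_cmul_distrib[of "i - 1" 1 X] by simp
  then show ?case using step2(2) tensor_value_add[of m x "frag_cmul (i - 1) X" X] by (simp add: zmul_pred eq_diff_eq)
qed simp

text \<open>Additivity of \<open>m\<close> is assumed only on almost all fibres. A relator is built
  in finitely many steps, so the exceptional sets add up to a null set.\<close>

lemma tensor_value_relators:
  assumes m: "\<And>b b'. AE y in M. \<forall>x. q x = y \<longrightarrow> m (b + b') x = m b x + m b' x"
    and X: "X \<in> bilinear_relators"
  shows "AE y in M. \<forall>x. q x = y \<longrightarrow> tensor_value m x X = 0"
  using X
proof induction
  case (right a b b')
  show ?case using m[of b b'] by eventually_elim (simp add: tensor_value_diff tensor_value_frag_of zmul_add_left)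
next
  case (diff x y)
  from diff.IH show ?case by eventually_elim (simp add: tensor_value_diff)
qed (simp_all add: tensor_value_diff tensor_value_frag_of zmul_add_right)

lemma tensor_value_cong:
  assumes m: "\<And>b b'. AE y in M. \<forall>x. q x = y \<longrightarrow> m (b + b') x = m b x + m b' x"
    and X: "abs_tensor X = abs_tensor X'"
  shows "AE y in M. \<forall>x. q x = y \<longrightarrow> tensor_value m x X = tensor_value m x X'"
proof -
  have "X - X' \<in> bilinear_relators" using X by (simp add: tensor.abs_eq_iff tensor_rel_def)
  from tensor_value_relators[OF m this] show ?thesis by eventually_elim (simp add: tensor_value_diff)
qed

text \<open>Evaluated on a chosen representative, hence determined by the class only on almost all
  fibres.\<close>

abbreviation zmult :: "(real^3) list \<Rightarrow> zchain \<Rightarrow> real^3 \<Rightarrow> int" where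
  "zmult es z x \<equiv> mult es (rep_zchain z) x"

lemma zmult_abs:
  assumes "orthonormal_frame es"
  shows "AE y in frame_measure 0 es. \<forall>x. proj es x = y \<longrightarrow> zmult es (abs_zchain c) x = mult es c x"
proof -
  have "same_integrals (rep_zchain (abs_zchain c)) c"
    by (metis Quotient3_abs_rep Quotient3_zchain zchain.abs_eq_iff)
  then show ?thesis by (rule mult_same_integrals[OF assms])
qed

lemma abs_zchain_add: "abs_zchain (a + b) = abs_zchain a + abs_zchain b"
  by (simp add: plus_zchain.abs_eq)

lemma rep_zchain_add: "same_integrals (rep_zchain (a + b)) (rep_zchain a + rep_zchain b)"
  by (metis Quotient3_abs_rep Quotient3_zchain zchain.abs_eq_iff abs_zchain_add)

lemma zmult_add:
  assumes "orthonormal_frame es"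
  shows "AE y in frame_measure 0 es. \<forall>x. proj es x = y \<longrightarrow> zmult es (a + b) x = zmult es a x + zmult es b x"
  using mult_same_integrals[OF assms rep_zchain_add[of a b]] by (simp add: mult_add)

lemma zmult_zboundary:
  assumes es: "orthonormal_frame es"
  shows "AE y in frame_measure 0 es. \<forall>x. proj es x = y \<longrightarrow>
    zmult es (zboundary (abs_zchain c)) x = mult es (frag_extend cell_boundary c) x"
proof -
  have "same_integrals (rep_zchain (abs_zchain c)) c"
    by (metis Quotient3_abs_rep Quotient3_zchain zchain.abs_eq_iff)
  from mult_boundary_same_integrals[OF es this] zmult_abs[OF es, of "frag_extend cell_boundary (rep_zchain (abs_zchain c))"]
  show ?thesis by eventually_elim (simp add: zboundary_def)
qed

lemma zmult_zboundary_add: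
  assumes es: "orthonormal_frame es"
  shows "AE y in frame_measure 0 es. \<forall>x. proj es x = y \<longrightarrow>
    zmult es (zboundary (a + b)) x = zmult es (zboundary a) x + zmult es (zboundary b) x"
proof -
  have abs_rep: "abs_zchain (rep_zchain c) = c" for c by (rule Quotient3_abs_rep[OF Quotient3_zchain])
  from zmult_zboundary[OF es, of "rep_zchain a + rep_zchain b"] zmult_zboundary[OF es, of "rep_zchain a"]
    zmult_zboundary[OF es, of "rep_zchain b"]
  show ?thesis by eventually_elim (simp add: abs_zchain_add abs_rep frag_extend_add mult_add)
qed

lemma abs_tensor_add: "abs_tensor (a + b) = abs_tensor a + abs_tensor b"
  by (simp add: plus_tensor.abs_eq)

lemma abs_tensor_zero: "abs_tensor 0 = 0"
  by (simp add: zero_tensor_def)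

lemma abs_tensor_sum: "abs_tensor (\<Sum>i\<in>I. X i) = (\<Sum>i\<in>I. abs_tensor (X i))"
  by (induction I rule: infinite_finite_induct) (auto simp: abs_tensor_add abs_tensor_zero)

definition cell_rep :: "nat \<Rightarrow> 'g::ab_group_add chain \<Rightarrow> nat \<Rightarrow> (nat \<Rightarrow> 'g) \<Rightarrow> (nat \<Rightarrow> oriented_cell) \<Rightarrow> bool" where
  "cell_rep k T n g \<sigma> \<longleftrightarrow> nonoverlapping k n \<sigma> \<and> T = (\<Sum>i<n. pure_tensor (g i) (zcell (\<sigma> i)))"

lemma cell_rep_abs:
  "cell_rep k T n g \<sigma> \<Longrightarrow> T = abs_tensor (\<Sum>i<n. frag_of (g i, zcell (\<sigma> i)))"
  by (simp add: cell_rep_def abs_tensor_sum pure_tensor_def)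

lemma AE_cell_rep_value:
  assumes es: "orthonormal_frame es" and T: "abs_tensor X = T" "cell_rep k T n g \<sigma>"
  shows "AE y in frame_measure 0 es. \<forall>x. proj es x = y \<longrightarrow>
    tensor_value (zmult es) x X = (\<Sum>i<n. zmul (mult es (frag_of (\<sigma> i)) x) (g i))"
proof -
  have "abs_tensor X = abs_tensor (\<Sum>i<n. frag_of (g i, zcell (\<sigma> i)))" using T cell_rep_abs by metis
  from tensor_value_cong[OF zmult_add[OF es] this]
  have "AE y in frame_measure 0 es. \<forall>x. proj es x = y \<longrightarrow>
    tensor_value (zmult es) x X = tensor_value (zmult es) x (\<Sum>i<n. frag_of (g i, zcell (\<sigma> i)))" .
  moreover have "AE y in frame_measure 0 es. \<forall>i\<in>{..<n}. \<forall>x. proj es x = y \<longrightarrow> zmult es (zcell (\<sigma> i)) x = mult es (frag_of (\<sigma> i)) x"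
    using zmult_abs[OF es] unfolding zcell_def by (intro AE_finite_allI) auto
  ultimately show ?thesis
    by eventually_elim (simp add: tensor_value_sum tensor_value_frag_of)
qed

lemma tensor_value_boundary:
  "tensor_value m x (frag_extend (\<lambda>(a, b). frag_of (a, f b)) X) = tensor_value (\<lambda>z. m (f z)) x X"
proof -
  have "tensor_value m x (frag_extend (\<lambda>(a, b). frag_of (a, f b)) X) =
      (\<Sum>p\<in>Poly_Mapping.keys X. zmul (Poly_Mapping.lookup X p) (tensor_value m x (frag_of (fst p, f (snd p)))))"
    by (simp add: frag_extend_def tensor_value_sum tensor_value_cmul split_beta)
  then show ?thesis by (simp add: tensor_value_frag_of tensor_value_def[of _ x X] zmul_mult)
qed

lemma AE_cell_rep_boundary_value:
  assumes es: "orthonormal_frame es" and C: "cell_rep k C n g \<tau>" and X: "abs_tensor X = chain_boundary C"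
  shows "AE y in frame_measure 0 es. \<forall>x. proj es x = y \<longrightarrow>
    tensor_value (zmult es) x X = (\<Sum>i<n. zmul (mult es (cell_boundary (\<tau> i)) x) (g i))"
proof -
  \<comment> \<open>The given representative of the boundary is replaced by the image of one of
    \<open>C\<close>, and that one by the representation with cells. Each exchange is allowed
    because the multiplicities, of chains or of their boundaries, are additive on almost all
    fibres.\<close>
  let ?B = "frag_extend (\<lambda>(a, b). frag_of (a, zboundary b)) (rep_tensor C)"
  have "abs_tensor X = abs_tensor ?B" using X by (simp add: chain_boundary_def tensor_map_def)
  from tensor_value_cong[OF zmult_add[OF es] this]
  have 1: "AE y in frame_measure 0 es. \<forall>x. proj es x = y \<longrightarrow>
    tensor_value (zmult es) x X = tensor_value (\<lambda>z. zmult es (zboundary z)) x (rep_tensor C)"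
    by (simp add: tensor_value_boundary)
  have "abs_tensor (rep_tensor C) = abs_tensor (\<Sum>i<n. frag_of (g i, zcell (\<tau> i)))"
    using Quotient3_abs_rep[OF Quotient3_tensor, of C] cell_rep_abs[OF C] by simp
  from tensor_value_cong[OF zmult_zboundary_add[OF es] this]
  have 2: "AE y in frame_measure 0 es. \<forall>x. proj es x = y \<longrightarrow>
    tensor_value (\<lambda>z. zmult es (zboundary z)) x (rep_tensor C) =
      (\<Sum>i<n. zmul (zmult es (zboundary (zcell (\<tau> i))) x) (g i))"
    by (simp add: tensor_value_sum tensor_value_frag_of)
  have 3: "AE y in frame_measure 0 es. \<forall>i\<in>{..<n}. \<forall>x. proj es x = y \<longrightarrow>
      zmult es (zboundary (zcell (\<tau> i))) x = mult es (cell_boundary (\<tau> i)) x"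
    using zmult_zboundary[OF es, of "frag_of (\<tau> _)"] unfolding zcell_def by (intro AE_finite_allI) auto
  from 1 2 3 show ?thesis by eventually_elim simp
qed

section \<open>Existence of nonoverlapping representations\<close>

lemma pure_tensor_add_right: "pure_tensor g (a + b) = pure_tensor g a + pure_tensor g b"
proof -
  have "frag_of (g, a + b) - frag_of (g, a) - frag_of (g, b) \<in> bilinear_relators" by (rule bilinear_relators.right)
  then have "tensor_rel (frag_of (g, a + b)) (frag_of (g, a) + frag_of (g, b))"
    by (simp add: tensor_rel_def diff_diff_add)
  then have "abs_tensor (frag_of (g, a + b)) = abs_tensor (frag_of (g, a) + frag_of (g, b))"
    by (simp add: tensor.abs_eq_iff)
  then show ?thesis by (simp add: pure_tensor_def abs_tensor_add)
qed

lemma pure_tensor_add_left: "pure_tensor (g + h) a = pure_tensor g a + pure_tensor h a"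
proof -
  have "frag_of (g + h, a) - frag_of (g, a) - frag_of (h, a) \<in> bilinear_relators" by (rule bilinear_relators.left)
  then have "tensor_rel (frag_of (g + h, a)) (frag_of (g, a) + frag_of (h, a))"
    by (simp add: tensor_rel_def diff_diff_add)
  then have "abs_tensor (frag_of (g + h, a)) = abs_tensor (frag_of (g, a) + frag_of (h, a))"
    by (simp add: tensor.abs_eq_iff)
  then show ?thesis by (simp add: pure_tensor_def abs_tensor_add)
qed

lemma pure_tensor_zero: "pure_tensor g 0 = 0" "pure_tensor 0 a = 0"
  using pure_tensor_add_right[of g 0 0] pure_tensor_add_left[of 0 0 a] by auto

lemma pure_tensor_uminus: "pure_tensor g (- a) = - pure_tensor g a" "pure_tensor (- g) a = - pure_tensor g a"
  using pure_tensor_add_right[of g "- a" a] pure_tensor_add_left[of "- g" g a]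
  by (simp_all add: pure_tensor_zero eq_neg_iff_add_eq_0)

lemma pure_tensor_diff:
  "pure_tensor g (a - b) = pure_tensor g a - pure_tensor g b" "pure_tensor (g - h) a = pure_tensor g a - pure_tensor h a"
  using pure_tensor_add_right[of g a "- b"] pure_tensor_add_left[of g "- h" a]
  by (simp_all add: pure_tensor_uminus)

lemma abs_zchain_diff: "abs_zchain (a - b) = abs_zchain a - abs_zchain b"
  using abs_zchain_add[of "a - b" b] by (simp add: eq_diff_eq)

lemma abs_zchain_zero: "abs_zchain 0 = 0"
  by (simp add: zero_zchain_def)

text \<open>After a common refinement of all cells that occur, the chains with one coefficient for
  each refined cell form a subgroup \<open>E\<close>. It contains every term of the given
  sum.\<close>

lemma chains_cell_rep:
  fixes T :: "'g::ab_group_add chain"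
  assumes "T \<in> chains k"
  obtains n g \<sigma> where "cell_rep k T n g \<sigma>"
proof -
  obtain N :: nat and g z where T: "T = (\<Sum>i<N. pure_tensor (g i) (z i))" and z: "\<And>i. i < N \<Longrightarrow> z i \<in> zchains k"
    using assms unfolding chains_def by blast
  have "\<exists>c. z i = abs_zchain c \<and> (\<forall>\<sigma>\<in>Poly_Mapping.keys c. cell_dim \<sigma> = k)" if "i < N" for i
    using z[OF that] unfolding zchains_def by blast
  then obtain c where c: "\<And>i. i < N \<Longrightarrow> z i = abs_zchain (c i)"
    "\<And>i \<sigma>. i < N \<Longrightarrow> \<sigma> \<in> Poly_Mapping.keys (c i) \<Longrightarrow> cell_dim \<sigma> = k" by metis
  let ?S = "\<Union>i<N. Poly_Mapping.keys (c i)"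
  have finS: "finite ?S" by simp
  have dimS: "cell_dim \<sigma> = k" if "\<sigma> \<in> ?S" for \<sigma> using that c(2) by blast
  obtain Q where Q: "finite Q" "\<And>\<rho>. \<rho> \<in> Q \<Longrightarrow> cell_dim \<rho> = k"
    "\<And>\<rho> \<rho>'. \<rho> \<in> Q \<Longrightarrow> \<rho>' \<in> Q \<Longrightarrow> \<rho> \<noteq> \<rho>' \<Longrightarrow> cell_set \<rho> \<inter> cell_set \<rho>' = {}"
    "\<And>\<sigma>. \<sigma> \<in> ?S \<Longrightarrow> \<exists>c. Poly_Mapping.keys c \<subseteq> Q \<and> same_integrals (frag_of \<sigma>) c"
    using common_refinement[OF finS dimS] by blast
  define E :: "'g chain set" where "E = {\<Sum>\<rho>\<in>Q. pure_tensor (G \<rho>) (zcell \<rho>) | G. True}"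
  have E0: "0 \<in> E" unfolding E_def by (auto intro!: exI[of _ "\<lambda>_. 0"] simp: pure_tensor_zero)
  have Ediff: "a - b \<in> E" if ab: "a \<in> E" "b \<in> E" for a b
  proof -
    obtain G H where "a = (\<Sum>\<rho>\<in>Q. pure_tensor (G \<rho>) (zcell \<rho>))" "b = (\<Sum>\<rho>\<in>Q. pure_tensor (H \<rho>) (zcell \<rho>))"
      using ab unfolding E_def by blast
    then have "a - b = (\<Sum>\<rho>\<in>Q. pure_tensor (G \<rho> - H \<rho>) (zcell \<rho>))"
      by (simp add: pure_tensor_diff sum_subtractf)
    then show ?thesis unfolding E_def by (intro CollectI exI[of _ "\<lambda>\<rho>. G \<rho> - H \<rho>"] conjI TrueI)
  qed
  have Eadd: "a + b \<in> E" if "a \<in> E" "b \<in> E" for a b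
    using Ediff[OF that(1) Ediff[OF E0 that(2)]] by simp
  have Esum: "(\<Sum>i\<in>I. f i) \<in> E" if "\<And>i. i \<in> I \<Longrightarrow> f i \<in> E" for f and I :: "nat set"
    using that by (induction I rule: infinite_finite_induct) (auto simp: E0 Eadd)
  have EQ: "pure_tensor a (abs_zchain d) \<in> E" if "Poly_Mapping.keys d \<subseteq> Q" for a d
    using that
  proof (induction d rule: frag_induction)
    case zero
    show ?case by (simp add: abs_zchain_zero pure_tensor_zero E0)
  next
    case (one \<rho>)
    have "pure_tensor a (zcell \<rho>) = (\<Sum>\<rho>'\<in>Q. if \<rho>' = \<rho> then pure_tensor a (zcell \<rho>') else 0)"
      using one Q(1) by simp
    also have "\<dots> = (\<Sum>\<rho>'\<in>Q. pure_tensor (if \<rho>' = \<rho> then a else 0) (zcell \<rho>'))"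
      by (intro sum.cong refl) (simp add: pure_tensor_zero)
    finally show ?case
      unfolding E_def zcell_def[symmetric] by (intro CollectI exI[of _ "\<lambda>\<rho>'. if \<rho>' = \<rho> then a else 0"] conjI TrueI)
  next
    case (diff u v)
    then show ?case by (simp add: abs_zchain_diff pure_tensor_diff Ediff)
  qed
  have ES: "pure_tensor a (abs_zchain d) \<in> E" if "Poly_Mapping.keys d \<subseteq> ?S" for a d
    using that
  proof (induction d rule: frag_induction)
    case zero
    show ?case by (simp add: abs_zchain_zero pure_tensor_zero E0)
  next
    case (one \<sigma>)
    obtain c' where c': "Poly_Mapping.keys c' \<subseteq> Q" "same_integrals (frag_of \<sigma>) c'" using Q(4)[OF one] by blast
    then have "abs_zchain (frag_of \<sigma>) = abs_zchain c'" by (simp add: zchain.abs_eq_iff)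
    then show ?case using EQ[OF c'(1)] by simp
  next
    case (diff u v)
    then show ?case by (simp add: abs_zchain_diff pure_tensor_diff Ediff)
  qed
  have "T \<in> E" unfolding T using c by (intro Esum) (auto intro!: ES)
  then obtain G where G: "T = (\<Sum>\<rho>\<in>Q. pure_tensor (G \<rho>) (zcell \<rho>))" unfolding E_def by blast
  obtain \<sigma> where \<sigma>: "bij_betw \<sigma> {0..<card Q} Q" using ex_bij_betw_nat_finite[OF Q(1)] by blast
  have \<sigma>': "bij_betw \<sigma> {..<card Q} Q" using \<sigma> by (simp add: atLeast0LessThan)
  have "cell_rep k T (card Q) (\<lambda>i. G (\<sigma> i)) \<sigma>"
    unfolding cell_rep_def nonoverlapping_def
  proof (intro conjI allI impI)
    fix i assume i: "i < card Q"
    then show "cell_dim (\<sigma> i) = k" using \<sigma>' Q(2) by (auto simp: bij_betw_def)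
    fix j assume j: "j < card Q" "i \<noteq> j"
    then have "\<sigma> i \<noteq> \<sigma> j" using \<sigma>' i by (auto simp: bij_betw_def inj_on_def)
    then show "cell_set (\<sigma> i) \<inter> cell_set (\<sigma> j) = {}" using \<sigma>' i j Q(3) by (auto simp: bij_betw_def)
  next
    show "T = (\<Sum>i<card Q. pure_tensor (G (\<sigma> i)) (zcell (\<sigma> i)))"
      unfolding G by (rule sum.reindex_bij_betw[OF \<sigma>', symmetric])
  qed
  then show ?thesis by (rule that)
qed

section \<open>Multiplicities determine the class; additivity of the boundary\<close>

lemma emeasure_cell_pos:
  assumes A: "is_cell k A" and es: "orthonormal_frame es" "span (set es) = direction_space A" and p: "p \<in> A"
  shows "0 < emeasure (frame_measure p es) A"
proof -
  obtain G where G: "open G" "A = affine hull A \<inter> G" using is_cell_structure(8)[OF A] by blast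
  obtain r where r: "0 < r" "ball p r \<subseteq> G" using G p open_contains_ball by blast
  \<comment> \<open>The side of a cube of diameter less than \<open>r\<close>; the added 1 keeps the
    denominator positive for a cell of dimension 0.\<close>
  define s where "s = r / (real (length es) + 1)"
  have s: "0 < s" unfolding s_def using r(1) by simp
  have "real (length es) * s < (real (length es) + 1) * s" using s by (simp add: distrib_right)
  also have "\<dots> = r" unfolding s_def by simp
  finally have sr: "real (length es) * s < r" .
  have "frame_cube p es s \<subseteq> A"
  proof
    fix x assume x: "x \<in> frame_cube p es s"
    have "p \<in> frame_cube p es s" using s by (simp add: frame_cube_iff[OF es(1)] span_zero)
    then have "dist p x < r" using dist_frame_cube[OF es(1) _ x] sr by (meson le_less_trans)
    then have "x \<in> G" using r(2) by auto
    moreover have "x \<in> affine hull A"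
      using x affine_hull_iff_direction_space[OF p] es(2) by (simp add: frame_cube_iff[OF es(1)])
    ultimately show "x \<in> A" using G(2) by blast
  qed
  then have "emeasure (frame_measure p es) (frame_cube p es s) \<le> emeasure (frame_measure p es) A"
    by (rule emeasure_mono) (simp add: is_cell_borel[OF A])
  moreover have "0 < emeasure (frame_measure p es) (frame_cube p es s)"
    using emeasure_frame_cube[OF es(1), of s p] s by simp
  ultimately show ?thesis by (rule less_le_trans[rotated])
qed

text \<open>The converse of \<open>mult_same_integrals\<close>. Refine the chain to disjoint cells
  and project to the plane of one of them: up to sign its coefficient is the multiplicity at each of
  its points, which lie on a set of fibres of positive measure. So the coefficient vanishes.\<close>

lemma mult_zero_same_integrals:
  assumes m: "\<And>es. orthonormal_frame es \<Longrightarrow> AE y in frame_measure 0 es. \<forall>x. proj es x = y \<longrightarrow> mult es d x = 0"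
  shows "same_integrals d 0"
  unfolding same_integrals_def
proof (intro allI impI)
  fix k \<omega> assume \<omega>: "smooth_form k \<omega>"
  define S where "S = {\<sigma>\<in>Poly_Mapping.keys d. cell_dim \<sigma> = k}"
  have S: "finite S" "\<And>\<sigma>. \<sigma> \<in> S \<Longrightarrow> cell_dim \<sigma> = k" by (auto simp: S_def)
  obtain Q where Q: "finite Q" "\<And>\<rho>. \<rho> \<in> Q \<Longrightarrow> cell_dim \<rho> = k"
    "\<And>\<rho> \<rho>'. \<rho> \<in> Q \<Longrightarrow> \<rho>' \<in> Q \<Longrightarrow> \<rho> \<noteq> \<rho>' \<Longrightarrow> cell_set \<rho> \<inter> cell_set \<rho>' = {}"
    "\<And>\<sigma>. \<sigma> \<in> S \<Longrightarrow> \<exists>c. Poly_Mapping.keys c \<subseteq> Q \<and> same_integrals (frag_of \<sigma>) c"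
    using common_refinement[OF S] by blast
  then obtain c where c: "\<And>\<sigma>. \<sigma> \<in> S \<Longrightarrow> Poly_Mapping.keys (c \<sigma>) \<subseteq> Q" "\<And>\<sigma>. \<sigma> \<in> S \<Longrightarrow> same_integrals (frag_of \<sigma>) (c \<sigma>)"
    by metis
  let ?n = "\<lambda>\<sigma>. Poly_Mapping.lookup d \<sigma>"
  define dk where "dk = (\<Sum>\<sigma>\<in>S. frag_cmul (?n \<sigma>) (frag_of \<sigma>))"
  define c' where "c' = (\<Sum>\<sigma>\<in>S. frag_cmul (?n \<sigma>) (c \<sigma>))"
  have keys: "Poly_Mapping.keys c' \<subseteq> Q"
  proof -
    have "Poly_Mapping.keys c' \<subseteq> (\<Union>\<sigma>\<in>S. Poly_Mapping.keys (frag_cmul (?n \<sigma>) (c \<sigma>)))"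
      unfolding c'_def by (rule keys_sum)
    also have "\<dots> \<subseteq> Q" using c(1) keys_cmul by fastforce
    finally show ?thesis .
  qed
  have si: "same_integrals dk c'"
    using c(2) unfolding same_integrals_def dk_def c'_def
    by (simp add: formal_integral_sum formal_integral_cmul)
  have mk: "mult es dk x = mult es d x" if "length es = k" for es x
    unfolding dk_def mult_sum mult_frag_cmul mult_frag_of mult_def[of es d]
    using that by (intro sum.mono_neutral_cong_left) (auto simp: S_def cell_sign_def)
  have zero: "Poly_Mapping.lookup c' \<rho> = 0" if \<rho>: "\<rho> \<in> Q" for \<rho>
  proof (rule ccontr)
    assume nz: "Poly_Mapping.lookup c' \<rho> \<noteq> 0"
    obtain p fs where fs: "p \<in> cell_set \<rho>" "orthonormal_frame fs" "span (set fs) = direction_space (cell_set \<rho>)"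
      "length fs = cell_dim \<rho>" "ordered_basis (direction_space (cell_set \<rho>)) fs"
      using cell_measure_frame[of \<rho>] by metis
    have lf: "length fs = k" using fs(4) Q(2)[OF \<rho>] by simp
    obtain t where t: "frame_ratio t fs (cell_frame \<rho>)" using frame_ratio_exists[OF fs(5) oriented_cell_props(2)] .
    have "kvector_inner fs (cell_frame \<rho>) = t"
      using frame_ratio_form[OF t alternating_form_kvector_inner] kvector_inner_dual[OF dual_frame_self[OF fs(2)]] by simp
    then have sg: "cell_sign fs \<rho> \<noteq> 0"
      using frame_ratio_nonzero[OF t] fs(4) by (auto simp: cell_sign_def)
    have val: "mult fs c' x = Poly_Mapping.lookup c' \<rho> * cell_sign fs \<rho>" if x: "x \<in> cell_set \<rho>" for x
    proof -
      have "mult fs c' x = (\<Sum>\<sigma>\<in>Q. if x \<in> cell_set \<sigma> then Poly_Mapping.lookup c' \<sigma> * cell_sign fs \<sigma> else 0)"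
        by (rule mult_superset[OF Q(1) keys])
      also have "\<dots> = (\<Sum>\<sigma>\<in>{\<rho>}. if x \<in> cell_set \<sigma> then Poly_Mapping.lookup c' \<sigma> * cell_sign fs \<sigma> else 0)"
        using Q(1,3) \<rho> x by (intro sum.mono_neutral_right) auto
      finally show ?thesis using x by simp
    qed
    have AE0: "AE y in frame_measure 0 fs. y \<notin> proj fs ` cell_set \<rho>"
      using m[OF fs(2)] mult_same_integrals[OF fs(2) si]
    proof eventually_elim
      case (elim y)
      show ?case
      proof
        assume "y \<in> proj fs ` cell_set \<rho>"
        then obtain x where x: "x \<in> cell_set \<rho>" "proj fs x = y" by blast
        then have "mult fs c' x = 0" using elim mk[OF lf] by metis
        then show False using val[OF x(1)] nz sg by simp
      qed
    qed
    have ind: "(indicator (cell_set \<rho>) :: _ \<Rightarrow> ennreal) \<in> borel_measurable borel" by simp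
    have "emeasure (frame_measure p fs) (cell_set \<rho>) = (\<integral>\<^sup>+ x. indicator (cell_set \<rho>) x \<partial>frame_measure p fs)" by simp
    also have "\<dots> = (\<integral>\<^sup>+ y. indicator (cell_set \<rho>) (lift fs p fs y) \<partial>frame_measure 0 fs)"
      by (rule frame_measure_lift[OF fs(2) dual_frame_self[OF fs(2)] ind])
    also have "\<dots> = (\<integral>\<^sup>+ y. 0 \<partial>frame_measure 0 fs)"
    proof (rule nn_integral_cong_AE)
      show "AE y in frame_measure 0 fs. indicator (cell_set \<rho>) (lift fs p fs y) = (0 :: ennreal)"
        using AE0 AE_frame_measure_plane[of 0 fs]
      proof eventually_elim
        case (elim y)
        have "proj fs (lift fs p fs y) = y"
          using proj_lift[OF fs(2) dual_frame_self[OF fs(2)]] elim(2) by simp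
        then have "lift fs p fs y \<notin> cell_set \<rho>" using elim(1) by (metis imageI)
        then show ?case by simp
      qed
    qed
    finally show False using emeasure_cell_pos[OF oriented_cell_props(1) fs(2,3,1)] by simp
  qed
  have c0: "c' = 0"
    by (rule poly_mapping_eqI) (use zero keys in \<open>auto simp: in_keys_iff subset_iff\<close>)
  have "formal_integral k \<omega> d = formal_integral k \<omega> dk"
    unfolding dk_def formal_integral_sum formal_integral_cmul formal_integral_frag_of formal_integral_def[of k \<omega> d]
    by (intro sum.mono_neutral_cong_right) (auto simp: S_def)
  also have "\<dots> = formal_integral k \<omega> c'" using si \<omega> unfolding same_integrals_def by blast
  finally show "formal_integral k \<omega> d = formal_integral k \<omega> 0" unfolding c0 .
qed

text \<open>The boundary of the chosen representative of a sum has to be compared with the sum of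
  boundaries of other representatives. Their multiplicities agree in every projection, and this
  determines the class.\<close>

lemma zboundary_add: "zboundary (a + b) = zboundary a + zboundary b"
proof -
  let ?f = "frag_extend cell_boundary"
  let ?d = "?f (rep_zchain (a + b)) - (?f (rep_zchain a) + ?f (rep_zchain b))"
  have "same_integrals ?d 0"
  proof (rule mult_zero_same_integrals)
    fix es assume "orthonormal_frame es"
    from mult_boundary_same_integrals[OF this rep_zchain_add[of a b]]
    show "AE y in frame_measure 0 es. \<forall>x. proj es x = y \<longrightarrow> mult es ?d x = 0"
      by eventually_elim (simp add: mult_diff frag_extend_add)
  qed
  then have "abs_zchain ?d = 0" by (simp add: zero_zchain_def zchain.abs_eq_iff)
  then show ?thesis by (simp add: zboundary_def abs_zchain_diff abs_zchain_add)
qed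

lemma tensor_map_relators:
  assumes f: "\<And>b b'. f (b + b') = f b + f b'" and X: "X \<in> bilinear_relators"
  shows "frag_extend (\<lambda>(a, b). frag_of (a, f b)) X \<in> bilinear_relators"
  using X
proof induction
  case (left a a' b)
  show ?case by (simp add: frag_extend_diff bilinear_relators.left)
next
  case (right a b b')
  show ?case by (simp add: frag_extend_diff f bilinear_relators.right)
next
  case (diff x y)
  then show ?case by (simp add: frag_extend_diff bilinear_relators.diff)
qed (simp add: bilinear_relators.zero)

lemma tensor_map_abs:
  assumes f: "\<And>b b'. f (b + b') = f b + f b'"
  shows "tensor_map f (abs_tensor X) = abs_tensor (frag_extend (\<lambda>(a, b). frag_of (a, f b)) X)"
proof -
  have "tensor_rel (rep_tensor (abs_tensor X)) X"
    using Quotient3_abs_rep[OF Quotient3_tensor, of "abs_tensor X"] by (simp add: tensor.abs_eq_iff)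
  then show ?thesis
    using tensor_map_relators[OF f, of "rep_tensor (abs_tensor X) - X"]
    by (simp add: tensor_map_def tensor.abs_eq_iff tensor_rel_def frag_extend_diff)
qed

lemma chain_boundary_zero: "chain_boundary 0 = 0"
  using tensor_map_abs[OF zboundary_add, of 0] by (simp add: chain_boundary_def abs_tensor_zero)

lemma abs_tensor_uminus: "abs_tensor (- X) = - abs_tensor X"
  by (simp add: uminus_tensor.abs_eq)

lemma chain_boundary_uminus: "chain_boundary (- C) = - chain_boundary C"
proof -
  have C: "C = abs_tensor (rep_tensor C)" by (rule Quotient3_abs_rep[OF Quotient3_tensor, symmetric])
  have "chain_boundary (- C) = abs_tensor (frag_extend (\<lambda>(a, b). frag_of (a, zboundary b)) (- rep_tensor C))"
    unfolding chain_boundary_def by (subst C) (simp only: abs_tensor_uminus[symmetric] tensor_map_abs[OF zboundary_add])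
  also have "\<dots> = - chain_boundary C"
    by (simp add: frag_extend_minus abs_tensor_uminus chain_boundary_def tensor_map_def)
  finally show ?thesis .
qed

section \<open>Lower semicontinuity of mass\<close>

text \<open>Translation invariance makes the distance to 0 a symmetric subadditive length on the
  group.\<close>

lemma dist_zmul_le:
  assumes TI: "\<And>a b c :: 'g::{ab_group_add, metric_space}. dist (a + c) (b + c) = dist a b"
  shows "dist (a + b :: 'g) 0 \<le> dist a 0 + dist b 0" "dist (- a :: 'g) 0 = dist a 0"
    "dist (\<Sum>i\<in>I. f i :: 'g) 0 \<le> (\<Sum>i\<in>I. dist (f i) 0)"
    "dist (zmul n a :: 'g) 0 \<le> \<bar>real_of_int n\<bar> * dist a 0"
    "\<bar>n\<bar> \<le> 1 \<Longrightarrow> dist (zmul n a :: 'g) 0 = \<bar>real_of_int n\<bar> * dist a 0"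
proof -
  have add: "dist (a + b :: 'g) 0 \<le> dist a 0 + dist b 0" for a b
    using dist_triangle[of "a + b" 0 b] TI[of a b 0] by simp
  have minus: "dist (- a :: 'g) 0 = dist a 0" for a
    using TI[of "- a" a 0] by (simp add: dist_commute)
  have sum: "dist (\<Sum>i\<in>I. f i :: 'g) 0 \<le> (\<Sum>i\<in>I. dist (f i) 0)" for I :: "'z set" and f
    by (induction I rule: infinite_finite_induct) (auto intro: order_trans[OF add])
  have le: "dist (zmul n a :: 'g) 0 \<le> \<bar>real_of_int n\<bar> * dist a 0" for n a
  proof -
    have nn: "dist (zmul (int m) a) 0 \<le> real m * dist a 0" for m
    proof (induction m)
      case (Suc m)
      have "zmul (int (Suc m)) a = zmul (int m) a + a" using zmul_succ[of "int m" a] by (simp add: add.commute)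
      then show ?case using add[of "zmul (int m) a" a] Suc by (simp add: distrib_right)
    qed simp
    show ?thesis
    proof (cases "0 \<le> n")
      case True
      then show ?thesis using nn[of "nat n"] by simp
    next
      case False
      then show ?thesis using nn[of "nat (- n)"] minus[of "zmul n a"] by (simp add: zmul_uminus)
    qed
  qed
  show "dist (a + b :: 'g) 0 \<le> dist a 0 + dist b 0" "dist (- a :: 'g) 0 = dist a 0"
    "dist (\<Sum>i\<in>I. f i :: 'g) 0 \<le> (\<Sum>i\<in>I. dist (f i) 0)"
    "dist (zmul n a :: 'g) 0 \<le> \<bar>real_of_int n\<bar> * dist a 0" by (rule add minus sum le)+
  assume "\<bar>n\<bar> \<le> 1"
  then consider "n = 0" | "n = 1" | "n = - 1" by linarith
  then show "dist (zmul n a :: 'g) 0 = \<bar>real_of_int n\<bar> * dist a 0"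
    by cases (use minus in \<open>simp_all add: zmul_uminus[of 1, simplified]\<close>)
qed

lemma fibre_sum_frag_of:
  "fibre_sum es (frag_of \<sigma>) w y = real_of_int (cell_sign es \<sigma>) * (indicat_real (cell_set \<sigma>) (cell_lift es \<sigma> y) * w (cell_lift es \<sigma> y))"
  by (simp add: fibre_sum_def)

lemma cell_sign_abs_le: "\<bar>cell_sign es \<sigma>\<bar> \<le> 1"
  by (simp add: cell_sign_def)

lemma mult_support:
  assumes es: "orthonormal_frame es" and m: "mult es c x \<noteq> 0"
  shows "\<exists>\<sigma>\<in>Poly_Mapping.keys c. cell_sign es \<sigma> \<noteq> 0 \<and> x = cell_lift es \<sigma> (proj es x)"
proof -
  have "\<exists>\<sigma>\<in>Poly_Mapping.keys c. (if x \<in> cell_set \<sigma> then Poly_Mapping.lookup c \<sigma> * cell_sign es \<sigma> else 0) \<noteq> 0"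
  proof (rule ccontr)
    assume "\<not> ?thesis"
    then have "mult es c x = 0" unfolding mult_def by (intro sum.neutral) blast
    with m show False by simp
  qed
  then obtain \<sigma> where s: "\<sigma> \<in> Poly_Mapping.keys c" "x \<in> cell_set \<sigma>" "cell_sign es \<sigma> \<noteq> 0" by (auto split: if_splits)
  then show ?thesis using cell_lift_proj[OF es s(3,2)] by (intro bexI[of _ \<sigma>]) auto
qed

text \<open>Sum the multiplicities with values in the group over the points of the fibre that lie in
  \<open>B\<close>, and solve for the term of the cell \<open>\<sigma> j\<close>. Since
  \<open>B\<close> is quantified inside, one null set of fibres serves every
  \<open>B\<close>.\<close>

lemma AE_fibre_inequality:
  fixes g :: "nat \<Rightarrow> 'g::{ab_group_add, metric_space}"
  assumes TI: "\<And>a b c :: 'g. dist (a + c) (b + c) = dist a b"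
    and es: "orthonormal_frame es" and eq: "P' = P + A + A' + chain_boundary C"
    and P: "cell_rep k P n g \<sigma>" and P': "cell_rep k P' n' g' \<sigma>'"
    and A: "cell_rep k A na ga \<alpha>" and A': "cell_rep k A' na' ga' \<alpha>'" and C: "cell_rep (Suc k) C m h \<tau>"
    and j: "j < n"
  shows "AE y in frame_measure 0 es. \<forall>B.
     dist (g j) 0 * \<bar>fibre_sum es (frag_of (\<sigma> j)) (indicat_real B) y\<bar> \<le>
       (\<Sum>i\<in>{..<n} - {j}. dist (g i) 0 * \<bar>fibre_sum es (frag_of (\<sigma> i)) (indicat_real B) y\<bar>)
     + (\<Sum>i<n'. dist (g' i) 0 * \<bar>fibre_sum es (frag_of (\<sigma>' i)) (indicat_real B) y\<bar>)
     + (\<Sum>i<na. dist (ga i) 0 * \<bar>fibre_sum es (frag_of (\<alpha> i)) (indicat_real B) y\<bar>)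
     + (\<Sum>i<na'. dist (ga' i) 0 * \<bar>fibre_sum es (frag_of (\<alpha>' i)) (indicat_real B) y\<bar>)
     + (\<Sum>i<m. dist (h i) 0 * \<bar>fibre_sum es (cell_boundary (\<tau> i)) (indicat_real B) y\<bar>)"
proof -
  have ar: "abs_tensor (rep_tensor T) = T" for T :: "'g chain" by (rule Quotient3_abs_rep[OF Quotient3_tensor])
  have "abs_tensor (rep_tensor P') = abs_tensor (rep_tensor P + rep_tensor A + rep_tensor A' + rep_tensor (chain_boundary C))"
    by (simp only: abs_tensor_add ar eq)
  from tensor_value_cong[OF zmult_add[OF es] this]
  have v: "AE y in frame_measure 0 es. \<forall>x. proj es x = y \<longrightarrow>
      tensor_value (zmult es) x (rep_tensor P') = tensor_value (zmult es) x (rep_tensor P) + tensor_value (zmult es) x (rep_tensor A)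
      + tensor_value (zmult es) x (rep_tensor A') + tensor_value (zmult es) x (rep_tensor (chain_boundary C))"
    by (simp add: tensor_value_add)
  have span: "AE y in frame_measure 0 es. y \<in> span (set es)" using AE_frame_measure_plane[of 0 es] by simp
  show ?thesis
    using v AE_cell_rep_value[OF es ar P] AE_cell_rep_value[OF es ar P'] AE_cell_rep_value[OF es ar A]
      AE_cell_rep_value[OF es ar A'] AE_cell_rep_boundary_value[OF es C ar] span
  proof eventually_elim
    case (elim y)
    show ?case
    proof
      fix B
      define Ks where "Ks = \<sigma> ` {..<n} \<union> \<sigma>' ` {..<n'} \<union> \<alpha> ` {..<na} \<union> \<alpha>' ` {..<na'} \<union>
        (\<Union>i<m. Poly_Mapping.keys (cell_boundary (\<tau> i)))"
      have finK: "finite Ks" by (simp add: Ks_def)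
      \<comment> \<open>A finite set with all points above \<open>y\<close> at which one of the
        chains involved can have a nonzero multiplicity.\<close>
      define X where "X = (\<lambda>\<rho>. cell_lift es \<rho> y) ` {\<rho> \<in> Ks. cell_sign es \<rho> \<noteq> 0}"
      have finX: "finite X" using finK by (simp add: X_def)
      have pX: "proj es x = y" if "x \<in> X" for x
        using that proj_cell_lift[OF es _ elim(7)] by (auto simp: X_def)
      define N where "N c = (\<Sum>x\<in>X \<inter> B. mult es c x)" for c
      have N: "real_of_int (N c) = fibre_sum es c (indicat_real B) y" if c: "Poly_Mapping.keys c \<subseteq> Ks" for c
      proof -
        have "fibre_sum es c (indicat_real B) y = (\<Sum>x\<in>X. real_of_int (mult es c x) * indicat_real B x)"
        proof (rule fibre_sum_eq[OF es elim(7) finX pX])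
          fix x assume "proj es x = y" "mult es c x \<noteq> 0"
          then show "x \<in> X" using mult_support[OF es, of c x] c by (auto simp: X_def)
        qed
        also have "\<dots> = (\<Sum>x\<in>X \<inter> B. real_of_int (mult es c x))"
          using finX by (intro sum.mono_neutral_cong_right) (auto simp: indicator_def)
        finally show ?thesis by (simp add: N_def)
      qed
      have swap: "(\<Sum>x\<in>X \<inter> B. \<Sum>i<q. zmul (mult es (c i) x) (f i)) = (\<Sum>i<q. zmul (N (c i)) (f i))"
        for q :: nat and c and f :: "nat \<Rightarrow> 'g"
        unfolding N_def zmul_sum by (rule sum.swap)
      have "(\<Sum>i<n'. zmul (N (frag_of (\<sigma>' i))) (g' i)) = (\<Sum>i<n. zmul (N (frag_of (\<sigma> i))) (g i))
          + (\<Sum>i<na. zmul (N (frag_of (\<alpha> i))) (ga i)) + (\<Sum>i<na'. zmul (N (frag_of (\<alpha>' i))) (ga' i))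
          + (\<Sum>i<m. zmul (N (cell_boundary (\<tau> i))) (h i))"
        unfolding swap[symmetric] sum.distrib[symmetric]
        by (intro sum.cong refl) (use elim(1-6) pX in force)
      moreover have "(\<Sum>i<n. zmul (N (frag_of (\<sigma> i))) (g i)) =
          zmul (N (frag_of (\<sigma> j))) (g j) + (\<Sum>i\<in>{..<n} - {j}. zmul (N (frag_of (\<sigma> i))) (g i))"
        by (rule sum.remove) (use j in auto)
      ultimately have e: "zmul (N (frag_of (\<sigma> j))) (g j) =
         - (\<Sum>i\<in>{..<n} - {j}. zmul (N (frag_of (\<sigma> i))) (g i)) + (\<Sum>i<n'. zmul (N (frag_of (\<sigma>' i))) (g' i))
          + - (\<Sum>i<na. zmul (N (frag_of (\<alpha> i))) (ga i)) + - (\<Sum>i<na'. zmul (N (frag_of (\<alpha>' i))) (ga' i))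
          + - (\<Sum>i<m. zmul (N (cell_boundary (\<tau> i))) (h i))"
        by (simp add: algebra_simps)
      note nm = dist_zmul_le[OF TI]
      have sm: "dist (\<Sum>i\<in>I. zmul (N (c i)) (f i)) 0 \<le> (\<Sum>i\<in>I. dist (f i) 0 * \<bar>fibre_sum es (c i) (indicat_real B) y\<bar>)"
        if "\<And>i. i \<in> I \<Longrightarrow> Poly_Mapping.keys (c i) \<subseteq> Ks" for I :: "nat set" and c and f :: "nat \<Rightarrow> 'g"
      proof -
        have "dist (zmul (N (c i)) (f i)) 0 \<le> dist (f i) 0 * \<bar>fibre_sum es (c i) (indicat_real B) y\<bar>" if "i \<in> I" for i
          using nm(4)[of "N (c i)" "f i"] N[OF \<open>\<And>i. i \<in> I \<Longrightarrow> Poly_Mapping.keys (c i) \<subseteq> Ks\<close>[OF that]] by (simp add: mult.commute)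
        then show ?thesis by (intro order_trans[OF nm(3)] sum_mono)
      qed
      have kj: "Poly_Mapping.keys (frag_of (\<sigma> j)) \<subseteq> Ks" using j by (auto simp: Ks_def)
      \<comment> \<open>A single cell meets the fibre at most once, with sign 1 or -1. For such
        integers the length of \<open>zmul n a\<close> equals that of \<open>a\<close> times the
        absolute value of \<open>n\<close>; for larger ones it may be smaller, for instance if
        \<open>a\<close> has finite order.\<close>
      have "\<bar>real_of_int (N (frag_of (\<sigma> j)))\<bar> \<le> 1"
        unfolding N[OF kj] fibre_sum_frag_of using cell_sign_abs_le[of es "\<sigma> j"] by (auto simp: indicator_def abs_mult)
      then have "\<bar>N (frag_of (\<sigma> j))\<bar> \<le> 1" by linarith
      then have "dist (g j) 0 * \<bar>fibre_sum es (frag_of (\<sigma> j)) (indicat_real B) y\<bar> = dist (zmul (N (frag_of (\<sigma> j))) (g j)) 0"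
        using nm(5)[of "N (frag_of (\<sigma> j))" "g j"] N[OF kj] by (simp add: mult.commute)
      also have "\<dots> \<le> dist (\<Sum>i\<in>{..<n} - {j}. zmul (N (frag_of (\<sigma> i))) (g i)) 0 + dist (\<Sum>i<n'. zmul (N (frag_of (\<sigma>' i))) (g' i)) 0
          + dist (\<Sum>i<na. zmul (N (frag_of (\<alpha> i))) (ga i)) 0 + dist (\<Sum>i<na'. zmul (N (frag_of (\<alpha>' i))) (ga' i)) 0
          + dist (\<Sum>i<m. zmul (N (cell_boundary (\<tau> i))) (h i)) 0"
        unfolding e using nm(2) by (intro order_trans[OF nm(1)] add_mono) auto
      also have "\<dots> \<le> (\<Sum>i\<in>{..<n} - {j}. dist (g i) 0 * \<bar>fibre_sum es (frag_of (\<sigma> i)) (indicat_real B) y\<bar>)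
         + (\<Sum>i<n'. dist (g' i) 0 * \<bar>fibre_sum es (frag_of (\<sigma>' i)) (indicat_real B) y\<bar>)
         + (\<Sum>i<na. dist (ga i) 0 * \<bar>fibre_sum es (frag_of (\<alpha> i)) (indicat_real B) y\<bar>)
         + (\<Sum>i<na'. dist (ga' i) 0 * \<bar>fibre_sum es (frag_of (\<alpha>' i)) (indicat_real B) y\<bar>)
         + (\<Sum>i<m. dist (h i) 0 * \<bar>fibre_sum es (cell_boundary (\<tau> i)) (indicat_real B) y\<bar>)"
        by (intro add_mono sm) (auto simp: Ks_def)
      finally show "dist (g j) 0 * \<bar>fibre_sum es (frag_of (\<sigma> j)) (indicat_real B) y\<bar> \<le>
           (\<Sum>i\<in>{..<n} - {j}. dist (g i) 0 * \<bar>fibre_sum es (frag_of (\<sigma> i)) (indicat_real B) y\<bar>)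
         + (\<Sum>i<n'. dist (g' i) 0 * \<bar>fibre_sum es (frag_of (\<sigma>' i)) (indicat_real B) y\<bar>)
         + (\<Sum>i<na. dist (ga i) 0 * \<bar>fibre_sum es (frag_of (\<alpha> i)) (indicat_real B) y\<bar>)
         + (\<Sum>i<na'. dist (ga' i) 0 * \<bar>fibre_sum es (frag_of (\<alpha>' i)) (indicat_real B) y\<bar>)
         + (\<Sum>i<m. dist (h i) 0 * \<bar>fibre_sum es (cell_boundary (\<tau> i)) (indicat_real B) y\<bar>)" .
    qed
  qed
qed

lemma fibre_sum_measurable [measurable]:
  assumes [measurable]: "w \<in> borel_measurable borel"
  shows "fibre_sum es c w \<in> borel_measurable borel"
  unfolding fibre_sum_def by measurable

lemma nn_integral_fibre_sum_cell:
  assumes es: "orthonormal_frame es" and B: "B \<in> sets borel"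
  shows "hausdorff_factor (length es) * (\<integral>\<^sup>+ y. ennreal \<bar>fibre_sum es (frag_of \<sigma>) (indicat_real B) y\<bar> \<partial>frame_measure 0 es)
    \<le> emeasure (cell_measure \<sigma>) B"
proof (cases "cell_sign es \<sigma> = 0")
  case False
  then have "cell_sign es \<sigma> = 1 \<or> cell_sign es \<sigma> = - 1" by (auto simp: cell_sign_def split: if_splits)
  then have "ennreal \<bar>fibre_sum es (frag_of \<sigma>) (indicat_real B) y\<bar> = indicator (cell_set \<sigma> \<inter> B) (cell_lift es \<sigma> y)" for y
    by (auto simp: fibre_sum_frag_of indicator_def)
  then show ?thesis using cell_shadow_le[OF es False B] by simp
qed (simp add: fibre_sum_frag_of)

text \<open>\<open>fs\<close> and \<open>es\<close> are orthonormal bases of the same space, so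
  their ratio is at most 1 in absolute value: the projection to the plane of the cell itself loses
  no area.\<close>

lemma nn_integral_fibre_sum_own_cell:
  assumes es: "orthonormal_frame es" "span (set es) = direction_space (cell_set \<sigma>)" and B: "B \<in> sets borel"
  shows "emeasure (cell_measure \<sigma>) B \<le>
    hausdorff_factor (length es) * (\<integral>\<^sup>+ y. ennreal \<bar>fibre_sum es (frag_of \<sigma>) (indicat_real B) y\<bar> \<partial>frame_measure 0 es)"
proof -
  obtain p fs where fs: "p \<in> cell_set \<sigma>" "orthonormal_frame fs" "span (set fs) = direction_space (cell_set \<sigma>)"
    "length fs = cell_dim \<sigma>" "ordered_basis (direction_space (cell_set \<sigma>)) fs" "p = (SOME p. p \<in> cell_set \<sigma>)"
    "\<forall>B\<in>sets borel. emeasure (cell_measure \<sigma>) B =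
      hausdorff_factor (cell_dim \<sigma>) * emeasure (frame_measure p fs) (cell_set \<sigma> \<inter> B)"
    by (rule cell_measure_frame[of \<sigma>])
  have ob: "ordered_basis (direction_space (cell_set \<sigma>)) es" using orthonormal_frame_basis[OF es(1)] es(2) by simp
  have l: "length es = cell_dim \<sigma>" using ob fs(4,5) by (simp add: ordered_basis_iff)
  obtain t where t: "frame_ratio t es (cell_frame \<sigma>)" using frame_ratio_exists[OF ob oriented_cell_props(2)] .
  have "kvector_inner es (cell_frame \<sigma>) = t"
    using frame_ratio_form[OF t alternating_form_kvector_inner] kvector_inner_dual[OF dual_frame_self[OF es(1)]] by simp
  then have s: "cell_sign es \<sigma> = 1 \<or> cell_sign es \<sigma> = - 1"
    using frame_ratio_nonzero[OF t] l by (auto simp: cell_sign_def)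
  then have s0: "cell_sign es \<sigma> \<noteq> 0" by auto
  obtain bs where bs: "dual_frame es bs" "ordered_basis (direction_space (cell_set \<sigma>)) bs"
    "cell_lift es \<sigma> = lift es (SOME p. p \<in> cell_set \<sigma>) bs" by (rule cell_lift_frame[OF es(1) s0])
  obtain r where r: "frame_ratio r es bs" using frame_ratio_exists[OF ob bs(2)] .
  have r1: "r = 1"
    using frame_ratio_form[OF r alternating_form_kvector_inner] kvector_inner_dual[OF dual_frame_self[OF es(1)]]
      kvector_inner_dual[OF bs(1)] by simp
  obtain q where q: "frame_ratio q fs es" using frame_ratio_exists[OF fs(5) ob] .
  have "kvector_inner fs es = q"
    using frame_ratio_form[OF q alternating_form_kvector_inner] kvector_inner_dual[OF dual_frame_self[OF fs(2)]] by simp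
  then have q1: "\<bar>q\<bar> \<le> 1" using kvector_inner_orthonormal_le[OF fs(2) es(1)] l fs(4) by simp
  have ind: "(indicator (cell_set \<sigma> \<inter> B) :: _ \<Rightarrow> ennreal) \<in> borel_measurable borel" using B by simp
  have "emeasure (frame_measure p fs) (cell_set \<sigma> \<inter> B) = (\<integral>\<^sup>+ x. indicator (cell_set \<sigma> \<inter> B) x \<partial>frame_measure p fs)"
    using B by simp
  also have "\<dots> = ennreal \<bar>q\<bar> * (\<integral>\<^sup>+ x. indicator (cell_set \<sigma> \<inter> B) x \<partial>frame_measure p es)"
    by (rule frame_ratio_integral[OF q ind])
  also have "\<dots> \<le> 1 * (\<integral>\<^sup>+ x. indicator (cell_set \<sigma> \<inter> B) x \<partial>frame_measure p es)"
    using ennreal_leI[OF q1] by (intro mult_right_mono) simp_all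
  also have "\<dots> = (\<integral>\<^sup>+ x. indicator (cell_set \<sigma> \<inter> B) x \<partial>frame_measure p bs)"
    using frame_ratio_integral[OF r ind, of p] r1 by simp
  also have "\<dots> = (\<integral>\<^sup>+ y. indicator (cell_set \<sigma> \<inter> B) (cell_lift es \<sigma> y) \<partial>frame_measure 0 es)"
    unfolding bs(3) fs(6) by (rule frame_measure_lift[OF es(1) bs(1) ind])
  also have "\<dots> = (\<integral>\<^sup>+ y. ennreal \<bar>fibre_sum es (frag_of \<sigma>) (indicat_real B) y\<bar> \<partial>frame_measure 0 es)"
  proof (rule nn_integral_cong)
    fix y show "indicator (cell_set \<sigma> \<inter> B) (cell_lift es \<sigma> y) = ennreal \<bar>fibre_sum es (frag_of \<sigma>) (indicat_real B) y\<bar>"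
      using s by (auto simp: fibre_sum_frag_of indicator_def)
  qed
  finally show ?thesis using bspec[OF fs(7) B] l by (simp add: mult_left_mono)
qed

text \<open>The fibre inequality is integrated over the projection. The integral is at least the
  measure for the distinguished cell and at most the measure for the others; the boundary terms are
  kept, to be averaged over \<open>s\<close> later.\<close>

lemma cell_measure_inequality:
  fixes g :: "nat \<Rightarrow> 'g::{ab_group_add, metric_space}"
  assumes TI: "\<And>a b c :: 'g. dist (a + c) (b + c) = dist a b"
    and es: "orthonormal_frame es" and eq: "P' = P + A + A' + chain_boundary C"
    and P: "cell_rep k P n g \<sigma>" and P': "cell_rep k P' n' g' \<sigma>'"
    and A: "cell_rep k A na ga \<alpha>" and A': "cell_rep k A' na' ga' \<alpha>'" and C: "cell_rep (Suc k) C m h \<tau>"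
    and j: "j < n" and sp: "span (set es) = direction_space (cell_set (\<sigma> j))" and B: "B \<in> sets borel"
  shows "ennreal (dist (g j) 0) * emeasure (cell_measure (\<sigma> j)) B \<le>
       (\<Sum>i\<in>{..<n} - {j}. ennreal (dist (g i) 0) * emeasure (cell_measure (\<sigma> i)) B)
     + (\<Sum>i<n'. ennreal (dist (g' i) 0) * emeasure (cell_measure (\<sigma>' i)) B)
     + (\<Sum>i<na. ennreal (dist (ga i) 0) * emeasure (cell_measure (\<alpha> i)) B)
     + (\<Sum>i<na'. ennreal (dist (ga' i) 0) * emeasure (cell_measure (\<alpha>' i)) B)
     + (\<Sum>i<m. ennreal (dist (h i) 0) * (hausdorff_factor (length es) *
         (\<integral>\<^sup>+ y. ennreal \<bar>fibre_sum es (cell_boundary (\<tau> i)) (indicat_real B) y\<bar> \<partial>frame_measure 0 es)))"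
proof -
  let ?\<mu> = "frame_measure 0 es" and ?f = "hausdorff_factor (length es)"
  let ?F = "\<lambda>c y. \<bar>fibre_sum es c (indicat_real B) y\<bar>"
  let ?J = "\<lambda>c. \<integral>\<^sup>+ y. ennreal (?F c y) \<partial>?\<mu>"
  have [measurable]: "fibre_sum es c (indicat_real B) \<in> borel_measurable borel" for c
    by (rule fibre_sum_measurable) (use B in simp)
  have S: "?f * (\<integral>\<^sup>+ y. ennreal (\<Sum>i\<in>I. dist (a i) 0 * ?F (c i) y) \<partial>?\<mu>) = (\<Sum>i\<in>I. ennreal (dist (a i) 0) * (?f * ?J (c i)))"
    if "finite I" for I :: "nat set" and a :: "nat \<Rightarrow> 'g" and c
  proof -
    have "(\<integral>\<^sup>+ y. ennreal (\<Sum>i\<in>I. dist (a i) 0 * ?F (c i) y) \<partial>?\<mu>) = (\<integral>\<^sup>+ y. (\<Sum>i\<in>I. ennreal (dist (a i) 0) * ennreal (?F (c i) y)) \<partial>?\<mu>)"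
      by (simp add: sum_ennreal[symmetric] ennreal_mult)
    also have "\<dots> = (\<Sum>i\<in>I. ennreal (dist (a i) 0) * ?J (c i))"
      by (subst nn_integral_sum) (auto simp: nn_integral_cmult)
    finally show ?thesis by (simp add: sum_distrib_left mult.left_commute)
  qed
  let ?R = "\<lambda>y. (\<Sum>i\<in>{..<n} - {j}. dist (g i) 0 * ?F (frag_of (\<sigma> i)) y)"
  let ?R1 = "\<lambda>y. (\<Sum>i<n'. dist (g' i) 0 * ?F (frag_of (\<sigma>' i)) y)"
  let ?R2 = "\<lambda>y. (\<Sum>i<na. dist (ga i) 0 * ?F (frag_of (\<alpha> i)) y)"
  let ?R3 = "\<lambda>y. (\<Sum>i<na'. dist (ga' i) 0 * ?F (frag_of (\<alpha>' i)) y)"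
  let ?R4 = "\<lambda>y. (\<Sum>i<m. dist (h i) 0 * ?F (cell_boundary (\<tau> i)) y)"
  have "ennreal (dist (g j) 0) * emeasure (cell_measure (\<sigma> j)) B \<le> ennreal (dist (g j) 0) * (?f * ?J (frag_of (\<sigma> j)))"
    by (intro mult_left_mono nn_integral_fibre_sum_own_cell[OF es sp B]) simp
  also have "\<dots> = ?f * (\<integral>\<^sup>+ y. ennreal (dist (g j) 0 * ?F (frag_of (\<sigma> j)) y) \<partial>?\<mu>)"
    using S[of "{j}" g "\<lambda>i. frag_of (\<sigma> i)"] by simp
  also have "\<dots> \<le> ?f * (\<integral>\<^sup>+ y. ennreal (?R y + ?R1 y + ?R2 y + ?R3 y + ?R4 y) \<partial>?\<mu>)"
  proof (intro mult_left_mono nn_integral_mono_AE)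
    show "AE y in ?\<mu>. ennreal (dist (g j) 0 * ?F (frag_of (\<sigma> j)) y) \<le> ennreal (?R y + ?R1 y + ?R2 y + ?R3 y + ?R4 y)"
      using AE_fibre_inequality[OF TI es eq P P' A A' C j]
    proof eventually_elim
      case (elim y)
      from spec[OF elim, of B] show ?case by (rule ennreal_leI)
    qed
  qed simp
  also have "(\<integral>\<^sup>+ y. ennreal (?R y + ?R1 y + ?R2 y + ?R3 y + ?R4 y) \<partial>?\<mu>) =
      (\<integral>\<^sup>+ y. ennreal (?R y) + ennreal (?R1 y) + ennreal (?R2 y) + ennreal (?R3 y) + ennreal (?R4 y) \<partial>?\<mu>)"
    by (intro nn_integral_cong) (simp add: ennreal_plus sum_nonneg)
  also have "\<dots> = (\<integral>\<^sup>+ y. ennreal (?R y) \<partial>?\<mu>) + (\<integral>\<^sup>+ y. ennreal (?R1 y) \<partial>?\<mu>) + (\<integral>\<^sup>+ y. ennreal (?R2 y) \<partial>?\<mu>)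
      + (\<integral>\<^sup>+ y. ennreal (?R3 y) \<partial>?\<mu>) + (\<integral>\<^sup>+ y. ennreal (?R4 y) \<partial>?\<mu>)"
  proof -
    have m: "(\<lambda>y. ennreal (?R y)) \<in> borel_measurable ?\<mu>" "(\<lambda>y. ennreal (?R1 y)) \<in> borel_measurable ?\<mu>"
      "(\<lambda>y. ennreal (?R2 y)) \<in> borel_measurable ?\<mu>" "(\<lambda>y. ennreal (?R3 y)) \<in> borel_measurable ?\<mu>"
      "(\<lambda>y. ennreal (?R4 y)) \<in> borel_measurable ?\<mu>" by measurable
    note a2 = borel_measurable_add[OF m(1,2)]
    note a3 = borel_measurable_add[OF a2 m(3)]
    note a4 = borel_measurable_add[OF a3 m(4)]
    show ?thesis
      by (simp only: nn_integral_add[OF a4 m(5)] nn_integral_add[OF a3 m(4)] nn_integral_add[OF a2 m(3)] nn_integral_add[OF m(1,2)])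
  qed
  also have "?f * \<dots> = (\<Sum>i\<in>{..<n} - {j}. ennreal (dist (g i) 0) * (?f * ?J (frag_of (\<sigma> i))))
     + (\<Sum>i<n'. ennreal (dist (g' i) 0) * (?f * ?J (frag_of (\<sigma>' i))))
     + (\<Sum>i<na. ennreal (dist (ga i) 0) * (?f * ?J (frag_of (\<alpha> i))))
     + (\<Sum>i<na'. ennreal (dist (ga' i) 0) * (?f * ?J (frag_of (\<alpha>' i))))
     + (\<Sum>i<m. ennreal (dist (h i) 0) * (?f * ?J (cell_boundary (\<tau> i))))"
    by (simp only: distrib_left S finite_Diff finite_lessThan)
  also have "\<dots> \<le> (\<Sum>i\<in>{..<n} - {j}. ennreal (dist (g i) 0) * emeasure (cell_measure (\<sigma> i)) B)
     + (\<Sum>i<n'. ennreal (dist (g' i) 0) * emeasure (cell_measure (\<sigma>' i)) B)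
     + (\<Sum>i<na. ennreal (dist (ga i) 0) * emeasure (cell_measure (\<alpha> i)) B)
     + (\<Sum>i<na'. ennreal (dist (ga' i) 0) * emeasure (cell_measure (\<alpha>' i)) B)
     + (\<Sum>i<m. ennreal (dist (h i) 0) * (?f * ?J (cell_boundary (\<tau> i))))"
    by (intro add_mono sum_mono mult_left_mono nn_integral_fibre_sum_cell[OF es B]) simp_all
  finally show ?thesis .
qed

section \<open>Compact cores of disjoint cells\<close>

lemma measure_cell_measure_self: "measure (cell_measure \<sigma>) (cell_set \<sigma>) = cell_mass \<sigma>"
  and cell_measure_disjoint: "S \<in> sets borel \<Longrightarrow> S \<inter> cell_set \<sigma> = {} \<Longrightarrow> measure (cell_measure \<sigma>) S = 0"
proof -
  obtain p fs where e: "\<forall>B\<in>sets borel. emeasure (cell_measure \<sigma>) B =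
      hausdorff_factor (cell_dim \<sigma>) * emeasure (frame_measure p fs) (cell_set \<sigma> \<inter> B)"
    using cell_measure_frame[of \<sigma>] by metis
  have "emeasure (cell_measure \<sigma>) (cell_set \<sigma>) = emeasure (cell_measure \<sigma>) UNIV"
    using bspec[OF e, of UNIV] bspec[OF e, of "cell_set \<sigma>"] by simp
  then show "measure (cell_measure \<sigma>) (cell_set \<sigma>) = cell_mass \<sigma>"
    by (simp add: measure_def emeasure_cell_measure_UNIV cell_mass_def)
  assume "S \<in> sets borel" "S \<inter> cell_set \<sigma> = {}"
  then show "measure (cell_measure \<sigma>) S = 0"
    using bspec[OF e, of S] by (simp add: measure_def Int_commute)
qed

lemma cell_mass_nonneg: "0 \<le> cell_mass \<sigma>"
  by (simp add: cell_mass_def)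

lemma compact_in_cell:
  assumes "0 < d"
  shows "\<exists>K. compact K \<and> K \<noteq> {} \<and> K \<subseteq> cell_set \<sigma> \<and> cell_mass \<sigma> - d \<le> measure (cell_measure \<sigma>) K"
proof -
  let ?M = "cell_measure \<sigma>"
  interpret finite_measure ?M by (rule finite_measure_cell_measure)
  obtain p where p: "p \<in> cell_set \<sigma>" using some_in_cell by blast
  show ?thesis
  \<comment> \<open>A nonpositive bound is met by a single point, which also supplies nonemptiness;
    a positive bound survives the passage to \<open>ennreal\<close> and is reached by inner
    regularity.\<close>
  proof (cases "cell_mass \<sigma> \<le> d")
    case True
    then have "cell_mass \<sigma> - d \<le> measure ?M {p}" using measure_nonneg[of ?M "{p}"] by linarith
    then show ?thesis using p by (intro exI[of _ "{p}"]) auto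
  next
    case False
    have "emeasure ?M (cell_set \<sigma>) = (SUP K\<in>{K. K \<subseteq> cell_set \<sigma> \<and> compact K}. emeasure ?M K)"
      by (rule inner_regular) (auto simp: emeasure_cell_measure_UNIV)
    moreover have "ennreal (cell_mass \<sigma> - d) < emeasure ?M (cell_set \<sigma>)"
      using False assms by (simp add: emeasure_eq_measure measure_cell_measure_self ennreal_less_iff)
    ultimately obtain K where K: "K \<subseteq> cell_set \<sigma>" "compact K" "ennreal (cell_mass \<sigma> - d) < emeasure ?M K"
      by (auto simp: less_SUP_iff)
    then have "cell_mass \<sigma> - d < measure ?M K"
      using False by (simp add: emeasure_eq_measure ennreal_less_iff)
    moreover have "K \<noteq> {}" using K(3) by auto
    ultimately show ?thesis using K by (intro exI[of _ K]) auto
  qed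
qed

text \<open>The neighbourhoods shrink to the compact sets, which are disjoint from each other and
  from the other cells. So for small \<open>\<epsilon>\<close> they are disjoint, and the other
  cells have little measure in them.\<close>

lemma cells_separation:
  fixes w :: "nat \<Rightarrow> real"
  assumes no: "nonoverlapping k n \<sigma>" and w: "\<And>i. 0 \<le> w i" and \<eta>: "0 < \<eta>"
  shows "\<exists>K \<epsilon>. 0 < \<epsilon> \<and> (\<forall>j<n. K j \<noteq> {} \<and> compact (K j)) \<and>
    (\<forall>i<n. \<forall>j<n. i \<noteq> j \<longrightarrow> {x. infdist x (K i) < \<epsilon>} \<inter> {x. infdist x (K j) < \<epsilon>} = {}) \<and>
    (\<Sum>j<n. w j * cell_mass (\<sigma> j)) \<le> (\<Sum>j<n. w j * measure (cell_measure (\<sigma> j)) (K j)) + \<eta> \<and>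
    (\<Sum>j<n. \<Sum>i\<in>{..<n} - {j}. w i * measure (cell_measure (\<sigma> i)) {x. infdist x (K j) < \<epsilon>}) \<le> \<eta>"
proof -
  \<comment> \<open>The loss allowed for each cell, so that the weighted losses add up to at most
    \<open>\<eta>\<close>; the added 1 provides for the case that all weights are zero.\<close>
  define d where "d = \<eta> / (1 + (\<Sum>j<n. w j))"
  have W: "0 \<le> (\<Sum>j<n. w j)" by (intro sum_nonneg w)
  have d: "0 < d" unfolding d_def using \<eta> W by (intro divide_pos_pos) auto
  have "\<exists>K. compact K \<and> K \<noteq> {} \<and> K \<subseteq> cell_set (\<sigma> j) \<and> cell_mass (\<sigma> j) - d \<le> measure (cell_measure (\<sigma> j)) K" for j
    by (rule compact_in_cell[OF d])
  then obtain K where K: "\<And>j. compact (K j)" "\<And>j. K j \<noteq> {}" "\<And>j. K j \<subseteq> cell_set (\<sigma> j)"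
    "\<And>j. cell_mass (\<sigma> j) - d \<le> measure (cell_measure (\<sigma> j)) (K j)"
    by metis
  have s1: "(\<Sum>j<n. w j * cell_mass (\<sigma> j)) \<le> (\<Sum>j<n. w j * measure (cell_measure (\<sigma> j)) (K j)) + \<eta>"
  proof -
    have "(\<Sum>j<n. w j * cell_mass (\<sigma> j)) \<le> (\<Sum>j<n. w j * measure (cell_measure (\<sigma> j)) (K j) + w j * d)"
    proof (rule sum_mono)
      fix j
      have "w j * cell_mass (\<sigma> j) \<le> w j * (measure (cell_measure (\<sigma> j)) (K j) + d)"
        using K(4)[of j] w[of j] by (intro mult_left_mono) auto
      then show "w j * cell_mass (\<sigma> j) \<le> w j * measure (cell_measure (\<sigma> j)) (K j) + w j * d" by (simp add: distrib_left)
    qed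
    also have "\<dots> = (\<Sum>j<n. w j * measure (cell_measure (\<sigma> j)) (K j)) + (\<Sum>j<n. w j) * d"
      by (simp add: sum.distrib sum_distrib_right)
    also have "(\<Sum>j<n. w j) * d \<le> (1 + (\<Sum>j<n. w j)) * d" using d by (simp add: distrib_right)
    also have "\<dots> = \<eta>" unfolding d_def using W by (simp add: add_nonneg_eq_0_iff)
    finally show ?thesis by simp
  qed
  have disj: "cell_set (\<sigma> i) \<inter> cell_set (\<sigma> j) = {}" if "i < n" "j < n" "i \<noteq> j" for i j
    using no that by (auto simp: nonoverlapping_def)
  let ?e = "\<lambda>m::nat. 1 / real (Suc m)"
  let ?B = "\<lambda>j m. {x. infdist x (K j) < ?e m}"
  have e0: "?e \<longlonglongrightarrow> 0" by (rule LIMSEQ_Suc[OF lim_1_over_n])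
  have sep: "eventually (\<lambda>m. ?B i m \<inter> ?B j m = {}) sequentially" if ij: "i < n" "j < n" "i \<noteq> j" for i j
  proof -
    have "K i \<inter> K j = {}" using disj[OF ij] K(3)[of i] K(3)[of j] by blast
    then obtain r where r: "0 < r" "\<And>x y. x \<in> K i \<Longrightarrow> y \<in> K j \<Longrightarrow> r \<le> dist x y"
      using separate_compact_closed[OF K(1)[of i] compact_imp_closed[OF K(1)[of j]]] by blast
    have "eventually (\<lambda>m. ?e m < r / 2) sequentially" using e0 r(1) by (intro order_tendstoD) auto
    then show ?thesis
    proof eventually_elim
      case (elim m)
      show ?case
      proof (rule ccontr)
        assume "?B i m \<inter> ?B j m \<noteq> {}"
        then obtain x where x: "infdist x (K i) < ?e m" "infdist x (K j) < ?e m" by blast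
        obtain a where a: "a \<in> K i" "infdist x (K i) = dist x a"
          using infdist_attains_inf[OF compact_imp_closed[OF K(1)] K(2)] by blast
        obtain b where b: "b \<in> K j" "infdist x (K j) = dist x b"
          using infdist_attains_inf[OF compact_imp_closed[OF K(1)] K(2)] by blast
        have "r \<le> dist a b" by (rule r(2)[OF a(1) b(1)])
        also have "\<dots> \<le> dist x a + dist x b" by (metis dist_commute dist_triangle)
        also have "\<dots> < r" using x a(2) b(2) elim by linarith
        finally show False by simp
      qed
    qed
  qed
  have lim: "(\<lambda>m. measure (cell_measure (\<sigma> i)) (?B j m)) \<longlonglongrightarrow> 0" if ij: "i < n" "j < n" "i \<noteq> j" for i j
  proof -
    interpret finite_measure "cell_measure (\<sigma> i)" by (rule finite_measure_cell_measure)
    have "(\<lambda>m. measure (cell_measure (\<sigma> i)) (?B j m)) \<longlonglongrightarrow> measure (cell_measure (\<sigma> i)) (\<Inter>m. ?B j m)"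
    proof (rule finite_Lim_measure_decseq)
      show "range (?B j) \<subseteq> sets (cell_measure (\<sigma> i))"
        by (auto intro!: borel_open open_Collect_less continuous_intros)
      show "decseq (?B j)"
        unfolding decseq_def
      proof (intro allI impI subsetI)
        fix m m' x assume "m \<le> m'" "x \<in> ?B j m'"
        moreover have "?e m' \<le> ?e m" using \<open>m \<le> m'\<close> by (intro divide_left_mono) auto
        ultimately show "x \<in> ?B j m" by simp
      qed
    qed
    moreover have "(\<Inter>m. ?B j m) = K j"
    proof
      show "K j \<subseteq> (\<Inter>m. ?B j m)" by auto
      show "(\<Inter>m. ?B j m) \<subseteq> K j"
      proof
        fix x assume x: "x \<in> (\<Inter>m. ?B j m)"
        have "infdist x (K j) \<le> ?e m" for m
        proof -
          have "x \<in> ?B j m" using x by blast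
          then show ?thesis by simp
        qed
        then have "infdist x (K j) \<le> 0" by (intro LIMSEQ_le_const[OF e0]) blast
        then show "x \<in> K j"
          using in_closed_iff_infdist_zero[OF compact_imp_closed[OF K(1)[of j]] K(2)] infdist_nonneg[of x "K j"] by simp
      qed
    qed
    moreover have "measure (cell_measure (\<sigma> i)) (K j) = 0"
      using disj[OF ij] K(3)[of j] by (intro cell_measure_disjoint borel_closed compact_imp_closed K(1)) blast
    ultimately show ?thesis by simp
  qed
  have "(\<lambda>m. \<Sum>j<n. \<Sum>i\<in>{..<n} - {j}. w i * measure (cell_measure (\<sigma> i)) (?B j m)) \<longlonglongrightarrow> (\<Sum>j<n. \<Sum>i\<in>{..<n} - {j}. w i * 0)"
    by (intro tendsto_sum tendsto_mult_left lim) auto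
  then have "eventually (\<lambda>m. (\<Sum>j<n. \<Sum>i\<in>{..<n} - {j}. w i * measure (cell_measure (\<sigma> i)) (?B j m)) < \<eta>) sequentially"
    using \<eta> by (intro order_tendstoD) auto
  moreover have "eventually (\<lambda>m. \<forall>i\<in>{..<n}. \<forall>j\<in>{..<n}. i \<noteq> j \<longrightarrow> ?B i m \<inter> ?B j m = {}) sequentially"
    using sep by (intro eventually_ball_finite ballI) auto
  ultimately have "eventually (\<lambda>m. (\<Sum>j<n. \<Sum>i\<in>{..<n} - {j}. w i * measure (cell_measure (\<sigma> i)) (?B j m)) < \<eta> \<and>
      (\<forall>i\<in>{..<n}. \<forall>j\<in>{..<n}. i \<noteq> j \<longrightarrow> ?B i m \<inter> ?B j m = {})) sequentially"
    by eventually_elim blast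
  from eventually_happens'[OF sequentially_bot this]
  obtain m where m0: "(\<Sum>j<n. \<Sum>i\<in>{..<n} - {j}. w i * measure (cell_measure (\<sigma> i)) (?B j m)) < \<eta> \<and>
      (\<forall>i\<in>{..<n}. \<forall>j\<in>{..<n}. i \<noteq> j \<longrightarrow> ?B i m \<inter> ?B j m = {})" ..
  note m1 = conjunct1[OF m0] and m2 = conjunct2[OF m0]
  show ?thesis
  proof (intro exI[of _ K] exI[of _ "?e m"] conjI)
    show "\<forall>i<n. \<forall>j<n. i \<noteq> j \<longrightarrow> ?B i m \<inter> ?B j m = {}" using m2 by simp
  qed (use K(1,2) s1 m1 in auto)
qed

definition rep_mass :: "nat \<Rightarrow> (nat \<Rightarrow> 'g::{zero, metric_space}) \<Rightarrow> (nat \<Rightarrow> oriented_cell) \<Rightarrow> real" where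
  "rep_mass n g \<sigma> = (\<Sum>i<n. dist (g i) 0 * cell_mass (\<sigma> i))"

lemma rep_mass_nonneg: "0 \<le> rep_mass n g \<sigma>"
  unfolding rep_mass_def by (intro sum_nonneg mult_nonneg_nonneg cell_mass_nonneg) auto

lemma ennreal_rep_mass: "ennreal (rep_mass n g \<sigma>) = (\<Sum>i<n. ennreal (dist (g i) 0) * emeasure (cell_measure (\<sigma> i)) UNIV)"
  unfolding rep_mass_def emeasure_cell_measure_UNIV
  by (subst sum_ennreal[symmetric]) (auto simp: ennreal_mult cell_mass_nonneg)

lemma cell_measure_le_rep_mass:
  "(\<Sum>i<n. ennreal (dist (g i) 0) * emeasure (cell_measure (\<sigma> i)) B) \<le> ennreal (rep_mass n g \<sigma>)"
proof -
  have "emeasure (cell_measure (\<sigma> i)) B \<le> emeasure (cell_measure (\<sigma> i)) UNIV" for i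
    by (rule emeasure_mono) auto
  then show ?thesis unfolding ennreal_rep_mass by (intro sum_mono mult_left_mono) auto
qed

text \<open>Disjointness keeps any part of the chain from being counted twice. This is why the mass
  of the approximating chain enters the final bound with the constant 1.\<close>

lemma cell_measure_disjoint_le_rep_mass:
  fixes q :: nat
  assumes B: "\<And>j. j < q \<Longrightarrow> B j \<in> sets borel" and d: "\<And>i j. i < q \<Longrightarrow> j < q \<Longrightarrow> i \<noteq> j \<Longrightarrow> B i \<inter> B j = {}"
  shows "(\<Sum>j<q. \<Sum>i<n. ennreal (dist (g i) 0) * emeasure (cell_measure (\<sigma> i)) (B j)) \<le> ennreal (rep_mass n g \<sigma>)"
proof -
  have "(\<Sum>j<q. emeasure (cell_measure (\<sigma> i)) (B j)) = emeasure (cell_measure (\<sigma> i)) (\<Union>j<q. B j)" for i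
    by (rule sum_emeasure) (use B d in \<open>auto simp: disjoint_family_on_def\<close>)
  then have "(\<Sum>j<q. \<Sum>i<n. ennreal (dist (g i) 0) * emeasure (cell_measure (\<sigma> i)) (B j)) =
      (\<Sum>i<n. ennreal (dist (g i) 0) * emeasure (cell_measure (\<sigma> i)) (\<Union>j<q. B j))"
    by (subst sum.swap) (simp add: sum_distrib_left[symmetric])
  also have "\<dots> \<le> ennreal (rep_mass n g \<sigma>)" by (rule cell_measure_le_rep_mass)
  finally show ?thesis .
qed

text \<open>\<open>Q\<close> is the quotient of the factors in dimensions \<open>k\<close> and
  \<open>Suc k\<close>: the slice is measured with the one, the cell with the other. It is fixed
  before the projection, the cell and the function \<open>u\<close>.\<close>

lemma boundary_slice_factor:
  obtains Q :: real where "0 \<le> Q" "\<And>es \<tau> u. orthonormal_frame es \<Longrightarrow> length es = k \<Longrightarrow> cell_dim \<tau> = Suc k \<Longrightarrow>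
    (\<And>x y. \<bar>u x - u y :: real\<bar> \<le> dist x y) \<Longrightarrow>
    (\<integral>\<^sup>+ s. hausdorff_factor k * (\<integral>\<^sup>+ y. ennreal \<bar>fibre_sum es (cell_boundary \<tau>) (\<lambda>x. indicat_real {x. u x < s} x) y\<bar> \<partial>frame_measure 0 es) \<partial>lborel)
      \<le> ennreal (Q * cell_mass \<tau>)"
proof -
  define Q where "Q = enn2real (hausdorff_factor k) / enn2real (hausdorff_factor (Suc k))"
  have "(\<integral>\<^sup>+ s. hausdorff_factor k * (\<integral>\<^sup>+ y. ennreal \<bar>fibre_sum es (cell_boundary \<tau>) (\<lambda>x. indicat_real {x. u x < s} x) y\<bar> \<partial>frame_measure 0 es) \<partial>lborel)
      \<le> ennreal (Q * cell_mass \<tau>)"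
    if es: "orthonormal_frame es" "length es = k" and \<tau>: "cell_dim \<tau> = Suc k"
      and u: "\<And>x y. \<bar>u x - u y :: real\<bar> \<le> dist x y" for es \<tau> u
  proof -
    let ?I = "\<lambda>s. \<integral>\<^sup>+ y. ennreal \<bar>fibre_sum es (cell_boundary \<tau>) (\<lambda>x. indicat_real {x. u x < s} x) y\<bar> \<partial>frame_measure 0 es"
    obtain fs where fs: "orthonormal_frame fs" "length fs = Suc k"
      using cell_measure_frame[of \<tau>] \<tau> by metis
    obtain a where a: "hausdorff_factor k = ennreal a" "0 < a"
      using hausdorff_factor_finite[OF es] hausdorff_factor_pos[OF es] by (cases "hausdorff_factor k") auto
    obtain b where b: "hausdorff_factor (Suc k) = ennreal b" "0 < b"
      using hausdorff_factor_finite[OF fs] hausdorff_factor_pos[OF fs] by (cases "hausdorff_factor (Suc k)") auto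
    have uc: "continuous_on UNIV u"
      unfolding continuous_on_iff using u by (metis dist_real_def le_less_trans)
    have um: "u \<in> borel_measurable borel" by (rule borel_measurable_continuous_onI[OF uc])
    interpret S: sigma_finite_measure "frame_measure 0 es" by (rule sigma_finite_frame_measure[OF orthonormal_frame_basis[OF es(1)]])
    have Im: "?I \<in> borel_measurable lborel"
    proof (rule S.borel_measurable_nn_integral)
      have [measurable]: "(\<lambda>z. fibre_sum es (cell_boundary \<tau>) (\<lambda>x. indicat_real {x. u x < fst z} x) (snd z)) \<in> borel_measurable (borel \<Otimes>\<^sub>M borel)"
        using fibre_sum_measurable_pair[OF um, of es "cell_boundary \<tau>"] by (simp add: split_beta)
      have "(\<lambda>z. ennreal \<bar>fibre_sum es (cell_boundary \<tau>) (\<lambda>x. indicat_real {x. u x < fst z} x) (snd z)\<bar>) \<in> borel_measurable (borel \<Otimes>\<^sub>M borel)" by measurable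
      then show "(\<lambda>(s, y). ennreal \<bar>fibre_sum es (cell_boundary \<tau>) (\<lambda>x. indicat_real {x. u x < s} x) y\<bar>) \<in> borel_measurable (lborel \<Otimes>\<^sub>M frame_measure 0 es)"
        by (simp add: split_beta measurable_cong_sets[OF sets_pair_measure_cong[OF sets_lborel sets_frame_measure] refl])
    qed
    have "ennreal b * (\<integral>\<^sup>+ s. ?I s \<partial>lborel) \<le> ennreal (cell_mass \<tau>)"
      using boundary_slice[OF es(1) _ u, of \<tau>] \<tau> es(2) b(1) by simp
    then have le: "ennreal (a / b) * (ennreal b * (\<integral>\<^sup>+ s. ?I s \<partial>lborel)) \<le> ennreal (a / b) * ennreal (cell_mass \<tau>)"
      by (rule mult_left_mono) simp
    have "(\<integral>\<^sup>+ s. hausdorff_factor k * ?I s \<partial>lborel) = ennreal a * (\<integral>\<^sup>+ s. ?I s \<partial>lborel)"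
      unfolding a(1) by (rule nn_integral_cmult[OF Im])
    also have "\<dots> = ennreal (a / b) * (ennreal b * (\<integral>\<^sup>+ s. ?I s \<partial>lborel))"
      using a(2) b(2) by (simp add: mult.assoc[symmetric] ennreal_mult[symmetric])
    also have "\<dots> \<le> ennreal (a / b) * ennreal (cell_mass \<tau>)" by (rule le)
    also have "\<dots> = ennreal (Q * cell_mass \<tau>)"
    proof -
      have "Q = a / b" using a b by (simp add: Q_def)
      then show ?thesis using a b cell_mass_nonneg[of \<tau>] by (simp only: ennreal_mult divide_nonneg_nonneg less_imp_le)
    qed
    finally show ?thesis .
  qed
  moreover have "0 \<le> Q" by (simp add: Q_def)
  ultimately show ?thesis using that by blast
qed

lemma infdist_lipschitz: "\<bar>infdist x K - infdist y K\<bar> \<le> dist x y"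
  using infdist_triangle_abs[of x K y] by simp

lemma mass_lower_bound:
  fixes g :: "nat \<Rightarrow> 'g::{ab_group_add, metric_space}"
  assumes TI: "\<And>a b c :: 'g. dist (a + c) (b + c) = dist a b"
    and P: "cell_rep k P n g \<sigma>" and \<eta>: "0 < \<eta>"
  shows "\<exists>L\<ge>0. \<forall>P' A A' C n' g' \<sigma>' na ga \<alpha> na' ga' \<alpha>' m h \<tau>.
    P' = P + A + A' + chain_boundary C \<longrightarrow> cell_rep k P' n' g' \<sigma>' \<longrightarrow> cell_rep k A na ga \<alpha> \<longrightarrow>
    cell_rep k A' na' ga' \<alpha>' \<longrightarrow> cell_rep (Suc k) C m h \<tau> \<longrightarrow>
    rep_mass n g \<sigma> \<le> rep_mass n' g' \<sigma>' + \<eta> + L * (rep_mass na ga \<alpha> + rep_mass na' ga' \<alpha>' + rep_mass m h \<tau>)"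
proof -
  have no: "nonoverlapping k n \<sigma>" using P by (simp add: cell_rep_def)
  have half: "0 < \<eta> / 2" using \<eta> by simp
  obtain K \<epsilon> where K\<epsilon>: "0 < \<epsilon> \<and> (\<forall>j<n. K j \<noteq> {} \<and> compact (K j)) \<and>
    (\<forall>i<n. \<forall>j<n. i \<noteq> j \<longrightarrow> {x. infdist x (K i) < \<epsilon>} \<inter> {x. infdist x (K j) < \<epsilon>} = {}) \<and>
    (\<Sum>j<n. dist (g j) 0 * cell_mass (\<sigma> j)) \<le> (\<Sum>j<n. dist (g j) 0 * measure (cell_measure (\<sigma> j)) (K j)) + \<eta> / 2 \<and>
    (\<Sum>j<n. \<Sum>i\<in>{..<n} - {j}. dist (g i) 0 * measure (cell_measure (\<sigma> i)) {x. infdist x (K j) < \<epsilon>}) \<le> \<eta> / 2"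
    by (insert cells_separation[where w = "\<lambda>i. dist (g i) 0", OF no zero_le_dist half], elim exE, rule that)
  note \<epsilon> = conjunct1[OF K\<epsilon>] and K' = conjunct1[OF conjunct2[OF K\<epsilon>]]
    and sep' = conjunct1[OF conjunct2[OF conjunct2[OF K\<epsilon>]]]
    and big = conjunct1[OF conjunct2[OF conjunct2[OF conjunct2[OF K\<epsilon>]]]]
    and small = conjunct2[OF conjunct2[OF conjunct2[OF conjunct2[OF K\<epsilon>]]]]
  have K: "K j \<noteq> {} \<and> compact (K j)" if "j < n" for j using K' that by blast
  have sep: "{x. infdist x (K i) < \<epsilon>} \<inter> {x. infdist x (K j) < \<epsilon>} = {}" if "i < n" "j < n" "i \<noteq> j" for i j
    using sep' that by blast
  obtain Q where Q: "0 \<le> Q" "\<And>es \<tau> u. orthonormal_frame es \<Longrightarrow> length es = k \<Longrightarrow> cell_dim \<tau> = Suc k \<Longrightarrow>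
    (\<And>x y. \<bar>u x - u y :: real\<bar> \<le> dist x y) \<Longrightarrow>
    (\<integral>\<^sup>+ s. hausdorff_factor k * (\<integral>\<^sup>+ y. ennreal \<bar>fibre_sum es (cell_boundary \<tau>) (\<lambda>x. indicat_real {x. u x < s} x) y\<bar> \<partial>frame_measure 0 es) \<partial>lborel)
      \<le> ennreal (Q * cell_mass \<tau>)"
    using boundary_slice_factor[of k] by blast
  have "\<exists>es. orthonormal_frame es \<and> span (set es) = direction_space (cell_set (\<sigma> j))" for j
    using orthonormal_frame_exists[OF subspace_direction_space] by metis
  then obtain E where E: "\<And>j. orthonormal_frame (E j)" "\<And>j. span (set (E j)) = direction_space (cell_set (\<sigma> j))" by metis
  have lE: "length (E j) = k" if "j < n" for j
  proof -
    have "length (E j) = cell_dim (\<sigma> j)"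
      using orthonormal_frame_basis[OF E(1)[of j]] E(2)[of j] oriented_cell_props(2,3)[of "\<sigma> j"] by (simp add: ordered_basis_iff)
    then show ?thesis using no that by (simp add: nonoverlapping_def)
  qed
  \<comment> \<open>\<open>real n\<close> arises because each of the \<open>n\<close> neighbourhoods
    may see the full mass of \<open>A\<close> and of \<open>A'\<close>;
    \<open>real n * Q / \<epsilon>\<close> arises from averaging the slices of \<open>C\<close> over
    radii up to \<open>\<epsilon>\<close>, once for each neighbourhood.\<close>
  define L where "L = real n + real n * Q / \<epsilon>"
  have "rep_mass n g \<sigma> \<le> rep_mass n' g' \<sigma>' + \<eta> + L * (rep_mass na ga \<alpha> + rep_mass na' ga' \<alpha>' + rep_mass m h \<tau>)"
    if eq: "P' = P + A + A' + chain_boundary C" and P': "cell_rep k P' n' g' \<sigma>'" and A: "cell_rep k A na ga \<alpha>"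
      and A': "cell_rep k A' na' ga' \<alpha>'" and C: "cell_rep (Suc k) C m h \<tau>"
    for P' A A' C n' g' \<sigma>' na ga \<alpha> na' ga' \<alpha>' m h \<tau>
  proof -
    let ?B = "\<lambda>j s. {x. infdist x (K j) < s}"
    have Bm: "?B j s \<in> sets borel" for j s by (intro borel_open open_Collect_less continuous_intros)
    let ?J = "\<lambda>j i s. hausdorff_factor k * (\<integral>\<^sup>+ y. ennreal \<bar>fibre_sum (E j) (cell_boundary (\<tau> i)) (indicat_real (?B j s)) y\<bar> \<partial>frame_measure 0 (E j))"
    define lo where "lo = (\<Sum>j<n. dist (g j) 0 * measure (cell_measure (\<sigma> j)) (K j))"
    define up where "up = \<eta> / 2 + rep_mass n' g' \<sigma>' + real n * rep_mass na ga \<alpha> + real n * rep_mass na' ga' \<alpha>'"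
    define R where "R s = (\<Sum>j<n. \<Sum>i<m. ennreal (dist (h i) 0) * ?J j i s)" for s
    have lo0: "0 \<le> lo" unfolding lo_def by (intro sum_nonneg mult_nonneg_nonneg) auto
    have up0: "0 \<le> up" unfolding up_def using \<eta> rep_mass_nonneg by (intro add_nonneg_nonneg mult_nonneg_nonneg) auto
    have em: "emeasure (cell_measure \<rho>) S = ennreal (measure (cell_measure \<rho>) S)" for \<rho> S
      by (rule finite_measure.emeasure_eq_measure[OF finite_measure_cell_measure])
    \<comment> \<open>The inequality at one radius. The neighbourhoods of radius \<open>s\<close>
      inherit from those of radius \<open>\<epsilon>\<close> that they are disjoint and carry little
      of the other cells of \<open>P\<close>.\<close>
    have point: "ennreal lo \<le> ennreal up + R s" if s: "0 < s" "s < \<epsilon>" for s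
    proof -
      have sub: "?B j s \<subseteq> ?B j \<epsilon>" for j using s by auto
      have KB: "K j \<subseteq> ?B j s" if "j < n" for j using s by auto
      have "ennreal lo = (\<Sum>j<n. ennreal (dist (g j) 0) * emeasure (cell_measure (\<sigma> j)) (K j))"
        unfolding lo_def em by (subst sum_ennreal[symmetric]) (auto simp: ennreal_mult)
      also have "\<dots> \<le> (\<Sum>j<n. ennreal (dist (g j) 0) * emeasure (cell_measure (\<sigma> j)) (?B j s))"
        using KB Bm by (intro sum_mono mult_left_mono emeasure_mono) auto
      also have "\<dots> \<le> (\<Sum>j<n. (\<Sum>i\<in>{..<n} - {j}. ennreal (dist (g i) 0) * emeasure (cell_measure (\<sigma> i)) (?B j s))
         + (\<Sum>i<n'. ennreal (dist (g' i) 0) * emeasure (cell_measure (\<sigma>' i)) (?B j s))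
         + (\<Sum>i<na. ennreal (dist (ga i) 0) * emeasure (cell_measure (\<alpha> i)) (?B j s))
         + (\<Sum>i<na'. ennreal (dist (ga' i) 0) * emeasure (cell_measure (\<alpha>' i)) (?B j s))
         + (\<Sum>i<m. ennreal (dist (h i) 0) * ?J j i s))"
      proof (rule sum_mono)
        fix j assume j: "j \<in> {..<n}"
        then show "ennreal (dist (g j) 0) * emeasure (cell_measure (\<sigma> j)) (?B j s) \<le>
           (\<Sum>i\<in>{..<n} - {j}. ennreal (dist (g i) 0) * emeasure (cell_measure (\<sigma> i)) (?B j s))
         + (\<Sum>i<n'. ennreal (dist (g' i) 0) * emeasure (cell_measure (\<sigma>' i)) (?B j s))
         + (\<Sum>i<na. ennreal (dist (ga i) 0) * emeasure (cell_measure (\<alpha> i)) (?B j s))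
         + (\<Sum>i<na'. ennreal (dist (ga' i) 0) * emeasure (cell_measure (\<alpha>' i)) (?B j s))
         + (\<Sum>i<m. ennreal (dist (h i) 0) * ?J j i s)"
          using cell_measure_inequality[OF TI E(1)[of j] eq P P' A A' C _ E(2)[of j] Bm[of j s]] lE[of j] by simp
      qed
      also have "\<dots> = (\<Sum>j<n. \<Sum>i\<in>{..<n} - {j}. ennreal (dist (g i) 0) * emeasure (cell_measure (\<sigma> i)) (?B j s))
         + (\<Sum>j<n. \<Sum>i<n'. ennreal (dist (g' i) 0) * emeasure (cell_measure (\<sigma>' i)) (?B j s))
         + (\<Sum>j<n. \<Sum>i<na. ennreal (dist (ga i) 0) * emeasure (cell_measure (\<alpha> i)) (?B j s))
         + (\<Sum>j<n. \<Sum>i<na'. ennreal (dist (ga' i) 0) * emeasure (cell_measure (\<alpha>' i)) (?B j s)) + R s"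
        unfolding R_def sum.distrib ..
      also have "\<dots> \<le> ennreal (\<eta> / 2) + ennreal (rep_mass n' g' \<sigma>') + ennreal (real n * rep_mass na ga \<alpha>)
          + ennreal (real n * rep_mass na' ga' \<alpha>') + R s"
      proof (intro add_mono order_refl)
        have "(\<Sum>j<n. \<Sum>i\<in>{..<n} - {j}. ennreal (dist (g i) 0) * emeasure (cell_measure (\<sigma> i)) (?B j s)) \<le>
            (\<Sum>j<n. \<Sum>i\<in>{..<n} - {j}. ennreal (dist (g i) 0) * emeasure (cell_measure (\<sigma> i)) (?B j \<epsilon>))"
          using sub Bm by (intro sum_mono mult_left_mono emeasure_mono) auto
        also have "\<dots> = ennreal (\<Sum>j<n. \<Sum>i\<in>{..<n} - {j}. dist (g i) 0 * measure (cell_measure (\<sigma> i)) (?B j \<epsilon>))"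
          unfolding em by (simp add: sum_ennreal[symmetric] sum_nonneg ennreal_mult)
        also have "\<dots> \<le> ennreal (\<eta> / 2)" by (rule ennreal_leI[OF small])
        finally show "(\<Sum>j<n. \<Sum>i\<in>{..<n} - {j}. ennreal (dist (g i) 0) * emeasure (cell_measure (\<sigma> i)) (?B j s)) \<le> ennreal (\<eta> / 2)" .
        have "?B i s \<inter> ?B j s = {}" if "i < n" "j < n" "i \<noteq> j" for i j
          using sep[OF that] sub[of i] sub[of j] by blast
        then show "(\<Sum>j<n. \<Sum>i<n'. ennreal (dist (g' i) 0) * emeasure (cell_measure (\<sigma>' i)) (?B j s)) \<le> ennreal (rep_mass n' g' \<sigma>')"
          using Bm by (intro cell_measure_disjoint_le_rep_mass) auto
        have c: "(\<Sum>j<n. ennreal r) = ennreal (real n * r)" for r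
          by (simp add: ennreal_mult' ennreal_of_nat_eq_real_of_nat)
        show "(\<Sum>j<n. \<Sum>i<na. ennreal (dist (ga i) 0) * emeasure (cell_measure (\<alpha> i)) (?B j s)) \<le> ennreal (real n * rep_mass na ga \<alpha>)"
          unfolding c[symmetric] by (intro sum_mono cell_measure_le_rep_mass)
        show "(\<Sum>j<n. \<Sum>i<na'. ennreal (dist (ga' i) 0) * emeasure (cell_measure (\<alpha>' i)) (?B j s)) \<le> ennreal (real n * rep_mass na' ga' \<alpha>')"
          unfolding c[symmetric] by (intro sum_mono cell_measure_le_rep_mass)
      qed
      also have "\<dots> = ennreal up + R s"
      proof -
        have plus4: "ennreal (a + b + c + d) = ennreal a + ennreal b + ennreal c + ennreal d"
          if "0 \<le> a" "0 \<le> b" "0 \<le> c" "0 \<le> d" for a b c d :: real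
          using that by simp
        have "ennreal up = ennreal (\<eta> / 2) + ennreal (rep_mass n' g' \<sigma>') + ennreal (real n * rep_mass na ga \<alpha>)
            + ennreal (real n * rep_mass na' ga' \<alpha>')"
          unfolding up_def
          using \<eta> by (intro plus4) (auto intro: rep_mass_nonneg mult_nonneg_nonneg)
        then show ?thesis by simp
      qed
      finally show ?thesis .
    qed
    have Jm: "(\<lambda>s. ?J j i s) \<in> borel_measurable lborel" for i j
    proof -
      interpret S: sigma_finite_measure "frame_measure 0 (E j)" by (rule sigma_finite_frame_measure[OF orthonormal_frame_basis[OF E(1)]])
      have um: "(\<lambda>x. infdist x (K j)) \<in> borel_measurable borel" by (intro borel_measurable_continuous_onI continuous_intros)
      have [measurable]: "(\<lambda>z. fibre_sum (E j) (cell_boundary (\<tau> i)) (\<lambda>x. indicat_real (?B j (fst z)) x) (snd z)) \<in> borel_measurable (borel \<Otimes>\<^sub>M borel)"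
        using fibre_sum_measurable_pair[OF um, of "E j" "cell_boundary (\<tau> i)"] by (simp add: split_beta)
      have "(\<lambda>z. ennreal \<bar>fibre_sum (E j) (cell_boundary (\<tau> i)) (\<lambda>x. indicat_real (?B j (fst z)) x) (snd z)\<bar>) \<in> borel_measurable (borel \<Otimes>\<^sub>M borel)" by measurable
      then have "(\<lambda>(s, y). ennreal \<bar>fibre_sum (E j) (cell_boundary (\<tau> i)) (indicat_real (?B j s)) y\<bar>) \<in> borel_measurable (lborel \<Otimes>\<^sub>M frame_measure 0 (E j))"
        by (simp add: split_beta measurable_cong_sets[OF sets_pair_measure_cong[OF sets_lborel sets_frame_measure] refl])
      then show ?thesis by (intro borel_measurable_times_ennreal S.borel_measurable_nn_integral) auto
    qed
    have Rm: "R \<in> borel_measurable lborel"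
      unfolding R_def by (intro borel_measurable_sum borel_measurable_times_ennreal Jm) auto
    have RI: "(\<integral>\<^sup>+ s. R s \<partial>lborel) \<le> ennreal (real n * Q * rep_mass m h \<tau>)"
    proof -
      have "(\<integral>\<^sup>+ s. R s \<partial>lborel) = (\<Sum>j<n. \<Sum>i<m. ennreal (dist (h i) 0) * (\<integral>\<^sup>+ s. ?J j i s \<partial>lborel))"
        unfolding R_def using Jm by (subst nn_integral_sum, (intro borel_measurable_sum borel_measurable_times_ennreal Jm, simp)+)
          (subst nn_integral_sum, (intro borel_measurable_times_ennreal Jm, simp)+, subst nn_integral_cmult, auto)
      also have "\<dots> \<le> (\<Sum>j<n. \<Sum>i<m. ennreal (dist (h i) 0) * ennreal (Q * cell_mass (\<tau> i)))"
      proof (intro sum_mono mult_left_mono)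
        fix j i assume ji: "j \<in> {..<n}" "i \<in> {..<m}"
        have "cell_dim (\<tau> i) = Suc k" using C ji by (simp add: cell_rep_def nonoverlapping_def)
        then show "(\<integral>\<^sup>+ s. ?J j i s \<partial>lborel) \<le> ennreal (Q * cell_mass (\<tau> i))"
          using Q(2)[OF E(1) lE _ infdist_lipschitz, of j "\<tau> i" "K j"] ji by simp
      qed simp
      also have "\<dots> = ennreal (\<Sum>j<n. \<Sum>i<m. dist (h i) 0 * (Q * cell_mass (\<tau> i)))"
        using Q(1) cell_mass_nonneg by (simp add: sum_ennreal[symmetric] sum_nonneg ennreal_mult ennreal_of_nat_eq_real_of_nat)
      also have "(\<Sum>j<n. \<Sum>i<m. dist (h i) 0 * (Q * cell_mass (\<tau> i))) = real n * Q * rep_mass m h \<tau>"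
        by (simp add: rep_mass_def sum_distrib_left mult_ac)
      finally show ?thesis .
    qed
    \<comment> \<open>The inequality is integrated over all radii below \<open>\<epsilon>\<close>
      and then divided by \<open>\<epsilon>\<close>, which has the effect of selecting a good
      radius.\<close>
    have "ennreal (lo * \<epsilon>) = (\<integral>\<^sup>+ s. ennreal lo * indicator {0<..<\<epsilon>} s \<partial>lborel)"
      using \<epsilon> lo0 by (simp add: nn_integral_cmult ennreal_mult)
    also have "\<dots> \<le> (\<integral>\<^sup>+ s. ennreal up * indicator {0<..<\<epsilon>} s + R s \<partial>lborel)"
      using point by (intro nn_integral_mono) (simp add: indicator_def)
    also have "\<dots> = ennreal (up * \<epsilon>) + (\<integral>\<^sup>+ s. R s \<partial>lborel)"
      using \<epsilon> up0 Rm by (subst nn_integral_add) (auto simp: nn_integral_cmult ennreal_mult)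
    also have "\<dots> \<le> ennreal (up * \<epsilon>) + ennreal (real n * Q * rep_mass m h \<tau>)" by (rule add_left_mono[OF RI])
    also have "\<dots> = ennreal (up * \<epsilon> + real n * Q * rep_mass m h \<tau>)"
      using up0 \<epsilon> Q(1) rep_mass_nonneg by (intro ennreal_plus[symmetric] mult_nonneg_nonneg) auto
    finally have "lo * \<epsilon> \<le> up * \<epsilon> + real n * Q * rep_mass m h \<tau>"
      using up0 \<epsilon> Q(1) rep_mass_nonneg[of m h \<tau>] by (subst (asm) ennreal_le_iff) (auto intro!: add_nonneg_nonneg mult_nonneg_nonneg)
    then have "lo \<le> up + real n * Q / \<epsilon> * rep_mass m h \<tau>"
      using \<epsilon> by (simp add: field_simps)
    moreover have "rep_mass n g \<sigma> \<le> lo + \<eta> / 2" using big by (simp add: rep_mass_def lo_def)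
    ultimately have "rep_mass n g \<sigma> \<le> rep_mass n' g' \<sigma>' + \<eta> + (real n * rep_mass na ga \<alpha> + real n * rep_mass na' ga' \<alpha>' + real n * Q / \<epsilon> * rep_mass m h \<tau>)"
      unfolding up_def by linarith
    also have "real n * rep_mass na ga \<alpha> + real n * rep_mass na' ga' \<alpha>' + real n * Q / \<epsilon> * rep_mass m h \<tau> \<le>
        L * (rep_mass na ga \<alpha> + rep_mass na' ga' \<alpha>' + rep_mass m h \<tau>)"
    proof -
      have "real n \<le> L" "real n * Q / \<epsilon> \<le> L" unfolding L_def using Q(1) \<epsilon> by auto
      then show ?thesis
        unfolding distrib_left using rep_mass_nonneg by (intro add_mono mult_right_mono) auto
    qed
    finally show ?thesis by simp
  qed
  moreover have "0 \<le> L" unfolding L_def using Q(1) \<epsilon> by auto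
  ultimately show ?thesis by blast
qed

section \<open>Mass as an invariant of the chain\<close>

lemma cell_rep_zero: "cell_rep k 0 0 g \<sigma>"
  by (simp add: cell_rep_def nonoverlapping_def)

text \<open>The lower bound, applied for every \<open>\<eta>\<close> to two representations of the
  same chain with all error chains zero, gives one inequality; the other follows by
  symmetry.\<close>

lemma rep_mass_unique:
  fixes g :: "nat \<Rightarrow> 'g::{ab_group_add, metric_space}"
  assumes TI: "\<And>a b c :: 'g. dist (a + c) (b + c) = dist a b"
    and P: "cell_rep k P n g \<sigma>" and P': "cell_rep k P n' g' \<sigma>'"
  shows "rep_mass n g \<sigma> = rep_mass n' g' \<sigma>'"
proof -
  have le: "rep_mass n g \<sigma> \<le> rep_mass n' g' \<sigma>'" if P: "cell_rep k P n g \<sigma>" and P': "cell_rep k P n' g' \<sigma>'"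
    for n n' and g g' :: "nat \<Rightarrow> 'g" and \<sigma> \<sigma>'
  proof (rule field_le_epsilon)
    fix \<eta> :: real assume \<eta>: "0 < \<eta>"
    obtain L where L: "\<forall>P' A A' C n' g' \<sigma>' na ga \<alpha> na' ga' \<alpha>' m h \<tau>.
        P' = P + A + A' + chain_boundary C \<longrightarrow> cell_rep k P' n' g' \<sigma>' \<longrightarrow> cell_rep k A na ga \<alpha> \<longrightarrow>
        cell_rep k A' na' ga' \<alpha>' \<longrightarrow> cell_rep (Suc k) C m h \<tau> \<longrightarrow>
        rep_mass n g \<sigma> \<le> rep_mass n' g' \<sigma>' + \<eta> + L * (rep_mass na ga \<alpha> + rep_mass na' ga' \<alpha>' + rep_mass m h \<tau>)"
      by (insert mass_lower_bound[OF TI P \<eta>], elim exE conjE, rule that)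
    have "P = P + 0 + 0 + chain_boundary 0" by (simp add: chain_boundary_zero)
    from L[rule_format, OF this P' cell_rep_zero cell_rep_zero cell_rep_zero, of g \<sigma> g \<sigma> g \<sigma>]
    show "rep_mass n g \<sigma> \<le> rep_mass n' g' \<sigma>' + \<eta>" by (simp add: rep_mass_def)
  qed
  show ?thesis using le[OF P P'] le[OF P' P] by simp
qed

text \<open>The common form of \<open>weight\<close> and \<open>mass\<close>, in which the definite
  description is dealt with once.\<close>

definition chain_mass :: "nat \<Rightarrow> 'g::{ab_group_add, metric_space} chain \<Rightarrow> real" where
  "chain_mass k T = (THE w. \<exists>n g \<sigma>. cell_rep k T n g \<sigma> \<and> w = rep_mass n g \<sigma>)"

lemma chain_mass_eq:
  fixes T :: "'g::{ab_group_add, metric_space} chain"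
  assumes TI: "\<And>a b c :: 'g. dist (a + c) (b + c) = dist a b" and T: "cell_rep k T n g \<sigma>"
  shows "chain_mass k T = rep_mass n g \<sigma>"
  unfolding chain_mass_def
proof (rule the_equality)
  show "\<exists>n' g' \<sigma>'. cell_rep k T n' g' \<sigma>' \<and> rep_mass n g \<sigma> = rep_mass n' g' \<sigma>'" using T by blast
  fix w assume "\<exists>n g \<sigma>. cell_rep k T n g \<sigma> \<and> w = rep_mass n g \<sigma>"
  then show "w = rep_mass n g \<sigma>" using rep_mass_unique[OF TI T] by metis
qed

lemma chain_mass_nonneg:
  fixes T :: "'g::{ab_group_add, metric_space} chain"
  assumes TI: "\<And>a b c :: 'g. dist (a + c) (b + c) = dist a b" and T: "T \<in> chains k"
  shows "0 \<le> chain_mass k T"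
proof -
  obtain n g \<sigma> where "cell_rep k T n g \<sigma>" by (rule chains_cell_rep[OF T])
  from chain_mass_eq[OF TI this] show ?thesis by (simp add: rep_mass_nonneg)
qed

lemma chain_mass_zero:
  assumes TI: "\<And>a b c :: 'g::{ab_group_add, metric_space}. dist (a + c) (b + c) = dist a b"
  shows "chain_mass k (0 :: 'g chain) = 0"
  using chain_mass_eq[OF TI cell_rep_zero, of k] by (simp add: rep_mass_def)

lemma chain_mass_lower_bound:
  fixes P :: "'g::{ab_group_add, metric_space} chain"
  assumes TI: "\<And>a b c :: 'g. dist (a + c) (b + c) = dist a b" and P: "P \<in> chains k" and \<eta>: "0 < \<eta>"
  shows "\<exists>L\<ge>0. \<forall>P' A A' C. P' = P + A + A' + chain_boundary C \<longrightarrow> P' \<in> chains k \<longrightarrow> A \<in> chains k \<longrightarrow> A' \<in> chains k \<longrightarrow>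
      C \<in> chains (Suc k) \<longrightarrow>
      chain_mass k P \<le> chain_mass k P' + \<eta> + L * (chain_mass k A + chain_mass k A' + chain_mass (Suc k) C)"
proof -
  obtain n g \<sigma> where r: "cell_rep k P n g \<sigma>" by (rule chains_cell_rep[OF P])
  obtain L where L0: "0 \<le> L" and L: "\<forall>P' A A' C n' g' \<sigma>' na ga \<alpha> na' ga' \<alpha>' m h \<tau>.
        P' = P + A + A' + chain_boundary C \<longrightarrow> cell_rep k P' n' g' \<sigma>' \<longrightarrow> cell_rep k A na ga \<alpha> \<longrightarrow>
        cell_rep k A' na' ga' \<alpha>' \<longrightarrow> cell_rep (Suc k) C m h \<tau> \<longrightarrow>
        rep_mass n g \<sigma> \<le> rep_mass n' g' \<sigma>' + \<eta> + L * (rep_mass na ga \<alpha> + rep_mass na' ga' \<alpha>' + rep_mass m h \<tau>)"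
    by (insert mass_lower_bound[OF TI r \<eta>], elim exE conjE, rule that)
  have "chain_mass k P \<le> chain_mass k P' + \<eta> + L * (chain_mass k A + chain_mass k A' + chain_mass (Suc k) C)"
    if *: "P' = P + A + A' + chain_boundary C" "P' \<in> chains k" "A \<in> chains k" "A' \<in> chains k" "C \<in> chains (Suc k)"
      for P' A A' C
  proof -
    obtain n' g' \<sigma>' where r1: "cell_rep k P' n' g' \<sigma>'" by (rule chains_cell_rep[OF *(2)])
    obtain na ga \<alpha> where r2: "cell_rep k A na ga \<alpha>" by (rule chains_cell_rep[OF *(3)])
    obtain na' ga' \<alpha>' where r3: "cell_rep k A' na' ga' \<alpha>'" by (rule chains_cell_rep[OF *(4)])
    obtain m h \<tau> where r4: "cell_rep (Suc k) C m h \<tau>" by (rule chains_cell_rep[OF *(5)])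
    from L[rule_format, OF *(1) r1 r2 r3 r4] show ?thesis
      by (simp add: chain_mass_eq[OF TI r] chain_mass_eq[OF TI r1] chain_mass_eq[OF TI r2]
          chain_mass_eq[OF TI r3] chain_mass_eq[OF TI r4])
  qed
  then show ?thesis using L0 by blast
qed

section \<open>From chains to dipolyhedra\<close>

lemma zero_in_chains: "0 \<in> chains k"
proof -
  have "(0 :: 'g::ab_group_add chain) = (\<Sum>i<(0::nat). pure_tensor 0 0) \<and> (\<forall>i<0::nat. (0 :: zchain) \<in> zchains k)" by simp
  then show ?thesis unfolding chains_def by (intro CollectI exI[of _ "0::nat"] exI[of _ "\<lambda>_. 0"]) auto
qed

lemma chains_add:
  fixes a b :: "'a::ab_group_add chain"
  assumes "a \<in> chains k" "b \<in> chains k"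
  shows "a + b \<in> chains k"
proof -
  obtain n g z where a: "a = (\<Sum>i<n. pure_tensor (g i) (z i))" "\<forall>i<n::nat. z i \<in> zchains k"
    using assms(1) unfolding chains_def by blast
  obtain m g' z' where b: "b = (\<Sum>i<m. pure_tensor (g' i) (z' i))" "\<forall>i<m::nat. z' i \<in> zchains k"
    using assms(2) unfolding chains_def by blast
  let ?g = "\<lambda>i. if i < n then g i else g' (i - n)" and ?z = "\<lambda>i. if i < n then z i else z' (i - n)"
  have split: "(\<Sum>i<n + m. f i) = (\<Sum>i<n. f i) + (\<Sum>i<m. f (n + i))" for f :: "nat \<Rightarrow> 'a chain"
    by (induction m) (simp_all add: add.assoc)
  have "(\<Sum>i<n + m. pure_tensor (?g i) (?z i)) =
      (\<Sum>i<n. pure_tensor (?g i) (?z i)) + (\<Sum>i<m. pure_tensor (?g (n + i)) (?z (n + i)))"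
    by (rule split)
  also have "(\<Sum>i<n. pure_tensor (?g i) (?z i)) = a" unfolding a(1) by (rule sum.cong) simp_all
  also have "(\<Sum>i<m. pure_tensor (?g (n + i)) (?z (n + i))) = b" unfolding b(1) by (rule sum.cong) simp_all
  finally have "a + b = (\<Sum>i<n + m. pure_tensor (?g i) (?z i))" by (rule sym)
  moreover have "\<forall>i<n + m. ?z i \<in> zchains k" using a(2) b(2) by auto
  ultimately show ?thesis unfolding chains_def by (intro CollectI exI[of _ "n + m"] exI[of _ ?g] exI[of _ ?z] conjI)
qed

lemma chains_uminus:
  assumes "a \<in> chains k"
  shows "- a \<in> chains k"
proof -
  obtain n g z where a: "a = (\<Sum>i<n. pure_tensor (g i) (z i))" "\<forall>i<n::nat. z i \<in> zchains k"
    using assms unfolding chains_def by blast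
  have "- a = (\<Sum>i<n. pure_tensor (- g i) (z i))" using a by (simp add: sum_negf pure_tensor_uminus)
  then show ?thesis using a(2) unfolding chains_def
    by (intro CollectI exI[of _ n] exI[of _ "\<lambda>i. - g i"] exI[of _ z] conjI)
qed

lemma dipolyhedra_iff:
  "D \<in> dipolyhedra k \<longleftrightarrow> fst D \<in> chains k \<and> (case k of 0 \<Rightarrow> snd D = 0 | Suc j \<Rightarrow> snd D \<in> chains j)"
  unfolding dipolyhedra_def dipole_chains_def mass_chains_def dipole_def masschain_def
  by (cases D; cases k) (auto simp: image_iff zero_prod_def)

lemma dipolyhedra_add: "D \<in> dipolyhedra k \<Longrightarrow> E \<in> dipolyhedra k \<Longrightarrow> D + E \<in> dipolyhedra k"
  by (auto simp: dipolyhedra_iff chains_add split: nat.splits)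

lemma dipolyhedra_uminus: "D \<in> dipolyhedra k \<Longrightarrow> - D \<in> dipolyhedra k"
  by (auto simp: dipolyhedra_iff chains_uminus split: nat.splits)

lemma sum_dipole: "(\<Sum>i\<in>I. dipole (f i)) = dipole (\<Sum>i\<in>I. f i)"
  by (induction I rule: infinite_finite_induct) (auto simp: dipole_def zero_prod_def)

lemma sum_masschain: "(\<Sum>i\<in>I. masschain (f i)) = masschain (\<Sum>i\<in>I. f i)"
  by (induction I rule: infinite_finite_induct) (auto simp: masschain_def zero_prod_def)

lemma weight_eq_chain_mass: "weight k D = chain_mass k (fst D)"
  unfolding weight_def chain_mass_def cell_rep_def rep_mass_def dipole_part_def sum_dipole
  by (simp add: dipole_def conj_assoc)

lemma mass_eq_chain_mass: "mass k D = chain_mass (k - 1) (snd D)"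
  unfolding mass_def chain_mass_def cell_rep_def rep_mass_def mass_part_def sum_masschain
  by (simp add: masschain_def conj_assoc)

lemma weight_nonneg:
  fixes D :: "'g::{ab_group_add, metric_space} dichain"
  assumes TI: "\<And>a b c :: 'g. dist (a + c) (b + c) = dist a b" and D: "D \<in> dipolyhedra k"
  shows "0 \<le> weight k D"
  unfolding weight_eq_chain_mass using D by (intro chain_mass_nonneg[OF TI]) (simp add: dipolyhedra_iff)

lemma mass_nonneg:
  fixes D :: "'g::{ab_group_add, metric_space} dichain"
  assumes TI: "\<And>a b c :: 'g. dist (a + c) (b + c) = dist a b" and D: "D \<in> dipolyhedra k"
  shows "0 \<le> mass k D"
  unfolding mass_eq_chain_mass using D
  by (intro chain_mass_nonneg[OF TI]) (auto simp: dipolyhedra_iff zero_in_chains split: nat.splits)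

lemma energy_flat_decomposition:
  fixes D :: "'g::{ab_group_add, metric_space} dichain"
  assumes TI: "\<And>a b c :: 'g. dist (a + c) (b + c) = dist a b" and D: "D \<in> dipolyhedra k" and e: "energy_flat k D < e"
  obtains B C where "B \<in> dipolyhedra k" "C \<in> dipolyhedra (Suc k)" "D = B + dipole_boundary C"
    "energy k B + energy (Suc k) C < e"
proof -
  let ?S = "{energy k B + energy (Suc k) C | B C. B \<in> dipolyhedra k \<and> C \<in> dipolyhedra (Suc k) \<and> D = B + dipole_boundary C}"
  \<comment> \<open>An infimum of reals yields elements close to it only if the set is nonempty;
    \<open>B = D\<close> with \<open>C = 0\<close> is an admissible decomposition.\<close>
  have "?S \<noteq> {}"
  proof -
    have "dipole_boundary (0 :: 'g dichain) = 0"
      by (simp add: dipole_boundary_def chain_boundary_zero dipole_def masschain_def zero_prod_def)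
    then have "D = D + dipole_boundary 0" "(0 :: 'g dichain) \<in> dipolyhedra (Suc k)"
      by (simp_all add: dipolyhedra_iff zero_in_chains)
    then show ?thesis using D by blast
  qed
  from cInf_lessD[OF this e[unfolded energy_flat_def]] obtain w where w: "w \<in> ?S" "w < e" by (rule bexE)
  from w(1) obtain B C where "w = energy k B + energy (Suc k) C"
    and BC: "B \<in> dipolyhedra k \<and> C \<in> dipolyhedra (Suc k) \<and> D = B + dipole_boundary C"
    by (elim CollectE exE conjE) (rule that, assumption, intro conjI)
  then have "energy k B + energy (Suc k) C < e" using w(2) by simp
  with BC show ?thesis by (elim conjE) (rule that)
qed

lemma chain_mass_uminus:
  fixes T :: "'g::{ab_group_add, metric_space} chain"
  assumes TI: "\<And>a b c :: 'g. dist (a + c) (b + c) = dist a b" and T: "T \<in> chains k"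
  shows "chain_mass k (- T) = chain_mass k T"
proof -
  obtain n g \<sigma> where r: "cell_rep k T n g \<sigma>" by (rule chains_cell_rep[OF T])
  then have r': "cell_rep k (- T) n (\<lambda>i. - g i) \<sigma>"
    by (simp add: cell_rep_def pure_tensor_uminus sum_negf)
  show ?thesis
    unfolding chain_mass_eq[OF TI r] chain_mass_eq[OF TI r'] rep_mass_def by (simp add: dist_zmul_le(2)[OF TI])
qed

text \<open>\<open>L\<close> may depend on \<open>\<eta>\<close>, as it multiplies a null sequence
  while \<open>\<eta>\<close> is fixed.\<close>

lemma liminf_ge_of_bound:
  fixes f :: "nat \<Rightarrow> real" and a :: real
  assumes e: "e \<longlonglongrightarrow> 0" and b: "\<And>\<eta>. 0 < \<eta> \<Longrightarrow> \<exists>L\<ge>0. \<forall>i. a \<le> f i + \<eta> + L * e i"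
  shows "ereal a \<le> liminf (\<lambda>i. ereal (f i))"
proof (rule ereal_le_epsilon2)
  fix \<eta> :: real assume \<eta>: "0 < \<eta>"
  obtain L where L: "\<And>i. a \<le> f i + \<eta> / 2 + L * e i" using b[of "\<eta> / 2"] \<eta> by auto
  have "(\<lambda>i. L * e i) \<longlonglongrightarrow> L * 0" by (intro tendsto_intros e)
  then have "eventually (\<lambda>i. L * e i < \<eta> / 2) sequentially" using \<eta> by (intro order_tendstoD) auto
  then have "eventually (\<lambda>i. ereal (a - \<eta>) \<le> ereal (f i)) sequentially"
  proof eventually_elim
    case (elim i)
    then show ?case using L[of i] by simp
  qed
  then have "ereal (a - \<eta>) \<le> liminf (\<lambda>i. ereal (f i))" by (rule Liminf_bounded)
  then show "ereal a \<le> liminf (\<lambda>i. ereal (f i)) + ereal \<eta>"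
    by (cases "liminf (\<lambda>i. ereal (f i))") auto
qed

lemma mass_and_weight_bound:
  fixes D :: "'g::{ab_group_add, metric_space} dichain"
  assumes TI: "\<And>a b c :: 'g. dist (a + c) (b + c) = dist a b" and D: "D \<in> dipolyhedra k" and \<eta>: "0 < \<eta>"
  shows "\<exists>L\<ge>0. \<forall>D' \<in> dipolyhedra k. \<forall>e. energy_flat k (D' - D) < e \<longrightarrow>
    weight k D \<le> weight k D' + \<eta> + L * e \<and> mass k D \<le> mass k D' + \<eta> + L * e"
proof -
  have W: "fst D \<in> chains k" using D by (simp add: dipolyhedra_iff)
  from chain_mass_lower_bound[OF TI W \<eta>] obtain L where L: "0 \<le> L" "\<And>P' A A' C. P' = fst D + A + A' + chain_boundary C \<Longrightarrow> P' \<in> chains k \<Longrightarrow>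
      A \<in> chains k \<Longrightarrow> A' \<in> chains k \<Longrightarrow> C \<in> chains (Suc k) \<Longrightarrow>
      chain_mass k (fst D) \<le> chain_mass k P' + \<eta> + L * (chain_mass k A + chain_mass k A' + chain_mass (Suc k) C)"
    by (elim exE conjE) (rule that, assumption, blast)
  \<comment> \<open>The mass part lives one dimension below \<open>k\<close>. Under the premise
    \<open>k = Suc j\<close> the claim is vacuous for \<open>k = 0\<close>, where the mass part is
    zero. Only one error chain besides the boundary occurs here, so the second one is taken to be
    0.\<close>
  have "\<exists>L'\<ge>0. \<forall>P' A C. k = Suc j \<longrightarrow> P' = snd D + A + chain_boundary C \<longrightarrow> P' \<in> chains j \<longrightarrow>
      A \<in> chains j \<longrightarrow> C \<in> chains k \<longrightarrow>
      chain_mass j (snd D) \<le> chain_mass j P' + \<eta> + L' * (chain_mass j A + chain_mass k C)" for j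
  proof (cases "k = Suc j")
    case True
    then have M: "snd D \<in> chains j" using D by (simp add: dipolyhedra_iff)
    from chain_mass_lower_bound[OF TI M \<eta>] obtain L where L: "0 \<le> L" "\<And>P' A A' C. P' = snd D + A + A' + chain_boundary C \<Longrightarrow> P' \<in> chains j \<Longrightarrow>
      A \<in> chains j \<Longrightarrow> A' \<in> chains j \<Longrightarrow> C \<in> chains (Suc j) \<Longrightarrow>
      chain_mass j (snd D) \<le> chain_mass j P' + \<eta> + L * (chain_mass j A + chain_mass j A' + chain_mass (Suc j) C)"
      by (elim exE conjE) (rule that, assumption, blast)
    have "chain_mass j (snd D) \<le> chain_mass j P' + \<eta> + L * (chain_mass j A + chain_mass k C)"
      if "P' = snd D + A + chain_boundary C" "P' \<in> chains j" "A \<in> chains j" "C \<in> chains k" for P' A C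
    proof -
      have "P' = snd D + A + 0 + chain_boundary C" using that(1) by simp
      from L(2)[OF this that(2,3) zero_in_chains that(4)[unfolded True]] show ?thesis
        unfolding True chain_mass_zero[OF TI] by (simp only: add_0_right)
    qed
    then show ?thesis using L(1) by blast
  qed (rule exI[of _ 0], simp)
  then obtain L' where L': "0 \<le> L'" "\<And>P' A C j. k = Suc j \<Longrightarrow> P' = snd D + A + chain_boundary C \<Longrightarrow> P' \<in> chains j \<Longrightarrow>
      A \<in> chains j \<Longrightarrow> C \<in> chains k \<Longrightarrow>
      chain_mass j (snd D) \<le> chain_mass j P' + \<eta> + L' * (chain_mass j A + chain_mass k C)"
    by (cases k) (metis nat.distinct(1) order_refl, metis nat.inject)
  have "weight k D \<le> weight k D' + \<eta> + (L + L') * e \<and> mass k D \<le> mass k D' + \<eta> + (L + L') * e"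
    if D': "D' \<in> dipolyhedra k" and e: "energy_flat k (D' - D) < e" for D' e
  proof -
    have "D' - D \<in> dipolyhedra k" using dipolyhedra_add[OF D' dipolyhedra_uminus[OF D]] by simp
    from energy_flat_decomposition[OF TI this e] obtain B C where BC: "B \<in> dipolyhedra k" "C \<in> dipolyhedra (Suc k)"
      "D' - D = B + dipole_boundary C" "energy k B + energy (Suc k) C < e" by blast
    have B: "fst B \<in> chains k" and C: "fst C \<in> chains (Suc k)" "snd C \<in> chains k" and D'1: "fst D' \<in> chains k"
      using BC(1,2) D' by (simp_all add: dipolyhedra_iff)
    have db: "dipole_boundary C = (chain_boundary (fst C) + snd C, - chain_boundary (snd C))"
      by (simp add: dipole_boundary_def dipole_def masschain_def)
    \<comment> \<open>\<open>snd C\<close> occurs in both equations: as an error chain of the dipole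
      part, and up to sign as the chain whose boundary is added to the mass part. In both roles it
      is measured by \<open>mass (Suc k) C\<close>.\<close>
    have e1: "fst D' = fst D + fst B + snd C + chain_boundary (fst C)"
      and e2: "snd D' = snd D + snd B + chain_boundary (- snd C)"
      using BC(3) unfolding db by (auto simp: prod_eq_iff algebra_simps chain_boundary_uminus)
    note nn = weight_nonneg[OF TI BC(1)] weight_nonneg[OF TI BC(2)] mass_nonneg[OF TI BC(1)] mass_nonneg[OF TI BC(2)]
    have E: "weight k B + mass k B + (weight (Suc k) C + mass (Suc k) C) < e" using BC(4) by (simp add: energy_def)
    have e0: "0 \<le> e" using E nn by linarith
    have "weight k D \<le> weight k D' + \<eta> + L * (weight k B + mass (Suc k) C + weight (Suc k) C)"
      using L(2)[OF e1 D'1 B C(2,1)] by (simp add: weight_eq_chain_mass mass_eq_chain_mass)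
    also have "L * (weight k B + mass (Suc k) C + weight (Suc k) C) \<le> (L + L') * e"
      using E nn L(1) L'(1) by (intro mult_mono) auto
    finally have w: "weight k D \<le> weight k D' + \<eta> + (L + L') * e" by simp
    have "mass k D \<le> mass k D' + \<eta> + (L + L') * e"
    proof (cases k)
      case 0
      then have "snd D = 0" using D by (simp add: dipolyhedra_iff)
      then have "mass k D = 0" using chain_mass_zero[OF TI] by (simp add: mass_eq_chain_mass)
      then show ?thesis using mass_nonneg[OF TI D'] \<eta> e0 L(1) L'(1) by simp
    next
      case (Suc j)
      have "snd D' \<in> chains j" "snd B \<in> chains j" using D' BC(1) Suc by (simp_all add: dipolyhedra_iff)
      from L'(2)[OF Suc e2 this chains_uminus[OF C(2)]] have
        "mass k D \<le> mass k D' + \<eta> + L' * (mass k B + mass (Suc k) C)"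
        using Suc chain_mass_uminus[OF TI C(2)] by (simp add: mass_eq_chain_mass)
      also have "L' * (mass k B + mass (Suc k) C) \<le> (L + L') * e"
        using E nn L(1) L'(1) by (intro mult_mono) auto
      finally show ?thesis by simp
    qed
    with w show ?thesis by blast
  qed
  then show ?thesis using L(1) L'(1) by (intro exI[of _ "L + L'"]) auto
qed

theorem theorem4p1:
  fixes k :: nat
    and D :: "'g::{ab_group_add, complete_space} dichain"
    and Di :: "nat \<Rightarrow> 'g dichain"
  assumes translation_invariant: "\<And>a b c :: 'g. dist (a + c) (b + c) = dist a b"
    and "D \<in> dipolyhedra k"
    and "\<And>i. Di i \<in> dipolyhedra k"
    and "(\<lambda>i. energy_flat k (Di i - D)) \<longlonglongrightarrow> 0"
  shows "ereal (weight k D) \<le> liminf (\<lambda>i. ereal (weight k (Di i)))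
    \<and> ereal (mass k D) \<le> liminf (\<lambda>i. ereal (mass k (Di i)))
    \<and> ereal (energy k D) \<le> liminf (\<lambda>i. ereal (energy k (Di i)))"
proof -
  \<comment> \<open>The added null sequence makes \<open>energy_flat k (Di i - D) < e i\<close>
    strict, as the infimum need not be attained.\<close>
  define e where "e i = energy_flat k (Di i - D) + 1 / real (Suc i)" for i
  have "e \<longlonglongrightarrow> 0 + 0" unfolding e_def by (intro tendsto_add assms(4) LIMSEQ_Suc[OF lim_1_over_n])
  then have e0: "e \<longlonglongrightarrow> 0" by simp
  have bound: "\<exists>L\<ge>0. \<forall>i. weight k D \<le> weight k (Di i) + \<eta> + L * e i \<and> mass k D \<le> mass k (Di i) + \<eta> + L * e i"
    if \<eta>: "0 < \<eta>" for \<eta>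
  proof -
    obtain L where L: "0 \<le> L" "\<And>D' e. D' \<in> dipolyhedra k \<Longrightarrow> energy_flat k (D' - D) < e \<Longrightarrow>
        weight k D \<le> weight k D' + \<eta> + L * e \<and> mass k D \<le> mass k D' + \<eta> + L * e"
      using mass_and_weight_bound[OF translation_invariant assms(2) \<eta>] by blast
    have "energy_flat k (Di i - D) < e i" for i by (simp add: e_def)
    then show ?thesis using L assms(3) by blast
  qed
  show ?thesis
  proof (intro conjI liminf_ge_of_bound[OF e0])
    fix \<eta> :: real assume \<eta>: "0 < \<eta>"
    show "\<exists>L\<ge>0. \<forall>i. weight k D \<le> weight k (Di i) + \<eta> + L * e i"
      and "\<exists>L\<ge>0. \<forall>i. mass k D \<le> mass k (Di i) + \<eta> + L * e i" using bound[OF \<eta>] by blast+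
    obtain L where L: "0 \<le> L" "\<And>i. weight k D \<le> weight k (Di i) + \<eta> / 2 + L * e i \<and> mass k D \<le> mass k (Di i) + \<eta> / 2 + L * e i"
      using bound[of "\<eta> / 2"] \<eta> by auto
    \<comment> \<open>The bounds for weight and mass were taken with half of \<open>\<eta>\<close>
      each; adding them doubles \<open>L\<close>.\<close>
    have "energy k D \<le> energy k (Di i) + \<eta> + 2 * L * e i" for i
      using L(2)[of i] unfolding energy_def by linarith
    then show "\<exists>L\<ge>0. \<forall>i. energy k D \<le> energy k (Di i) + \<eta> + L * e i"
      using L(1) by (intro exI[of _ "2 * L"]) auto
  qed
qed

end
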